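(* Let $\Bbbk$ be an algebraically closed field of characteristic zero. Let $A=A(\alpha,\beta)$ be a graded down-up algebra with weights $\deg x=n$, $\deg y=m$, $\beta\ne 0$, $\gcd(n,m)=1$, $m\ge n\ge1$, and let $\nabla A$ be its Beilinson algebra. A $\Bbbk$-basis of $\mathrm{HH}^1(\nabla A)$ is given as follows. \begin{itemize} \item $n=m=1$, Case I (and Case 1): $\big\{[\sum_{r=1}^{n+2m}\tau_{x_r}],\ [\tau_{x_2}],\ [\tau_{y_2}^{x}],\ [\beta\tau_{y_3}^x+\tau_{y_1}^x],\ [\tau_{x_2}^y],\ [\beta\tau_{x_3}^y+\tau_{x_1}^y]\big\}$; \item $n=m=1$, Case II and Case 2: $\big\{[\sum_{r=1}^{n+2m}\tau_{x_r}],\ [(\tfrac{\alpha}{2})^2\tau_{y_3}^x+\tfrac{\alpha}{2}\tau_{y_2}^x+\tau_{y_1}^x],\ [(\tfrac{\alpha}{2})^2\tau_{x_3}^y+\tfrac{\alpha}{2}\tau_{x_2}^y+\tau_{x_1}^y]\big\}$; \item $n=m=1$, Case II and Case 3: $\big\{[\sum_{r=1}^{n+2m}\tau_{x_r}]\big\}$; \item $m>n=1$, Case I (and Case 1): $\big\{[\sum_{r=1}^{n+2m}\tau_{x_r}],\ [\sum_{r=1}^m(-1)^{r-1}\tau_{x_{n+r}}],\ [\sum_{r=2}^{m+2}\lambda_{r-1}\tau_{y_r}^{x^m}],\ [\beta\sum_{r=1}^{m+2}\lambda_{r-2}\tau_{y_r}^{x^m}]\big\}$; \item $m>n=1$, Case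 II and Case 1: $\big\{[\sum_{r=1}^{n+2m}\tau_{x_r}],\ [\sum_{r=2}^{m+2}\lambda_{r-1}\tau_{y_r}^{x^m}],\ [\beta\sum_{r=1}^{m+2}\lambda_{r-2}\tau_{y_r}^{x^m}]\big\}$; \item $m>n=1$, Case II and Case 2: $\big\{[\sum_{r=1}^{n+2m}\tau_{x_r}],\ [\sum_{r=1}^{m+2}(\tfrac{\alpha}{2})^{r-1}\tau_{y_r}^{x^m}]\big\}$; \item $m>n=1$, Case II and Case 3: $\big\{[\sum_{r=1}^{n+2m}\tau_{x_r}]\big\}$; \item $m>n>1$, Case I: $\big\{[\sum_{r=1}^{n+2m}\tau_{x_r}],\ [\sum_{r=1}^m(-1)^{r-1}\tau_{x_{n+r}}]\big\}$; \item $m>n>1$, Case II: $\big\{[\sum_{r=1}^{n+2m}\tau_{x_r}]\big\}$. \end{itemize}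
   Context: Down-up algebra: $A(\alpha,\beta)=\Bbbk\langle x,y\rangle/(x^2y-\beta yx^2-\alpha xyx,\ xy^2-\beta y^2x-\alpha yxy)$, graded by $\deg x=n$, $\deg y=m$. Beilinson algebra: $\nabla A$ is the path algebra $\Bbbk Q/\mathcal I$ (paths composed left to right), where $Q$ has vertices $e_1,\dots,e_{2(n+m)}$, arrows $x_i:e_i\to e_{i+n}$ ($1\le i\le n+2m$) and $y_j:e_j\to e_{j+m}$ ($1\le j\le 2n+m$), and $\mathcal I$ is generated by $f_i=x_ix_{i+n}y_{i+2n}-\alpha x_iy_{i+n}x_{i+n+m}-\beta y_ix_{i+m}x_{i+n+m}$ ($1\le i\le m$) and $g_j=x_jy_{j+n}y_{j+n+m}-\alpha y_jx_{j+m}y_{j+n+m}-\beta y_jy_{j+m}x_{j+2m}$ ($1\le j\le n$). Resolution: let $\mathcal G^0,\mathcal G^1$ be the sets of vertices and of arrows, $\mathcal G^2=\{f_1,\dots,f_m,g_1,\dots,g_n\}$, and $P^r=\bigoplus_{h\in\mathcal G^r}\nabla A\,s(h)\otimes_{\Bbbk}t(h)\,\nabla A$ for $r=0,1,2$, where $s,t$ denote source and target. The minimal projective bimodule resolution of $\nabla A$ is $0\to P^2\xrightarrow{\partial^2}P^1\xrightarrow{\partial^1}P^0\xrightarrow{\partial^0}\nabla A\to0$, with $\partial^0$ multiplication, $\partial^1(s(a)\otimes t(a))=(s(a)\otimes s(a))a-a(t(a)\otimes t(a))$ for an arrow $a$, and for a relation $h=\sum_p c_p\,p\in\mathcal G^2$,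 $\partial^2(s(h)\otimes t(h))=\sum_p c_p\sum_{p=p'ap''}p'(s(a)\otimes t(a))p''$, the inner sum being over the arrows $a$ occurring in the path $p$. Let $\widehat{P^r}=\mathrm{Hom}_{(\nabla A)^{\mathrm e}}(P^r,\nabla A)$, where $(\nabla A)^{\mathrm e}=(\nabla A)^{\mathrm{op}}\otimes_{\Bbbk}\nabla A$; $\mathrm{HH}^r(\nabla A)=\mathrm{Ext}^r_{(\nabla A)^{\mathrm e}}(\nabla A,\nabla A)$ is the cohomology of $0\to\widehat{P^0}\xrightarrow{\widehat{\partial^1}}\widehat{P^1}\xrightarrow{\widehat{\partial^2}}\widehat{P^2}\to0$, and $[\tau]$ denotes the class of $\tau$. Notation: for $h\in\mathcal G^r$ and a word $w$ in $x,y$ spelling a path from $s(h)$ to $t(h)$ (e.g. $x^m$ for $h=y_r$, $n=1$, gives $x_rx_{r+1}\cdots x_{r+m-1}$), $\tau_h^w\in\widehat{P^r}$ sends $s(h)\otimes t(h)$ to that path and the other generators $s(h')\otimes t(h')$, $h'\neq h$, to $0$. For an arrow $a$, $\tau_a$ sends $s(a)\otimes t(a)$ to $a$ and the other generators to $0$. Scalars: $\lambda_{-1}=\beta^{-1}$, $\lambda_0=0$, $\lambda_{r+2}=\alpha\lambda_{r+1}+\beta\lambda_r$. Cases: Case I: $n+m$ is even and $\alpha=0$. Case II: otherwise. Case 1: $\lambda_{m+1}=0$. Case 2: $\lambda_{m+1}\neq0$ and $\alpha^2+4\beta=0$. Case 3: $\lambda_{m+1}\ne0$ and $\alpha^2+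4\beta\neq0$.
   Formalization: For n=m=1 the printed classes with τ_{x_1}^y and τ_{x_3}^y are not cocycles in general (e.g. α=0, β=2); proved with indices 1 and 3 exchanged: [βτ_{x_1}^y+τ_{x_3}^y] in Case I and [(α/2)²τ_{x_1}^y+(α/2)τ_{x_2}^y+τ_{x_3}^y] in Case II, Case 2. *)

theory Defs
  imports
    "HOL-Algebra.QuotRing"
    "Jordan_Normal_Form.VS_Connect"
    "Graph_Theory.Arc_Walk"
begin

section \<open>Linear algebra over a field given as a type\<close>

text \<open>
  The ground field is a type \<open>'k\<close>; \<^term>\<open>class_ring\<close> is its record. Vector spaces are
  \<^typ>\<open>('k, 'm) module\<close> records. When a record only serves as a vector space or a bimodule, its
  ring multiplication and unit are irrelevant.
\<close>

definition free_module :: "'p set \<Rightarrow> ('k::field, 'p \<Rightarrow> 'k) module" where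
  "free_module S =
    \<lparr>carrier = {f. finite {p. f p \<noteq> 0} \<and> {p. f p \<noteq> 0} \<subseteq> S},
     mult = undefined, one = undefined,
     zero = (\<lambda>_. 0), add = (\<lambda>f g p. f p + g p), smult = (\<lambda>c f p. c * f p)\<rparr>"

definition basis_elem :: "'p \<Rightarrow> 'p \<Rightarrow> 'k::field" where
  "basis_elem p = (\<lambda>q. of_bool (q = p))"

text \<open>
  The quotient by a subspace \<open>N\<close>. If \<open>M\<close> carries an algebra structure and \<open>N\<close> is a two-sided
  ideal, this is the quotient algebra.
\<close>

definition quot :: "('k::field, 'm) module \<Rightarrow> 'm set \<Rightarrow> ('k, 'm set) module" where
  "quot M N = ring.extend (M Quot N)
     (module.fields (\<lambda>c X. \<Union>x\<in>X. N +>\<^bsub>M\<^esub> (c \<odot>\<^bsub>M\<^esub> x)))"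

text \<open>The members of a basis are listed without repetition.\<close>

definition basis_list :: "('k::field, 'm) module \<Rightarrow> 'm list \<Rightarrow> bool" where
  "basis_list V xs \<longleftrightarrow> distinct xs \<and> vectorspace.basis class_ring V (set xs)"

subsection \<open>Tensor products over the ground field\<close>

definition tensor_relations ::
    "('k::field, 'm) module \<Rightarrow> ('k, 'n) module \<Rightarrow> ('m \<times> 'n \<Rightarrow> 'k) set" where
  "tensor_relations M N =
     {(\<lambda>p. basis_elem (x \<oplus>\<^bsub>M\<^esub> x', y) p - basis_elem (x, y) p - basis_elem (x', y) p) | x x' y.
        x \<in> carrier M \<and> x' \<in> carrier M \<and> y \<in> carrier N} \<union>
     {(\<lambda>p. basis_elem (x, y \<oplus>\<^bsub>N\<^esub> y') p - basis_elem (x, y) p - basis_elem (x, y') p) | x y y'.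
        x \<in> carrier M \<and> y \<in> carrier N \<and> y' \<in> carrier N} \<union>
     {(\<lambda>p. basis_elem (c \<odot>\<^bsub>M\<^esub> x, y) p - c * basis_elem (x, y) p) | c x y.
        x \<in> carrier M \<and> y \<in> carrier N} \<union>
     {(\<lambda>p. basis_elem (x, c \<odot>\<^bsub>N\<^esub> y) p - c * basis_elem (x, y) p) | c x y.
        x \<in> carrier M \<and> y \<in> carrier N}"

definition tensor_null ::
    "('k::field, 'm) module \<Rightarrow> ('k, 'n) module \<Rightarrow> ('m \<times> 'n \<Rightarrow> 'k) set" where
  "tensor_null M N =
     LinearCombinations.module.span class_ring (free_module (carrier M \<times> carrier N))
       (tensor_relations M N)"

definition tensor ::
    "('k::field, 'm) module \<Rightarrow> ('k, 'n) module \<Rightarrow> ('k, ('m \<times> 'n \<Rightarrow> 'k) set) module" where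
  "tensor M N = quot (free_module (carrier M \<times> carrier N)) (tensor_null M N)"

definition pure_tensor ::
    "('k::field, 'm) module \<Rightarrow> ('k, 'n) module \<Rightarrow> 'm \<Rightarrow> 'n \<Rightarrow> ('m \<times> 'n \<Rightarrow> 'k) set" where
  "pure_tensor M N x y =
     tensor_null M N +>\<^bsub>free_module (carrier M \<times> carrier N)\<^esub> basis_elem (x, y)"

text \<open>
  The linear extension of a map of index sets to finitely supported functions, and the map it
  induces on the tensor product: for linear \<open>f\<close> and \<open>g\<close>, \<open>\<theta> = map_prod f g\<close> induces \<open>f \<otimes> g\<close>.
\<close>

definition push :: "('p \<Rightarrow> 'q) \<Rightarrow> ('p \<Rightarrow> 'k::field) \<Rightarrow> 'q \<Rightarrow> 'k" where
  "push \<theta> f = (\<lambda>q. \<Sum>p | f p \<noteq> 0 \<and> \<theta> p = q. f p)"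

definition tensor_map ::
    "('k::field, 'm) module \<Rightarrow> ('k, 'n) module \<Rightarrow> ('m \<times> 'n \<Rightarrow> 'm \<times> 'n) \<Rightarrow>
     ('m \<times> 'n \<Rightarrow> 'k) set \<Rightarrow> ('m \<times> 'n \<Rightarrow> 'k) set" where
  "tensor_map M N \<theta> X =
     (\<Union>f\<in>X. tensor_null M N +>\<^bsub>free_module (carrier M \<times> carrier N)\<^esub> push \<theta> f)"

section \<open>Bimodules over an algebra\<close>

text \<open>
  Modules over the enveloping algebra of \<open>A\<close> are treated as \<open>A\<close>-bimodules on which the ground
  field acts centrally; the homomorphisms are the linear maps commuting with both actions.
\<close>

record ('k, 'a, 'm) bimodule = "('k, 'm) module" +
  lact :: "'a \<Rightarrow> 'm \<Rightarrow> 'm"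
  ract :: "'m \<Rightarrow> 'a \<Rightarrow> 'm"

definition regular_bimodule :: "('k::field, 'a) module \<Rightarrow> ('k, 'a, 'a) bimodule" where
  "regular_bimodule A = module.extend A
     (bimodule.fields (\<lambda>a x. a \<otimes>\<^bsub>A\<^esub> x) (\<lambda>x a. x \<otimes>\<^bsub>A\<^esub> a))"

definition left_ideal :: "('k::field, 'a) module \<Rightarrow> 'a \<Rightarrow> ('k, 'a) module" where
  "left_ideal A e = A\<lparr>carrier := (\<lambda>a. a \<otimes>\<^bsub>A\<^esub> e) ` carrier A\<rparr>"

definition right_ideal :: "('k::field, 'a) module \<Rightarrow> 'a \<Rightarrow> ('k, 'a) module" where
  "right_ideal A e = A\<lparr>carrier := (\<lambda>a. e \<otimes>\<^bsub>A\<^esub> a) ` carrier A\<rparr>"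

text \<open>The bimodule \<open>A e \<otimes> e' A\<close>.\<close>

definition proj_bimodule ::
    "('k::field, 'a) module \<Rightarrow> 'a \<Rightarrow> 'a \<Rightarrow> ('k, 'a, ('a \<times> 'a \<Rightarrow> 'k) set) bimodule" where
  "proj_bimodule A e e' = module.extend (tensor (left_ideal A e) (right_ideal A e'))
     (bimodule.fields
       (\<lambda>a. tensor_map (left_ideal A e) (right_ideal A e') (\<lambda>(x, y). (a \<otimes>\<^bsub>A\<^esub> x, y)))
       (\<lambda>z a. tensor_map (left_ideal A e) (right_ideal A e') (\<lambda>(x, y). (x, y \<otimes>\<^bsub>A\<^esub> a)) z))"

definition bimodule_sum ::
    "'i set \<Rightarrow> ('i \<Rightarrow> ('k::field, 'a, 'm) bimodule) \<Rightarrow> ('k, 'a, 'i \<Rightarrow> 'm) bimodule" where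
  "bimodule_sum I P =
    \<lparr>carrier = {z \<in> (\<Pi>\<^sub>E i\<in>I. carrier (P i)). finite {i \<in> I. z i \<noteq> \<zero>\<^bsub>P i\<^esub>}},
     mult = undefined, one = undefined,
     zero = (\<lambda>i\<in>I. \<zero>\<^bsub>P i\<^esub>),
     add = (\<lambda>z z'. \<lambda>i\<in>I. z i \<oplus>\<^bsub>P i\<^esub> z' i),
     smult = (\<lambda>c z. \<lambda>i\<in>I. c \<odot>\<^bsub>P i\<^esub> z i),
     lact = (\<lambda>a z. \<lambda>i\<in>I. lact (P i) a (z i)),
     ract = (\<lambda>z a. \<lambda>i\<in>I. ract (P i) (z i) a)\<rparr>"

definition bimodule_hom ::
    "('k::field, 'a) module \<Rightarrow> ('k, 'a, 'm) bimodule \<Rightarrow> ('k, 'a, 'n) bimodule \<Rightarrow> ('m \<Rightarrow> 'n) set"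
  where
  "bimodule_hom A P Q =
     {\<phi> \<in> extensional (carrier P). \<phi> \<in> LinearCombinations.module_hom class_ring P Q \<and>
        (\<forall>a\<in>carrier A. \<forall>z\<in>carrier P.
           \<phi> (lact P a z) = lact Q a (\<phi> z) \<and> \<phi> (ract P z a) = ract Q (\<phi> z) a)}"

definition hom_space ::
    "('k::field, 'a) module \<Rightarrow> ('k, 'a, 'm) bimodule \<Rightarrow> ('k, 'a, 'n) bimodule \<Rightarrow>
     ('k, 'm \<Rightarrow> 'n) module" where
  "hom_space A P Q =
    \<lparr>carrier = bimodule_hom A P Q,
     mult = undefined, one = undefined,
     zero = (\<lambda>z\<in>carrier P. \<zero>\<^bsub>Q\<^esub>),
     add = (\<lambda>\<phi> \<psi>. \<lambda>z\<in>carrier P. \<phi> z \<oplus>\<^bsub>Q\<^esub> \<psi> z),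
     smult = (\<lambda>c \<phi>. \<lambda>z\<in>carrier P. c \<odot>\<^bsub>Q\<^esub> \<phi> z)\<rparr>"

text \<open>The homomorphism with prescribed values \<open>v\<close> on the generators \<open>g h\<close> (\<open>h \<in> H\<close>) of \<open>P\<close>.\<close>

definition hom_with_values ::
    "('k::field, 'a) module \<Rightarrow> ('k, 'a, 'm) bimodule \<Rightarrow> ('k, 'a, 'n) bimodule \<Rightarrow>
     'h set \<Rightarrow> ('h \<Rightarrow> 'm) \<Rightarrow> ('h \<Rightarrow> 'n) \<Rightarrow> 'm \<Rightarrow> 'n" where
  "hom_with_values A P Q H g v =
     (THE \<phi>. \<phi> \<in> bimodule_hom A P Q \<and> (\<forall>h\<in>H. \<phi> (g h) = v h))"

section \<open>Path algebras\<close>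

text \<open>
  A path is given by its source and its list of arrows, so that the trivial paths at distinct
  vertices are distinct. The coefficient of a path in a product is the sum over the ways of
  cutting it in two (paths compose from left to right).
\<close>

definition paths :: "('v, 'e) pre_digraph \<Rightarrow> ('v \<times> 'e list) set" where
  "paths Q = {(u, p). \<exists>v. pre_digraph.awalk Q u p v}"

definition path_algebra :: "('v, 'e) pre_digraph \<Rightarrow> ('k::field, 'v \<times> 'e list \<Rightarrow> 'k) module" where
  "path_algebra Q = (free_module (paths Q))
    \<lparr>mult := (\<lambda>f g (u, p). \<Sum>i\<le>length p.
        f (u, take i p) * g (pre_digraph.awlast Q u (take i p), drop i p)),
     one := (\<lambda>(u, p). of_bool (u \<in> verts Q \<and> p = []))\<rparr>"

section \<open>The Beilinson algebra of a graded down-up algebra\<close>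

datatype arrow = ArrX nat | ArrY nat

datatype relator = RelF nat | RelG nat

datatype letter = LX | LY

fun lam_shift :: "'k::field \<Rightarrow> 'k \<Rightarrow> nat \<Rightarrow> 'k" where
  "lam_shift \<alpha> \<beta> 0 = inverse \<beta>"
| "lam_shift \<alpha> \<beta> (Suc 0) = 0"
| "lam_shift \<alpha> \<beta> (Suc (Suc r)) = \<alpha> * lam_shift \<alpha> \<beta> (Suc r) + \<beta> * lam_shift \<alpha> \<beta> r"

text \<open>The scalars \<open>\<lambda>\<^sub>r\<close>, for \<open>r \<ge> -1\<close>.\<close>

definition lam :: "'k::field \<Rightarrow> 'k \<Rightarrow> int \<Rightarrow> 'k" where
  "lam \<alpha> \<beta> r = lam_shift \<alpha> \<beta> (nat (r + 1))"

definition case_I :: "'k::field \<Rightarrow> nat \<Rightarrow> nat \<Rightarrow> bool" where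
  "case_I \<alpha> n m \<longleftrightarrow> even (n + m) \<and> \<alpha> = 0"

definition case_II :: "'k::field \<Rightarrow> nat \<Rightarrow> nat \<Rightarrow> bool" where
  "case_II \<alpha> n m \<longleftrightarrow> \<not> case_I \<alpha> n m"

definition case_1 :: "'k::field \<Rightarrow> 'k \<Rightarrow> nat \<Rightarrow> bool" where
  "case_1 \<alpha> \<beta> m \<longleftrightarrow> lam \<alpha> \<beta> (int m + 1) = 0"

definition case_2 :: "'k::field \<Rightarrow> 'k \<Rightarrow> nat \<Rightarrow> bool" where
  "case_2 \<alpha> \<beta> m \<longleftrightarrow> lam \<alpha> \<beta> (int m + 1) \<noteq> 0 \<and> \<alpha>\<^sup>2 + 4 * \<beta> = 0"

definition case_3 :: "'k::field \<Rightarrow> 'k \<Rightarrow> nat \<Rightarrow> bool" where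
  "case_3 \<alpha> \<beta> m \<longleftrightarrow> lam \<alpha> \<beta> (int m + 1) \<noteq> 0 \<and> \<alpha>\<^sup>2 + 4 * \<beta> \<noteq> 0"

type_synonym 'k alg_elem = "(nat \<times> arrow list \<Rightarrow> 'k) set"

type_synonym ('k, 'h) proj_elem = "'h \<Rightarrow> ('k alg_elem \<times> 'k alg_elem \<Rightarrow> 'k) set"

locale beilinson =
  fixes \<alpha> \<beta> :: "'k::field" and n m :: nat
begin

definition quiver :: "(nat, arrow) pre_digraph" where
  "quiver =
    \<lparr>verts = {1..2 * (n + m)},
     arcs = ArrX ` {1..n + 2 * m} \<union> ArrY ` {1..2 * n + m},
     tail = (\<lambda>a. case a of ArrX i \<Rightarrow> i | ArrY j \<Rightarrow> j),
     head = (\<lambda>a. case a of ArrX i \<Rightarrow> i + n | ArrY j \<Rightarrow> j + m)\<rparr>"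

definition relators :: "relator set" where
  "relators = RelF ` {1..m} \<union> RelG ` {1..n}"

fun relation :: "relator \<Rightarrow> nat \<times> arrow list \<Rightarrow> 'k" where
  "relation (RelF i) = (\<lambda>p.
      basis_elem (i, [ArrX i, ArrX (i + n), ArrY (i + 2 * n)]) p
      - \<alpha> * basis_elem (i, [ArrX i, ArrY (i + n), ArrX (i + n + m)]) p
      - \<beta> * basis_elem (i, [ArrY i, ArrX (i + m), ArrX (i + n + m)]) p)"
| "relation (RelG j) = (\<lambda>p.
      basis_elem (j, [ArrX j, ArrY (j + n), ArrY (j + n + m)]) p
      - \<alpha> * basis_elem (j, [ArrY j, ArrX (j + m), ArrY (j + n + m)]) p
      - \<beta> * basis_elem (j, [ArrY j, ArrY (j + m), ArrX (j + 2 * m)]) p)"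

fun rel_source :: "relator \<Rightarrow> nat" where
  "rel_source (RelF i) = i"
| "rel_source (RelG j) = j"

fun rel_target :: "relator \<Rightarrow> nat" where
  "rel_target (RelF i) = i + 2 * n + m"
| "rel_target (RelG j) = j + n + 2 * m"

definition rel_ideal :: "'k alg_elem" where
  "rel_ideal = Idl\<^bsub>path_algebra quiver\<^esub> (relation ` relators)"

definition algebra :: "('k, 'k alg_elem) module" where
  "algebra = quot (path_algebra quiver) rel_ideal"

definition path_class :: "nat \<times> arrow list \<Rightarrow> 'k alg_elem" where
  "path_class p = rel_ideal +>\<^bsub>(path_algebra quiver :: ('k, _) module)\<^esub> basis_elem p"

abbreviation vertex :: "nat \<Rightarrow> 'k alg_elem" where
  "vertex v \<equiv> path_class (v, [])"

abbreviation arrow_class :: "arrow \<Rightarrow> 'k alg_elem" where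
  "arrow_class a \<equiv> path_class (tail quiver a, [a])"

subsection \<open>The bimodule resolution and the Hochschild complex\<close>

definition proj_sum :: "'h set \<Rightarrow> ('h \<Rightarrow> nat) \<Rightarrow> ('h \<Rightarrow> nat) \<Rightarrow>
    ('k, 'k alg_elem, ('k, 'h) proj_elem) bimodule" where
  "proj_sum H src tgt =
     bimodule_sum H (\<lambda>h. proj_bimodule algebra (vertex (src h)) (vertex (tgt h)))"

text \<open>The generator \<open>s(h) \<otimes> t(h)\<close> of the summand indexed by \<open>h\<close>.\<close>

definition proj_gen :: "'h set \<Rightarrow> ('h \<Rightarrow> nat) \<Rightarrow> ('h \<Rightarrow> nat) \<Rightarrow> 'h \<Rightarrow> ('k, 'h) proj_elem" where
  "proj_gen H src tgt h = (\<lambda>h'\<in>H.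
     if h' = h
     then pure_tensor (left_ideal algebra (vertex (src h))) (right_ideal algebra (vertex (tgt h)))
            (vertex (src h)) (vertex (tgt h))
     else \<zero>\<^bsub>proj_bimodule algebra (vertex (src h')) (vertex (tgt h'))\<^esub>)"

definition P0 :: "('k, 'k alg_elem, ('k, nat) proj_elem) bimodule" where
  "P0 = proj_sum (verts quiver) id id"
definition P1 :: "('k, 'k alg_elem, ('k, arrow) proj_elem) bimodule" where
  "P1 = proj_sum (arcs quiver) (tail quiver) (head quiver)"
definition P2 :: "('k, 'k alg_elem, ('k, relator) proj_elem) bimodule" where
  "P2 = proj_sum relators rel_source rel_target"

definition gen0 :: "nat \<Rightarrow> ('k, nat) proj_elem" where
  "gen0 = proj_gen (verts quiver) id id"
definition gen1 :: "arrow \<Rightarrow> ('k, arrow) proj_elem" where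
  "gen1 = proj_gen (arcs quiver) (tail quiver) (head quiver)"
definition gen2 :: "relator \<Rightarrow> ('k, relator) proj_elem" where
  "gen2 = proj_gen relators rel_source rel_target"

definition d1 :: "('k, arrow) proj_elem \<Rightarrow> ('k, nat) proj_elem" where
  "d1 = hom_with_values algebra P1 P0 (arcs quiver) gen1 (\<lambda>a.
     ract P0 (gen0 (tail quiver a)) (arrow_class a)
     \<ominus>\<^bsub>P0\<^esub> lact P0 (arrow_class a) (gen0 (head quiver a)))"

definition d2 :: "('k, relator) proj_elem \<Rightarrow> ('k, arrow) proj_elem" where
  "d2 = hom_with_values algebra P2 P1 relators gen2 (\<lambda>h.
     finsum P1 (\<lambda>(u, p). relation h (u, p) \<odot>\<^bsub>P1\<^esub>
       (\<Oplus>\<^bsub>P1\<^esub>i\<in>{..<length p}.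
          lact P1 (path_class (u, take i p))
            (ract P1 (gen1 (p ! i)) (path_class (head quiver (p ! i), drop (Suc i) p)))))
       {q. relation h q \<noteq> 0})"

definition Phat0 :: "('k, ('k, nat) proj_elem \<Rightarrow> 'k alg_elem) module" where
  "Phat0 = hom_space algebra P0 (regular_bimodule algebra)"
definition Phat1 :: "('k, ('k, arrow) proj_elem \<Rightarrow> 'k alg_elem) module" where
  "Phat1 = hom_space algebra P1 (regular_bimodule algebra)"
definition Phat2 :: "('k, ('k, relator) proj_elem \<Rightarrow> 'k alg_elem) module" where
  "Phat2 = hom_space algebra P2 (regular_bimodule algebra)"

definition dhat1 :: "(('k, nat) proj_elem \<Rightarrow> 'k alg_elem) \<Rightarrow>
    ('k, arrow) proj_elem \<Rightarrow> 'k alg_elem" where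
  "dhat1 \<phi> = compose (carrier P1) \<phi> d1"
definition dhat2 :: "(('k, arrow) proj_elem \<Rightarrow> 'k alg_elem) \<Rightarrow>
    ('k, relator) proj_elem \<Rightarrow> 'k alg_elem" where
  "dhat2 \<phi> = compose (carrier P2) \<phi> d2"

definition cocycles :: "(('k, arrow) proj_elem \<Rightarrow> 'k alg_elem) set" where
  "cocycles = {\<phi> \<in> carrier Phat1. dhat2 \<phi> = \<zero>\<^bsub>Phat2\<^esub>}"
definition coboundaries :: "(('k, arrow) proj_elem \<Rightarrow> 'k alg_elem) set" where
  "coboundaries = dhat1 ` carrier Phat0"

text \<open>
  \<open>HH\<^sup>1 = Ext\<^sup>1\<close> computed from the projective bimodule resolution
  \<open>0 \<rightarrow> P2 \<rightarrow> P1 \<rightarrow> P0\<close> of the algebra.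
\<close>

definition HH1 :: "('k, (('k, arrow) proj_elem \<Rightarrow> 'k alg_elem) set) module" where
  "HH1 = quot (Phat1\<lparr>carrier := cocycles\<rparr>) coboundaries"

definition cohom_class :: "(('k, arrow) proj_elem \<Rightarrow> 'k alg_elem) \<Rightarrow>
    (('k, arrow) proj_elem \<Rightarrow> 'k alg_elem) set" where
  "cohom_class \<phi> = coboundaries +>\<^bsub>Phat1\<^esub> \<phi>"

fun spell :: "nat \<Rightarrow> letter list \<Rightarrow> arrow list" where
  "spell v [] = []"
| "spell v (LX # w) = ArrX v # spell (v + n) w"
| "spell v (LY # w) = ArrY v # spell (v + m) w"

definition tau :: "arrow \<Rightarrow> letter list \<Rightarrow> ('k, arrow) proj_elem \<Rightarrow> 'k alg_elem" where
  "tau h w = hom_with_values algebra P1 (regular_bimodule algebra) (arcs quiver) gen1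
     (\<lambda>h'. if h' = h then path_class (tail quiver h, spell (tail quiver h) w) else \<zero>\<^bsub>algebra\<^esub>)"

text \<open>
  For \<open>n = m = 1\<close>, interchanging \<open>x\<close> and \<open>y\<close> reverses the order of the words in the relations, so
  a cocycle \<open>c\<^sub>3 \<tau>(y\<^sub>3, x) + c\<^sub>2 \<tau>(y\<^sub>2, x) + c\<^sub>1 \<tau>(y\<^sub>1, x)\<close> corresponds to
  \<open>c\<^sub>3 \<tau>(x\<^sub>1, y) + c\<^sub>2 \<tau>(x\<^sub>2, y) + c\<^sub>1 \<tau>(x\<^sub>3, y)\<close>: the indices run backwards. For instance, with
  \<open>\<alpha> = 0\<close> the cochain \<open>\<beta> \<tau>(x\<^sub>3, y) + \<tau>(x\<^sub>1, y)\<close> takes \<open>f\<^sub>1\<close> to \<open>1 - \<beta>\<^sup>2\<close> times the path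
  \<open>y\<^sub>1 x\<^sub>2 y\<^sub>3\<close>, and so is a cocycle only if \<open>\<beta>\<^sup>2 = 1\<close>.
\<close>

definition tau_arrow :: "arrow \<Rightarrow> ('k, arrow) proj_elem \<Rightarrow> 'k alg_elem" where
  "tau_arrow a = hom_with_values algebra P1 (regular_bimodule algebra) (arcs quiver) gen1
     (\<lambda>h'. if h' = a then arrow_class a else \<zero>\<^bsub>algebra\<^esub>)"

end

end

theory Submission
  imports Defs "HOL-Number_Theory.Cong"
begin

text \<open>
  A 1-cochain sends \<open>x\<^sub>i\<close> to \<open>a\<^sub>i x\<^sub>i + d\<^sub>i y\<^sub>i\<close> and \<open>y\<^sub>j\<close> to \<open>b\<^sub>j y\<^sub>j + c\<^sub>j x\<^sup>m\<close>, where \<open>d\<close> can be nonzero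
  only for \<open>n = m\<close> and \<open>c\<close> only for \<open>n = 1\<close>. The cocycle condition splits into conditions on \<open>(a, b)\<close>, on \<open>c\<close> and on
  \<open>d\<close>, and coboundaries only affect \<open>(a, b)\<close>. The condition on \<open>(a, b)\<close> concerns the curl
  \<open>a\<^sub>k + b\<^sub>k\<^sub>+\<^sub>n - b\<^sub>k - a\<^sub>k\<^sub>+\<^sub>m\<close> at the vertices \<open>k \<le> n + m\<close>: it changes sign along a cycle through all these
  vertices, and vanishes if \<open>\<alpha> \<noteq> 0\<close>. So it is zero in Case II and determined by one scalar in Case I, and pairs
  without curl are, up to coboundaries, the multiples of \<open>a = 1, b = 0\<close>. The coefficients \<open>c\<close> satisfy the recurrence
  of \<open>\<lambda>\<close> together with \<open>(2 c\<^sub>2 - \<alpha> c\<^sub>1) \<lambda>\<^sub>m\<^sub>+\<^sub>1 = 0 = (\<alpha> c\<^sub>2 + 2 \<beta> c\<^sub>1) \<lambda>\<^sub>m\<^sub>+\<^sub>1\<close>, a system whose determinant without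
  the factors \<open>\<lambda>\<^sub>m\<^sub>+\<^sub>1\<close> is \<open>\<alpha>\<^sup>2 + 4 \<beta>\<close>; the same holds for \<open>d\<close> with the indices reversed.
\<close>

text \<open>No basis of the algebra is constructed. Membership in the ideal of relations is shown by
  explicit combinations, and necessary conditions come from functionals on words that respect the
  relations; this suffices because only a few families of words are parallel to an arrow or to a
  relation. The scalars \<lambda> come from pushing \<open>y\<close> to the left: by the relations
  \<open>f\<close>, \<open>x^k y x^l\<close> equals \<open>\<lambda>\<^sub>k x y x^(k+l-1) + \<beta>
  \<lambda>\<^sub>k\<^sub>-\<^sub>1 y x^(k+l)\<close>. A cochain with values \<open>x^m\<close> at
  the \<open>y\<close>-arrows sends \<open>g\<^sub>1\<close> to a combination containing
  \<open>x^(m+1) y\<close> and \<open>x^m y x\<close>, and rewriting these produces the factors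
  \<open>\<lambda>\<^sub>m\<^sub>+\<^sub>1\<close>. Coboundaries are differences of functions on
  vertices because a path of weight 0 is trivial. Characteristic zero enters through division by m,
  which finds the multiple of a = 1, and by 2, in the sign argument and in the recurrence. Tensor
  products are quotients of free modules and the differentials are definite descriptions, so
  universal properties come before any computation with them.\<close>

abbreviation vspace :: "('k::field, 'm, 'z) module_scheme \<Rightarrow> bool" where
  "vspace \<equiv> vectorspace class_ring"

abbreviation lin :: "('k::field, 'm, 'y) module_scheme \<Rightarrow> ('k, 'n, 'z) module_scheme \<Rightarrow> ('m \<Rightarrow> 'n) set"
  where "lin \<equiv> LinearCombinations.module_hom class_ring"

abbreviation subsp :: "'m set \<Rightarrow> ('k::field, 'm, 'z) module_scheme \<Rightarrow> bool" where
  "subsp \<equiv> submodule class_ring"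

section \<open>Vector spaces, linear maps, subspaces and quotients given as records\<close>

lemma field_class_ring: "Ring.field (class_ring :: 'k::field ring)"
  by (rule class_field.field_axioms)

lemma cring_class_ring: "cring (class_ring :: 'k::field ring)"
  by (rule domain.axioms(1)[OF Ring.field.axioms(1)[OF field_class_ring]])

text \<open>Additive inverses are supplied by the scalar -1, since 1 + (-1) acts as zero.\<close>

lemma vspaceI:
  fixes V :: "('k::field, 'm, 'z) module_scheme" (structure)
  assumes "\<zero> \<in> carrier V"
    and "\<And>x y. x \<in> carrier V \<Longrightarrow> y \<in> carrier V \<Longrightarrow> x \<oplus> y \<in> carrier V"
    and "\<And>c x. x \<in> carrier V \<Longrightarrow> c \<odot> x \<in> carrier V"
    and "\<And>x y z. x \<in> carrier V \<Longrightarrow> y \<in> carrier V \<Longrightarrow> z \<in> carrier V \<Longrightarrow> (x \<oplus> y) \<oplus> z = x \<oplus> (y \<oplus> z)"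
    and "\<And>x y. x \<in> carrier V \<Longrightarrow> y \<in> carrier V \<Longrightarrow> x \<oplus> y = y \<oplus> x"
    and "\<And>x. x \<in> carrier V \<Longrightarrow> x \<oplus> \<zero> = x"
    and "\<And>x. x \<in> carrier V \<Longrightarrow> 0 \<odot> x = \<zero>"
    and "\<And>x. x \<in> carrier V \<Longrightarrow> 1 \<odot> x = x"
    and "\<And>c d x. x \<in> carrier V \<Longrightarrow> (c * d) \<odot> x = c \<odot> (d \<odot> x)"
    and "\<And>c d x. x \<in> carrier V \<Longrightarrow> (c + d) \<odot> x = c \<odot> x \<oplus> d \<odot> x"
    and "\<And>c x y. x \<in> carrier V \<Longrightarrow> y \<in> carrier V \<Longrightarrow> c \<odot> (x \<oplus> y) = c \<odot> x \<oplus> c \<odot> y"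
  shows "vspace V"
proof -
  have "Module.module class_ring V"
  proof (rule module_criteria)
    show "\<forall>v\<in>carrier V. \<exists>n\<in>carrier V. v \<oplus> n = \<zero>"
    proof
      fix v assume v: "v \<in> carrier V"
      have "v \<oplus> (- 1) \<odot> v = (1 + - 1) \<odot> v"
        using assms(10)[OF v, of 1 "- 1"] assms(8)[OF v] by simp
      then show "\<exists>n\<in>carrier V. v \<oplus> n = \<zero>"
        using assms(3)[OF v, of "- 1"] assms(7)[OF v] by auto
    qed
  qed (use assms cring_class_ring in auto)
  then show ?thesis
    by (rule vectorspace.intro) (rule field_class_ring)
qed

text \<open>Restates the laws with the operations of the type \<open>'k\<close>, so that
  simplification does not meet the record operations of \<open>class_ring\<close>.\<close>

locale vsp = vectorspace class_ring V for V :: "('k::field, 'm, 'z) module_scheme" (structure)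
begin

lemma zero_in [simp]: "\<zero> \<in> carrier V" by simp
lemma add_in [simp]: "x \<in> carrier V \<Longrightarrow> y \<in> carrier V \<Longrightarrow> x \<oplus> y \<in> carrier V" by simp
lemma smult_in [simp]: "x \<in> carrier V \<Longrightarrow> c \<odot> x \<in> carrier V" by simp
lemma smult_zero [simp]: "c \<odot> \<zero> = \<zero>" by simp
lemma zero_smult [simp]: "x \<in> carrier V \<Longrightarrow> 0 \<odot> x = \<zero>"
  using smult_l_null[of x] by simp
lemma one_smult [simp]: "x \<in> carrier V \<Longrightarrow> 1 \<odot> x = x"
  using smult_one[of x] by simp
lemma mult_smult: "x \<in> carrier V \<Longrightarrow> (c * d) \<odot> x = c \<odot> (d \<odot> x)"
  using smult_assoc1[of c d x] by simp
lemma add_smult: "x \<in> carrier V \<Longrightarrow> (c + d) \<odot> x = c \<odot> x \<oplus> d \<odot> x"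
  using smult_l_distr[of c d x] by simp
lemma smult_add: "x \<in> carrier V \<Longrightarrow> y \<in> carrier V \<Longrightarrow> c \<odot> (x \<oplus> y) = c \<odot> x \<oplus> c \<odot> y"
  using smult_r_distr[of c x y] by simp
lemma minus_one_smult: "x \<in> carrier V \<Longrightarrow> (- 1) \<odot> x = \<ominus> x"
proof -
  assume x: "x \<in> carrier V"
  have "x \<oplus> (- 1) \<odot> x = \<zero>"
    using add_smult[OF x, of 1 "- 1"] x by simp
  then show ?thesis
    using x by (metis M.minus_equality M.add.m_comm smult_in)
qed
lemma minus_eq_add: "x \<ominus> y = x \<oplus> \<ominus> y" by (simp add: a_minus_def)

end

lemma vspI: "vspace V \<Longrightarrow> vsp V" by (simp add: vsp_def)

lemma linI:
  assumes "\<And>x. x \<in> carrier V \<Longrightarrow> f x \<in> carrier W"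
    and "\<And>x y. x \<in> carrier V \<Longrightarrow> y \<in> carrier V \<Longrightarrow> f (x \<oplus>\<^bsub>V\<^esub> y) = f x \<oplus>\<^bsub>W\<^esub> f y"
    and "\<And>c x. x \<in> carrier V \<Longrightarrow> f (c \<odot>\<^bsub>V\<^esub> x) = c \<odot>\<^bsub>W\<^esub> f x"
  shows "f \<in> lin V W"
  using assms unfolding LinearCombinations.module_hom_def by auto

lemma linD:
  assumes "f \<in> lin V W"
  shows lin_closed: "x \<in> carrier V \<Longrightarrow> f x \<in> carrier W"
    and lin_add: "x \<in> carrier V \<Longrightarrow> y \<in> carrier V \<Longrightarrow> f (x \<oplus>\<^bsub>V\<^esub> y) = f x \<oplus>\<^bsub>W\<^esub> f y"
    and lin_smult: "x \<in> carrier V \<Longrightarrow> f (c \<odot>\<^bsub>V\<^esub> x) = c \<odot>\<^bsub>W\<^esub> f x"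
  using assms unfolding LinearCombinations.module_hom_def by auto

lemma lin_mod_hom: "vspace V \<Longrightarrow> vspace W \<Longrightarrow> f \<in> lin V W \<Longrightarrow> mod_hom class_ring V W f"
  by (simp add: mod_hom_def mod_hom_axioms_def vectorspace_def)

lemma lin_zero: "vspace V \<Longrightarrow> vspace W \<Longrightarrow> f \<in> lin V W \<Longrightarrow> f \<zero>\<^bsub>V\<^esub> = \<zero>\<^bsub>W\<^esub>"
  by (rule mod_hom.f0_is_0[OF lin_mod_hom])

lemma lin_minus:
  "vspace V \<Longrightarrow> vspace W \<Longrightarrow> f \<in> lin V W \<Longrightarrow> x \<in> carrier V \<Longrightarrow> y \<in> carrier V \<Longrightarrow>
   f (x \<ominus>\<^bsub>V\<^esub> y) = f x \<ominus>\<^bsub>W\<^esub> f y"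
  by (rule mod_hom.f_minus[OF lin_mod_hom])

lemma lin_ker_subsp:
  "vspace V \<Longrightarrow> vspace W \<Longrightarrow> f \<in> lin V W \<Longrightarrow> subsp {x \<in> carrier V. f x = \<zero>\<^bsub>W\<^esub>} V"
  by (subst mod_hom.ker_def[OF lin_mod_hom, symmetric]) (auto intro: mod_hom.ker_is_submodule[OF lin_mod_hom])

lemma lin_finsum:
  assumes V: "vspace V" and W: "vspace W" and f: "f \<in> lin V W" and "finite I"
    and g: "\<And>i. i \<in> I \<Longrightarrow> g i \<in> carrier V"
  shows "f (finsum V g I) = finsum W (\<lambda>i. f (g i)) I"
  using \<open>finite I\<close> g
proof (induction I)
  case empty
  interpret V: vsp V using V by (rule vspI)
  interpret W: vsp W using W by (rule vspI)
  show ?case using lin_zero[OF V W f] by simp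
next
  case (insert i I)
  interpret V: vsp V using V by (rule vspI)
  interpret W: vsp W using W by (rule vspI)
  have g: "g \<in> I \<rightarrow> carrier V" "g i \<in> carrier V" using insert.prems by auto
  then have fg: "(\<lambda>i. f (g i)) \<in> I \<rightarrow> carrier W" "f (g i) \<in> carrier W"
    using linD(1)[OF f] by auto
  have "f (finsum V g (insert i I)) = f (g i \<oplus>\<^bsub>V\<^esub> finsum V g I)"
    by (subst V.M.finsum_insert) (use insert.hyps g in auto)
  also have "\<dots> = f (g i) \<oplus>\<^bsub>W\<^esub> f (finsum V g I)"
    by (rule linD(2)[OF f]) (use g V.M.finsum_closed in auto)
  also have "\<dots> = finsum W (\<lambda>i. f (g i)) (insert i I)"
    using W.M.finsum_insert[OF insert.hyps fg] insert.IH insert.prems by simp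
  finally show ?case .
qed

lemma subspI:
  assumes "vspace V" "N \<subseteq> carrier V" "\<zero>\<^bsub>V\<^esub> \<in> N"
    "\<And>x y. x \<in> N \<Longrightarrow> y \<in> N \<Longrightarrow> x \<oplus>\<^bsub>V\<^esub> y \<in> N" "\<And>c x. x \<in> N \<Longrightarrow> c \<odot>\<^bsub>V\<^esub> x \<in> N"
  shows "subsp N V"
  using assms by (simp add: submodule_def vectorspace_def)

lemma subsp_vspace: "vspace V \<Longrightarrow> subsp N V \<Longrightarrow> vspace (V\<lparr>carrier := N\<rparr>)"
  by (simp add: LinearCombinations.module.submodule_is_module vectorspace_def)

locale vsp_sub = vsp V for V :: "('k::field, 'm, 'z) module_scheme" (structure) +
  fixes N assumes sub: "subsp N V"
begin

lemma sub_carrier: "x \<in> N \<Longrightarrow> x \<in> carrier V" using sub by (auto simp: submodule_def)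
lemma sub_add: "x \<in> N \<Longrightarrow> y \<in> N \<Longrightarrow> x \<oplus> y \<in> N" using sub by (auto simp: submodule_def)
lemma sub_zero: "\<zero> \<in> N" using sub by (auto simp: submodule_def)
lemma sub_smult: "x \<in> N \<Longrightarrow> c \<odot> x \<in> N" using sub by (auto simp: submodule_def)
lemma sub_uminus: "x \<in> N \<Longrightarrow> \<ominus> x \<in> N"
  using sub_smult[of x "- 1"] minus_one_smult[of x] sub_carrier by simp

lemma sub_abelian: "abelian_subgroup N V"
proof (rule abelian_subgroupI3)
  show "abelian_group V" by (rule M.abelian_group_axioms)
  show "additive_subgroup N V"
  proof (rule additive_subgroup.intro, rule subgroup.intro)
    show "inv\<^bsub>add_monoid V\<^esub> x \<in> N" if "x \<in> N" for x
      using sub_uminus[OF that] by (simp add: a_inv_def)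
  qed (auto simp: sub_carrier sub_add sub_zero)
qed

sublocale N: abelian_subgroup N V by (rule sub_abelian)

lemma coset_eq_iff:
  assumes "x \<in> carrier V" "y \<in> carrier V"
  shows "N +> x = N +> y \<longleftrightarrow> x \<ominus> y \<in> N"
proof
  assume "N +> x = N +> y"
  then have "x \<in> N +> y" using N.a_rcos_self[OF assms(1)] by simp
  then show "x \<ominus> y \<in> N" using N.a_rcos_module[OF assms(2,1)] by (simp add: minus_eq_add)
next
  assume "x \<ominus> y \<in> N"
  then have "x \<in> N +> y" using N.a_rcos_module[OF assms(2,1)] by (simp add: minus_eq_add)
  then show "N +> x = N +> y"
    using N.a_repr_independence'[OF _ assms(2)] by simp
qed

lemma coset_mem_iff: "y \<in> N +> x \<longleftrightarrow> (\<exists>h\<in>N. y = h \<oplus> x)"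
  by (simp add: a_r_coset_def' )

text \<open>The scalar action of \<open>quot\<close> is a union over all representatives of a coset.
  Two representatives differ by a member of \<open>N\<close>, so the sets united are one and the
  same coset.\<close>

lemma smult_coset:
  assumes "x \<in> carrier V"
  shows "(\<Union>y\<in>N +> x. N +> (c \<odot> y)) = N +> (c \<odot> x)"
proof -
  have "N +> (c \<odot> y) = N +> (c \<odot> x)" if "y \<in> N +> x" for y
  proof -
    from that[unfolded coset_mem_iff] obtain h where h: "h \<in> N" "y = h \<oplus> x" by (rule bexE)
    have hV: "h \<in> carrier V" by (rule sub_carrier[OF h(1)])
    have yV: "y \<in> carrier V" using h hV assms by simp
    have "c \<odot> y \<ominus> c \<odot> x = (c \<odot> h \<oplus> c \<odot> x) \<oplus> \<ominus> (c \<odot> x)"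
      by (simp only: h(2) smult_add[OF hV assms] a_minus_def)
    also have "\<dots> = c \<odot> h \<oplus> (c \<odot> x \<oplus> \<ominus> (c \<odot> x))"
      by (rule M.a_assoc) (simp_all add: hV assms)
    also have "\<dots> = c \<odot> h"
      by (simp only: M.r_neg[OF smult_in[OF assms]] M.r_zero[OF smult_in[OF hV]])
    also have "\<dots> \<in> N" by (rule sub_smult[OF h(1)])
    finally show ?thesis
      using coset_eq_iff[OF smult_in[OF yV] smult_in[OF assms]] by simp
  qed
  then have "(\<lambda>y. N +> (c \<odot> y)) ` (N +> x) = (\<lambda>y. N +> (c \<odot> x)) ` (N +> x)"
    by (rule image_cong[OF refl])
  also have "\<dots> = {N +> (c \<odot> x)}"
    by (rule image_constant) (rule N.a_rcos_self[OF assms])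
  finally show ?thesis by simp
qed

end

locale vsp_quot = vsp_sub V N for V :: "('k::field, 'm) module" (structure) and N
begin

lemma quot_carrier: "carrier (quot V N) = (\<lambda>x. N +> x) ` carrier V"
  unfolding quot_def FactRing_def ring.defs module.defs A_RCOSETS_def' by auto

lemma quot_zero: "\<zero>\<^bsub>quot V N\<^esub> = N"
  by (simp add: quot_def FactRing_def ring.defs module.defs)

lemma quot_add:
  "x \<in> carrier V \<Longrightarrow> y \<in> carrier V \<Longrightarrow> (N +> x) \<oplus>\<^bsub>quot V N\<^esub> (N +> y) = N +> (x \<oplus> y)"
  by (simp add: quot_def FactRing_def ring.defs module.defs N.a_rcos_sum)

lemma quot_smult: "x \<in> carrier V \<Longrightarrow> c \<odot>\<^bsub>quot V N\<^esub> (N +> x) = N +> (c \<odot> x)"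
  by (simp add: quot_def FactRing_def ring.defs module.defs smult_coset)

lemmas quot_simps = quot_carrier quot_zero quot_add quot_smult

lemma quot_zero_coset: "N +> \<zero> = N"
  by (rule a_coset_add_zero) (auto intro: sub_carrier)

lemma vspace_quot: "vspace (quot V N)"
proof -
  have zero: "\<zero>\<^bsub>quot V N\<^esub> = N +> \<zero>" by (simp add: quot_zero quot_zero_coset)
  note s = quot_add quot_smult zero
  have rep: "\<exists>x\<in>carrier V. X = N +> x" if "X \<in> carrier (quot V N)" for X
    using that by (auto simp: quot_carrier)
  have mem: "N +> x \<in> carrier (quot V N)" if "x \<in> carrier V" for x
    using that by (auto simp: quot_carrier)
  show ?thesis
  proof (rule vspaceI)
    show "\<zero>\<^bsub>quot V N\<^esub> \<in> carrier (quot V N)" unfolding zero by (rule mem) simp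
  next
    fix X Y assume "X \<in> carrier (quot V N)" "Y \<in> carrier (quot V N)"
    then obtain x y where X: "X = N +> x" "x \<in> carrier V" "Y = N +> y" "y \<in> carrier V"
      using rep by metis
    show "X \<oplus>\<^bsub>quot V N\<^esub> Y \<in> carrier (quot V N)" using X by (simp add: s mem)
    show "X \<oplus>\<^bsub>quot V N\<^esub> Y = Y \<oplus>\<^bsub>quot V N\<^esub> X" using X by (simp add: s M.add.m_comm)
    show "c \<odot>\<^bsub>quot V N\<^esub> (X \<oplus>\<^bsub>quot V N\<^esub> Y) =
        c \<odot>\<^bsub>quot V N\<^esub> X \<oplus>\<^bsub>quot V N\<^esub> c \<odot>\<^bsub>quot V N\<^esub> Y" for c
      using X by (simp add: s smult_add)
    show "c \<odot>\<^bsub>quot V N\<^esub> X \<in> carrier (quot V N)" for c using X by (simp add: s mem)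
    show "X \<oplus>\<^bsub>quot V N\<^esub> \<zero>\<^bsub>quot V N\<^esub> = X" using X by (simp add: s del: a_coset_add_zero)
    show "0 \<odot>\<^bsub>quot V N\<^esub> X = \<zero>\<^bsub>quot V N\<^esub>" using X by (simp add: s del: a_coset_add_zero)
    show "1 \<odot>\<^bsub>quot V N\<^esub> X = X" using X by (simp add: s)
    show "(c * d) \<odot>\<^bsub>quot V N\<^esub> X = c \<odot>\<^bsub>quot V N\<^esub> (d \<odot>\<^bsub>quot V N\<^esub> X)" for c d
      using X by (simp add: s mult_smult)
    show "(c + d) \<odot>\<^bsub>quot V N\<^esub> X = c \<odot>\<^bsub>quot V N\<^esub> X \<oplus>\<^bsub>quot V N\<^esub> d \<odot>\<^bsub>quot V N\<^esub> X" for c d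
      using X by (simp add: s add_smult)
    fix Z assume "Z \<in> carrier (quot V N)"
    then obtain z where Z: "Z = N +> z" "z \<in> carrier V" using rep by metis
    show "X \<oplus>\<^bsub>quot V N\<^esub> Y \<oplus>\<^bsub>quot V N\<^esub> Z = X \<oplus>\<^bsub>quot V N\<^esub> (Y \<oplus>\<^bsub>quot V N\<^esub> Z)"
      using X Z by (simp add: s M.add.m_assoc)
  qed
qed

lemma coset_lin: "(\<lambda>x. N +> x) \<in> lin V (quot V N)"
  by (rule linI) (simp_all add: quot_simps)

lemma coset_eq_zero_iff: "x \<in> carrier V \<Longrightarrow> N +> x = N \<longleftrightarrow> x \<in> N"
  using N.a_rcos_self[of x] a_coset_join2[OF _ N.a_subgroup, of x] by metis

lemma lin_factor:
  assumes W: "vspace W" and f: "f \<in> lin V W" and ker: "\<And>x. x \<in> N \<Longrightarrow> f x = \<zero>\<^bsub>W\<^esub>"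
  obtains g where "g \<in> lin (quot V N) W" "\<And>x. x \<in> carrier V \<Longrightarrow> g (N +> x) = f x"
proof -
  interpret W: vsp W using W by (rule vspI)
  \<comment> \<open>Any representative serves: \<open>f\<close> kills \<open>N\<close> and is
    therefore constant on cosets.\<close>
  define g where "g X = f (SOME x. x \<in> X)" for X
  have g: "g (N +> x) = f x" if x: "x \<in> carrier V" for x
  proof -
    have "(SOME y. y \<in> N +> x) \<in> N +> x" using N.a_rcos_self[OF x] by (rule someI)
    then obtain h where h: "h \<in> N" "(SOME y. y \<in> N +> x) = h \<oplus> x"
      by (auto simp: coset_mem_iff)
    then show ?thesis
      using x lin_add[OF f sub_carrier[OF h(1)] x] ker[OF h(1)] lin_closed[OF f x]
      by (simp add: g_def)
  qed
  have "g \<in> lin (quot V N) W"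
    by (rule linI) (auto simp: quot_simps g linD[OF f])
  then show thesis using g that by blast
qed

end

lemma vsp_quotI: "vspace V \<Longrightarrow> subsp N V \<Longrightarrow> vsp_quot V N"
  by (simp add: vsp_quot_def vsp_sub_def vsp_sub_axioms_def vsp_def)

subsection \<open>Free modules\<close>

lemma free_module_simps:
  "carrier (free_module S) = {f. finite {p. f p \<noteq> 0} \<and> {p. f p \<noteq> 0} \<subseteq> S}"
  "\<zero>\<^bsub>free_module S\<^esub> = (\<lambda>_. 0)"
  "f \<oplus>\<^bsub>free_module S\<^esub> g = (\<lambda>p. f p + g p)"
  "c \<odot>\<^bsub>free_module S\<^esub> f = (\<lambda>p. c * f p)"
  by (simp_all add: free_module_def)

lemma free_add_closed:
  assumes "f \<in> carrier (free_module S)" "g \<in> carrier (free_module S)"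
  shows "(\<lambda>p. f p + g p) \<in> carrier (free_module S)"
proof -
  have "{p. f p + g p \<noteq> 0} \<subseteq> {p. f p \<noteq> 0} \<union> {p. g p \<noteq> 0}" by auto
  moreover have "finite ({p. f p \<noteq> 0} \<union> {p. g p \<noteq> 0})" "{p. f p \<noteq> 0} \<union> {p. g p \<noteq> 0} \<subseteq> S"
    using assms by (simp_all add: free_module_simps)
  ultimately show ?thesis unfolding free_module_simps mem_Collect_eq
    by (meson finite_subset subset_trans)
qed

lemma free_smult_closed:
  assumes "f \<in> carrier (free_module S)"
  shows "(\<lambda>p. c * f p) \<in> carrier (free_module S)"
proof -
  have "{p. c * f p \<noteq> 0} \<subseteq> {p. f p \<noteq> 0}" by auto
  moreover have "finite {p. f p \<noteq> 0}" "{p. f p \<noteq> 0} \<subseteq> S"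
    using assms by (simp_all add: free_module_simps)
  ultimately show ?thesis unfolding free_module_simps mem_Collect_eq
    by (meson finite_subset subset_trans)
qed

lemma vspace_free: "vspace (free_module S)"
proof (rule vspaceI)
  show "\<zero>\<^bsub>free_module S\<^esub> \<in> carrier (free_module S)" by (simp add: free_module_simps)
qed (simp_all only: free_module_simps(2-) free_add_closed free_smult_closed, auto simp: algebra_simps)

lemma basis_elem_closed: "p \<in> S \<Longrightarrow> basis_elem p \<in> carrier (free_module S)"
  by (simp add: free_module_simps basis_elem_def)

lemma free_module_induct [consumes 1, case_names zero step]:
  fixes f :: "'p \<Rightarrow> 'k::field"
  assumes f: "f \<in> carrier (free_module S)" and zero: "P (\<lambda>_. 0)"
    and step: "\<And>c p g. p \<in> S \<Longrightarrow> g \<in> carrier (free_module S) \<Longrightarrow> P g \<Longrightarrow>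
      P (\<lambda>q. c * basis_elem p q + g q)"
  shows "P f"
proof -
  \<comment> \<open>The induction runs over a finite set containing the support, so that a
    coefficient can be cleared without knowing whether it was nonzero.\<close>
  have "P f" if "finite A" "{p. f p \<noteq> 0} \<subseteq> A" "A \<subseteq> S" for A f
    using that
  proof (induction A arbitrary: f rule: finite_induct)
    case empty
    then have "f = (\<lambda>_. 0)" by auto
    then show ?case using zero by simp
  next
    case (insert a A)
    define g where "g = f(a := 0)"
    have g: "{p. g p \<noteq> 0} \<subseteq> A" using insert.prems by (auto simp: g_def)
    have "finite {p. g p \<noteq> 0}" using g insert.hyps finite_subset by blast
    then have "g \<in> carrier (free_module S)"
      using g insert.prems by (auto simp: free_module_simps)
    moreover have "P g" using g insert by auto
    ultimately have "P (\<lambda>q. f a * basis_elem a q + g q)"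
      using step insert.prems by auto
    moreover have "(\<lambda>q. f a * basis_elem a q + g q) = f" by (auto simp: basis_elem_def g_def)
    ultimately show ?case by simp
  qed
  then show ?thesis using f by (auto simp: free_module_simps)
qed

lemma free_module_extend:
  fixes b :: "'p \<Rightarrow> 'w"
  assumes W: "vspace (W :: ('k::field, 'w, 'z) module_scheme)"
    and b: "\<And>p. p \<in> S \<Longrightarrow> b p \<in> carrier W"
  obtains L where "L \<in> lin (free_module S) W" "\<And>p. p \<in> S \<Longrightarrow> L (basis_elem p) = b p"
proof -
  interpret W: vsp W using W by (rule vspI)
  define L where "L f = finsum W (\<lambda>p. f p \<odot>\<^bsub>W\<^esub> b p) {p. f p \<noteq> 0}" for f
  \<comment> \<open>The supports of \<open>f\<close>, \<open>g\<close> and \<open>f + g\<close>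
    differ; this lets all three values be computed over one common finite set.\<close>
  have L: "L f = finsum W (\<lambda>p. f p \<odot>\<^bsub>W\<^esub> b p) A"
    if "finite A" "{p. f p \<noteq> 0} \<subseteq> A" "A \<subseteq> S" for A f
    unfolding L_def
    by (rule W.M.add.finprod_mono_neutral_cong_left) (use that b in auto)
  have supp: "finite {p. f p \<noteq> 0}" "{p. f p \<noteq> 0} \<subseteq> S" if "f \<in> carrier (free_module S)" for f :: "'p \<Rightarrow> 'k"
    using that by (auto simp: free_module_simps)
  have "L \<in> lin (free_module S) W"
  proof (rule linI)
    fix f :: "'p \<Rightarrow> 'k" assume f: "f \<in> carrier (free_module S)"
    show "L f \<in> carrier W"
      unfolding L_def by (rule W.M.finsum_closed) (use supp[OF f] b in auto)
    show "L (c \<odot>\<^bsub>free_module S\<^esub> f) = c \<odot>\<^bsub>W\<^esub> L f" for c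
    proof -
      have "L (c \<odot>\<^bsub>free_module S\<^esub> f) = finsum W (\<lambda>p. (c * f p) \<odot>\<^bsub>W\<^esub> b p) {p. f p \<noteq> 0}"
        unfolding free_module_simps by (rule L[OF supp(1)[OF f] _ supp(2)[OF f]]) auto
      also have "\<dots> = finsum W (\<lambda>p. c \<odot>\<^bsub>W\<^esub> (f p \<odot>\<^bsub>W\<^esub> b p)) {p. f p \<noteq> 0}"
        by (rule W.M.finsum_cong') (use supp[OF f] b in \<open>auto simp: W.mult_smult\<close>)
      also have "\<dots> = c \<odot>\<^bsub>W\<^esub> L f"
        unfolding L_def by (rule W.finsum_smult[symmetric]) (use supp[OF f] b in auto)
      finally show ?thesis .
    qed
    fix g :: "'p \<Rightarrow> 'k" assume g: "g \<in> carrier (free_module S)"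
    let ?A = "{p. f p \<noteq> 0} \<union> {p. g p \<noteq> 0}"
    have A: "finite ?A" "?A \<subseteq> S" using supp[OF f] supp[OF g] by auto
    have "L (f \<oplus>\<^bsub>free_module S\<^esub> g) = finsum W (\<lambda>p. (f p + g p) \<odot>\<^bsub>W\<^esub> b p) ?A"
      unfolding free_module_simps by (rule L[OF A(1) _ A(2)]) auto
    also have "\<dots> = finsum W (\<lambda>p. f p \<odot>\<^bsub>W\<^esub> b p \<oplus>\<^bsub>W\<^esub> g p \<odot>\<^bsub>W\<^esub> b p) ?A"
      by (rule W.M.finsum_cong') (use A b in \<open>auto simp: W.add_smult\<close>)
    also have "\<dots> = L f \<oplus>\<^bsub>W\<^esub> L g"
      using L[OF A(1) _ A(2), of f] L[OF A(1) _ A(2), of g] A b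
      by (subst W.M.finsum_addf) auto
    finally show "L (f \<oplus>\<^bsub>free_module S\<^esub> g) = L f \<oplus>\<^bsub>W\<^esub> L g" .
  qed
  moreover have "L (basis_elem p) = b p" if "p \<in> S" for p
    using L[of "{p}" "basis_elem p"] that b[OF that] by (simp add: basis_elem_def)
  ultimately show thesis using that by blast
qed

lemma free_lin_eqI:
  assumes W: "vspace W" and f: "f \<in> lin (free_module S) W" and g: "g \<in> lin (free_module S) W"
    and eq: "\<And>p. p \<in> S \<Longrightarrow> f (basis_elem p) = g (basis_elem p)"
    and x: "x \<in> carrier (free_module S)"
  shows "f x = g x"
  using x
proof (induction x rule: free_module_induct)
  case zero
  show ?case using lin_zero[OF vspace_free W f] lin_zero[OF vspace_free W g]
    by (simp add: free_module_simps)
next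
  case (step c p h)
  have e: "(\<lambda>q. c * basis_elem p q + h q) =
      c \<odot>\<^bsub>free_module S\<^esub> basis_elem p \<oplus>\<^bsub>free_module S\<^esub> h"
    by (simp only: free_module_simps)
  have cl: "c \<odot>\<^bsub>free_module S\<^esub> basis_elem p \<in> carrier (free_module S)"
    unfolding free_module_simps(4) by (rule free_smult_closed[OF basis_elem_closed[OF step(1)]])
  note h = step(2) and b = basis_elem_closed[OF step(1)]
  show ?case
    unfolding e lin_add[OF f cl h] lin_add[OF g cl h] lin_smult[OF f b] lin_smult[OF g b]
      eq[OF step(1)] step(3) ..
qed

subsection \<open>Tensor products\<close>

locale tensor_pair = M: vsp M + N: vsp N
  for M :: "('k::field, 'm) module" and N :: "('k, 'n) module"
begin

abbreviation F where "F \<equiv> free_module (carrier M \<times> carrier N) :: ('k, 'm \<times> 'n \<Rightarrow> 'k) module"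

sublocale F: vsp F by (rule vspI[OF vspace_free])

lemma diff_closed:
  assumes "f \<in> carrier F" "g \<in> carrier F"
  shows "(\<lambda>p. f p - g p) \<in> carrier F"
  using free_add_closed[OF assms(1) free_smult_closed[OF assms(2), of "- 1"]] by simp

lemma be: "x \<in> carrier M \<Longrightarrow> y \<in> carrier N \<Longrightarrow> basis_elem (x, y) \<in> carrier F"
  by (simp add: basis_elem_closed)

lemma tensor_relations_closed: "tensor_relations M N \<subseteq> carrier F"
  unfolding tensor_relations_def
  by (auto intro!: diff_closed free_smult_closed be)

lemma tensor_null_subsp: "subsp (tensor_null M N) F"
  unfolding tensor_null_def by (rule F.span_is_submodule[OF tensor_relations_closed])

sublocale Q: vsp_quot F "tensor_null M N"
  by (rule vsp_quotI[OF vspace_free tensor_null_subsp])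

lemma tensor_vspace: "vspace (tensor M N)"
  unfolding tensor_def by (rule Q.vspace_quot)

sublocale T: vsp "tensor M N" by (rule vspI[OF tensor_vspace])

lemma relation_null: "f \<in> tensor_relations M N \<Longrightarrow> f \<in> tensor_null M N"
  unfolding tensor_null_def using F.span_mem[OF tensor_relations_closed] by blast

lemma null_minimal:
  assumes "subsp S F" "tensor_relations M N \<subseteq> S"
  shows "tensor_null M N \<subseteq> S"
  unfolding tensor_null_def by (rule F.span_is_subset[OF assms(2,1)])

abbreviation pt where "pt \<equiv> pure_tensor M N"

lemma coset_closed: "f \<in> carrier F \<Longrightarrow> tensor_null M N +>\<^bsub>F\<^esub> f \<in> carrier (tensor M N)"
  by (auto simp: tensor_def Q.quot_carrier)

lemma pt_closed: "x \<in> carrier M \<Longrightarrow> y \<in> carrier N \<Longrightarrow> pt x y \<in> carrier (tensor M N)"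
  unfolding pure_tensor_def by (rule coset_closed[OF be])

lemma F_minus:
  assumes "f \<in> carrier F" "g \<in> carrier F"
  shows "f \<ominus>\<^bsub>F\<^esub> g = (\<lambda>p. f p - g p)"
  unfolding F.minus_eq_add F.minus_one_smult[OF assms(2), symmetric] by (simp add: free_module_simps)

lemma pt_add_left:
  assumes "x \<in> carrier M" "x' \<in> carrier M" "y \<in> carrier N"
  shows "pt (x \<oplus>\<^bsub>M\<^esub> x') y = pt x y \<oplus>\<^bsub>tensor M N\<^esub> pt x' y"
proof -
  have 1: "(\<lambda>p. basis_elem (x \<oplus>\<^bsub>M\<^esub> x', y) p - basis_elem (x, y) p - basis_elem (x', y) p)
      \<in> tensor_relations M N"
    unfolding tensor_relations_def using assms by blast
  have s: "basis_elem (x, y) \<oplus>\<^bsub>F\<^esub> basis_elem (x', y) \<in> carrier F"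
    using assms by (simp only: F.add_in be)
  have "basis_elem (x \<oplus>\<^bsub>M\<^esub> x', y) \<ominus>\<^bsub>F\<^esub> (basis_elem (x, y) \<oplus>\<^bsub>F\<^esub> basis_elem (x', y))
      \<in> tensor_null M N"
    using relation_null[OF 1] F_minus[OF be[OF M.add_in[OF assms(1,2)] assms(3)] s]
    by (simp add: free_module_simps diff_diff_eq)
  then have "pt (x \<oplus>\<^bsub>M\<^esub> x') y =
      tensor_null M N +>\<^bsub>F\<^esub> (basis_elem (x, y) \<oplus>\<^bsub>F\<^esub> basis_elem (x', y))"
    unfolding pure_tensor_def
    using Q.coset_eq_iff[OF be[OF M.add_in[OF assms(1,2)] assms(3)] s] by simp
  then show ?thesis
    using Q.quot_add[OF be[OF assms(1,3)] be[OF assms(2,3)]] unfolding pure_tensor_def tensor_def by simp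
qed

lemma pt_add_right:
  assumes "x \<in> carrier M" "y \<in> carrier N" "y' \<in> carrier N"
  shows "pt x (y \<oplus>\<^bsub>N\<^esub> y') = pt x y \<oplus>\<^bsub>tensor M N\<^esub> pt x y'"
proof -
  have 1: "(\<lambda>p. basis_elem (x, y \<oplus>\<^bsub>N\<^esub> y') p - basis_elem (x, y) p - basis_elem (x, y') p)
      \<in> tensor_relations M N"
    unfolding tensor_relations_def using assms by blast
  have s: "basis_elem (x, y) \<oplus>\<^bsub>F\<^esub> basis_elem (x, y') \<in> carrier F"
    using assms by (simp only: F.add_in be)
  have "basis_elem (x, y \<oplus>\<^bsub>N\<^esub> y') \<ominus>\<^bsub>F\<^esub> (basis_elem (x, y) \<oplus>\<^bsub>F\<^esub> basis_elem (x, y'))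
      \<in> tensor_null M N"
    using relation_null[OF 1] F_minus[OF be[OF assms(1) N.add_in[OF assms(2,3)]] s]
    by (simp add: free_module_simps diff_diff_eq)
  then have "pt x (y \<oplus>\<^bsub>N\<^esub> y') =
      tensor_null M N +>\<^bsub>F\<^esub> (basis_elem (x, y) \<oplus>\<^bsub>F\<^esub> basis_elem (x, y'))"
    unfolding pure_tensor_def
    using Q.coset_eq_iff[OF be[OF assms(1) N.add_in[OF assms(2,3)]] s] by simp
  then show ?thesis
    using Q.quot_add[OF be[OF assms(1,2)] be[OF assms(1,3)]] unfolding pure_tensor_def tensor_def by simp
qed

lemma pt_smult_left:
  assumes "x \<in> carrier M" "y \<in> carrier N"
  shows "pt (c \<odot>\<^bsub>M\<^esub> x) y = c \<odot>\<^bsub>tensor M N\<^esub> pt x y"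
proof -
  have 1: "(\<lambda>p. basis_elem (c \<odot>\<^bsub>M\<^esub> x, y) p - c * basis_elem (x, y) p) \<in> tensor_relations M N"
    unfolding tensor_relations_def using assms by blast
  have s: "c \<odot>\<^bsub>F\<^esub> basis_elem (x, y) \<in> carrier F" using assms by (simp only: F.smult_in be)
  have "basis_elem (c \<odot>\<^bsub>M\<^esub> x, y) \<ominus>\<^bsub>F\<^esub> (c \<odot>\<^bsub>F\<^esub> basis_elem (x, y)) \<in> tensor_null M N"
    using relation_null[OF 1] F_minus[OF be[OF M.smult_in[OF assms(1)] assms(2)] s]
    by (simp add: free_module_simps)
  then have "pt (c \<odot>\<^bsub>M\<^esub> x) y = tensor_null M N +>\<^bsub>F\<^esub> (c \<odot>\<^bsub>F\<^esub> basis_elem (x, y))"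
    unfolding pure_tensor_def
    using Q.coset_eq_iff[OF be[OF M.smult_in[OF assms(1)] assms(2)] s] by simp
  then show ?thesis
    using Q.quot_smult[OF be[OF assms]] unfolding pure_tensor_def tensor_def by simp
qed

lemma pt_smult_right:
  assumes "x \<in> carrier M" "y \<in> carrier N"
  shows "pt x (c \<odot>\<^bsub>N\<^esub> y) = c \<odot>\<^bsub>tensor M N\<^esub> pt x y"
proof -
  have 1: "(\<lambda>p. basis_elem (x, c \<odot>\<^bsub>N\<^esub> y) p - c * basis_elem (x, y) p) \<in> tensor_relations M N"
    unfolding tensor_relations_def using assms by blast
  have s: "c \<odot>\<^bsub>F\<^esub> basis_elem (x, y) \<in> carrier F" using assms by (simp only: F.smult_in be)
  have "basis_elem (x, c \<odot>\<^bsub>N\<^esub> y) \<ominus>\<^bsub>F\<^esub> (c \<odot>\<^bsub>F\<^esub> basis_elem (x, y)) \<in> tensor_null M N"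
    using relation_null[OF 1] F_minus[OF be[OF assms(1) N.smult_in[OF assms(2)]] s]
    by (simp add: free_module_simps)
  then have "pt x (c \<odot>\<^bsub>N\<^esub> y) = tensor_null M N +>\<^bsub>F\<^esub> (c \<odot>\<^bsub>F\<^esub> basis_elem (x, y))"
    unfolding pure_tensor_def
    using Q.coset_eq_iff[OF be[OF assms(1) N.smult_in[OF assms(2)]] s] by simp
  then show ?thesis
    using Q.quot_smult[OF be[OF assms]] unfolding pure_tensor_def tensor_def by simp
qed

lemma tensor_rep:
  assumes "z \<in> carrier (tensor M N)"
  obtains f where "f \<in> carrier F" "z = tensor_null M N +>\<^bsub>F\<^esub> f"
  using assms unfolding tensor_def Q.quot_carrier by (rule imageE)

text \<open>Sums of pure tensors need no coefficients, because a scalar is absorbed into the left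
  factor.\<close>

lemma tensor_induct [consumes 1, case_names zero step]:
  assumes z: "z \<in> carrier (tensor M N)" and zero: "P \<zero>\<^bsub>tensor M N\<^esub>"
    and step: "\<And>x y w. x \<in> carrier M \<Longrightarrow> y \<in> carrier N \<Longrightarrow> w \<in> carrier (tensor M N) \<Longrightarrow> P w \<Longrightarrow>
      P (pt x y \<oplus>\<^bsub>tensor M N\<^esub> w)"
  shows "P z"
proof -
  have "P (tensor_null M N +>\<^bsub>F\<^esub> f)" if "f \<in> carrier F" for f
    using that
  proof (induction f rule: free_module_induct)
    case zero
    have "tensor_null M N +>\<^bsub>F\<^esub> (\<lambda>_. 0) = \<zero>\<^bsub>tensor M N\<^esub>"
      using Q.quot_zero_coset unfolding tensor_def Q.quot_zero by (simp add: free_module_simps)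
    then show ?case using assms(2) by simp
  next
    case (step c p g)
    obtain x y where p: "p = (x, y)" "x \<in> carrier M" "y \<in> carrier N" using step(1) by auto
    have "tensor_null M N +>\<^bsub>F\<^esub> (\<lambda>q. c * basis_elem p q + g q) =
        tensor_null M N +>\<^bsub>F\<^esub> (c \<odot>\<^bsub>F\<^esub> basis_elem (x, y) \<oplus>\<^bsub>F\<^esub> g)"
      by (simp add: free_module_simps p)
    also have "\<dots> = c \<odot>\<^bsub>tensor M N\<^esub> pt x y \<oplus>\<^bsub>tensor M N\<^esub> (tensor_null M N +>\<^bsub>F\<^esub> g)"
      unfolding tensor_def pure_tensor_def
      by (simp only: Q.quot_add Q.quot_smult be p F.smult_in step(2))
    also have "\<dots> = pt (c \<odot>\<^bsub>M\<^esub> x) y \<oplus>\<^bsub>tensor M N\<^esub> (tensor_null M N +>\<^bsub>F\<^esub> g)"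
      by (simp add: pt_smult_left p)
    finally show ?case
      using assms(3)[OF M.smult_in[OF p(2)] p(3) coset_closed[OF step(2)] step(3)] by simp
  qed
  then show ?thesis using tensor_rep[OF z] by metis
qed

text \<open>The universal property. The linear extension of \<open>b\<close> to the free module
  kills each defining relation, hence their span, and so factors through the quotient.\<close>

lemma tensor_lift:
  fixes b :: "'m \<Rightarrow> 'n \<Rightarrow> 'w"
  assumes W: "vspace (W :: ('k, 'w, 'z) module_scheme)"
    and closed: "\<And>x y. x \<in> carrier M \<Longrightarrow> y \<in> carrier N \<Longrightarrow> b x y \<in> carrier W"
    and add_l: "\<And>x x' y. x \<in> carrier M \<Longrightarrow> x' \<in> carrier M \<Longrightarrow> y \<in> carrier N \<Longrightarrow>
      b (x \<oplus>\<^bsub>M\<^esub> x') y = b x y \<oplus>\<^bsub>W\<^esub> b x' y"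
    and add_r: "\<And>x y y'. x \<in> carrier M \<Longrightarrow> y \<in> carrier N \<Longrightarrow> y' \<in> carrier N \<Longrightarrow>
      b x (y \<oplus>\<^bsub>N\<^esub> y') = b x y \<oplus>\<^bsub>W\<^esub> b x y'"
    and smult_l: "\<And>c x y. x \<in> carrier M \<Longrightarrow> y \<in> carrier N \<Longrightarrow> b (c \<odot>\<^bsub>M\<^esub> x) y = c \<odot>\<^bsub>W\<^esub> b x y"
    and smult_r: "\<And>c x y. x \<in> carrier M \<Longrightarrow> y \<in> carrier N \<Longrightarrow> b x (c \<odot>\<^bsub>N\<^esub> y) = c \<odot>\<^bsub>W\<^esub> b x y"
  obtains t where "t \<in> lin (tensor M N) W"
    "\<And>x y. x \<in> carrier M \<Longrightarrow> y \<in> carrier N \<Longrightarrow> t (pt x y) = b x y"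
proof -
  interpret W: vsp W using W by (rule vspI)
  obtain L where L: "L \<in> lin F W" "\<And>p. p \<in> carrier M \<times> carrier N \<Longrightarrow> L (basis_elem p) = b (fst p) (snd p)"
  proof (rule free_module_extend[OF W, of "carrier M \<times> carrier N" "\<lambda>p. b (fst p) (snd p)"])
    show "b (fst p) (snd p) \<in> carrier W" if "p \<in> carrier M \<times> carrier N" for p
      using that closed by auto
  qed (use that in blast)
  have Lb: "L (basis_elem (x, y)) = b x y" if "x \<in> carrier M" "y \<in> carrier N" for x y
    using L(2)[of "(x, y)"] that by simp
  have Ld: "L (\<lambda>p. f p - g p) = L f \<ominus>\<^bsub>W\<^esub> L g" if "f \<in> carrier F" "g \<in> carrier F" for f g
    using lin_minus[OF vspace_free W L(1) that] by (simp add: F_minus[OF that])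
  have Ls: "L (\<lambda>p. c * f p) = c \<odot>\<^bsub>W\<^esub> L f" if "f \<in> carrier F" for c f
    using lin_smult[OF L(1) that] by (simp add: free_module_simps)
  have canc: "(u \<oplus>\<^bsub>W\<^esub> v) \<ominus>\<^bsub>W\<^esub> u \<ominus>\<^bsub>W\<^esub> v = \<zero>\<^bsub>W\<^esub>" if "u \<in> carrier W" "v \<in> carrier W" for u v
    using that by (simp add: W.minus_eq_add W.M.add.m_comm[of u v] W.M.add.m_assoc W.M.r_neg)
  have canc1: "u \<ominus>\<^bsub>W\<^esub> u = \<zero>\<^bsub>W\<^esub>" if "u \<in> carrier W" for u
    using that by (simp add: W.minus_eq_add W.M.r_neg)
  have "tensor_relations M N \<subseteq> {f \<in> carrier F. L f = \<zero>\<^bsub>W\<^esub>}"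
    using tensor_relations_closed unfolding tensor_relations_def
    by (auto simp: Ld Ls Lb be diff_closed free_smult_closed add_l add_r smult_l smult_r closed canc canc1)
  then have null: "L f = \<zero>\<^bsub>W\<^esub>" if "f \<in> tensor_null M N" for f
    using null_minimal[OF lin_ker_subsp[OF vspace_free W L(1)]] that by auto
  obtain t where t: "t \<in> lin (tensor M N) W"
    "\<And>f. f \<in> carrier F \<Longrightarrow> t (tensor_null M N +>\<^bsub>F\<^esub> f) = L f"
    using Q.lin_factor[OF W L(1) null] unfolding tensor_def by metis
  have "t (pt x y) = b x y" if "x \<in> carrier M" "y \<in> carrier N" for x y
    using t(2)[OF be[OF that]] Lb[OF that] by (simp add: pure_tensor_def)
  then show thesis using that[OF t(1)] by simp
qed

lemma tensor_lin_eqI: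
  assumes W: "vspace W" and f: "f \<in> lin (tensor M N) W" and g: "g \<in> lin (tensor M N) W"
    and eq: "\<And>x y. x \<in> carrier M \<Longrightarrow> y \<in> carrier N \<Longrightarrow> f (pt x y) = g (pt x y)"
    and z: "z \<in> carrier (tensor M N)"
  shows "f z = g z"
  using z
proof (induction z rule: tensor_induct)
  case zero
  show ?case using lin_zero[OF tensor_vspace W f] lin_zero[OF tensor_vspace W g] by simp
next
  case (step x y w)
  note p = pt_closed[OF step(1,2)]
  show ?case
    unfolding lin_add[OF f p step(3)] lin_add[OF g p step(3)] eq[OF step(1,2)] step(4) ..
qed

end

lemma push_basis: "push \<theta> (\<lambda>q. basis_elem p q :: 'k::field) = basis_elem (\<theta> p)"
proof
  fix q
  have "{r. basis_elem p r \<noteq> (0::'k) \<and> \<theta> r = q} = (if \<theta> p = q then {p} else {})"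
    by (auto simp: basis_elem_def)
  then show "push \<theta> (\<lambda>q. basis_elem p q :: 'k) q = basis_elem (\<theta> p) q"
    by (auto simp: push_def basis_elem_def)
qed

lemma push_superset:
  assumes "finite A" "{p. f p \<noteq> 0} \<subseteq> A"
  shows "push \<theta> f q = (\<Sum>p\<in>A. if \<theta> p = q then f p else 0)"
proof -
  have "push \<theta> f q = (\<Sum>p\<in>{p \<in> A. \<theta> p = q}. f p)"
    unfolding push_def by (rule sum.mono_neutral_left) (use assms in auto)
  also have "\<dots> = (\<Sum>p\<in>A. if \<theta> p = q then f p else 0)"
    by (rule sum.inter_filter[OF assms(1)])
  finally show ?thesis .
qed

lemma push_lin:
  assumes \<theta>: "\<And>p. p \<in> S \<Longrightarrow> \<theta> p \<in> S'"
  shows "push \<theta> \<in> lin (free_module S) (free_module S')"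
proof (rule linI)
  fix f :: "'a \<Rightarrow> 'c" assume f: "f \<in> carrier (free_module S)"
  have supp: "finite {p. f p \<noteq> 0}" "{p. f p \<noteq> 0} \<subseteq> S" using f by (auto simp: free_module_simps)
  have sub: "{q. push \<theta> f q \<noteq> 0} \<subseteq> \<theta> ` {p. f p \<noteq> 0}"
    unfolding push_def by (auto elim!: sum.not_neutral_contains_not_neutral)
  have "\<theta> ` {p. f p \<noteq> 0} \<subseteq> S'"
    by (rule image_subsetI, rule \<theta>) (rule subsetD[OF supp(2)])
  then show "push \<theta> f \<in> carrier (free_module S')"
    unfolding free_module_simps mem_Collect_eq
    using finite_subset[OF sub finite_imageI[OF supp(1)]] order_trans[OF sub] by simp
  show "push \<theta> (c \<odot>\<^bsub>free_module S\<^esub> f) = c \<odot>\<^bsub>free_module S'\<^esub> push \<theta> f" for c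
  proof
    fix q
    have "push \<theta> (\<lambda>p. c * f p) q = (\<Sum>p | f p \<noteq> 0. if \<theta> p = q then c * f p else 0)"
      by (rule push_superset[OF supp(1)]) auto
    then show "push \<theta> (c \<odot>\<^bsub>free_module S\<^esub> f) q = (c \<odot>\<^bsub>free_module S'\<^esub> push \<theta> f) q"
      using push_superset[OF supp(1) order_refl, of \<theta> q]
      by (simp add: free_module_simps sum_distrib_left if_distrib cong: if_cong)
  qed
  fix g :: "'a \<Rightarrow> 'c" assume g: "g \<in> carrier (free_module S)"
  have supp': "finite {p. g p \<noteq> 0}" using g by (auto simp: free_module_simps)
  show "push \<theta> (f \<oplus>\<^bsub>free_module S\<^esub> g) = push \<theta> f \<oplus>\<^bsub>free_module S'\<^esub> push \<theta> g"
  proof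
    fix q
    let ?A = "{p. f p \<noteq> 0} \<union> {p. g p \<noteq> 0}"
    have A: "finite ?A" using supp supp' by simp
    have "push \<theta> (\<lambda>p. f p + g p) q = (\<Sum>p\<in>?A. if \<theta> p = q then f p + g p else 0)"
      by (rule push_superset[OF A]) auto
    also have "\<dots> = (\<Sum>p\<in>?A. (if \<theta> p = q then f p else 0) + (if \<theta> p = q then g p else 0))"
      by (rule sum.cong) auto
    also have "\<dots> = push \<theta> f q + push \<theta> g q"
      using push_superset[OF A, of f \<theta> q] push_superset[OF A, of g \<theta> q] by (simp add: sum.distrib)
    finally show "push \<theta> (f \<oplus>\<^bsub>free_module S\<^esub> g) q = (push \<theta> f \<oplus>\<^bsub>free_module S'\<^esub> push \<theta> g) q"
      by (simp add: free_module_simps)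
  qed
qed

context tensor_pair
begin

text \<open>\<open>tensor_map\<close> is a union over the representatives of a class, so it is not
  visibly well defined. It is compared with the map \<open>t\<close> supplied by the universal
  property: composed with the quotient map, both are linear on the free module and agree on its
  basis. Hence every representative contributes the same class.\<close>

lemma tensor_map_facts:
  assumes f: "f \<in> lin M M" and g: "g \<in> lin N N"
  shows tensor_map_lin: "tensor_map M N (\<lambda>(x, y). (f x, g y)) \<in> lin (tensor M N) (tensor M N)"
    and tensor_map_pt: "x \<in> carrier M \<Longrightarrow> y \<in> carrier N \<Longrightarrow>
      tensor_map M N (\<lambda>(x, y). (f x, g y)) (pt x y) = pt (f x) (g y)"
proof -
  let ?\<theta> = "\<lambda>(x, y). (f x, g y)"
  let ?N = "tensor_null M N"
  have p: "push ?\<theta> \<in> lin F F"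
    by (rule push_lin) (auto simp: lin_closed[OF f] lin_closed[OF g])
  have pb: "push ?\<theta> (basis_elem (x, y)) = (basis_elem (f x, g y) :: _ \<Rightarrow> 'k)" for x y
    using push_basis[of ?\<theta> "(x, y)"] by simp
  have pc: "(\<lambda>h. ?N +>\<^bsub>F\<^esub> push ?\<theta> h) \<in> lin F (tensor M N)"
    using linD[OF p] linD[OF Q.coset_lin] by (intro linI) (auto simp: tensor_def)
  obtain t where t: "t \<in> lin (tensor M N) (tensor M N)"
    "\<And>x y. x \<in> carrier M \<Longrightarrow> y \<in> carrier N \<Longrightarrow> t (pt x y) = pt (f x) (g y)"
    by (rule tensor_lift[OF tensor_vspace, of "\<lambda>x y. pt (f x) (g y)"])
      (auto simp: linD[OF f] linD[OF g] pt_closed pt_add_left pt_add_right pt_smult_left pt_smult_right)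
  have tc: "(\<lambda>h. t (?N +>\<^bsub>F\<^esub> h)) \<in> lin F (tensor M N)"
    using linD[OF t(1)] linD[OF Q.coset_lin[folded tensor_def]] coset_closed by (intro linI) auto
  have eq: "?N +>\<^bsub>F\<^esub> push ?\<theta> h = t (?N +>\<^bsub>F\<^esub> h)" if "h \<in> carrier F" for h
  proof (rule free_lin_eqI[OF tensor_vspace pc tc _ that])
    fix p assume "p \<in> carrier M \<times> carrier N"
    then show "?N +>\<^bsub>F\<^esub> push ?\<theta> (basis_elem p) = t (?N +>\<^bsub>F\<^esub> basis_elem p)"
      using t(2) pb by (cases p) (simp add: pure_tensor_def)
  qed
  have main: "tensor_map M N ?\<theta> z = t z" if z: "z \<in> carrier (tensor M N)" for z
  proof -
    obtain h where h: "h \<in> carrier F" "z = ?N +>\<^bsub>F\<^esub> h" using tensor_rep[OF z] .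
    have "?N +>\<^bsub>F\<^esub> push ?\<theta> h' = t z" if h': "h' \<in> z" for h'
    proof -
      have F: "h' \<in> carrier F"
        using h' h Q.N.a_elemrcos_carrier by blast
      have "?N +>\<^bsub>F\<^esub> h' = z"
        using Q.N.a_repr_independence'[OF h'[unfolded h(2)] h(1)] h(2) by simp
      then show ?thesis using eq[OF F] by simp
    qed
    then have "(\<lambda>h. ?N +>\<^bsub>F\<^esub> push ?\<theta> h) ` z = (\<lambda>_. t z) ` z" by (rule image_cong[OF refl])
    also have "\<dots> = {t z}"
      by (rule image_constant[of h]) (use h Q.N.a_rcos_self[OF h(1)] in simp)
    finally show ?thesis unfolding tensor_map_def by simp
  qed
  show "tensor_map M N ?\<theta> \<in> lin (tensor M N) (tensor M N)"
    by (rule linI) (simp_all only: main linD[OF t(1)] T.add_in T.smult_in)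
  show "tensor_map M N ?\<theta> (pt x y) = pt (f x) (g y)" if "x \<in> carrier M" "y \<in> carrier N"
    using main[OF pt_closed[OF that]] t(2)[OF that] by simp
qed

end

section \<open>Algebras, bimodules and the projective bimodules attached to pairs of
  idempotents\<close>

context vsp
begin

lemma add_zero: "x \<in> carrier V \<Longrightarrow> x \<oplus> \<zero> = x" by simp
lemma zero_add: "x \<in> carrier V \<Longrightarrow> \<zero> \<oplus> x = x" by simp
lemma add_comm: "x \<in> carrier V \<Longrightarrow> y \<in> carrier V \<Longrightarrow> x \<oplus> y = y \<oplus> x" by (rule M.a_comm)
lemma add_assoc:
  "x \<in> carrier V \<Longrightarrow> y \<in> carrier V \<Longrightarrow> z \<in> carrier V \<Longrightarrow> x \<oplus> y \<oplus> z = x \<oplus> (y \<oplus> z)"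
  by (rule M.a_assoc)

end

text \<open>Bimodule records and the path algebra share carrier, zero, addition and scalar action
  with records already known to be vector spaces.\<close>

lemma vspace_cong:
  assumes V: "vspace V" and c: "carrier W = carrier V" "\<zero>\<^bsub>W\<^esub> = \<zero>\<^bsub>V\<^esub>"
    "\<And>x y. x \<oplus>\<^bsub>W\<^esub> y = x \<oplus>\<^bsub>V\<^esub> y" "\<And>c x. c \<odot>\<^bsub>W\<^esub> x = c \<odot>\<^bsub>V\<^esub> x"
  shows "vspace W"
proof -
  interpret V: vsp V using V by (rule vspI)
  show ?thesis
    by (rule vspaceI; unfold c)
      (simp_all add: V.M.a_assoc V.mult_smult V.add_smult V.smult_add V.M.a_comm V.M.a_lcomm)
qed

locale kalg = A: vsp A + R: ring A for A :: "('k::field, 'a) module" (structure) +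
  assumes smult_mult_left: "x \<in> carrier A \<Longrightarrow> y \<in> carrier A \<Longrightarrow> (c \<odot> x) \<otimes> y = c \<odot> (x \<otimes> y)"
    and smult_mult_right: "x \<in> carrier A \<Longrightarrow> y \<in> carrier A \<Longrightarrow> x \<otimes> (c \<odot> y) = c \<odot> (x \<otimes> y)"
begin

lemma left_ideal_simps:
  "carrier (left_ideal A e) = (\<lambda>a. a \<otimes> e) ` carrier A" "\<zero>\<^bsub>left_ideal A e\<^esub> = \<zero>"
  "x \<oplus>\<^bsub>left_ideal A e\<^esub> y = x \<oplus> y" "c \<odot>\<^bsub>left_ideal A e\<^esub> x = c \<odot> x"
  by (simp_all add: left_ideal_def)

lemma right_ideal_simps:
  "carrier (right_ideal A e) = (\<lambda>a. e \<otimes> a) ` carrier A" "\<zero>\<^bsub>right_ideal A e\<^esub> = \<zero>"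
  "x \<oplus>\<^bsub>right_ideal A e\<^esub> y = x \<oplus> y" "c \<odot>\<^bsub>right_ideal A e\<^esub> x = c \<odot> x"
  by (simp_all add: right_ideal_def)

lemma left_ideal_vspace:
  assumes e: "e \<in> carrier A"
  shows "vspace (left_ideal A e)"
proof -
  have "subsp ((\<lambda>a. a \<otimes> e) ` carrier A) A"
  proof (rule subspI)
    show "vspace A" by (rule A.vectorspace_axioms)
    show "(\<lambda>a. a \<otimes> e) ` carrier A \<subseteq> carrier A" using e by auto
    show "\<zero> \<in> (\<lambda>a. a \<otimes> e) ` carrier A" using e by (intro image_eqI[of _ _ \<zero>]) auto
    show "x \<oplus> y \<in> (\<lambda>a. a \<otimes> e) ` carrier A"
      if "x \<in> (\<lambda>a. a \<otimes> e) ` carrier A" "y \<in> (\<lambda>a. a \<otimes> e) ` carrier A" for x y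
    proof -
      from that(1) obtain a where a: "x = a \<otimes> e" "a \<in> carrier A" by (rule imageE)
      from that(2) obtain b where b: "y = b \<otimes> e" "b \<in> carrier A" by (rule imageE)
      show ?thesis using e a b by (intro image_eqI[of _ _ "a \<oplus> b"]) (simp_all add: R.l_distr)
    qed
    show "c \<odot> x \<in> (\<lambda>a. a \<otimes> e) ` carrier A" if "x \<in> (\<lambda>a. a \<otimes> e) ` carrier A" for c x
    proof -
      from that obtain a where a: "x = a \<otimes> e" "a \<in> carrier A" by (rule imageE)
      show ?thesis using e a by (intro image_eqI[of _ _ "c \<odot> a"]) (simp_all add: smult_mult_left)
    qed
  qed
  then show ?thesis unfolding left_ideal_def by (rule subsp_vspace[OF A.vectorspace_axioms])
qed

lemma right_ideal_vspace:
  assumes e: "e \<in> carrier A"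
  shows "vspace (right_ideal A e)"
proof -
  have "subsp ((\<lambda>a. e \<otimes> a) ` carrier A) A"
  proof (rule subspI)
    show "vspace A" by (rule A.vectorspace_axioms)
    show "(\<lambda>a. e \<otimes> a) ` carrier A \<subseteq> carrier A" using e by auto
    show "\<zero> \<in> (\<lambda>a. e \<otimes> a) ` carrier A" using e by (intro image_eqI[of _ _ \<zero>]) auto
    show "x \<oplus> y \<in> (\<lambda>a. e \<otimes> a) ` carrier A"
      if "x \<in> (\<lambda>a. e \<otimes> a) ` carrier A" "y \<in> (\<lambda>a. e \<otimes> a) ` carrier A" for x y
    proof -
      from that(1) obtain a where a: "x = e \<otimes> a" "a \<in> carrier A" by (rule imageE)
      from that(2) obtain b where b: "y = e \<otimes> b" "b \<in> carrier A" by (rule imageE)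
      show ?thesis using e a b by (intro image_eqI[of _ _ "a \<oplus> b"]) (simp_all add: R.r_distr)
    qed
    show "c \<odot> x \<in> (\<lambda>a. e \<otimes> a) ` carrier A" if "x \<in> (\<lambda>a. e \<otimes> a) ` carrier A" for c x
    proof -
      from that obtain a where a: "x = e \<otimes> a" "a \<in> carrier A" by (rule imageE)
      show ?thesis using e a by (intro image_eqI[of _ _ "c \<odot> a"]) (simp_all add: smult_mult_right)
    qed
  qed
  then show ?thesis unfolding right_ideal_def by (rule subsp_vspace[OF A.vectorspace_axioms])
qed

end

locale bimod = A: kalg A + Q: vsp Q
  for A :: "('k::field, 'a) module" and Q :: "('k, 'a, 'q) bimodule" +
  assumes l_closed: "a \<in> carrier A \<Longrightarrow> z \<in> carrier Q \<Longrightarrow> lact Q a z \<in> carrier Q"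
    and l_add: "a \<in> carrier A \<Longrightarrow> z \<in> carrier Q \<Longrightarrow> z' \<in> carrier Q \<Longrightarrow>
      lact Q a (z \<oplus>\<^bsub>Q\<^esub> z') = lact Q a z \<oplus>\<^bsub>Q\<^esub> lact Q a z'"
    and l_smult: "a \<in> carrier A \<Longrightarrow> z \<in> carrier Q \<Longrightarrow>
      lact Q a (c \<odot>\<^bsub>Q\<^esub> z) = c \<odot>\<^bsub>Q\<^esub> lact Q a z"
    and l_add_alg: "a \<in> carrier A \<Longrightarrow> b \<in> carrier A \<Longrightarrow> z \<in> carrier Q \<Longrightarrow>
      lact Q (a \<oplus>\<^bsub>A\<^esub> b) z = lact Q a z \<oplus>\<^bsub>Q\<^esub> lact Q b z"
    and l_smult_alg: "a \<in> carrier A \<Longrightarrow> z \<in> carrier Q \<Longrightarrow>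
      lact Q (c \<odot>\<^bsub>A\<^esub> a) z = c \<odot>\<^bsub>Q\<^esub> lact Q a z"
    and l_assoc: "a \<in> carrier A \<Longrightarrow> b \<in> carrier A \<Longrightarrow> z \<in> carrier Q \<Longrightarrow>
      lact Q (a \<otimes>\<^bsub>A\<^esub> b) z = lact Q a (lact Q b z)"
    and r_closed: "a \<in> carrier A \<Longrightarrow> z \<in> carrier Q \<Longrightarrow> ract Q z a \<in> carrier Q"
    and r_add: "a \<in> carrier A \<Longrightarrow> z \<in> carrier Q \<Longrightarrow> z' \<in> carrier Q \<Longrightarrow>
      ract Q (z \<oplus>\<^bsub>Q\<^esub> z') a = ract Q z a \<oplus>\<^bsub>Q\<^esub> ract Q z' a"
    and r_smult: "a \<in> carrier A \<Longrightarrow> z \<in> carrier Q \<Longrightarrow>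
      ract Q (c \<odot>\<^bsub>Q\<^esub> z) a = c \<odot>\<^bsub>Q\<^esub> ract Q z a"
    and r_add_alg: "a \<in> carrier A \<Longrightarrow> b \<in> carrier A \<Longrightarrow> z \<in> carrier Q \<Longrightarrow>
      ract Q z (a \<oplus>\<^bsub>A\<^esub> b) = ract Q z a \<oplus>\<^bsub>Q\<^esub> ract Q z b"
    and r_smult_alg: "a \<in> carrier A \<Longrightarrow> z \<in> carrier Q \<Longrightarrow>
      ract Q z (c \<odot>\<^bsub>A\<^esub> a) = c \<odot>\<^bsub>Q\<^esub> ract Q z a"
    and r_assoc: "a \<in> carrier A \<Longrightarrow> b \<in> carrier A \<Longrightarrow> z \<in> carrier Q \<Longrightarrow>
      ract Q z (a \<otimes>\<^bsub>A\<^esub> b) = ract Q (ract Q z a) b"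
    and l_r: "a \<in> carrier A \<Longrightarrow> b \<in> carrier A \<Longrightarrow> z \<in> carrier Q \<Longrightarrow>
      ract Q (lact Q a z) b = lact Q a (ract Q z b)"
begin

lemma l_lin: "a \<in> carrier A \<Longrightarrow> lact Q a \<in> lin Q Q"
  by (rule linI) (simp_all add: l_closed l_add l_smult)

lemma r_lin: "a \<in> carrier A \<Longrightarrow> (\<lambda>z. ract Q z a) \<in> lin Q Q"
  by (rule linI) (simp_all add: r_closed r_add r_smult)

lemma l_zero: "a \<in> carrier A \<Longrightarrow> lact Q a \<zero>\<^bsub>Q\<^esub> = \<zero>\<^bsub>Q\<^esub>"
  using lin_zero[OF Q.vectorspace_axioms Q.vectorspace_axioms l_lin] .

lemma r_zero: "a \<in> carrier A \<Longrightarrow> ract Q \<zero>\<^bsub>Q\<^esub> a = \<zero>\<^bsub>Q\<^esub>"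
  using lin_zero[OF Q.vectorspace_axioms Q.vectorspace_axioms r_lin] .

end

context kalg
begin

lemma regular_bimodule_simps:
  "carrier (regular_bimodule A) = carrier A" "\<zero>\<^bsub>regular_bimodule A\<^esub> = \<zero>"
  "x \<oplus>\<^bsub>regular_bimodule A\<^esub> y = x \<oplus> y" "c \<odot>\<^bsub>regular_bimodule A\<^esub> x = c \<odot> x"
  "lact (regular_bimodule A) x y = x \<otimes> y" "ract (regular_bimodule A) x y = x \<otimes> y"
  by (simp_all add: regular_bimodule_def module.defs bimodule.defs)

lemma regular_bimodule_vspace: "vspace (regular_bimodule A)"
  by (rule vspace_cong[OF A.vectorspace_axioms]) (simp_all add: regular_bimodule_simps)

lemma regular_bimod: "bimod A (regular_bimodule A)"
  by (intro bimod.intro bimod_axioms.intro kalg_axioms vspI[OF regular_bimodule_vspace])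
    (simp_all add: regular_bimodule_simps R.l_distr R.r_distr R.m_assoc smult_mult_left smult_mult_right)

end

locale proj_one = A: kalg A for A :: "('k::field, 'a) module" (structure) +
  fixes e e' :: 'a
  assumes e_in: "e \<in> carrier A" "e' \<in> carrier A"
begin

abbreviation L where "L \<equiv> left_ideal A e"
abbreviation R where "R \<equiv> right_ideal A e'"
abbreviation P where "P \<equiv> proj_bimodule A e e'"

sublocale T: tensor_pair L R
  by (intro tensor_pair.intro vspI A.left_ideal_vspace A.right_ideal_vspace e_in)

lemma L_carrier: "x \<in> carrier L \<Longrightarrow> x \<in> carrier A"
  using e_in by (auto simp: A.left_ideal_simps)

lemma R_carrier: "x \<in> carrier R \<Longrightarrow> x \<in> carrier A"
  using e_in by (auto simp: A.right_ideal_simps)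

lemma mult_L: "a \<in> carrier A \<Longrightarrow> x \<in> carrier L \<Longrightarrow> a \<otimes> x \<in> carrier L"
  using e_in by (auto simp: A.left_ideal_simps A.R.m_assoc[symmetric])

lemma mult_R: "a \<in> carrier A \<Longrightarrow> x \<in> carrier R \<Longrightarrow> x \<otimes> a \<in> carrier R"
  using e_in by (auto simp: A.right_ideal_simps A.R.m_assoc)

lemma L_lin: "a \<in> carrier A \<Longrightarrow> (\<lambda>x. a \<otimes> x) \<in> lin L L"
  by (rule linI)
    (simp_all add: mult_L A.left_ideal_simps(3,4) L_carrier A.R.r_distr A.smult_mult_right)

lemma R_lin: "a \<in> carrier A \<Longrightarrow> (\<lambda>x. x \<otimes> a) \<in> lin R R"
  by (rule linI)
    (simp_all add: mult_R A.right_ideal_simps(3,4) R_carrier A.R.l_distr A.smult_mult_left)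

lemma id_lin: "(\<lambda>x. x) \<in> lin V V"
  by (rule linI) auto

lemma P_simps:
  "carrier P = carrier (tensor L R)" "\<zero>\<^bsub>P\<^esub> = \<zero>\<^bsub>tensor L R\<^esub>"
  "x \<oplus>\<^bsub>P\<^esub> y = x \<oplus>\<^bsub>tensor L R\<^esub> y" "c \<odot>\<^bsub>P\<^esub> x = c \<odot>\<^bsub>tensor L R\<^esub> x"
  "lact P a = tensor_map L R (\<lambda>(x, y). (a \<otimes> x, y))"
  "ract P z a = tensor_map L R (\<lambda>(x, y). (x, y \<otimes> a)) z"
  by (simp_all add: proj_bimodule_def module.defs bimodule.defs)

lemma P_vspace: "vspace P"
  by (rule vspace_cong[OF T.tensor_vspace]) (simp_all add: P_simps)

lemma lin_P: "lin P W = lin (tensor L R) W" "lin W P = lin W (tensor L R)"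
  by (simp_all add: LinearCombinations.module_hom_def P_simps)

lemma l_lin: "a \<in> carrier A \<Longrightarrow> lact P a \<in> lin (tensor L R) (tensor L R)"
  unfolding P_simps by (rule T.tensor_map_lin[OF L_lin id_lin])

lemma r_lin: "a \<in> carrier A \<Longrightarrow> (\<lambda>z. ract P z a) \<in> lin (tensor L R) (tensor L R)"
  unfolding P_simps by (rule T.tensor_map_lin[OF id_lin R_lin])

lemma l_pt: "a \<in> carrier A \<Longrightarrow> x \<in> carrier L \<Longrightarrow> y \<in> carrier R \<Longrightarrow>
    lact P a (T.pt x y) = T.pt (a \<otimes> x) y"
  unfolding P_simps by (rule T.tensor_map_pt[OF L_lin id_lin])

lemma r_pt: "a \<in> carrier A \<Longrightarrow> x \<in> carrier L \<Longrightarrow> y \<in> carrier R \<Longrightarrow>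
    ract P (T.pt x y) a = T.pt x (y \<otimes> a)"
  unfolding P_simps by (rule T.tensor_map_pt[OF id_lin R_lin])

lemma sum_lin:
  "f \<in> lin (tensor L R) (tensor L R) \<Longrightarrow> g \<in> lin (tensor L R) (tensor L R) \<Longrightarrow>
   (\<lambda>z. f z \<oplus>\<^bsub>tensor L R\<^esub> g z) \<in> lin (tensor L R) (tensor L R)"
  by (rule linI)
    (simp_all add: linD T.T.smult_add T.T.M.a_assoc T.T.M.a_lcomm)

lemma smult_lin:
  "f \<in> lin (tensor L R) (tensor L R) \<Longrightarrow>
   (\<lambda>z. c \<odot>\<^bsub>tensor L R\<^esub> f z) \<in> lin (tensor L R) (tensor L R)"
  by (rule linI) (simp_all add: linD T.T.smult_add T.T.mult_smult[symmetric] mult.commute)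

lemma comp_lin:
  "f \<in> lin (tensor L R) (tensor L R) \<Longrightarrow> g \<in> lin (tensor L R) (tensor L R) \<Longrightarrow>
   (\<lambda>z. f (g z)) \<in> lin (tensor L R) (tensor L R)"
  by (rule linI) (simp_all add: linD)

lemmas eqI = T.tensor_lin_eqI[OF T.tensor_vspace]

lemma P_bimod: "bimod A P"
proof (intro bimod.intro bimod_axioms.intro A.kalg_axioms vspI[OF P_vspace])
  fix a z assume a: "a \<in> carrier A" and z: "z \<in> carrier P"
  note z' = z[unfolded P_simps]
  show "lact P a z \<in> carrier P" using lin_closed[OF l_lin[OF a] z'] by (simp add: P_simps)
  show "ract P z a \<in> carrier P" using lin_closed[OF r_lin[OF a] z'] by (simp add: P_simps)
  show "lact P a (c \<odot>\<^bsub>P\<^esub> z) = c \<odot>\<^bsub>P\<^esub> lact P a z" for c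
    using lin_smult[OF l_lin[OF a] z'] by (simp only: P_simps(4))
  show "ract P (c \<odot>\<^bsub>P\<^esub> z) a = c \<odot>\<^bsub>P\<^esub> ract P z a" for c
    using lin_smult[OF r_lin[OF a] z'] by (simp only: P_simps(4))
  show "lact P (c \<odot> a) z = c \<odot>\<^bsub>P\<^esub> lact P a z" for c
    unfolding P_simps(4)
    by (rule eqI[OF l_lin smult_lin[OF l_lin] _ z'])
      (simp_all add: a l_pt L_carrier A.smult_mult_left mult_L T.pt_smult_left[symmetric] A.left_ideal_simps(4))
  show "ract P z (c \<odot> a) = c \<odot>\<^bsub>P\<^esub> ract P z a" for c
    unfolding P_simps(4)
    by (rule eqI[OF r_lin smult_lin[OF r_lin] _ z'])
      (simp_all add: a r_pt R_carrier A.smult_mult_right mult_R T.pt_smult_right[symmetric] A.right_ideal_simps(4))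
  {
    fix z2 assume "z2 \<in> carrier P"
    note z2 = this[unfolded P_simps]
    show "lact P a (z \<oplus>\<^bsub>P\<^esub> z2) = lact P a z \<oplus>\<^bsub>P\<^esub> lact P a z2"
      using lin_add[OF l_lin[OF a] z' z2] by (simp only: P_simps(3))
    show "ract P (z \<oplus>\<^bsub>P\<^esub> z2) a = ract P z a \<oplus>\<^bsub>P\<^esub> ract P z2 a"
      using lin_add[OF r_lin[OF a] z' z2] by (simp only: P_simps(3))
  }
  fix b assume b: "b \<in> carrier A"
  show "lact P (a \<oplus> b) z = lact P a z \<oplus>\<^bsub>P\<^esub> lact P b z"
    unfolding P_simps(3)
    by (rule eqI[OF l_lin sum_lin[OF l_lin l_lin] _ z'])
      (simp_all add: a b l_pt L_carrier A.R.l_distr mult_L T.pt_add_left[symmetric] A.left_ideal_simps(3))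
  show "ract P z (a \<oplus> b) = ract P z a \<oplus>\<^bsub>P\<^esub> ract P z b"
    unfolding P_simps(3)
    by (rule eqI[OF r_lin sum_lin[OF r_lin r_lin] _ z'])
      (simp_all add: a b r_pt R_carrier A.R.r_distr mult_R T.pt_add_right[symmetric] A.right_ideal_simps(3))
  show "lact P (a \<otimes> b) z = lact P a (lact P b z)"
    by (rule eqI[OF l_lin comp_lin[OF l_lin l_lin] _ z'])
      (simp_all add: a b l_pt mult_L L_carrier A.R.m_assoc)
  show "ract P z (a \<otimes> b) = ract P (ract P z a) b"
    by (rule eqI[OF r_lin comp_lin[OF r_lin r_lin] _ z'])
      (simp_all add: a b r_pt mult_R R_carrier A.R.m_assoc)
  show "ract P (lact P a z) b = lact P a (ract P z b)"
    by (rule eqI[OF comp_lin[OF r_lin l_lin] comp_lin[OF l_lin r_lin] _ z'])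
      (simp_all add: a b l_pt r_pt mult_L mult_R)
qed

text \<open>The map sends the tensor of \<open>x\<close> and \<open>y\<close> to
  \<open>x v y\<close>, which is bilinear for every \<open>v\<close>. That the generator itself goes
  to \<open>v\<close> is settled later, for \<open>v\<close> fixed by both idempotents.\<close>

lemma hom_exists:
  assumes "bimod A Q" and v: "v \<in> carrier Q"
  obtains t where "t \<in> lin P Q"
    "\<And>x y. x \<in> carrier L \<Longrightarrow> y \<in> carrier R \<Longrightarrow> t (T.pt x y) = lact Q x (ract Q v y)"
    "\<And>a z. a \<in> carrier A \<Longrightarrow> z \<in> carrier P \<Longrightarrow> t (lact P a z) = lact Q a (t z)"
    "\<And>a z. a \<in> carrier A \<Longrightarrow> z \<in> carrier P \<Longrightarrow> t (ract P z a) = ract Q (t z) a"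
proof -
  interpret Q: bimod A Q by fact
  obtain t where t: "t \<in> lin (tensor L R) Q"
    "\<And>x y. x \<in> carrier L \<Longrightarrow> y \<in> carrier R \<Longrightarrow> t (T.pt x y) = lact Q x (ract Q v y)"
    by (rule T.tensor_lift[OF Q.Q.vectorspace_axioms, of "\<lambda>x y. lact Q x (ract Q v y)"])
      (simp_all add: L_carrier R_carrier v A.left_ideal_simps(3,4) A.right_ideal_simps(3,4)
        Q.l_closed Q.r_closed Q.l_add Q.l_add_alg Q.l_smult Q.l_smult_alg Q.r_add_alg Q.r_smult_alg)
  note eqQ = T.tensor_lin_eqI[OF Q.Q.vectorspace_axioms]
  have l: "t (lact P a z) = lact Q a (t z)" if a: "a \<in> carrier A" and z: "z \<in> carrier P" for a z
  proof (rule eqQ[OF _ _ _ z[unfolded P_simps]])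
    show "(\<lambda>z. t (lact P a z)) \<in> lin (tensor L R) Q"
      by (rule linI) (simp_all add: linD[OF l_lin[OF a]] linD[OF t(1)])
    show "(\<lambda>z. lact Q a (t z)) \<in> lin (tensor L R) Q"
      by (rule linI) (simp_all add: linD[OF Q.l_lin[OF a]] linD[OF t(1)])
    show "t (lact P a (T.pt x y)) = lact Q a (t (T.pt x y))" if "x \<in> carrier L" "y \<in> carrier R" for x y
      using that by (simp add: l_pt a t(2) mult_L L_carrier R_carrier Q.l_assoc Q.r_closed v)
  qed
  have r: "t (ract P z a) = ract Q (t z) a" if a: "a \<in> carrier A" and z: "z \<in> carrier P" for a z
  proof (rule eqQ[OF _ _ _ z[unfolded P_simps]])
    show "(\<lambda>z. t (ract P z a)) \<in> lin (tensor L R) Q"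
      by (rule linI) (simp_all add: linD[OF r_lin[OF a]] linD[OF t(1)])
    show "(\<lambda>z. ract Q (t z) a) \<in> lin (tensor L R) Q"
      by (rule linI) (simp_all add: linD[OF Q.r_lin[OF a]] linD[OF t(1)])
    show "t (ract P (T.pt x y) a) = ract Q (t (T.pt x y)) a" if "x \<in> carrier L" "y \<in> carrier R" for x y
      using that by (simp add: r_pt a t(2) mult_R L_carrier R_carrier Q.r_assoc Q.l_r Q.r_closed v)
  qed
  show thesis by (rule that[OF _ t(2) l r]) (simp add: lin_P t(1))
qed

end

locale proj_family = A: kalg A for A :: "('k::field, 'a) module" (structure) +
  fixes H :: "'h set" and e e' :: "'h \<Rightarrow> 'a"
  assumes fin: "finite H"
    and idem: "h \<in> H \<Longrightarrow> e h \<in> carrier A" "h \<in> H \<Longrightarrow> e' h \<in> carrier A"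
      "h \<in> H \<Longrightarrow> e h \<otimes> e h = e h" "h \<in> H \<Longrightarrow> e' h \<otimes> e' h = e' h"
begin

abbreviation P where "P \<equiv> bimodule_sum H (\<lambda>h. proj_bimodule A (e h) (e' h))"

abbreviation one where "one h \<equiv> proj_bimodule A (e h) (e' h)"

definition gen where
  "gen h = (\<lambda>h'\<in>H. if h' = h then pure_tensor (left_ideal A (e h)) (right_ideal A (e' h)) (e h) (e' h)
     else \<zero>\<^bsub>one h'\<^esub>)"

definition incl where
  "incl h w = (\<lambda>h'\<in>H. if h' = h then w else \<zero>\<^bsub>one h'\<^esub>)"

lemma one: "h \<in> H \<Longrightarrow> proj_one A (e h) (e' h)"
  by (intro proj_one.intro proj_one_axioms.intro A.kalg_axioms idem)

lemma one_bimod: "h \<in> H \<Longrightarrow> bimod A (one h)"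
  by (rule proj_one.P_bimod[OF one])

text \<open>Since \<open>H\<close> is finite, the finiteness condition in the carrier of
  \<open>bimodule_sum\<close> holds automatically.\<close>

lemma P_simps:
  "carrier P = (\<Pi>\<^sub>E h\<in>H. carrier (one h))" "\<zero>\<^bsub>P\<^esub> = (\<lambda>h\<in>H. \<zero>\<^bsub>one h\<^esub>)"
  "x \<oplus>\<^bsub>P\<^esub> y = (\<lambda>h\<in>H. x h \<oplus>\<^bsub>one h\<^esub> y h)" "c \<odot>\<^bsub>P\<^esub> x = (\<lambda>h\<in>H. c \<odot>\<^bsub>one h\<^esub> x h)"
  "lact P a x = (\<lambda>h\<in>H. lact (one h) a (x h))" "ract P x a = (\<lambda>h\<in>H. ract (one h) (x h) a)"
  using fin by (simp_all add: bimodule_sum_def)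

lemma P_eqI:
  assumes "x \<in> extensional H" "y \<in> extensional H" "\<And>h. h \<in> H \<Longrightarrow> x h = y h"
  shows "x = y"
  using assms by (rule extensionalityI)

lemma P_mem: "x \<in> carrier P \<Longrightarrow> h \<in> H \<Longrightarrow> x h \<in> carrier (one h)"
  unfolding P_simps by (rule PiE_mem)

lemma P_ext: "x \<in> carrier P \<Longrightarrow> x \<in> extensional H"
  unfolding P_simps PiE_def by simp

lemma restrict_in: "(\<And>h. h \<in> H \<Longrightarrow> f h \<in> carrier (one h)) \<Longrightarrow> (\<lambda>h\<in>H. f h) \<in> carrier P"
  unfolding P_simps by (rule restrict_PiE_iff[THEN iffD2]) blast

lemma P_vspace: "vspace P"
proof (rule vspaceI)
  note v = bimod.axioms(2)[OF one_bimod]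
  show "\<zero>\<^bsub>P\<^esub> \<in> carrier P" unfolding P_simps(2) by (rule restrict_in) (rule vsp.zero_in[OF v])
  fix x assume x: "x \<in> carrier P"
  show "c \<odot>\<^bsub>P\<^esub> x \<in> carrier P" for c
    unfolding P_simps(4) by (rule restrict_in) (rule vsp.smult_in[OF v P_mem[OF x]])
  show "x \<oplus>\<^bsub>P\<^esub> \<zero>\<^bsub>P\<^esub> = x"
    unfolding P_simps(2-4)
    by (rule P_eqI[OF restrict_extensional P_ext[OF x]])
      (simp add: vsp.add_zero[OF v] P_mem[OF x])
  show "0 \<odot>\<^bsub>P\<^esub> x = \<zero>\<^bsub>P\<^esub>"
    unfolding P_simps(2-4)
    by (rule P_eqI[OF restrict_extensional restrict_extensional])
      (simp add: vsp.zero_smult[OF v] P_mem[OF x])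
  show "1 \<odot>\<^bsub>P\<^esub> x = x"
    unfolding P_simps(2-4)
    by (rule P_eqI[OF restrict_extensional P_ext[OF x]])
      (simp add: vsp.one_smult[OF v] P_mem[OF x])
  show "(c * d) \<odot>\<^bsub>P\<^esub> x = c \<odot>\<^bsub>P\<^esub> (d \<odot>\<^bsub>P\<^esub> x)" for c d
    unfolding P_simps(2-4)
    by (rule P_eqI[OF restrict_extensional restrict_extensional])
      (simp add: vsp.mult_smult[OF v] P_mem[OF x])
  show "(c + d) \<odot>\<^bsub>P\<^esub> x = c \<odot>\<^bsub>P\<^esub> x \<oplus>\<^bsub>P\<^esub> d \<odot>\<^bsub>P\<^esub> x" for c d
    unfolding P_simps(2-4)
    by (rule P_eqI[OF restrict_extensional restrict_extensional])
      (simp add: vsp.add_smult[OF v] P_mem[OF x])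
  fix y assume y: "y \<in> carrier P"
  show "x \<oplus>\<^bsub>P\<^esub> y \<in> carrier P"
    unfolding P_simps(3) by (rule restrict_in) (rule vsp.add_in[OF v P_mem[OF x] P_mem[OF y]])
  show "x \<oplus>\<^bsub>P\<^esub> y = y \<oplus>\<^bsub>P\<^esub> x"
    unfolding P_simps(2-4)
    by (rule P_eqI[OF restrict_extensional restrict_extensional])
      (simp add: vsp.add_comm[OF v] P_mem[OF x] P_mem[OF y])
  show "c \<odot>\<^bsub>P\<^esub> (x \<oplus>\<^bsub>P\<^esub> y) = c \<odot>\<^bsub>P\<^esub> x \<oplus>\<^bsub>P\<^esub> c \<odot>\<^bsub>P\<^esub> y" for c
    unfolding P_simps(2-4)
    by (rule P_eqI[OF restrict_extensional restrict_extensional])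
      (simp add: vsp.smult_add[OF v] P_mem[OF x] P_mem[OF y])
  fix z assume z: "z \<in> carrier P"
  show "x \<oplus>\<^bsub>P\<^esub> y \<oplus>\<^bsub>P\<^esub> z = x \<oplus>\<^bsub>P\<^esub> (y \<oplus>\<^bsub>P\<^esub> z)"
    unfolding P_simps(2-4)
    by (rule P_eqI[OF restrict_extensional restrict_extensional])
      (simp add: vsp.add_assoc[OF v] P_mem[OF x] P_mem[OF y] P_mem[OF z])
qed

sublocale P: vsp P by (rule vspI[OF P_vspace])

lemma P_bimod: "bimod A P"
proof (intro bimod.intro bimod_axioms.intro A.kalg_axioms vspI[OF P_vspace])
  note b = one_bimod
  note E = P_eqI[OF restrict_extensional restrict_extensional]
  fix a x assume a: "a \<in> carrier A" and x: "x \<in> carrier P"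
  show "lact P a x \<in> carrier P"
    unfolding P_simps(5) by (rule restrict_in) (rule bimod.l_closed[OF b a P_mem[OF x]])
  show "ract P x a \<in> carrier P"
    unfolding P_simps(6) by (rule restrict_in) (rule bimod.r_closed[OF b a P_mem[OF x]])
  show "lact P a (c \<odot>\<^bsub>P\<^esub> x) = c \<odot>\<^bsub>P\<^esub> lact P a x" for c
    unfolding P_simps(2-6) by (rule E) (simp add: bimod.l_smult[OF b a] P_mem[OF x])
  show "ract P (c \<odot>\<^bsub>P\<^esub> x) a = c \<odot>\<^bsub>P\<^esub> ract P x a" for c
    unfolding P_simps(2-6) by (rule E) (simp add: bimod.r_smult[OF b a] P_mem[OF x])
  show "lact P (c \<odot> a) x = c \<odot>\<^bsub>P\<^esub> lact P a x" for c
    unfolding P_simps(2-6) by (rule E) (simp add: bimod.l_smult_alg[OF b a] P_mem[OF x])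
  show "ract P x (c \<odot> a) = c \<odot>\<^bsub>P\<^esub> ract P x a" for c
    unfolding P_simps(2-6) by (rule E) (simp add: bimod.r_smult_alg[OF b a] P_mem[OF x])
  {
    fix y assume y: "y \<in> carrier P"
    show "lact P a (x \<oplus>\<^bsub>P\<^esub> y) = lact P a x \<oplus>\<^bsub>P\<^esub> lact P a y"
      unfolding P_simps(2-6) by (rule E) (simp add: bimod.l_add[OF b a] P_mem[OF x] P_mem[OF y])
    show "ract P (x \<oplus>\<^bsub>P\<^esub> y) a = ract P x a \<oplus>\<^bsub>P\<^esub> ract P y a"
      unfolding P_simps(2-6) by (rule E) (simp add: bimod.r_add[OF b a] P_mem[OF x] P_mem[OF y])
  }
  fix a' assume a': "a' \<in> carrier A"
  show "lact P (a \<oplus> a') x = lact P a x \<oplus>\<^bsub>P\<^esub> lact P a' x"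
    unfolding P_simps(2-6) by (rule E) (simp add: bimod.l_add_alg[OF b a a'] P_mem[OF x])
  show "ract P x (a \<oplus> a') = ract P x a \<oplus>\<^bsub>P\<^esub> ract P x a'"
    unfolding P_simps(2-6) by (rule E) (simp add: bimod.r_add_alg[OF b a a'] P_mem[OF x])
  show "lact P (a \<otimes> a') x = lact P a (lact P a' x)"
    unfolding P_simps(2-6) by (rule E) (simp add: bimod.l_assoc[OF b a a'] P_mem[OF x])
  show "ract P x (a \<otimes> a') = ract P (ract P x a) a'"
    unfolding P_simps(2-6) by (rule E) (simp add: bimod.r_assoc[OF b a a'] P_mem[OF x])
  show "ract P (lact P a x) a' = lact P a (ract P x a')"
    unfolding P_simps(2-6) by (rule E) (simp add: bimod.l_r[OF b a a'] P_mem[OF x])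
qed

sublocale PB: bimod A P by (rule P_bimod)

lemma idem_mem: "h \<in> H \<Longrightarrow> e h \<in> carrier (left_ideal A (e h))"
    "h \<in> H \<Longrightarrow> e' h \<in> carrier (right_ideal A (e' h))"
  using idem by (auto simp: A.left_ideal_simps A.right_ideal_simps intro: image_eqI[of _ _ "e h"] image_eqI[of _ _ "e' h"])

abbreviation pt where "pt h \<equiv> pure_tensor (left_ideal A (e h)) (right_ideal A (e' h))"

lemma pt_mem:
  assumes "h \<in> H" "x \<in> carrier (left_ideal A (e h))" "y \<in> carrier (right_ideal A (e' h))"
  shows "pt h x y \<in> carrier (one h)"
proof -
  interpret o: proj_one A "e h" "e' h" by (rule one[OF assms(1)])
  show ?thesis using o.T.pt_closed[OF assms(2,3)] by (simp add: o.P_simps)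
qed

lemma gen_incl: "gen h = incl h (pt h (e h) (e' h))"
  by (simp add: gen_def incl_def)

lemma incl_mem: "w \<in> carrier (one h) \<Longrightarrow> incl h w \<in> carrier P"
  unfolding incl_def
proof (rule restrict_in)
  fix h' assume "w \<in> carrier (one h)" "h' \<in> H"
  then show "(if h' = h then w else \<zero>\<^bsub>one h'\<^esub>) \<in> carrier (one h')"
    using vsp.zero_in[OF bimod.axioms(2)[OF one_bimod]] by simp
qed

lemma gen_mem: "h \<in> H \<Longrightarrow> gen h \<in> carrier P"
  unfolding gen_incl by (intro incl_mem pt_mem idem_mem)

lemma l_incl: "a \<in> carrier A \<Longrightarrow> lact P a (incl h w) = incl h (lact (one h) a w)"
  unfolding incl_def P_simps
  by (rule P_eqI[OF restrict_extensional restrict_extensional]) (simp add: bimod.l_zero[OF one_bimod])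

lemma r_incl: "a \<in> carrier A \<Longrightarrow> ract P (incl h w) a = incl h (ract (one h) w a)"
  unfolding incl_def P_simps
  by (rule P_eqI[OF restrict_extensional restrict_extensional]) (simp add: bimod.r_zero[OF one_bimod])

lemma incl_lin: "h \<in> H \<Longrightarrow> incl h \<in> lin (one h) P"
proof (rule linI)
  note v = bimod.axioms(2)[OF one_bimod]
  show "incl h (x \<oplus>\<^bsub>one h\<^esub> y) = incl h x \<oplus>\<^bsub>P\<^esub> incl h y" for x y
    unfolding incl_def P_simps
    by (rule P_eqI[OF restrict_extensional restrict_extensional])
      (simp add: vsp.add_zero[OF v] vsp.zero_in[OF v])
  show "incl h (c \<odot>\<^bsub>one h\<^esub> x) = c \<odot>\<^bsub>P\<^esub> incl h x" for c x
    unfolding incl_def P_simps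
    by (rule P_eqI[OF restrict_extensional restrict_extensional]) (simp add: vsp.smult_zero[OF v])
qed (rule incl_mem)

text \<open>Here \<open>x e = x\<close> and \<open>e' y = y\<close>, so every pure tensor is
  obtained from the generator by the two actions. This is why a homomorphism is determined by its
  values on the generators.\<close>

lemma incl_pt:
  assumes h: "h \<in> H" and x: "x \<in> carrier (left_ideal A (e h))" and y: "y \<in> carrier (right_ideal A (e' h))"
  shows "incl h (pt h x y) = lact P x (ract P (gen h) y)"
proof -
  interpret o: proj_one A "e h" "e' h" by (rule one[OF h])
  have x': "x \<in> carrier A" and y': "y \<in> carrier A" using o.L_carrier[OF x] o.R_carrier[OF y] .
  have "x \<otimes> e h = x" using x idem[OF h] by (auto simp: A.left_ideal_simps A.R.m_assoc)
  moreover have "e' h \<otimes> y = y" using y idem[OF h] by (auto simp: A.right_ideal_simps A.R.m_assoc[symmetric])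
  ultimately show ?thesis
    using idem_mem[OF h] x' y' y by (simp add: gen_incl l_incl r_incl o.r_pt o.l_pt)
qed

lemma l_gen: "h \<in> H \<Longrightarrow> lact P (e h) (gen h) = gen h"
proof -
  assume h: "h \<in> H"
  interpret o: proj_one A "e h" "e' h" by (rule one[OF h])
  show ?thesis using idem_mem[OF h] idem[OF h] by (simp add: gen_incl l_incl o.l_pt)
qed

lemma r_gen: "h \<in> H \<Longrightarrow> ract P (gen h) (e' h) = gen h"
proof -
  assume h: "h \<in> H"
  interpret o: proj_one A "e h" "e' h" by (rule one[OF h])
  show ?thesis using idem_mem[OF h] idem[OF h] by (simp add: gen_incl r_incl o.r_pt)
qed

lemma lin_eq_one:
  assumes h: "h \<in> H" and W: "vspace W" and f: "f \<in> lin P W" and g: "g \<in> lin P W"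
    and eq: "\<And>x y. x \<in> carrier (left_ideal A (e h)) \<Longrightarrow> y \<in> carrier (right_ideal A (e' h)) \<Longrightarrow>
      f (incl h (pt h x y)) = g (incl h (pt h x y))"
    and w: "w \<in> carrier (one h)"
  shows "f (incl h w) = g (incl h w)"
proof -
  interpret o: proj_one A "e h" "e' h" by (rule one[OF h])
  have i: "incl h \<in> lin (tensor o.L o.R) P" using incl_lin[OF h] by (simp add: o.lin_P)
  show ?thesis
  proof (rule o.T.tensor_lin_eqI[OF W, where f = "\<lambda>w. f (incl h w)" and g = "\<lambda>w. g (incl h w)"])
    show "(\<lambda>w. f (incl h w)) \<in> lin (tensor o.L o.R) W" "(\<lambda>w. g (incl h w)) \<in> lin (tensor o.L o.R) W"
      by (rule linI; simp add: linD[OF i] linD[OF f] linD[OF g])+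
  qed (use eq w o.P_simps in simp_all)
qed

lemma lin_eqI:
  assumes W: "vspace W" and f: "f \<in> lin P W" and g: "g \<in> lin P W"
    and eq: "\<And>h x y. h \<in> H \<Longrightarrow> x \<in> carrier (left_ideal A (e h)) \<Longrightarrow> y \<in> carrier (right_ideal A (e' h)) \<Longrightarrow>
      f (incl h (pt h x y)) = g (incl h (pt h x y))"
    and z: "z \<in> carrier P"
  shows "f z = g z"
proof -
  note v = bimod.axioms(2)[OF one_bimod]
  \<comment> \<open>\<open>?r S\<close> keeps the coordinates of \<open>z\<close> in
    \<open>S\<close> and is zero elsewhere, so that \<open>z\<close> can be rebuilt one coordinate
    at a time.\<close>
  let ?r = "\<lambda>S. \<lambda>h\<in>H. if h \<in> S then z h else \<zero>\<^bsub>one h\<^esub>"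
  have mem: "?r S \<in> carrier P" for S
    by (rule restrict_in) (simp add: vsp.zero_in[OF v] P_mem[OF z])
  have "f (?r S) = g (?r S)" if "finite S" "S \<subseteq> H" for S
    using that
  proof (induction S rule: finite_induct)
    case empty
    have "?r {} = \<zero>\<^bsub>P\<^esub>" by (simp add: P_simps(2))
    then show ?case using lin_zero[OF P_vspace W f] lin_zero[OF P_vspace W g] by simp
  next
    case (insert s S)
    have s: "s \<in> H" using insert.prems by simp
    have split: "?r (insert s S) = incl s (z s) \<oplus>\<^bsub>P\<^esub> ?r S"
      unfolding P_simps incl_def
    proof (rule P_eqI[OF restrict_extensional restrict_extensional])
      fix h assume h: "h \<in> H"
      note m = v[OF h]
      show "?r (insert s S) h = (\<lambda>h\<in>H. (\<lambda>h'\<in>H. if h' = s then z s else \<zero>\<^bsub>one h'\<^esub>) h \<oplus>\<^bsub>one h\<^esub> ?r S h) h"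
        using h insert.hyps vsp.add_zero[OF m P_mem[OF z h]] vsp.zero_add[OF m P_mem[OF z h]]
          vsp.zero_add[OF m vsp.zero_in[OF m]] by (cases "h = s") simp_all
    qed
    have "f (incl s (z s)) = g (incl s (z s))"
      by (rule lin_eq_one[OF s W f g eq[OF s] P_mem[OF z s]])
    then show ?case
      unfolding split lin_add[OF f incl_mem[OF P_mem[OF z s]] mem] lin_add[OF g incl_mem[OF P_mem[OF z s]] mem]
      using insert.IH insert.prems by (simp only: insert_subset)
  qed
  from this[OF fin order_refl] have "f (?r H) = g (?r H)" .
  moreover have "?r H = z" by (rule P_eqI[OF restrict_extensional P_ext[OF z]]) simp
  ultimately show ?thesis by simp
qed

text \<open>Homomorphisms from \<open>A e\<close> tensor \<open>e' A\<close> to \<open>Q\<close>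
  correspond to elements of the corner \<open>e Q e'\<close>; the two conditions \<open>ev\<close>
  place \<open>v h\<close> in its corner. The homomorphism is the sum of the ones on the
  summands.\<close>

lemma hom_exists:
  assumes B: "bimod A Q" and v: "\<And>h. h \<in> H \<Longrightarrow> v h \<in> carrier Q"
    and ev: "\<And>h. h \<in> H \<Longrightarrow> lact Q (e h) (v h) = v h" "\<And>h. h \<in> H \<Longrightarrow> ract Q (v h) (e' h) = v h"
  shows "\<exists>\<phi>\<in>bimodule_hom A P Q. \<forall>h\<in>H. \<phi> (gen h) = v h"
proof -
  interpret Q: bimod A Q by (rule B)
  have "\<forall>h\<in>H. \<exists>t. t \<in> lin (one h) Q \<and>
      (\<forall>x\<in>carrier (left_ideal A (e h)). \<forall>y\<in>carrier (right_ideal A (e' h)). t (pt h x y) = lact Q x (ract Q (v h) y)) \<and>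
      (\<forall>a\<in>carrier A. \<forall>z\<in>carrier (one h). t (lact (one h) a z) = lact Q a (t z)) \<and>
      (\<forall>a\<in>carrier A. \<forall>z\<in>carrier (one h). t (ract (one h) z a) = ract Q (t z) a)"
    (is "\<forall>h\<in>H. \<exists>t. ?\<Phi> h t")
  proof
    fix h assume h: "h \<in> H"
    show "\<exists>t. ?\<Phi> h t"
      by (rule proj_one.hom_exists[OF one[OF h] B v[OF h]]) blast
  qed
  then obtain t where t': "\<forall>h\<in>H. ?\<Phi> h (t h)" by (rule bchoice[THEN exE])
  have t: "\<And>h. h \<in> H \<Longrightarrow> t h \<in> lin (one h) Q"
    "\<And>h x y. h \<in> H \<Longrightarrow> x \<in> carrier (left_ideal A (e h)) \<Longrightarrow> y \<in> carrier (right_ideal A (e' h)) \<Longrightarrow>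
      t h (pt h x y) = lact Q x (ract Q (v h) y)"
    "\<And>h a z. h \<in> H \<Longrightarrow> a \<in> carrier A \<Longrightarrow> z \<in> carrier (one h) \<Longrightarrow> t h (lact (one h) a z) = lact Q a (t h z)"
    "\<And>h a z. h \<in> H \<Longrightarrow> a \<in> carrier A \<Longrightarrow> z \<in> carrier (one h) \<Longrightarrow> t h (ract (one h) z a) = ract Q (t h z) a"
    using t' by simp_all
  have tm: "t h (z h) \<in> carrier Q" if "z \<in> carrier P" "h \<in> H" for z h
    using lin_closed[OF t(1) P_mem] that by simp
  define \<phi> where "\<phi> z = finsum Q (\<lambda>h. t h (z h)) H" for z
  have cong: "finsum Q f H = finsum Q g H" if "\<And>h. h \<in> H \<Longrightarrow> f h = g h" "\<And>h. h \<in> H \<Longrightarrow> g h \<in> carrier Q" for f g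
    by (rule Q.Q.M.finsum_cong') (use that in auto)
  have \<phi>: "\<phi> \<in> lin P Q"
  proof (rule linI)
    fix x assume x: "x \<in> carrier P"
    show "\<phi> x \<in> carrier Q" unfolding \<phi>_def by (rule Q.Q.M.finsum_closed) (use tm[OF x] in auto)
    show "\<phi> (c \<odot>\<^bsub>P\<^esub> x) = c \<odot>\<^bsub>Q\<^esub> \<phi> x" for c
    proof -
      have "\<phi> (c \<odot>\<^bsub>P\<^esub> x) = finsum Q (\<lambda>h. c \<odot>\<^bsub>Q\<^esub> t h (x h)) H"
        unfolding \<phi>_def P_simps(4)
        by (rule cong) (simp_all add: lin_smult[OF t(1)] P_mem[OF x] tm[OF x])
      also have "\<dots> = c \<odot>\<^bsub>Q\<^esub> \<phi> x"
        unfolding \<phi>_def by (rule Q.Q.finsum_smult[symmetric]) (use tm[OF x] in auto)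
      finally show ?thesis .
    qed
    fix y assume y: "y \<in> carrier P"
    have "\<phi> (x \<oplus>\<^bsub>P\<^esub> y) = finsum Q (\<lambda>h. t h (x h) \<oplus>\<^bsub>Q\<^esub> t h (y h)) H"
      unfolding \<phi>_def P_simps(3)
      by (rule cong) (simp_all add: lin_add[OF t(1)] P_mem[OF x] P_mem[OF y] tm[OF x] tm[OF y])
    also have "\<dots> = \<phi> x \<oplus>\<^bsub>Q\<^esub> \<phi> y"
      unfolding \<phi>_def by (rule Q.Q.M.finsum_addf) (use tm[OF x] tm[OF y] in auto)
    finally show "\<phi> (x \<oplus>\<^bsub>P\<^esub> y) = \<phi> x \<oplus>\<^bsub>Q\<^esub> \<phi> y" .
  qed
  have l: "\<phi> (lact P a z) = lact Q a (\<phi> z)" if a: "a \<in> carrier A" and z: "z \<in> carrier P" for a z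
  proof -
    have "\<phi> (lact P a z) = finsum Q (\<lambda>h. lact Q a (t h (z h))) H"
      unfolding \<phi>_def P_simps(5)
      by (rule cong) (simp_all add: t(3) a P_mem[OF z] tm[OF z] Q.l_closed)
    also have "\<dots> = lact Q a (\<phi> z)"
      unfolding \<phi>_def
      by (rule lin_finsum[OF Q.Q.vectorspace_axioms Q.Q.vectorspace_axioms Q.l_lin[OF a] fin, symmetric]) (rule tm[OF z])
    finally show ?thesis .
  qed
  have r: "\<phi> (ract P z a) = ract Q (\<phi> z) a" if a: "a \<in> carrier A" and z: "z \<in> carrier P" for a z
  proof -
    have "\<phi> (ract P z a) = finsum Q (\<lambda>h. ract Q (t h (z h)) a) H"
      unfolding \<phi>_def P_simps(6)
      by (rule cong) (simp_all add: t(4) a P_mem[OF z] tm[OF z] Q.r_closed)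
    also have "\<dots> = ract Q (\<phi> z) a"
      unfolding \<phi>_def
      by (rule lin_finsum[OF Q.Q.vectorspace_axioms Q.Q.vectorspace_axioms Q.r_lin[OF a] fin, symmetric]) (rule tm[OF z])
    finally show ?thesis .
  qed
  have g: "\<phi> (gen h) = v h" if h: "h \<in> H" for h
  proof -
    have "t h' (gen h h') = (if h' = h then v h else \<zero>\<^bsub>Q\<^esub>)" if h': "h' \<in> H" for h'
      using h' t(2)[OF h idem_mem[OF h]] ev[OF h]
        lin_zero[OF vsp.axioms(1)[OF bimod.axioms(2)[OF one_bimod[OF h']]] Q.Q.vectorspace_axioms t(1)[OF h']]
      by (simp add: gen_def)
    then have "\<phi> (gen h) = finsum Q (\<lambda>h'. if h = h' then v h' else \<zero>\<^bsub>Q\<^esub>) H"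
      unfolding \<phi>_def by (intro cong) (simp_all add: v)
    also have "\<dots> = v h"
      by (rule Q.Q.M.finsum_singleton[OF h fin]) (use v in auto)
    finally show ?thesis .
  qed
  have "restrict \<phi> (carrier P) \<in> bimodule_hom A P Q"
    unfolding bimodule_hom_def
  proof (intro CollectI conjI ballI)
    show "restrict \<phi> (carrier P) \<in> lin P Q"
      by (rule linI) (simp_all only: restrict_apply' P.add_in P.smult_in linD[OF \<phi>])
    fix a z assume a: "a \<in> carrier A" and z: "z \<in> carrier P"
    show "restrict \<phi> (carrier P) (lact P a z) = lact Q a (restrict \<phi> (carrier P) z)"
      by (simp only: restrict_apply' PB.l_closed[OF a z] z l[OF a z])
    show "restrict \<phi> (carrier P) (ract P z a) = ract Q (restrict \<phi> (carrier P) z) a"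
      by (simp only: restrict_apply' PB.r_closed[OF a z] z r[OF a z])
  qed (rule restrict_extensional)
  then show ?thesis
  proof (rule bexI[rotated], intro ballI)
    show "restrict \<phi> (carrier P) (gen h) = v h" if "h \<in> H" for h
      unfolding restrict_apply'[OF gen_mem[OF that]] by (rule g[OF that])
  qed
qed

lemma homD:
  assumes "\<phi> \<in> bimodule_hom A P Q"
  shows hom_ext: "\<phi> \<in> extensional (carrier P)" and hom_lin: "\<phi> \<in> lin P Q"
    and hom_l: "a \<in> carrier A \<Longrightarrow> z \<in> carrier P \<Longrightarrow> \<phi> (lact P a z) = lact Q a (\<phi> z)"
    and hom_r: "a \<in> carrier A \<Longrightarrow> z \<in> carrier P \<Longrightarrow> \<phi> (ract P z a) = ract Q (\<phi> z) a"
  using assms unfolding bimodule_hom_def by blast+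

lemma hom_eqI:
  assumes B: "bimod A Q" and f: "f \<in> bimodule_hom A P Q" and g: "g \<in> bimodule_hom A P Q"
    and eq: "\<And>h. h \<in> H \<Longrightarrow> f (gen h) = g (gen h)"
  shows "f = g"
proof (rule extensionalityI[OF hom_ext[OF f] hom_ext[OF g]])
  interpret Q: bimod A Q by (rule B)
  fix z assume z: "z \<in> carrier P"
  show "f z = g z"
  proof (rule lin_eqI[OF Q.Q.vectorspace_axioms hom_lin[OF f] hom_lin[OF g] _ z])
    fix h x y assume h: "h \<in> H" and x: "x \<in> carrier (left_ideal A (e h))"
      and y: "y \<in> carrier (right_ideal A (e' h))"
    interpret o: proj_one A "e h" "e' h" by (rule one[OF h])
    show "f (incl h (pt h x y)) = g (incl h (pt h x y))"
      unfolding incl_pt[OF h x y]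
      by (simp only: hom_l[OF f] hom_l[OF g] hom_r[OF f] hom_r[OF g] o.L_carrier[OF x] o.R_carrier[OF y]
          PB.r_closed gen_mem[OF h] eq[OF h])
  qed
qed

lemma hom_gen:
  assumes "\<phi> \<in> bimodule_hom A P Q" "h \<in> H"
  shows "\<phi> (gen h) \<in> carrier Q" "lact Q (e h) (\<phi> (gen h)) = \<phi> (gen h)"
    "ract Q (\<phi> (gen h)) (e' h) = \<phi> (gen h)"
  using lin_closed[OF hom_lin[OF assms(1)] gen_mem[OF assms(2)]]
    hom_l[OF assms(1) idem(1)[OF assms(2)] gen_mem[OF assms(2)]]
    hom_r[OF assms(1) idem(2)[OF assms(2)] gen_mem[OF assms(2)]] l_gen[OF assms(2)] r_gen[OF assms(2)]
  by simp_all

text \<open>The constant is a definite description: \<open>hom_exists\<close> gives existence and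
  \<open>hom_eqI\<close> uniqueness. Every later differential and cochain gets its values from
  here.\<close>

lemma hom_with_values:
  assumes B: "bimod A Q" and v: "\<And>h. h \<in> H \<Longrightarrow> v h \<in> carrier Q"
    "\<And>h. h \<in> H \<Longrightarrow> lact Q (e h) (v h) = v h" "\<And>h. h \<in> H \<Longrightarrow> ract Q (v h) (e' h) = v h"
  shows "hom_with_values A P Q H gen v \<in> bimodule_hom A P Q"
    and "h \<in> H \<Longrightarrow> hom_with_values A P Q H gen v (gen h) = v h"
proof -
  have ex1: "\<exists>!\<phi>. \<phi> \<in> bimodule_hom A P Q \<and> (\<forall>h\<in>H. \<phi> (gen h) = v h)"
  proof (rule ex_ex1I)
    show "\<exists>\<phi>. \<phi> \<in> bimodule_hom A P Q \<and> (\<forall>h\<in>H. \<phi> (gen h) = v h)"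
      using hom_exists[OF assms] by blast
    show "\<phi> = \<psi>" if "\<phi> \<in> bimodule_hom A P Q \<and> (\<forall>h\<in>H. \<phi> (gen h) = v h)"
      "\<psi> \<in> bimodule_hom A P Q \<and> (\<forall>h\<in>H. \<psi> (gen h) = v h)" for \<phi> \<psi>
      using that by (intro hom_eqI[OF B]) simp_all
  qed
  from theI'[OF ex1] show "hom_with_values A P Q H gen v \<in> bimodule_hom A P Q"
    "h \<in> H \<Longrightarrow> hom_with_values A P Q H gen v (gen h) = v h"
    unfolding hom_with_values_def by blast+
qed

lemma hom_space_simps:
  "carrier (hom_space A P Q) = bimodule_hom A P Q"
  "\<zero>\<^bsub>hom_space A P Q\<^esub> = (\<lambda>z\<in>carrier P. \<zero>\<^bsub>Q\<^esub>)"
  "f \<oplus>\<^bsub>hom_space A P Q\<^esub> g = (\<lambda>z\<in>carrier P. f z \<oplus>\<^bsub>Q\<^esub> g z)"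
  "c \<odot>\<^bsub>hom_space A P Q\<^esub> f = (\<lambda>z\<in>carrier P. c \<odot>\<^bsub>Q\<^esub> f z)"
  by (simp_all add: hom_space_def)

lemma hom_space_vspace:
  assumes B: "bimod A Q"
  shows "vspace (hom_space A P Q)"
proof (rule vspaceI)
  interpret Q: bimod A Q by (rule B)
  let ?S = "hom_space A P Q"
  note S = hom_space_simps
  note E = extensionalityI[OF restrict_extensional restrict_extensional]
  \<comment> \<open>Members of \<open>bimodule_hom\<close> are extensional, so the operations
    produce restricted functions. Only the unrestricted map then has to be checked.\<close>
  have mk: "restrict f (carrier P) \<in> carrier ?S"
    if f: "f \<in> lin P Q" and l: "\<And>a z. a \<in> carrier A \<Longrightarrow> z \<in> carrier P \<Longrightarrow> f (lact P a z) = lact Q a (f z)"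
      and r: "\<And>a z. a \<in> carrier A \<Longrightarrow> z \<in> carrier P \<Longrightarrow> f (ract P z a) = ract Q (f z) a" for f
    unfolding S bimodule_hom_def
    by (intro CollectI conjI ballI restrict_extensional linI)
      (simp_all only: restrict_apply' P.add_in P.smult_in PB.l_closed PB.r_closed linD[OF f] l r)
  show "\<zero>\<^bsub>?S\<^esub> \<in> carrier ?S"
    unfolding S(2) by (rule mk) (simp_all add: linI Q.l_zero Q.r_zero)
  fix x assume "x \<in> carrier ?S"
  then have x: "x \<in> bimodule_hom A P Q" by (simp add: S)
  note xl = hom_lin[OF x]
  note xc = lin_closed[OF xl]
  show "c \<odot>\<^bsub>?S\<^esub> x \<in> carrier ?S" for c
    unfolding S(4)
  proof (rule mk)
    show "(\<lambda>z. c \<odot>\<^bsub>Q\<^esub> x z) \<in> lin P Q"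
      by (rule linI)
        (simp_all add: linD[OF xl] Q.Q.smult_add Q.Q.mult_smult[symmetric] mult.commute)
  qed (simp_all add: hom_l[OF x] hom_r[OF x] Q.l_smult Q.r_smult xc)
  show "x \<oplus>\<^bsub>?S\<^esub> \<zero>\<^bsub>?S\<^esub> = x"
    unfolding S(2-4) by (rule extensionalityI[OF restrict_extensional hom_ext[OF x]]) (simp add: xc)
  show "0 \<odot>\<^bsub>?S\<^esub> x = \<zero>\<^bsub>?S\<^esub>" unfolding S(2-4) by (rule E) (simp add: xc)
  show "1 \<odot>\<^bsub>?S\<^esub> x = x"
    unfolding S(2-4) by (rule extensionalityI[OF restrict_extensional hom_ext[OF x]]) (simp add: xc)
  show "(c * d) \<odot>\<^bsub>?S\<^esub> x = c \<odot>\<^bsub>?S\<^esub> (d \<odot>\<^bsub>?S\<^esub> x)" for c d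
    unfolding S(2-4) by (rule E) (simp add: xc Q.Q.mult_smult)
  show "(c + d) \<odot>\<^bsub>?S\<^esub> x = c \<odot>\<^bsub>?S\<^esub> x \<oplus>\<^bsub>?S\<^esub> d \<odot>\<^bsub>?S\<^esub> x" for c d
    unfolding S(2-4) by (rule E) (simp add: xc Q.Q.add_smult)
  fix y assume "y \<in> carrier ?S"
  then have y: "y \<in> bimodule_hom A P Q" by (simp add: S)
  note yl = hom_lin[OF y]
  note yc = lin_closed[OF yl]
  show "x \<oplus>\<^bsub>?S\<^esub> y \<in> carrier ?S"
    unfolding S(3)
  proof (rule mk)
    show "(\<lambda>z. x z \<oplus>\<^bsub>Q\<^esub> y z) \<in> lin P Q"
      by (rule linI)
        (simp_all add: linD[OF xl] linD[OF yl] Q.Q.smult_add Q.Q.M.a_assoc Q.Q.M.a_lcomm)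
  qed (simp_all add: hom_l[OF x] hom_r[OF x] hom_l[OF y] hom_r[OF y] Q.l_add Q.r_add xc yc)
  show "x \<oplus>\<^bsub>?S\<^esub> y = y \<oplus>\<^bsub>?S\<^esub> x" unfolding S(2-4) by (rule E) (simp add: xc yc Q.Q.M.a_comm)
  show "c \<odot>\<^bsub>?S\<^esub> (x \<oplus>\<^bsub>?S\<^esub> y) = c \<odot>\<^bsub>?S\<^esub> x \<oplus>\<^bsub>?S\<^esub> c \<odot>\<^bsub>?S\<^esub> y" for c
    unfolding S(2-4) by (rule E) (simp add: xc yc Q.Q.smult_add)
  fix z assume "z \<in> carrier ?S"
  then have z: "z \<in> bimodule_hom A P Q" by (simp add: S)
  note zc = lin_closed[OF hom_lin[OF z]]
  show "x \<oplus>\<^bsub>?S\<^esub> y \<oplus>\<^bsub>?S\<^esub> z = x \<oplus>\<^bsub>?S\<^esub> (y \<oplus>\<^bsub>?S\<^esub> z)"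
    unfolding S(2-4) by (rule E) (simp add: xc yc zc Q.Q.M.a_assoc)
qed

end

subsection \<open>Quotient algebras\<close>

locale kalg_ideal = kalg A + I: ideal I A for A :: "('k::field, 'a) module" (structure) and I
begin

text \<open>A ring ideal is closed under scalars because \<open>c x = (c 1) x\<close>.\<close>

lemma ideal_subsp: "subsp I A"
proof (rule subspI[OF A.vectorspace_axioms])
  show "c \<odot> x \<in> I" if x: "x \<in> I" for c x
  proof -
    have xA: "x \<in> carrier A" by (rule I.a_Hcarr[OF x])
    have "(c \<odot> \<one>) \<otimes> x \<in> I" by (rule I.I_l_closed[OF x]) simp
    moreover have "(c \<odot> \<one>) \<otimes> x = c \<odot> x" using xA by (simp add: smult_mult_left)
    ultimately show ?thesis by simp
  qed
qed (use I.a_subset I.additive_subgroup_axioms in auto)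

sublocale VQ: vsp_quot A I by (rule vsp_quotI[OF A.vectorspace_axioms ideal_subsp])

lemma quot_mult:
  "x \<in> carrier A \<Longrightarrow> y \<in> carrier A \<Longrightarrow> (I +> x) \<otimes>\<^bsub>quot A I\<^esub> (I +> y) = I +> (x \<otimes> y)"
  by (simp add: quot_def FactRing_def ring.defs module.defs I.rcoset_mult_add)

lemma quot_one: "\<one>\<^bsub>quot A I\<^esub> = I +> \<one>"
  by (simp add: quot_def FactRing_def ring.defs module.defs)

lemma quot_kalg: "kalg (quot A I)"
proof -
  interpret Q: vsp "quot A I" by (rule vspI[OF VQ.vspace_quot])
  note s = quot_mult quot_one VQ.quot_add VQ.quot_smult
  have rep: "\<exists>x\<in>carrier A. X = I +> x" if "X \<in> carrier (quot A I)" for X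
    using that by (auto simp: VQ.quot_carrier)
  have mem: "I +> x \<in> carrier (quot A I)" if "x \<in> carrier A" for x
    using that by (auto simp: VQ.quot_carrier)
  have mon: "Group.monoid (quot A I)"
  proof (rule monoidI)
    show "\<one>\<^bsub>quot A I\<^esub> \<in> carrier (quot A I)" unfolding quot_one by (rule mem) simp
    fix X assume "X \<in> carrier (quot A I)"
    then obtain x where X: "x \<in> carrier A" "X = I +> x" using rep by metis
    show "\<one>\<^bsub>quot A I\<^esub> \<otimes>\<^bsub>quot A I\<^esub> X = X" using X by (simp add: s)
    show "X \<otimes>\<^bsub>quot A I\<^esub> \<one>\<^bsub>quot A I\<^esub> = X" using X by (simp add: s)
    fix Y assume "Y \<in> carrier (quot A I)"
    then obtain y where Y: "y \<in> carrier A" "Y = I +> y" using rep by metis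
    show "X \<otimes>\<^bsub>quot A I\<^esub> Y \<in> carrier (quot A I)" using X Y by (simp add: s mem)
    fix Z assume "Z \<in> carrier (quot A I)"
    then obtain z where Z: "z \<in> carrier A" "Z = I +> z" using rep by metis
    show "X \<otimes>\<^bsub>quot A I\<^esub> Y \<otimes>\<^bsub>quot A I\<^esub> Z = X \<otimes>\<^bsub>quot A I\<^esub> (Y \<otimes>\<^bsub>quot A I\<^esub> Z)"
      using X Y Z by (simp add: s R.m_assoc)
  qed
  have rng: "ring (quot A I)"
  proof (rule ringI[OF Q.M.abelian_group_axioms mon])
    fix X Y Z assume "X \<in> carrier (quot A I)" "Y \<in> carrier (quot A I)" "Z \<in> carrier (quot A I)"
    then obtain x y z where X: "x \<in> carrier A" "X = I +> x" "y \<in> carrier A" "Y = I +> y"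
      "z \<in> carrier A" "Z = I +> z" using rep by metis
    show "(X \<oplus>\<^bsub>quot A I\<^esub> Y) \<otimes>\<^bsub>quot A I\<^esub> Z = X \<otimes>\<^bsub>quot A I\<^esub> Z \<oplus>\<^bsub>quot A I\<^esub> Y \<otimes>\<^bsub>quot A I\<^esub> Z"
      using X by (simp add: s R.l_distr)
    show "Z \<otimes>\<^bsub>quot A I\<^esub> (X \<oplus>\<^bsub>quot A I\<^esub> Y) = Z \<otimes>\<^bsub>quot A I\<^esub> X \<oplus>\<^bsub>quot A I\<^esub> Z \<otimes>\<^bsub>quot A I\<^esub> Y"
      using X by (simp add: s R.r_distr)
  qed
  show ?thesis
  proof (intro kalg.intro kalg_axioms.intro rng Q.vsp_axioms)
    fix X Y c assume "X \<in> carrier (quot A I)" "Y \<in> carrier (quot A I)"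
    then obtain x y where X: "x \<in> carrier A" "X = I +> x" "y \<in> carrier A" "Y = I +> y"
      using rep by metis
    show "(c \<odot>\<^bsub>quot A I\<^esub> X) \<otimes>\<^bsub>quot A I\<^esub> Y = c \<odot>\<^bsub>quot A I\<^esub> (X \<otimes>\<^bsub>quot A I\<^esub> Y)"
      using X by (simp add: s smult_mult_left)
    show "X \<otimes>\<^bsub>quot A I\<^esub> (c \<odot>\<^bsub>quot A I\<^esub> Y) = c \<odot>\<^bsub>quot A I\<^esub> (X \<otimes>\<^bsub>quot A I\<^esub> Y)"
      using X by (simp add: s smult_mult_right)
  qed
qed

end

subsection \<open>Path algebras\<close>

context pre_digraph
begin

text \<open>The product of the path algebra on arbitrary functions, with no condition on supports;
  associativity and bilinearity already hold at this level.\<close>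

definition pmult :: "('a \<times> 'b list \<Rightarrow> 'k::field) \<Rightarrow> ('a \<times> 'b list \<Rightarrow> 'k) \<Rightarrow> 'a \<times> 'b list \<Rightarrow> 'k" where
  "pmult f g = (\<lambda>(u, p). \<Sum>i\<le>length p. f (u, take i p) * g (awlast u (take i p), drop i p))"

lemma awlast_Cons: "awlast u (a # p) = awlast (head G a) p"
  by (cases p) simp_all

lemma pmult_Nil: "pmult f g (u, []) = f (u, []) * g (u, [])"
  by (simp add: pmult_def)

text \<open>Separating the cut in front of the first arrow turns the convolution into a recursion on
  the path.\<close>

lemma pmult_Cons:
  "pmult f g (u, a # p) = f (u, []) * g (u, a # p) + pmult (\<lambda>(v, q). f (u, a # q)) g (head G a, p)"
  by (simp add: pmult_def sum.atMost_Suc_shift awlast_Cons del: sum.atMost_Suc awalk_verts.simps(2))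

lemma pmult_cong: "(\<And>q. f (u, q) = f' (u, q)) \<Longrightarrow> pmult f g (u, p) = pmult f' g (u, p)"
  by (simp add: pmult_def)

lemma pmult_add_left: "pmult (\<lambda>p. f p + f' p) g = (\<lambda>p. pmult f g p + pmult f' g p)"
  by (auto simp: pmult_def sum.distrib algebra_simps)

lemma pmult_add_right: "pmult f (\<lambda>p. g p + g' p) = (\<lambda>p. pmult f g p + pmult f g' p)"
  by (auto simp: pmult_def sum.distrib algebra_simps)

lemma pmult_scale_left: "pmult (\<lambda>p. c * f p) g = (\<lambda>p. c * pmult f g p)"
  by (auto simp: pmult_def sum_distrib_left algebra_simps)

lemma pmult_scale_right: "pmult f (\<lambda>p. c * g p) = (\<lambda>p. c * pmult f g p)"
  by (auto simp: pmult_def sum_distrib_left algebra_simps)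

lemma pmult_zero: "pmult (\<lambda>p. 0) g = (\<lambda>p. 0)" "pmult f (\<lambda>p. 0) = (\<lambda>p. 0)"
  by (auto simp: pmult_def)

text \<open>For the derivative along the first arrow, written f', the recursion is a product rule:
  (f g)' = f(u, []) g' + f' g. The induction hypothesis is applied to f' in place of
  \<open>f\<close>, so \<open>f\<close> has to be general.\<close>

lemma pmult_assoc_at: "pmult (pmult f g) h (u, p) = pmult f (pmult g h) (u, p)"
proof (induction p arbitrary: u f g)
  case Nil
  show ?case by (simp add: pmult_Nil)
next
  case (Cons a p)
  let ?f = "\<lambda>(v, q). f (u, a # q)" and ?g = "\<lambda>(v, q). g (u, a # q)"
  have "pmult (\<lambda>(v, q). pmult f g (u, a # q)) h (head G a, p) =
      pmult (\<lambda>p. f (u, []) * ?g p + pmult ?f g p) h (head G a, p)"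
    by (rule pmult_cong) (simp add: pmult_Cons)
  also have "\<dots> = f (u, []) * pmult ?g h (head G a, p) + pmult ?f (pmult g h) (head G a, p)"
    by (simp only: pmult_add_left pmult_scale_left Cons.IH)
  finally show ?case
    by (simp add: pmult_Cons[of "pmult f g"] pmult_Cons[of f] pmult_Cons[of g] pmult_Nil algebra_simps)
qed

lemma pmult_assoc: "pmult (pmult f g) h = pmult f (pmult g h)"
  by (rule ext) (use pmult_assoc_at in \<open>auto\<close>)

text \<open>In the convolution only the cut after \<open>length p\<close> arrows can
  contribute.\<close>

lemma pmult_basis:
  "pmult (basis_elem (u, p)) (basis_elem (v, q)) =
    (if awlast u p = v then basis_elem (u, p @ q) else (\<lambda>_. 0 :: 'k::field))"
    (is "_ = ?rhs")
proof (rule ext)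
  fix r :: "'a \<times> 'b list"
  obtain w s where r: "r = (w, s)" by (cases r)
  let ?c = "of_bool (awlast u p = v \<and> w = u \<and> s = p @ q) :: 'k"
  have "pmult (basis_elem (u, p)) (basis_elem (v, q)) r =
      (\<Sum>i\<le>length s. if i = length p then ?c else 0)"
    unfolding r pmult_def prod.case
  proof (rule sum.cong[OF refl])
    fix i assume i: "i \<in> {..length s}"
    have "w = u \<and> take i s = p \<and> awlast w (take i s) = v \<and> drop i s = q \<longleftrightarrow>
        i = length p \<and> awlast u p = v \<and> w = u \<and> s = p @ q"
      using i by (auto simp: append_eq_conv_conj)
    then show "basis_elem (u, p) (w, take i s) * basis_elem (v, q) (awlast w (take i s), drop i s) =
        (if i = length p then ?c else 0)"
      unfolding basis_elem_def by auto
  qed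
  also have "\<dots> = ?rhs r"
    by (auto simp: r basis_elem_def)
  finally show "pmult (basis_elem (u, p)) (basis_elem (v, q)) r = ?rhs r" .
qed

abbreviation PA :: "('k::field, 'a \<times> 'b list \<Rightarrow> 'k) module" where "PA \<equiv> path_algebra G"

definition idem_sum :: "'a \<times> 'b list \<Rightarrow> 'k::field" where
  "idem_sum = (\<lambda>(u, p). of_bool (u \<in> verts G \<and> p = []))"

lemma PA_simps:
  "carrier PA = carrier (free_module (paths G))"
  "\<zero>\<^bsub>PA\<^esub> = (\<lambda>_. 0)" "f \<oplus>\<^bsub>PA\<^esub> g = (\<lambda>p. f p + g p)" "c \<odot>\<^bsub>PA\<^esub> f = (\<lambda>p. c * f p)"
  "f \<otimes>\<^bsub>PA\<^esub> g = pmult f g" "\<one>\<^bsub>PA\<^esub> = idem_sum"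
  by (simp_all add: path_algebra_def free_module_def pmult_def idem_sum_def)

end

text \<open>With finitely many vertices the sum of the trivial paths has finite support and is a
  unit of the path algebra.\<close>

locale fin_quiver = wf_digraph G for G :: "('a, 'b) pre_digraph" +
  assumes finite_verts: "finite (verts G)"
begin

lemma supp_PA:
  assumes "f \<in> carrier PA"
  shows "finite {p. f p \<noteq> 0}" "f (u, p) \<noteq> 0 \<Longrightarrow> \<exists>v. awalk u p v" "f q \<noteq> 0 \<Longrightarrow> q \<in> paths G"
  using assms by (auto simp: PA_simps free_module_simps paths_def)

lemma pmult_closed:
  assumes f: "f \<in> carrier PA" and g: "g \<in> carrier PA"
  shows "pmult f g \<in> carrier PA"
proof -
  have nz: "\<exists>v q1 q2. f (u, q1) \<noteq> 0 \<and> g (v, q2) \<noteq> 0 \<and> v = awlast u q1 \<and> p = q1 @ q2"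
    if nz: "pmult f g (u, p) \<noteq> 0" for u p
  proof -
    from nz obtain i where "f (u, take i p) * g (awlast u (take i p), drop i p) \<noteq> 0"
      unfolding pmult_def prod.case by (rule sum.not_neutral_contains_not_neutral)
    then have "f (u, take i p) \<noteq> 0 \<and> g (awlast u (take i p), drop i p) \<noteq> 0 \<and>
        awlast u (take i p) = awlast u (take i p) \<and> p = take i p @ drop i p" by simp
    then show ?thesis by blast
  qed
  let ?j = "\<lambda>((u, p), (v, q)). (u, p @ q)"
  have "{r. pmult f g r \<noteq> 0} \<subseteq> ?j ` ({p. f p \<noteq> 0} \<times> {p. g p \<noteq> 0})"
  proof
    fix r assume r: "r \<in> {r. pmult f g r \<noteq> 0}"
    obtain u p where up: "r = (u, p)" by (cases r)
    obtain v q1 q2 where "f (u, q1) \<noteq> 0" "g (v, q2) \<noteq> 0" "p = q1 @ q2" using nz r up by blast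
    then show "r \<in> ?j ` ({p. f p \<noteq> 0} \<times> {p. g p \<noteq> 0})"
      using up by (intro image_eqI[of _ _ "((u, q1), (v, q2))"]) simp_all
  qed
  then have fin: "finite {r. pmult f g r \<noteq> 0}"
    by (rule finite_subset) (intro finite_imageI finite_cartesian_product supp_PA(1) f g)
  have "r \<in> paths G" if r: "pmult f g r \<noteq> 0" for r
  proof -
    obtain u p where up: "r = (u, p)" by (cases r)
    obtain q1 q2 where q: "f (u, q1) \<noteq> 0" "g (awlast u q1, q2) \<noteq> 0" "p = q1 @ q2" using nz r up by blast
    obtain x where x: "awalk u q1 x" using supp_PA(2)[OF f q(1)] by blast
    obtain y where y: "awalk (awlast u q1) q2 y" using supp_PA(2)[OF g q(2)] by blast
    have l: "awlast u q1 = x" using x by simp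
    have "awalk u p y" unfolding q(3) by (rule awalk_appendI[OF x y[unfolded l]])
    then show ?thesis using up by (auto simp: paths_def)
  qed
  then show ?thesis using fin by (auto simp: PA_simps free_module_simps)
qed

lemma idem_sum_closed: "(idem_sum :: _ \<Rightarrow> 'k::field) \<in> carrier PA"
proof -
  have "{p. idem_sum p \<noteq> (0::'k::field)} = (\<lambda>u. (u, [])) ` verts G"
    by (auto simp: idem_sum_def)
  moreover have "(\<lambda>u. (u, [])) ` verts G \<subseteq> paths G"
    by (auto simp: paths_def awalk_Nil_iff)
  ultimately show ?thesis
    using finite_verts by (simp add: PA_simps free_module_simps)
qed

lemma pmult_idem_left:
  assumes f: "f \<in> carrier PA"
  shows "pmult idem_sum f = f"
proof (rule ext)
  fix r :: "'a \<times> 'b list"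
  obtain u p where r: "r = (u, p)" by (cases r)
  have "pmult idem_sum f r = (\<Sum>i\<le>length p. if i = 0 then of_bool (u \<in> verts G) * f (u, p) else 0)"
    unfolding r pmult_def prod.case
    by (rule sum.cong[OF refl]) (auto simp: idem_sum_def)
  also have "\<dots> = of_bool (u \<in> verts G) * f (u, p)" by simp
  also have "\<dots> = f r"
    using supp_PA(2)[OF f, of u p] awalk_hd_in_verts by (auto simp: r)
  finally show "pmult idem_sum f r = f r" .
qed

lemma pmult_idem_right:
  assumes f: "f \<in> carrier PA"
  shows "pmult f idem_sum = f"
proof (rule ext)
  fix r :: "'a \<times> 'b list"
  obtain u p where r: "r = (u, p)" by (cases r)
  have "pmult f idem_sum r = (\<Sum>i\<le>length p. if i = length p then f (u, p) * of_bool (awlast u p \<in> verts G) else 0)"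
    unfolding r pmult_def prod.case
    by (rule sum.cong[OF refl]) (auto simp: idem_sum_def)
  also have "\<dots> = f (u, p) * of_bool (awlast u p \<in> verts G)" by simp
  also have "\<dots> = f r"
  proof (cases "f (u, p) = 0")
    case False
    then obtain v where v: "awalk u p v" using supp_PA(2)[OF f] by blast
    then have "awlast u p \<in> verts G" using awalk_last_in_verts by simp
    then show ?thesis by (simp add: r)
  qed (simp add: r)
  finally show "pmult f idem_sum r = f r" .
qed

lemma PA_vspace: "vspace PA"
  by (rule vspace_cong[OF vspace_free[of "paths G"]]) (simp_all add: PA_simps free_module_simps(2-))

lemma PA_kalg: "kalg PA"
proof -
  interpret V: vsp PA by (rule vspI[OF PA_vspace])
  have mon: "Group.monoid PA"
    by (rule monoidI)
      (simp_all only: PA_simps(5,6) pmult_closed idem_sum_closed pmult_assoc pmult_idem_left pmult_idem_right)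
  have "ring PA"
    by (rule ringI[OF V.M.abelian_group_axioms mon])
      (simp_all only: PA_simps(3,5) pmult_add_left pmult_add_right)
  then show ?thesis
    by (intro kalg.intro kalg_axioms.intro V.vsp_axioms)
      (simp_all only: PA_simps(4,5) pmult_scale_left pmult_scale_right)
qed

end

subsection \<open>Linear functionals given by functions on paths\<close>

definition pair :: "('p \<Rightarrow> 'k::field) \<Rightarrow> ('p \<Rightarrow> 'k) \<Rightarrow> 'k" where
  "pair c f = (\<Sum>p | f p \<noteq> 0. c p * f p)"

lemma pair_superset: "finite A \<Longrightarrow> {p. f p \<noteq> 0} \<subseteq> A \<Longrightarrow> pair c f = (\<Sum>p\<in>A. c p * f p)"
  unfolding pair_def by (rule sum.mono_neutral_left) auto

lemma pair_add:
  assumes "finite {p. f p \<noteq> 0}" "finite {p. g p \<noteq> 0}"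
  shows "pair c (\<lambda>p. f p + g p) = pair c f + pair c g"
proof -
  let ?A = "{p. f p \<noteq> 0} \<union> {p. g p \<noteq> 0}"
  have A: "finite ?A" using assms by simp
  have "pair c (\<lambda>p. f p + g p) = (\<Sum>p\<in>?A. c p * (f p + g p))"
    by (rule pair_superset[OF A]) auto
  also have "\<dots> = pair c f + pair c g"
    using pair_superset[OF A, of f c] pair_superset[OF A, of g c]
    by (simp add: distrib_left sum.distrib)
  finally show ?thesis .
qed

lemma pair_scale: "pair c (\<lambda>p. k * f p) = k * pair c f"
  by (cases "k = 0") (simp_all add: pair_def sum_distrib_left algebra_simps)

lemma pair_basis: "pair c (basis_elem p) = c p"
  by (simp add: pair_def basis_elem_def)

lemma pair_zero: "pair c (\<lambda>_. 0) = 0"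
  by (simp add: pair_def)

context fin_quiver
begin

text \<open>The elements \<open>f\<close> for which the functional kills every product
  \<open>a f b\<close> form an ideal \<open>?J\<close>, the largest one in its kernel. By
  bilinearity it contains \<open>R\<close> as soon as products with single paths have been tested,
  hence it contains the generated ideal. The case a = b = 1 is the claim.\<close>

lemma pair_ideal:
  assumes R: "R \<subseteq> carrier PA" and f: "f \<in> Idl\<^bsub>PA\<^esub> R"
    and c: "\<And>r p q. r \<in> R \<Longrightarrow> p \<in> paths G \<Longrightarrow> q \<in> paths G \<Longrightarrow>
      pair c (pmult (basis_elem p) (pmult r (basis_elem q))) = 0"
  shows "pair c f = (0 :: 'k::field)"
proof -
  interpret A: kalg "PA :: ('k, 'a \<times> 'b list \<Rightarrow> 'k) module" by (rule PA_kalg)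
  let ?PA = "PA :: ('k, 'a \<times> 'b list \<Rightarrow> 'k) module"
  let ?J = "{f \<in> carrier ?PA. \<forall>a\<in>carrier ?PA. \<forall>b\<in>carrier ?PA. pair c (pmult a (pmult f b)) = (0::'k)}"
  have padd: "pair c (\<lambda>p. x p + y p) = pair c x + pair c y"
    if "x \<in> carrier ?PA" "y \<in> carrier ?PA" for x y :: "'a \<times> 'b list \<Rightarrow> 'k"
    by (rule pair_add) (rule supp_PA(1)[OF that(1)], rule supp_PA(1)[OF that(2)])
  have J: "ideal ?J ?PA"
  proof (rule idealI[OF A.R.ring_axioms])
    have minus: "\<ominus>\<^bsub>?PA\<^esub> x = (\<lambda>p. - 1 * x p)" if "x \<in> carrier ?PA" for x :: "'a \<times> 'b list \<Rightarrow> 'k"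
      using A.A.minus_one_smult[OF that] by (simp add: PA_simps)
    show "subgroup ?J (add_monoid ?PA)"
    proof (rule subgroup.intro)
      show "?J \<subseteq> carrier (add_monoid ?PA)" by auto
      show "\<one>\<^bsub>add_monoid ?PA\<^esub> \<in> ?J"
        using A.A.zero_in by (simp add: PA_simps(2) pmult_zero pair_zero)
      show "x \<otimes>\<^bsub>add_monoid ?PA\<^esub> y \<in> ?J" if "x \<in> ?J" "y \<in> ?J" for x y
      proof -
        have xy: "x \<in> carrier ?PA" "y \<in> carrier ?PA" using that by auto
        have "pair c (pmult a (pmult (\<lambda>p. x p + y p) b)) = 0"
          if ab: "a \<in> carrier ?PA" "b \<in> carrier ?PA" for a b
          using \<open>x \<in> ?J\<close> \<open>y \<in> ?J\<close> ab
          by (simp add: pmult_add_left pmult_add_right padd pmult_closed)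
        moreover have "(\<lambda>p. x p + y p) \<in> carrier ?PA" using A.A.add_in[OF xy] by (simp add: PA_simps(3))
        ultimately show ?thesis by (simp add: PA_simps(3))
      qed
      show "inv\<^bsub>add_monoid ?PA\<^esub> x \<in> ?J" if x: "x \<in> ?J" for x
      proof -
        have xP: "x \<in> carrier ?PA" using x by auto
        have "pair c (pmult a (pmult (\<ominus>\<^bsub>?PA\<^esub> x) b)) = 0"
          if ab: "a \<in> carrier ?PA" "b \<in> carrier ?PA" for a b
          using x ab unfolding minus[OF xP] by (simp only: pmult_scale_left pmult_scale_right pair_scale) simp
        then show ?thesis using A.A.M.a_inv_closed[OF xP] by (simp add: a_inv_def)
      qed
    qed
    fix x a assume x: "x \<in> ?J" and a: "a \<in> carrier ?PA"
    have xP: "x \<in> carrier ?PA" using x by auto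
    have "pair c (pmult b (pmult (pmult a x) d)) = 0" if "b \<in> carrier ?PA" "d \<in> carrier ?PA" for b d
    proof -
      have "pair c (pmult (pmult b a) (pmult x d)) = 0"
        using x pmult_closed[OF that(1) a] that(2) by simp
      then show ?thesis by (simp only: pmult_assoc)
    qed
    then show "a \<otimes>\<^bsub>?PA\<^esub> x \<in> ?J" using pmult_closed[OF a xP] by (simp add: PA_simps(5))
    have "pair c (pmult b (pmult (pmult x a) d)) = 0" if "b \<in> carrier ?PA" "d \<in> carrier ?PA" for b d
      using x pmult_closed[OF a that(2)] that by (simp add: pmult_assoc)
    then show "x \<otimes>\<^bsub>?PA\<^esub> a \<in> ?J" using pmult_closed[OF xP a] by (simp add: PA_simps(5))
  qed
  have bP: "basis_elem p \<in> carrier ?PA" if "p \<in> paths G" for p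
    unfolding PA_simps by (rule basis_elem_closed[OF that])
  have "r \<in> ?J" if r: "r \<in> R" for r
  proof -
    have rP: "r \<in> carrier ?PA" using r R by auto
    have 1: "pair c (pmult (basis_elem p) (pmult r b)) = 0" if p: "p \<in> paths G" and b: "b \<in> carrier ?PA" for p b
      using b unfolding PA_simps(1)
    proof (induction b rule: free_module_induct)
      case zero
      show ?case by (simp add: pmult_zero pair_zero)
    next
      case (step k q g)
      have g: "g \<in> carrier ?PA" using step(2) by (simp add: PA_simps)
      have kq: "(\<lambda>s. k * basis_elem q s) \<in> carrier ?PA"
        using A.A.smult_in[OF bP[OF step(1)]] by (simp add: PA_simps(4))
      show ?case
        unfolding pmult_add_right
        by (subst padd)
          (simp_all add: pmult_closed bP p rP g kq step(3), simp add: pmult_scale_right pair_scale c[OF r p step(1)])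
    qed
    have "pair c (pmult a (pmult r b)) = 0" if a: "a \<in> carrier ?PA" and b: "b \<in> carrier ?PA" for a b
      using a unfolding PA_simps(1)
    proof (induction a rule: free_module_induct)
      case zero
      show ?case by (simp add: pmult_zero pair_zero)
    next
      case (step k p g)
      have g: "g \<in> carrier ?PA" using step(2) by (simp add: PA_simps)
      have kq: "(\<lambda>s. k * basis_elem p s) \<in> carrier ?PA"
        using A.A.smult_in[OF bP[OF step(1)]] by (simp add: PA_simps(4))
      show ?case
        unfolding pmult_add_left
        by (subst padd)
          (simp_all add: pmult_closed b rP g kq step(3), simp add: pmult_scale_left pair_scale 1[OF step(1) b])
    qed
    then show ?thesis using rP by simp
  qed
  then have "R \<subseteq> ?J" by blast
  then have "Idl\<^bsub>?PA\<^esub> R \<subseteq> ?J" by (rule A.R.genideal_minimal[OF J])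
  then have "f \<in> ?J" using f by blast
  then have "pair c (pmult idem_sum (pmult f idem_sum)) = 0" "f \<in> carrier ?PA"
    using idem_sum_closed by auto
  then show ?thesis by (simp add: pmult_idem_left pmult_idem_right)
qed

end

section \<open>Paths as words, and the Beilinson algebra\<close>

context beilinson
begin

fun deg :: "letter list \<Rightarrow> nat" where
  "deg [] = 0"
| "deg (LX # w) = n + deg w"
| "deg (LY # w) = m + deg w"

fun letter_of :: "arrow \<Rightarrow> letter" where
  "letter_of (ArrX i) = LX"
| "letter_of (ArrY i) = LY"

abbreviation word :: "arrow list \<Rightarrow> letter list" where "word \<equiv> map letter_of"

lemma word_spell [simp]: "word (spell u w) = w"
  by (induction u w rule: spell.induct) auto

lemma spell_inj: "spell u w = spell u w' \<longleftrightarrow> w = w'"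
  using word_spell by metis

lemma deg_append [simp]: "deg (w @ w') = deg w + deg w'"
  by (induction w rule: deg.induct) auto

lemma spell_append: "spell u (w @ w') = spell u w @ spell (u + deg w) w'"
  by (induction u w rule: spell.induct) (auto simp: add.assoc)

lemma deg_replicate [simp]: "deg (replicate k LX) = k * n"
  by (induction k) auto

lemma quiver_simps:
  "verts quiver = {1..2 * (n + m)}"
  "arcs quiver = ArrX ` {1..n + 2 * m} \<union> ArrY ` {1..2 * n + m}"
  "tail quiver (ArrX i) = i" "tail quiver (ArrY i) = i"
  "head quiver (ArrX i) = i + n" "head quiver (ArrY i) = i + m"
  by (simp_all add: quiver_def)

sublocale Qv: fin_quiver quiver
  by unfold_locales (auto simp: quiver_simps)

lemma awlast_spell: "Qv.awlast u (spell u w) = u + deg w"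
proof (induction u w rule: spell.induct)
  case (1 v)
  show ?case by simp
next
  case (2 v w)
  then show ?case by (simp only: spell.simps deg.simps Qv.awlast_Cons quiver_simps add.assoc)
next
  case (3 v w)
  then show ?case by (simp only: spell.simps deg.simps Qv.awlast_Cons quiver_simps add.assoc)
qed

text \<open>Arrows never lower the vertex, and the arrows of the quiver are all those that stay
  within its vertices; so the two ends of a spelled path decide whether the whole of it lies in the
  quiver.\<close>

lemma awalk_spell:
  "Qv.awalk u (spell u w) v \<longleftrightarrow> 1 \<le> u \<and> v = u + deg w \<and> v \<le> 2 * (n + m)"
proof (induction u w arbitrary: v rule: spell.induct)
  case (1 u)
  show ?case by (auto simp: Qv.awalk_Nil_iff quiver_simps)
next
  case (2 u w)
  show ?case using 2 by (auto simp: Qv.awalk_Cons_iff quiver_simps image_iff)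
next
  case (3 u w)
  show ?case using 3 by (auto simp: Qv.awalk_Cons_iff quiver_simps image_iff)
qed

lemma awalk_spell_word: "Qv.awalk u p v \<Longrightarrow> p = spell u (word p)"
proof (induction p arbitrary: u)
  case Nil
  show ?case by simp
next
  case (Cons a p)
  then have "u = tail quiver a" "Qv.awalk (head quiver a) p v" by (auto simp: Qv.awalk_Cons_iff)
  with Cons.IH[of "head quiver a"] show ?case by (cases a) (auto simp: quiver_simps)
qed

text \<open>This replaces walks by pairs of a source and a word, which is how paths are handled from
  here on.\<close>

lemma paths_iff: "(u, p) \<in> paths quiver \<longleftrightarrow> (\<exists>w. p = spell u w \<and> 1 \<le> u \<and> u + deg w \<le> 2 * (n + m))"
proof
  assume "(u, p) \<in> paths quiver"
  then obtain v where v: "Qv.awalk u p v" by (auto simp: paths_def)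
  have p: "p = spell u (word p)" by (rule awalk_spell_word[OF v])
  from v have "Qv.awalk u (spell u (word p)) v" by (simp only: p[symmetric])
  then have "1 \<le> u \<and> u + deg (word p) \<le> 2 * (n + m)" unfolding awalk_spell by simp
  then show "\<exists>w. p = spell u w \<and> 1 \<le> u \<and> u + deg w \<le> 2 * (n + m)"
    using p by blast
next
  assume "\<exists>w. p = spell u w \<and> 1 \<le> u \<and> u + deg w \<le> 2 * (n + m)"
  then obtain w where "p = spell u w" "1 \<le> u" "u + deg w \<le> 2 * (n + m)" by blast
  then have "Qv.awalk u p (u + deg w)" by (simp add: awalk_spell)
  then show "(u, p) \<in> paths quiver" by (auto simp: paths_def)
qed

definition W :: "nat \<Rightarrow> letter list \<Rightarrow> nat \<times> arrow list \<Rightarrow> 'k" where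
  "W u w = basis_elem (u, spell u w)"

abbreviation ok :: "nat \<Rightarrow> letter list \<Rightarrow> bool" where
  "ok u w \<equiv> 1 \<le> u \<and> u + deg w \<le> 2 * (n + m)"

abbreviation KQ :: "('k, nat \<times> arrow list \<Rightarrow> 'k) module" where "KQ \<equiv> path_algebra quiver"

abbreviation mul :: "(nat \<times> arrow list \<Rightarrow> 'k) \<Rightarrow> (nat \<times> arrow list \<Rightarrow> 'k) \<Rightarrow> nat \<times> arrow list \<Rightarrow> 'k" where
  "mul \<equiv> Qv.pmult"

lemma W_closed: "ok u w \<Longrightarrow> W u w \<in> carrier KQ"
  unfolding W_def Qv.PA_simps by (rule basis_elem_closed) (auto simp: paths_iff)

lemma W_mult: "mul (W u w) (W v w') = (if v = u + deg w then W u (w @ w') else (\<lambda>_. 0))"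
  unfolding W_def Qv.pmult_basis awlast_spell by (auto simp: spell_append)

sublocale KQ: kalg KQ by (rule Qv.PA_kalg)

lemma KQ_sums:
  assumes "f \<in> carrier KQ"
  shows "g \<in> carrier KQ \<Longrightarrow> (\<lambda>p. f p + g p) \<in> carrier KQ"
    and "g \<in> carrier KQ \<Longrightarrow> (\<lambda>p. f p - g p) \<in> carrier KQ"
    and "(\<lambda>p. c * f p) \<in> carrier KQ"
proof -
  have s: "(\<lambda>p. c * f p) \<in> carrier KQ" if "f \<in> carrier KQ" for c and f :: "nat \<times> arrow list \<Rightarrow> 'k"
    using KQ.A.smult_in[OF that] by (simp add: Qv.PA_simps)
  have a: "(\<lambda>p. f p + g p) \<in> carrier KQ" if "f \<in> carrier KQ" "g \<in> carrier KQ" for f g :: "nat \<times> arrow list \<Rightarrow> 'k"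
    using KQ.A.add_in[OF that] by (simp add: Qv.PA_simps)
  show "(\<lambda>p. c * f p) \<in> carrier KQ" by (rule s[OF assms])
  show "(\<lambda>p. f p + g p) \<in> carrier KQ" if "g \<in> carrier KQ" by (rule a[OF assms that])
  show "(\<lambda>p. f p - g p) \<in> carrier KQ" if "g \<in> carrier KQ"
    using a[OF assms s[OF that, of "- 1"]] by simp
qed

lemma relation_W:
  "relation (RelF i) = (\<lambda>p. W i [LX, LX, LY] p - \<alpha> * W i [LX, LY, LX] p - \<beta> * W i [LY, LX, LX] p)"
  "relation (RelG i) = (\<lambda>p. W i [LX, LY, LY] p - \<alpha> * W i [LY, LX, LY] p - \<beta> * W i [LY, LY, LX] p)"
  by (simp_all add: W_def mult_2_right ac_simps)

lemma relation_closed: "h \<in> relators \<Longrightarrow> relation h \<in> carrier KQ"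
proof -
  have tri: "(\<lambda>p. W i x p - a * W i y p - b * W i z p) \<in> carrier KQ"
    if "ok i x" "ok i y" "ok i z" for i x y z a b
    by (rule KQ_sums(2)[OF KQ_sums(2)]; (rule KQ_sums(3))?; rule W_closed; rule that)
  assume "h \<in> relators"
  then consider i where "h = RelF i" "i \<in> {1..m}" | i where "h = RelG i" "i \<in> {1..n}"
    unfolding relators_def by blast
  then show ?thesis
  proof cases
    case 1
    show ?thesis unfolding 1(1) relation_W by (rule tri) (use 1(2) in auto)
  next
    case 2
    show ?thesis unfolding 2(1) relation_W by (rule tri) (use 2(2) in auto)
  qed
qed

sublocale I: kalg_ideal KQ rel_ideal
proof (intro kalg_ideal.intro KQ.kalg_axioms)
  show "ideal rel_ideal KQ"
    unfolding rel_ideal_def by (rule KQ.R.genideal_ideal) (auto intro: relation_closed)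
qed

sublocale B: kalg algebra unfolding algebra_def by (rule I.quot_kalg)

definition cls :: "(nat \<times> arrow list \<Rightarrow> 'k) \<Rightarrow> 'k alg_elem" where
  "cls f = rel_ideal +>\<^bsub>KQ\<^esub> f"

lemma path_class_cls: "path_class p = cls (basis_elem p)"
  by (simp add: path_class_def cls_def)

lemma path_class_W: "path_class (u, spell u w) = cls (W u w)"
  by (simp add: path_class_cls W_def)

lemma cls_lin: "cls \<in> lin KQ algebra"
  unfolding cls_def[abs_def] algebra_def by (rule I.VQ.coset_lin)

lemmas cls_closed = lin_closed[OF cls_lin]

lemma cls_add: "f \<in> carrier KQ \<Longrightarrow> g \<in> carrier KQ \<Longrightarrow> cls f \<oplus>\<^bsub>algebra\<^esub> cls g = cls (\<lambda>p. f p + g p)"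
  using lin_add[OF cls_lin] by (simp add: Qv.PA_simps)

lemma cls_smult: "f \<in> carrier KQ \<Longrightarrow> c \<odot>\<^bsub>algebra\<^esub> cls f = cls (\<lambda>p. c * f p)"
  using lin_smult[OF cls_lin] by (simp add: Qv.PA_simps)

lemma cls_mult: "f \<in> carrier KQ \<Longrightarrow> g \<in> carrier KQ \<Longrightarrow> cls f \<otimes>\<^bsub>algebra\<^esub> cls g = cls (mul f g)"
  unfolding cls_def algebra_def by (simp add: I.quot_mult Qv.PA_simps(5))

lemma cls_zero: "\<zero>\<^bsub>algebra\<^esub> = cls (\<lambda>_. 0)"
  using lin_zero[OF KQ.A.vectorspace_axioms B.A.vectorspace_axioms cls_lin] by (simp add: Qv.PA_simps)

lemma cls_eq_zero: "f \<in> carrier KQ \<Longrightarrow> cls f = \<zero>\<^bsub>algebra\<^esub> \<longleftrightarrow> f \<in> rel_ideal"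
  unfolding cls_def algebra_def I.VQ.quot_zero by (rule I.VQ.coset_eq_zero_iff)

lemma cls_rep: "b \<in> carrier algebra \<Longrightarrow> \<exists>f\<in>carrier KQ. b = cls f"
  unfolding cls_def algebra_def I.VQ.quot_carrier by blast

lemma rel_ideal_sums:
  assumes "f \<in> rel_ideal"
  shows "g \<in> rel_ideal \<Longrightarrow> (\<lambda>p. f p + g p) \<in> rel_ideal" "(\<lambda>p. c * f p) \<in> rel_ideal"
  using I.VQ.sub_add[OF assms] I.VQ.sub_smult[OF assms] by (simp_all add: Qv.PA_simps)

lemma relation_in: "h \<in> relators \<Longrightarrow> relation h \<in> rel_ideal"
  unfolding rel_ideal_def using KQ.R.genideal_self[of "relation ` relators"] relation_closed by blast

text \<open>Functions on words that respect the relations induce linear functionals on the algebra. They detect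
  coefficients without a normal form.\<close>

definition rel_compat :: "(letter list \<Rightarrow> 'k) \<Rightarrow> bool" where
  "rel_compat c \<longleftrightarrow> (\<forall>w w'.
    c (w @ [LX, LX, LY] @ w') = \<alpha> * c (w @ [LX, LY, LX] @ w') + \<beta> * c (w @ [LY, LX, LX] @ w') \<and>
    c (w @ [LX, LY, LY] @ w') = \<alpha> * c (w @ [LY, LX, LY] @ w') + \<beta> * c (w @ [LY, LY, LX] @ w'))"

definition wpair :: "(letter list \<Rightarrow> 'k) \<Rightarrow> (nat \<times> arrow list \<Rightarrow> 'k) \<Rightarrow> 'k" where
  "wpair c f = pair (\<lambda>(u, p). c (word p)) f"

lemma wpair_W: "wpair c (W u w) = c w"
  by (simp add: wpair_def W_def pair_basis)

lemma wpair_add: "f \<in> carrier KQ \<Longrightarrow> g \<in> carrier KQ \<Longrightarrow>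
    wpair c (\<lambda>p. f p + g p) = wpair c f + wpair c g"
  unfolding wpair_def by (rule pair_add) (rule Qv.supp_PA(1), assumption)+

lemma wpair_scale: "wpair c (\<lambda>p. k * f p) = k * wpair c f"
  unfolding wpair_def by (rule pair_scale)

lemma wpair_three:
  assumes "ok u x" "ok u y" "ok u z"
  shows "wpair c (\<lambda>s. W u x s + (a * W u y s + b * W u z s)) = c x + (a * c y + b * c z)"
proof -
  note y = KQ_sums(3)[OF W_closed[OF assms(2)], of a] and z = KQ_sums(3)[OF W_closed[OF assms(3)], of b]
  show ?thesis
    by (simp only: wpair_add[OF W_closed[OF assms(1)] KQ_sums(1)[OF y z]] wpair_add[OF y z] wpair_scale wpair_W)
qed

lemma wpair_zero: "wpair c (\<lambda>_. 0) = 0"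
  by (simp add: wpair_def pair_zero)

text \<open>Multiplying a relation by a path on each side gives either zero or its three words
  placed in a common context, and \<open>rel_compat\<close> quantifies over all such
  contexts.\<close>

lemma wpair_ideal:
  assumes c: "rel_compat c" and f: "f \<in> rel_ideal"
  shows "wpair c f = 0"
  unfolding wpair_def
proof (rule Qv.pair_ideal[OF _ f[unfolded rel_ideal_def]])
  show "relation ` relators \<subseteq> carrier KQ" using relation_closed by blast
  fix r p q assume r: "r \<in> relation ` relators" and p: "p \<in> paths quiver" and q: "q \<in> paths quiver"
  obtain u w where p: "basis_elem p = W u w" "ok u w"
    using p by (cases p) (auto simp: paths_iff W_def)
  obtain v w' where q: "basis_elem q = W v w'" "ok v w'"
    using q by (cases q) (auto simp: paths_iff W_def)
  have key: "wpair c (mul (W u w) (mul (\<lambda>s. W i x s - \<alpha> * W i y s - \<beta> * W i z s) (W v w'))) = 0"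
    if d: "deg x = d" "deg y = d" "deg z = d" and ok: "ok i x"
      and e: "\<And>w w'. c (w @ x @ w') = \<alpha> * c (w @ y @ w') + \<beta> * c (w @ z @ w')" for i x y z d
  proof -
    have split: "mul (W u w) (mul (\<lambda>s. W i x s - \<alpha> * W i y s - \<beta> * W i z s) (W v w')) =
        (if i = u + deg w \<and> v = i + d
         then (\<lambda>s. W u (w @ x @ w') s + (- \<alpha> * W u (w @ y @ w') s + - \<beta> * W u (w @ z @ w') s))
         else (\<lambda>_. 0))"
    proof -
      \<comment> \<open>Differences become sums of multiples, so that the bilinearity rules of
        \<open>pmult\<close> apply.\<close>
      have 1: "(\<lambda>s. W i x s - \<alpha> * W i y s - \<beta> * W i z s) = (\<lambda>s. W i x s + ((- \<alpha>) * W i y s + (- \<beta>) * W i z s))"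
        by (rule ext) simp
      show ?thesis
        unfolding 1 Qv.pmult_add_left Qv.pmult_scale_left Qv.pmult_add_right Qv.pmult_scale_right W_mult d
        by (cases "v = i + d"; cases "i = u + deg w") (simp_all add: W_mult d Qv.pmult_zero)
    qed
    show ?thesis
    proof (cases "i = u + deg w \<and> v = i + d")
      case True
      have okx: "ok u (w @ x @ w')" "ok u (w @ y @ w')" "ok u (w @ z @ w')"
        using True p(2) q(2) d by (simp_all add: add.assoc)
      show ?thesis
        unfolding split if_P[OF True] wpair_three[OF okx] using e by simp
    next
      case False
      show ?thesis unfolding split if_not_P[OF False] by (rule wpair_zero)
    qed
  qed
  have "wpair c (mul (W u w) (mul r (W v w'))) = 0"
    using r unfolding relators_def
  proof (elim imageE UnE; clarify)
    fix i assume i: "i \<in> {1..m}"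
    show "wpair c (mul (W u w) (mul (relation (RelF i)) (W v w'))) = 0"
      unfolding relation_W
      by (rule key[of _ "2 * n + m"]) (use i c[unfolded rel_compat_def] in auto)
  next
    fix i assume i: "i \<in> {1..n}"
    show "wpair c (mul (W u w) (mul (relation (RelG i)) (W v w'))) = 0"
      unfolding relation_W
      by (rule key[of _ "n + 2 * m"]) (use i c[unfolded rel_compat_def] in auto)
  qed
  then show "pair (\<lambda>(u, p). c (word p)) (mul (basis_elem p) (mul r (basis_elem q))) = 0"
    unfolding wpair_def p q .
qed

lemma vertex_W: "vertex v = cls (W v [])"
  by (simp add: path_class_cls W_def)

lemma vertex_facts:
  assumes "v \<in> verts quiver"
  shows "vertex v \<in> carrier algebra" "vertex v \<otimes>\<^bsub>algebra\<^esub> vertex v = vertex v"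
proof -
  have c: "W v [] \<in> carrier KQ" using assms by (intro W_closed) (auto simp: quiver_simps)
  show "vertex v \<in> carrier algebra" unfolding vertex_W by (rule cls_closed[OF c])
  show "vertex v \<otimes>\<^bsub>algebra\<^esub> vertex v = vertex v"
    unfolding vertex_W cls_mult[OF c c] by (simp add: W_mult)
qed

section \<open>The three projective bimodules and the differentials between them\<close>

lemma finite_relators: "finite relators" by (simp add: relators_def)

lemma finite_arcs: "finite (arcs quiver)" by (simp add: quiver_simps)

lemma arc_ends: "a \<in> arcs quiver \<Longrightarrow> tail quiver a \<in> verts quiver" "a \<in> arcs quiver \<Longrightarrow> head quiver a \<in> verts quiver"
  by simp_all

lemma rel_ends: "h \<in> relators \<Longrightarrow> rel_source h \<in> verts quiver" "h \<in> relators \<Longrightarrow> rel_target h \<in> verts quiver"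
  by (auto simp: relators_def quiver_simps)

text \<open>The \<open>id\<close> makes this instance agree with the unfolded definition of
  \<open>P0\<close> syntactically.\<close>

sublocale R0: proj_family algebra "verts quiver" "\<lambda>v. vertex (id v)" "\<lambda>v. vertex (id v)"
  by (intro proj_family.intro proj_family_axioms.intro B.kalg_axioms Qv.finite_verts; simp only: id_apply vertex_facts)

sublocale R1: proj_family algebra "arcs quiver" "\<lambda>a. vertex (tail quiver a)" "\<lambda>a. vertex (head quiver a)"
  by (intro proj_family.intro proj_family_axioms.intro B.kalg_axioms finite_arcs; simp only: vertex_facts arc_ends)

sublocale R2: proj_family algebra relators "\<lambda>h. vertex (rel_source h)" "\<lambda>h. vertex (rel_target h)"
  by (intro proj_family.intro proj_family_axioms.intro B.kalg_axioms finite_relators; simp only: vertex_facts rel_ends)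

lemma P_eqs: "P0 = R0.P" "P1 = R1.P" "P2 = R2.P"
  by (simp_all only: P0_def P1_def P2_def proj_sum_def)

lemma gen_eqs: "gen0 = R0.gen" "gen1 = R1.gen" "gen2 = R2.gen"
  by (simp_all only: gen0_def gen1_def gen2_def proj_gen_def[abs_def] R0.gen_def[abs_def] R1.gen_def[abs_def] R2.gen_def[abs_def])

lemmas P0_bimod = R0.P_bimod[folded P_eqs]
lemmas P1_bimod = R1.P_bimod[folded P_eqs]
lemmas P2_bimod = R2.P_bimod[folded P_eqs]

lemmas gen0_mem = R0.gen_mem[folded P_eqs gen_eqs]
lemmas gen1_mem = R1.gen_mem[folded P_eqs gen_eqs]
lemmas gen2_mem = R2.gen_mem[folded P_eqs gen_eqs]

sublocale Q0: bimod algebra P0 by (rule P0_bimod)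
sublocale Q1: bimod algebra P1 by (rule P1_bimod)
sublocale Q2: bimod algebra P2 by (rule P2_bimod)

abbreviation reg where "reg \<equiv> regular_bimodule algebra"

lemma walk_class:
  assumes "Qv.awalk u p v"
  shows "path_class (u, p) \<in> carrier algebra"
    "vertex u \<otimes>\<^bsub>algebra\<^esub> path_class (u, p) = path_class (u, p)"
    "path_class (u, p) \<otimes>\<^bsub>algebra\<^esub> vertex v = path_class (u, p)"
proof -
  define w where "w = word p"
  have p: "p = spell u w" unfolding w_def by (rule awalk_spell_word[OF assms])
  have uv: "1 \<le> u" "v = u + deg w" "v \<le> 2 * (n + m)" using assms unfolding p awalk_spell by auto
  have c: "W u w \<in> carrier KQ" using uv by (intro W_closed) simp
  have c0: "W u [] \<in> carrier KQ" "W v [] \<in> carrier KQ" using uv by (intro W_closed; simp)+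
  show "path_class (u, p) \<in> carrier algebra"
    unfolding p path_class_W by (rule cls_closed[OF c])
  show "vertex u \<otimes>\<^bsub>algebra\<^esub> path_class (u, p) = path_class (u, p)"
    unfolding p path_class_W vertex_W cls_mult[OF c0(1) c] by (simp add: W_mult)
  show "path_class (u, p) \<otimes>\<^bsub>algebra\<^esub> vertex v = path_class (u, p)"
    unfolding p path_class_W vertex_W cls_mult[OF c c0(2)] by (simp add: W_mult uv)
qed

lemma arc_walk: "a \<in> arcs quiver \<Longrightarrow> Qv.awalk (tail quiver a) [a] (head quiver a)"
  by (simp add: Qv.awalk_Cons_iff Qv.awalk_Nil_iff)

lemmas arrow_class_facts = walk_class[OF arc_walk]

text \<open>\<open>d1\<close> takes its intended values only once these are known to lie in the
  corner of \<open>P0\<close> cut out by the tail and the head of the arrow. That is the content of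
  \<open>facts\<close>.\<close>

lemma d1_facts:
  shows d1_hom: "d1 \<in> bimodule_hom algebra P1 P0"
    and d1_gen: "a \<in> arcs quiver \<Longrightarrow> d1 (gen1 a) =
      ract P0 (gen0 (tail quiver a)) (arrow_class a) \<ominus>\<^bsub>P0\<^esub> lact P0 (arrow_class a) (gen0 (head quiver a))"
proof -
  let ?v = "\<lambda>a. ract P0 (gen0 (tail quiver a)) (arrow_class a) \<ominus>\<^bsub>P0\<^esub> lact P0 (arrow_class a) (gen0 (head quiver a))"
  have lg: "lact P0 (vertex v) (gen0 v) = gen0 v" "ract P0 (gen0 v) (vertex v) = gen0 v" if "v \<in> verts quiver" for v
    using R0.l_gen[OF that] R0.r_gen[OF that] by (simp_all only: P_eqs gen_eqs id_apply)
  have facts: "?v a \<in> carrier P0" "lact P0 (vertex (tail quiver a)) (?v a) = ?v a"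
    "ract P0 (?v a) (vertex (head quiver a)) = ?v a" if a: "a \<in> arcs quiver" for a
  proof -
    note t = gen0_mem[OF arc_ends(1)[OF a]] and h = gen0_mem[OF arc_ends(2)[OF a]]
    note vt = vertex_facts(1)[OF arc_ends(1)[OF a]] and vh = vertex_facts(1)[OF arc_ends(2)[OF a]]
    note ac = arrow_class_facts[OF a]
    have m1: "ract P0 (gen0 (tail quiver a)) (arrow_class a) \<in> carrier P0" by (rule Q0.r_closed[OF ac(1) t])
    have m2: "lact P0 (arrow_class a) (gen0 (head quiver a)) \<in> carrier P0" by (rule Q0.l_closed[OF ac(1) h])
    show "?v a \<in> carrier P0" by (rule Q0.Q.M.minus_closed[OF m1 m2])
    have "lact P0 (vertex (tail quiver a)) (?v a) =
        lact P0 (vertex (tail quiver a)) (ract P0 (gen0 (tail quiver a)) (arrow_class a)) \<ominus>\<^bsub>P0\<^esub>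
        lact P0 (vertex (tail quiver a)) (lact P0 (arrow_class a) (gen0 (head quiver a)))"
      by (rule lin_minus[OF Q0.Q.vectorspace_axioms Q0.Q.vectorspace_axioms Q0.l_lin[OF vt] m1 m2])
    also have "\<dots> = ?v a"
      unfolding Q0.l_r[OF vt ac(1) t, symmetric] Q0.l_assoc[OF vt ac(1) h, symmetric] ac(2) lg(1)[OF arc_ends(1)[OF a]] ..
    finally show "lact P0 (vertex (tail quiver a)) (?v a) = ?v a" .
    have "ract P0 (?v a) (vertex (head quiver a)) =
        ract P0 (ract P0 (gen0 (tail quiver a)) (arrow_class a)) (vertex (head quiver a)) \<ominus>\<^bsub>P0\<^esub>
        ract P0 (lact P0 (arrow_class a) (gen0 (head quiver a))) (vertex (head quiver a))"
      by (rule lin_minus[OF Q0.Q.vectorspace_axioms Q0.Q.vectorspace_axioms Q0.r_lin[OF vh] m1 m2])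
    also have "\<dots> = ?v a"
      unfolding Q0.l_r[OF ac(1) vh h] Q0.r_assoc[OF ac(1) vh t, symmetric] ac(3) lg(2)[OF arc_ends(2)[OF a]] ..
    finally show "ract P0 (?v a) (vertex (head quiver a)) = ?v a" .
  qed
  show "d1 \<in> bimodule_hom algebra P1 P0"
    unfolding d1_def P_eqs(2) gen_eqs(2) by (rule R1.hom_with_values(1)[OF P0_bimod facts])
  show "a \<in> arcs quiver \<Longrightarrow> d1 (gen1 a) = ?v a"
    unfolding d1_def P_eqs(2) gen_eqs(2) by (rule R1.hom_with_values(2)[OF P0_bimod facts])
qed

text \<open>The image of a path under the universal derivation of the path algebra.\<close>

definition cofactor :: "nat \<times> arrow list \<Rightarrow> ('k, arrow) proj_elem" where
  "cofactor = (\<lambda>(u, p). \<Oplus>\<^bsub>P1\<^esub>i\<in>{..<length p}.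
     lact P1 (path_class (u, take i p))
       (ract P1 (gen1 (p ! i)) (path_class (head quiver (p ! i), drop (Suc i) p))))"

lemma awalk_split:
  assumes "Qv.awalk u p v" "i < length p"
  shows "p ! i \<in> arcs quiver" "Qv.awalk u (take i p) (tail quiver (p ! i))"
    "Qv.awalk (head quiver (p ! i)) (drop (Suc i) p) v"
proof -
  have "p = take i p @ p ! i # drop (Suc i) p" by (rule id_take_nth_drop[OF assms(2)])
  then have "Qv.awalk u (take i p @ p ! i # drop (Suc i) p) v" using assms(1) by metis
  then show "p ! i \<in> arcs quiver" "Qv.awalk u (take i p) (tail quiver (p ! i))"
    "Qv.awalk (head quiver (p ! i)) (drop (Suc i) p) v"
    unfolding Qv.awalk_append_iff Qv.awalk_Cons_iff by auto
qed

text \<open>The first three parts place the cofactor of a path in the corner of its end points. The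
  last is the Leibniz rule: a homomorphism out of \<open>P1\<close> acts on it as the derivation
  with the given values on arrows.\<close>

lemma cofactor_facts:
  assumes w: "Qv.awalk u p v"
  shows "cofactor (u, p) \<in> carrier P1"
    and "lact P1 (vertex u) (cofactor (u, p)) = cofactor (u, p)"
    and "ract P1 (cofactor (u, p)) (vertex v) = cofactor (u, p)"
    and "\<phi> \<in> bimodule_hom algebra P1 reg \<Longrightarrow> \<phi> (cofactor (u, p)) =
      (\<Oplus>\<^bsub>algebra\<^esub>i\<in>{..<length p}. path_class (u, take i p) \<otimes>\<^bsub>algebra\<^esub>
        (\<phi> (gen1 (p ! i)) \<otimes>\<^bsub>algebra\<^esub> path_class (head quiver (p ! i), drop (Suc i) p)))"
proof -
  let ?t = "\<lambda>i. lact P1 (path_class (u, take i p))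
       (ract P1 (gen1 (p ! i)) (path_class (head quiver (p ! i), drop (Suc i) p)))"
  have vu: "vertex u \<in> carrier algebra" and vv: "vertex v \<in> carrier algebra"
    using w Qv.awalk_hd_in_verts Qv.awalk_last_in_verts vertex_facts(1) by blast+
  note s = awalk_split[OF w]
  have r: "ract P1 (gen1 (p ! i)) (path_class (head quiver (p ! i), drop (Suc i) p)) \<in> carrier P1" if "i < length p" for i
    by (rule Q1.r_closed[OF walk_class(1)[OF s(3)[OF that]] gen1_mem[OF s(1)[OF that]]])
  have t: "?t i \<in> carrier P1" if "i < length p" for i
    by (rule Q1.l_closed[OF walk_class(1)[OF s(2)[OF that]] r[OF that]])
  have tl: "lact P1 (vertex u) (?t i) = ?t i" if i: "i < length p" for i
    using Q1.l_assoc[OF vu walk_class(1)[OF s(2)[OF i]] r[OF i]] walk_class(2)[OF s(2)[OF i]] by simp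
  have tr: "ract P1 (?t i) (vertex v) = ?t i" if i: "i < length p" for i
    using Q1.l_r[OF walk_class(1)[OF s(2)[OF i]] vv r[OF i]]
      Q1.r_assoc[OF walk_class(1)[OF s(3)[OF i]] vv gen1_mem[OF s(1)[OF i]]] walk_class(3)[OF s(3)[OF i]] by simp
  have cof: "cofactor (u, p) = finsum P1 ?t {..<length p}" by (simp add: cofactor_def)
  have cong: "finsum P1 f {..<length p} = finsum P1 ?t {..<length p}" if "\<And>i. i < length p \<Longrightarrow> f i = ?t i" for f
    by (rule Q1.Q.M.finsum_cong') (use that t in auto)
  show "cofactor (u, p) \<in> carrier P1"
    unfolding cof by (rule Q1.Q.M.finsum_closed) (use t in auto)
  show "lact P1 (vertex u) (cofactor (u, p)) = cofactor (u, p)"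
    unfolding cof
    by (subst lin_finsum[OF Q1.Q.vectorspace_axioms Q1.Q.vectorspace_axioms Q1.l_lin[OF vu] finite_lessThan])
      (simp_all only: lessThan_iff t cong[OF tl])
  have "ract P1 (finsum P1 ?t {..<length p}) (vertex v) = finsum P1 (\<lambda>i. ract P1 (?t i) (vertex v)) {..<length p}"
    by (rule lin_finsum[OF Q1.Q.vectorspace_axioms Q1.Q.vectorspace_axioms Q1.r_lin[OF vv] finite_lessThan])
      (simp only: lessThan_iff t)
  then show "ract P1 (cofactor (u, p)) (vertex v) = cofactor (u, p)"
    unfolding cof by (simp only: cong[OF tr])
  show "\<phi> (cofactor (u, p)) =
      (\<Oplus>\<^bsub>algebra\<^esub>i\<in>{..<length p}. path_class (u, take i p) \<otimes>\<^bsub>algebra\<^esub>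
        (\<phi> (gen1 (p ! i)) \<otimes>\<^bsub>algebra\<^esub> path_class (head quiver (p ! i), drop (Suc i) p)))"
    if \<phi>: "\<phi> \<in> bimodule_hom algebra P1 reg"
  proof -
    note \<phi>' = \<phi>[unfolded P_eqs]
    have \<phi>t: "\<phi> (?t i) = path_class (u, take i p) \<otimes>\<^bsub>algebra\<^esub>
        (\<phi> (gen1 (p ! i)) \<otimes>\<^bsub>algebra\<^esub> path_class (head quiver (p ! i), drop (Suc i) p))" if i: "i < length p" for i
      using R1.hom_l[OF \<phi>', folded P_eqs, OF walk_class(1)[OF s(2)[OF i]] r[OF i]]
        R1.hom_r[OF \<phi>', folded P_eqs, OF walk_class(1)[OF s(3)[OF i]] gen1_mem[OF s(1)[OF i]]]
      by (simp only: B.regular_bimodule_simps)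
    have \<phi>l: "\<phi> \<in> lin P1 algebra"
      using R1.hom_lin[OF \<phi>', folded P_eqs] by (simp add: LinearCombinations.module_hom_def B.regular_bimodule_simps)
    have "\<phi> (cofactor (u, p)) = finsum algebra (\<lambda>i. \<phi> (?t i)) {..<length p}"
      unfolding cof
      by (rule lin_finsum[OF Q1.Q.vectorspace_axioms B.A.vectorspace_axioms \<phi>l finite_lessThan]) (simp only: lessThan_iff t)
    also have "\<dots> = (\<Oplus>\<^bsub>algebra\<^esub>i\<in>{..<length p}. path_class (u, take i p) \<otimes>\<^bsub>algebra\<^esub>
        (\<phi> (gen1 (p ! i)) \<otimes>\<^bsub>algebra\<^esub> path_class (head quiver (p ! i), drop (Suc i) p)))"
    proof (rule B.A.M.finsum_cong'[OF refl])
      show "(\<lambda>i. path_class (u, take i p) \<otimes>\<^bsub>algebra\<^esub>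
        (\<phi> (gen1 (p ! i)) \<otimes>\<^bsub>algebra\<^esub> path_class (head quiver (p ! i), drop (Suc i) p))) \<in> {..<length p} \<rightarrow> carrier algebra"
        by (rule Pi_I) (simp only: lessThan_iff \<phi>t[symmetric] lin_closed[OF \<phi>l t])
    qed (simp only: lessThan_iff \<phi>t)
    finally show ?thesis .
  qed
qed

lemma relation_supp:
  assumes h: "h \<in> relators" and q: "relation h (u, p) \<noteq> 0"
  shows "u = rel_source h" "Qv.awalk u p (rel_target h)"
proof -
  have nz: "p \<in> {spell i x, spell i y, spell i z} \<and> u = i"
    if "W i x (u, p) - a * W i y (u, p) - b * W i z (u, p) \<noteq> 0" for i x y z a b
    using that by (cases "u = i") (auto simp: W_def basis_elem_def of_bool_def split: if_splits)
  consider i where "h = RelF i" "i \<in> {1..m}" | i where "h = RelG i" "i \<in> {1..n}"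
    using h unfolding relators_def by blast
  then have "u = rel_source h \<and> Qv.awalk u p (rel_target h)"
  proof cases
    case (1 i)
    have "p \<in> {spell i [LX, LX, LY], spell i [LX, LY, LX], spell i [LY, LX, LX]} \<and> u = i"
      using q unfolding 1(1) relation_W by (rule nz)
    then show ?thesis using 1 by (auto simp: awalk_spell simp del: spell.simps)
  next
    case (2 i)
    have "p \<in> {spell i [LX, LY, LY], spell i [LY, LX, LY], spell i [LY, LY, LX]} \<and> u = i"
      using q unfolding 2(1) relation_W by (rule nz)
    then show ?thesis using 2 by (auto simp: awalk_spell simp del: spell.simps)
  qed
  then show "u = rel_source h" "Qv.awalk u p (rel_target h)" by blast+
qed

lemma finite_supp: "h \<in> relators \<Longrightarrow> finite {q. relation h q \<noteq> 0}"
  by (rule Qv.supp_PA(1)[OF relation_closed])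

text \<open>The paths occurring in a relation are parallel, so the combination of their cofactors
  lies in the corner of the relation and is an admissible prescribed value.\<close>

lemma d2_facts:
  shows d2_hom: "d2 \<in> bimodule_hom algebra P2 P1"
    and d2_gen: "h \<in> relators \<Longrightarrow> d2 (gen2 h) =
      finsum P1 (\<lambda>q. relation h q \<odot>\<^bsub>P1\<^esub> cofactor q) {q. relation h q \<noteq> 0}"
proof -
  let ?v = "\<lambda>h. finsum P1 (\<lambda>q. relation h q \<odot>\<^bsub>P1\<^esub> cofactor q) {q. relation h q \<noteq> 0}"
  have val: "(\<lambda>h. finsum P1 (\<lambda>(u, p). relation h (u, p) \<odot>\<^bsub>P1\<^esub>
       (\<Oplus>\<^bsub>P1\<^esub>i\<in>{..<length p}.
          lact P1 (path_class (u, take i p))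
            (ract P1 (gen1 (p ! i)) (path_class (head quiver (p ! i), drop (Suc i) p)))))
       {q. relation h q \<noteq> 0}) = ?v"
    by (simp add: cofactor_def case_prod_unfold)
  have facts: "?v h \<in> carrier P1" "lact P1 (vertex (rel_source h)) (?v h) = ?v h"
    "ract P1 (?v h) (vertex (rel_target h)) = ?v h" if h: "h \<in> relators" for h
  proof -
    let ?S = "{q. relation h q \<noteq> 0}"
    have c: "cofactor q \<in> carrier P1" "lact P1 (vertex (rel_source h)) (cofactor q) = cofactor q"
      "ract P1 (cofactor q) (vertex (rel_target h)) = cofactor q" if q: "q \<in> ?S" for q
    proof -
      obtain u p where up: "q = (u, p)" by (cases q)
      have "relation h (u, p) \<noteq> 0" using q up by simp
      note s = relation_supp[OF h this]
      show "cofactor q \<in> carrier P1" "lact P1 (vertex (rel_source h)) (cofactor q) = cofactor q"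
        "ract P1 (cofactor q) (vertex (rel_target h)) = cofactor q"
        using cofactor_facts(1-3)[OF s(2)] unfolding up s(1)[symmetric] .
    qed
    have t: "relation h q \<odot>\<^bsub>P1\<^esub> cofactor q \<in> carrier P1" if "q \<in> ?S" for q
      by (rule Q1.Q.smult_in[OF c(1)[OF that]])
    have cong: "finsum P1 f ?S = ?v h" if "\<And>q. q \<in> ?S \<Longrightarrow> f q = relation h q \<odot>\<^bsub>P1\<^esub> cofactor q" for f
      by (rule Q1.Q.M.finsum_cong'[OF refl Pi_I that]) (rule t)
    note vs = vertex_facts(1)[OF rel_ends(1)[OF h]] and vt = vertex_facts(1)[OF rel_ends(2)[OF h]]
    show "?v h \<in> carrier P1" by (rule Q1.Q.M.finsum_closed[OF Pi_I]) (rule t)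
    have "lact P1 (vertex (rel_source h)) (?v h) =
        finsum P1 (\<lambda>q. lact P1 (vertex (rel_source h)) (relation h q \<odot>\<^bsub>P1\<^esub> cofactor q)) ?S"
      by (rule lin_finsum[OF Q1.Q.vectorspace_axioms Q1.Q.vectorspace_axioms Q1.l_lin[OF vs] finite_supp[OF h] t])
    also have "\<dots> = ?v h" by (rule cong) (simp only: Q1.l_smult[OF vs c(1)] c(2))
    finally show "lact P1 (vertex (rel_source h)) (?v h) = ?v h" .
    have "ract P1 (?v h) (vertex (rel_target h)) =
        finsum P1 (\<lambda>q. ract P1 (relation h q \<odot>\<^bsub>P1\<^esub> cofactor q) (vertex (rel_target h))) ?S"
      by (rule lin_finsum[OF Q1.Q.vectorspace_axioms Q1.Q.vectorspace_axioms Q1.r_lin[OF vt] finite_supp[OF h] t])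
    also have "\<dots> = ?v h" by (rule cong) (simp only: Q1.r_smult[OF vt c(1)] c(3))
    finally show "ract P1 (?v h) (vertex (rel_target h)) = ?v h" .
  qed
  show "d2 \<in> bimodule_hom algebra P2 P1"
    unfolding d2_def val P_eqs(3) gen_eqs(3) by (rule R2.hom_with_values(1)[OF P1_bimod facts])
  show "h \<in> relators \<Longrightarrow> d2 (gen2 h) = ?v h"
    unfolding d2_def val P_eqs(3) gen_eqs(3) by (rule R2.hom_with_values(2)[OF P1_bimod facts])
qed

end

lemma compose_bimodule_hom:
  assumes P: "bimod A P" and d: "d \<in> bimodule_hom A P P'" and \<phi>: "\<phi> \<in> bimodule_hom A P' Q"
  shows "compose (carrier P) \<phi> d \<in> bimodule_hom A P Q"
proof -
  interpret P: bimod A P by (rule P)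
  have d': "d \<in> lin P P'" "\<And>a z. a \<in> carrier A \<Longrightarrow> z \<in> carrier P \<Longrightarrow> d (lact P a z) = lact P' a (d z)"
    "\<And>a z. a \<in> carrier A \<Longrightarrow> z \<in> carrier P \<Longrightarrow> d (ract P z a) = ract P' (d z) a"
    using d unfolding bimodule_hom_def by blast+
  have \<phi>': "\<phi> \<in> lin P' Q" "\<And>a z. a \<in> carrier A \<Longrightarrow> z \<in> carrier P' \<Longrightarrow> \<phi> (lact P' a z) = lact Q a (\<phi> z)"
    "\<And>a z. a \<in> carrier A \<Longrightarrow> z \<in> carrier P' \<Longrightarrow> \<phi> (ract P' z a) = ract Q (\<phi> z) a"
    using \<phi> unfolding bimodule_hom_def by blast+
  note c = lin_closed[OF d'(1)]
  show ?thesis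
    unfolding bimodule_hom_def
  proof (intro CollectI conjI ballI)
    show "compose (carrier P) \<phi> d \<in> extensional (carrier P)" by (rule compose_extensional)
    show "compose (carrier P) \<phi> d \<in> lin P Q"
      by (rule linI) (simp_all add: compose_eq linD[OF d'(1)] linD[OF \<phi>'(1)])
    fix a z assume "a \<in> carrier A" "z \<in> carrier P"
    then show "compose (carrier P) \<phi> d (lact P a z) = lact Q a (compose (carrier P) \<phi> d z)"
      "compose (carrier P) \<phi> d (ract P z a) = ract Q (compose (carrier P) \<phi> d z) a"
      by (simp_all add: compose_eq P.l_closed P.r_closed d' \<phi>' c)
  qed
qed

section \<open>Words of small weight and corners of the algebra\<close>

locale down_up = beilinson \<alpha> \<beta> n m for \<alpha> \<beta> :: "'k::field_char_0" and n m :: nat +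
  assumes beta: "\<beta> \<noteq> 0" and cop: "coprime n m" and nm: "n \<le> m" and n1: "1 \<le> n"
begin

lemma deg_0: "deg w = 0 \<longleftrightarrow> w = []"
  using n1 nm by (induction w rule: deg.induct) auto

text \<open>Together with \<open>deg_m\<close> this lists the paths parallel to an arrow, and
  thereby the possible values of a 1-cochain.\<close>

lemma deg_n: "deg w = n \<longleftrightarrow> w = [LX] \<or> n = m \<and> w = [LY]"
proof (cases w rule: deg.cases)
  case 1
  then show ?thesis using n1 by auto
next
  case (2 w')
  then show ?thesis using deg_0[of w'] by auto
next
  case (3 w')
  have "m + deg w' = n \<longleftrightarrow> n = m \<and> deg w' = 0" using nm by auto
  then show ?thesis using 3 deg_0[of w'] by auto
qed

text \<open>A word of weight m that contains \<open>y\<close> is \<open>y\<close> itself. Otherwise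
  it is a power of \<open>x\<close>, so n divides m, and coprimality forces n = 1.\<close>

lemma deg_m: "deg w = m \<Longrightarrow> w = [LY] \<or> n = 1 \<and> w = replicate m LX"
proof -
  assume d: "deg w = m"
  show ?thesis
  proof (cases "LY \<in> set w")
    case True
    then obtain p q where w: "w = p @ LY # q" by (auto simp: in_set_conv_decomp)
    then have "deg p = 0" "deg q = 0" using d by auto
    then show ?thesis using w deg_0 by auto
  next
    case False
    then have w: "w = replicate (length w) LX"
      by (intro replicate_eqI) (use letter.exhaust in auto)
    then have l: "length w * n = m" using d deg_replicate by metis
    then have "n dvd m" by auto
    then have "n = 1" using cop by (metis coprime_common_divisor_nat dvd_refl)
    then show ?thesis using w l by auto
  qed
qed

text \<open>Multiplying a representative by the trivial paths at \<open>s\<close> and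
  \<open>t\<close> does not change its class and removes the coefficients of all other
  paths.\<close>

lemma corner:
  assumes b: "b \<in> carrier algebra" and s: "s \<in> verts quiver" and t: "t \<in> verts quiver"
    and e: "vertex s \<otimes>\<^bsub>algebra\<^esub> b = b" "b \<otimes>\<^bsub>algebra\<^esub> vertex t = b"
  obtains f where "f \<in> carrier KQ" "b = cls f"
    "\<And>r. f r \<noteq> 0 \<Longrightarrow> \<exists>w. r = (s, spell s w) \<and> s + deg w = t"
proof -
  obtain g where g: "g \<in> carrier KQ" "b = cls g" using cls_rep[OF b] by blast
  define f where "f = mul (W s []) (mul g (W t []))"
  have Ws: "W s [] \<in> carrier KQ" "W t [] \<in> carrier KQ" using s t by (auto intro!: W_closed simp: quiver_simps)
  have gt: "mul g (W t []) \<in> carrier KQ" by (rule Qv.pmult_closed[OF g(1) Ws(2)])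
  have f: "f \<in> carrier KQ" unfolding f_def by (rule Qv.pmult_closed[OF Ws(1) gt])
  have "b = cls f"
    unfolding f_def cls_mult[OF Ws(1) gt, symmetric] cls_mult[OF g(1) Ws(2), symmetric] vertex_W[symmetric]
      g(2)[symmetric] e ..
  moreover have "\<exists>w. r = (s, spell s w) \<and> s + deg w = t" if r: "f r \<noteq> 0" for r
  proof -
    obtain u p where up: "r = (u, p)" by (cases r)
    have left: "mul (W s []) h (u, p) = of_bool (u = s) * h (u, p)" for h
    proof -
      have "mul (W s []) h (u, p) = (\<Sum>i\<le>length p. if i = 0 then of_bool (u = s) * h (u, p) else 0)"
        unfolding Qv.pmult_def prod.case by (rule sum.cong[OF refl]) (auto simp: W_def basis_elem_def)
      then show ?thesis by simp
    qed
    have right: "mul h (W t []) (u, p) = h (u, p) * of_bool (Qv.awlast u p = t)" for h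
    proof -
      have "mul h (W t []) (u, p) =
          (\<Sum>i\<le>length p. if i = length p then h (u, p) * of_bool (Qv.awlast u p = t) else 0)"
        unfolding Qv.pmult_def prod.case by (rule sum.cong[OF refl]) (auto simp: W_def basis_elem_def)
      then show ?thesis by simp
    qed
    have nz: "u = s" "g (u, p) \<noteq> 0" "Qv.awlast u p = t"
      using r unfolding f_def up left right by (auto simp: of_bool_def split: if_splits)
    have "(u, p) \<in> paths quiver" by (rule Qv.supp_PA(3)[OF g(1) nz(2)])
    then obtain w where w: "p = spell u w" by (auto simp: paths_iff)
    then show ?thesis using nz up awlast_spell by auto
  qed
  ultimately show thesis using that f by blast
qed

subsection \<open>Coordinates for cochains\<close>

text \<open>A 1-cochain sends \<open>x\<^sub>i\<close> to \<open>x 0 i x\<^sub>i + x 3 i y\<^sub>i\<close> and \<open>y\<^sub>j\<close> to \<open>x 1 j y\<^sub>j + x 2 j x\<^sup>m\<close>, where the second terms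
  are present only for \<open>n = m\<close> and for \<open>n = 1\<close>, respectively.\<close>

fun arr :: "letter \<Rightarrow> nat \<Rightarrow> arrow" where "arr LX = ArrX" | "arr LY = ArrY"
fun wt :: "letter \<Rightarrow> nat" where "wt LX = n" | "wt LY = m"
fun alt :: "letter \<Rightarrow> letter list" where "alt LX = [LY]" | "alt LY = replicate m LX"
fun ix :: "letter \<Rightarrow> nat" where "ix LX = 0" | "ix LY = 1"
fun jx :: "letter \<Rightarrow> nat" where "jx LX = 3" | "jx LY = 2"

definition F :: "(nat \<Rightarrow> nat \<Rightarrow> 'k) \<Rightarrow> letter \<Rightarrow> nat \<Rightarrow> nat \<times> arrow list \<Rightarrow> 'k" where
  "F x l i = (\<lambda>p. x (ix l) i * W i [l] p + x (jx l) i * W i (alt l) p)"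

definition adm :: "(nat \<Rightarrow> nat \<Rightarrow> 'k) \<Rightarrow> bool" where
  "adm x \<longleftrightarrow> (n \<noteq> m \<longrightarrow> (\<forall>i. x 3 i = 0)) \<and> (n \<noteq> 1 \<longrightarrow> (\<forall>i. x 2 i = 0))"

lemma adm_alt: "adm x \<Longrightarrow> x (jx l) i = 0 \<or> deg (alt l) = wt l"
  by (cases l) (auto simp: adm_def)

lemma arr_simps:
  "tail quiver (arr l i) = i" "head quiver (arr l i) = i + wt l"
  "arr l i \<in> arcs quiver \<longleftrightarrow> 1 \<le> i \<and> i + wt l \<le> 2 * (n + m)"
  by (cases l; auto simp: quiver_simps)+

lemma arr_cases: obtains l i where "a = arr l i"
  by (cases a) (metis arr.simps)+

lemma deg_single: "deg [l] = wt l" by (cases l) auto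
lemma deg_cons: "deg (l # w) = wt l + deg w" by (cases l) auto
lemma spell_single: "spell i [l] = [arr l i]" by (cases l) auto
lemma spell_cons: "spell i (l # w) = arr l i # spell (i + wt l) w" by (cases l) auto

text \<open>The second term composes with \<open>W u w\<close> only if the alternative word has the
  weight of the arrow; if it does not, admissibility makes its coefficient zero.\<close>

lemma F_mult:
  assumes x: "adm x" and u: "u = i + wt l"
  shows "mul (F x l i) (W u w) = (\<lambda>p. x (ix l) i * W i (l # w) p + x (jx l) i * W i (alt l @ w) p)"
  unfolding F_def Qv.pmult_add_left Qv.pmult_scale_left W_mult u deg_single
  using adm_alt[OF x, of l i] by auto

lemma W_mult_combo:
  assumes i: "i = v + deg w'" and x: "adm x"
  shows "mul (W v w') (\<lambda>p. c * W i w p + c' * W i w'' p) = (\<lambda>p. c * W v (w' @ w) p + c' * W v (w' @ w'') p)"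
  unfolding Qv.pmult_add_right Qv.pmult_scale_right W_mult i by simp

lemma F_closed:
  assumes x: "adm x" and a: "arr l i \<in> arcs quiver"
  shows "F x l i \<in> carrier KQ"
proof -
  have ok: "1 \<le> i" "i + wt l \<le> 2 * (n + m)" using a by (simp_all add: arr_simps)
  have 1: "W i [l] \<in> carrier KQ" using ok by (intro W_closed) (simp add: deg_single)
  have 2: "(\<lambda>p. x (jx l) i * W i (alt l) p) \<in> carrier KQ"
  proof (cases "x (jx l) i = 0")
    case True
    then show ?thesis using KQ_sums(3)[OF 1, of 0] by simp
  next
    case False
    then have "deg (alt l) = wt l" using adm_alt[OF x] by blast
    then show ?thesis using ok by (intro KQ_sums(3) W_closed) simp
  qed
  show ?thesis unfolding F_def by (rule KQ_sums(1)[OF KQ_sums(3)[OF 1] 2])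
qed

definition coch :: "(nat \<Rightarrow> nat \<Rightarrow> 'k) \<Rightarrow> ('k, arrow) proj_elem \<Rightarrow> 'k alg_elem" where
  "coch x = hom_with_values algebra P1 reg (arcs quiver) gen1
     (\<lambda>a. cls (F x (letter_of a) (tail quiver a)))"

lemma letter_arr: "letter_of (arr l i) = l" by (cases l) auto

lemma coch_facts:
  assumes x: "adm x"
  shows coch_hom: "coch x \<in> bimodule_hom algebra P1 reg"
    and coch_gen: "arr l i \<in> arcs quiver \<Longrightarrow> coch x (gen1 (arr l i)) = cls (F x l i)"
proof -
  let ?v = "\<lambda>a. cls (F x (letter_of a) (tail quiver a))"
  have v: "?v a \<in> carrier reg" "lact reg (vertex (tail quiver a)) (?v a) = ?v a"
    "ract reg (?v a) (vertex (head quiver a)) = ?v a" if a: "a \<in> arcs quiver" for a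
  proof -
    obtain l i where li: "a = arr l i" by (rule arr_cases)
    have ok: "1 \<le> i" "i + wt l \<le> 2 * (n + m)" using a unfolding li arr_simps by auto
    note f = F_closed[OF x a[unfolded li]]
    have W: "W i [] \<in> carrier KQ" "W (i + wt l) [] \<in> carrier KQ" using ok by (auto intro!: W_closed)
    show "?v a \<in> carrier reg"
      unfolding li letter_arr arr_simps B.regular_bimodule_simps by (rule cls_closed[OF f])
    show "lact reg (vertex (tail quiver a)) (?v a) = ?v a"
      unfolding li letter_arr arr_simps B.regular_bimodule_simps vertex_W cls_mult[OF W(1) f]
      unfolding F_def by (subst W_mult_combo[OF _ x]) simp_all
    show "ract reg (?v a) (vertex (head quiver a)) = ?v a"
      unfolding li letter_arr arr_simps B.regular_bimodule_simps vertex_W cls_mult[OF f W(2)] F_mult[OF x refl]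
      by (simp add: F_def)
  qed
  show "coch x \<in> bimodule_hom algebra P1 reg"
    unfolding coch_def P_eqs(2) gen_eqs(2) by (rule R1.hom_with_values(1)[OF B.regular_bimod v])
  show "coch x (gen1 (arr l i)) = cls (F x l i)" if "arr l i \<in> arcs quiver"
  proof -
    have "coch x (gen1 (arr l i)) = ?v (arr l i)"
      unfolding coch_def P_eqs(2) gen_eqs(2) by (rule R1.hom_with_values(2)[OF B.regular_bimod v that])
    then show ?thesis by (simp add: letter_arr arr_simps)
  qed
qed

lemma Phat1_carrier: "carrier Phat1 = bimodule_hom algebra P1 reg"
  unfolding Phat1_def P_eqs by (rule R1.hom_space_simps)

lemma coch_in: "adm x \<Longrightarrow> coch x \<in> carrier Phat1"
  unfolding Phat1_carrier by (rule coch_hom)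

lemma hom1_eqI:
  assumes "\<phi> \<in> carrier Phat1" "\<psi> \<in> carrier Phat1"
    "\<And>l i. arr l i \<in> arcs quiver \<Longrightarrow> \<phi> (gen1 (arr l i)) = \<psi> (gen1 (arr l i))"
  shows "\<phi> = \<psi>"
  using assms(1,2) unfolding Phat1_carrier P_eqs
proof (rule R1.hom_eqI[OF B.regular_bimod])
  show "\<phi> (R1.gen a) = \<psi> (R1.gen a)" if "a \<in> arcs quiver" for a
    using assms(3) that arr_cases unfolding gen_eqs by metis
qed

text \<open>The value at a generator is represented in the corner of its arrow, where
  \<open>deg_n\<close> and \<open>deg_m\<close> leave only the arrow and its alternative
  word.\<close>

lemma coch_surj:
  assumes \<phi>: "\<phi> \<in> carrier Phat1"
  obtains x where "adm x" "\<phi> = coch x"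
proof -
  have "\<forall>li. \<exists>cd. \<forall>l i c d. li = (l, i) \<longrightarrow> cd = (c, d) \<longrightarrow> (d = 0 \<or> deg (alt l) = wt l) \<and>
      (arr l i \<in> arcs quiver \<longrightarrow> \<phi> (gen1 (arr l i)) = cls (\<lambda>p. c * W i [l] p + d * W i (alt l) p))"
  proof
    fix li :: "letter \<times> nat"
    obtain l i where li: "li = (l, i)" by (cases li)
    have "\<exists>c d. (d = 0 \<or> deg (alt l) = wt l) \<and>
      (arr l i \<in> arcs quiver \<longrightarrow> \<phi> (gen1 (arr l i)) = cls (\<lambda>p. c * W i [l] p + d * W i (alt l) p))"
    proof (cases "arr l i \<in> arcs quiver")
      case True
      note g = R1.hom_gen[OF \<phi>[unfolded Phat1_carrier P_eqs] True, folded gen_eqs, unfolded B.regular_bimodule_simps arr_simps]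
      have v: "i \<in> verts quiver" "i + wt l \<in> verts quiver" using arc_ends[OF True] by (simp_all add: arr_simps)
      obtain f where f: "f \<in> carrier KQ" "\<phi> (gen1 (arr l i)) = cls f"
        "\<And>r. f r \<noteq> 0 \<Longrightarrow> \<exists>w. r = (i, spell i w) \<and> i + deg w = i + wt l"
        by (rule corner[OF g(1) v g(2,3)]) (rule that)
      \<comment> \<open>The coefficient is set to 0 when the weights do not match, which makes the
        resulting coordinates admissible.\<close>
      define d where "d = (if deg (alt l) = wt l \<and> alt l \<noteq> [l] then f (i, spell i (alt l)) else 0)"
      have "f r = f (i, spell i [l]) * W i [l] r + d * W i (alt l) r" for r
      proof (cases "f r = 0")
        case True
        then show ?thesis by (auto simp: W_def basis_elem_def d_def)
      next
        case False
        from f(3)[OF False] obtain w where w: "r = (i, spell i w)" "deg w = wt l" by auto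
        have "w = [l] \<or> w = alt l"
          using w(2) deg_n deg_m by (cases l) auto
        then show ?thesis using w by (auto simp: W_def basis_elem_def d_def spell_inj simp del: spell.simps)
      qed
      then have feq: "f = (\<lambda>p. f (i, spell i [l]) * W i [l] p + d * W i (alt l) p)" by (rule ext)
      have "\<phi> (gen1 (arr l i)) = cls (\<lambda>p. f (i, spell i [l]) * W i [l] p + d * W i (alt l) p)"
        using f(2) arg_cong[OF feq, of cls] by (rule trans)
      moreover have "d = 0 \<or> deg (alt l) = wt l" by (simp add: d_def)
      ultimately show ?thesis by blast
    qed blast
    then obtain c d where "(d = 0 \<or> deg (alt l) = wt l) \<and>
      (arr l i \<in> arcs quiver \<longrightarrow> \<phi> (gen1 (arr l i)) = cls (\<lambda>p. c * W i [l] p + d * W i (alt l) p))" by blast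
    then show "\<exists>cd. \<forall>l i c d. li = (l, i) \<longrightarrow> cd = (c, d) \<longrightarrow> (d = 0 \<or> deg (alt l) = wt l) \<and>
      (arr l i \<in> arcs quiver \<longrightarrow> \<phi> (gen1 (arr l i)) = cls (\<lambda>p. c * W i [l] p + d * W i (alt l) p))"
      by (intro exI[of _ "(c, d)"]) (simp add: li)
  qed
  from choice[OF this] obtain g where g: "\<forall>li. \<forall>l i c d. li = (l, i) \<longrightarrow> g li = (c, d) \<longrightarrow> (d = 0 \<or> deg (alt l) = wt l) \<and>
      (arr l i \<in> arcs quiver \<longrightarrow> \<phi> (gen1 (arr l i)) = cls (\<lambda>p. c * W i [l] p + d * W i (alt l) p))"
    by (rule exE)
  define c where "c l i = fst (g (l, i))" for l i
  define d where "d l i = snd (g (l, i))" for l i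
  have gcd: "g (l, i) = (c l i, d l i)" for l i by (simp add: c_def d_def)
  have cd: "d l i = 0 \<or> deg (alt l) = wt l"
    "arr l i \<in> arcs quiver \<Longrightarrow> \<phi> (gen1 (arr l i)) = cls (\<lambda>p. c l i * W i [l] p + d l i * W i (alt l) p)" for l i
    using g[rule_format, OF refl gcd] by blast+
  define x where "x k = (if k = 0 then c LX else if k = 1 then c LY else if k = 2 then d LY else d LX)" for k :: nat
  have xi: "x (ix l) = c l" "x (jx l) = d l" for l by (cases l; simp add: x_def)+
  have adm: "adm x"
    using cd(1)[of LX] cd(1)[of LY] nm n1 by (auto simp: adm_def x_def)
  have "\<phi> = coch x"
    by (rule hom1_eqI[OF \<phi> coch_in[OF adm]]) (simp add: coch_gen[OF adm] cd(2) F_def xi)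
  then show thesis using that adm by blast
qed

lemma Phat1_vspace: "vspace Phat1"
  unfolding Phat1_def P_eqs by (rule R1.hom_space_vspace[OF B.regular_bimod])

sublocale C1: vsp Phat1 by (rule vspI[OF Phat1_vspace])

lemma Phat1_at:
  assumes "z \<in> carrier P1"
  shows "(\<phi> \<oplus>\<^bsub>Phat1\<^esub> \<psi>) z = \<phi> z \<oplus>\<^bsub>algebra\<^esub> \<psi> z" "(c \<odot>\<^bsub>Phat1\<^esub> \<phi>) z = c \<odot>\<^bsub>algebra\<^esub> \<phi> z"
  using assms unfolding Phat1_def by (simp_all add: hom_space_def B.regular_bimodule_simps)

lemma coch_add:
  assumes x: "adm x" and y: "adm y"
  shows "coch x \<oplus>\<^bsub>Phat1\<^esub> coch y = coch (\<lambda>k i. x k i + y k i)"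
proof -
  have xy: "adm (\<lambda>k i. x k i + y k i)" using x y by (auto simp: adm_def)
  show ?thesis
  proof (rule hom1_eqI[OF C1.add_in[OF coch_in[OF x] coch_in[OF y]] coch_in[OF xy]])
    fix l i assume a: "arr l i \<in> arcs quiver"
    show "(coch x \<oplus>\<^bsub>Phat1\<^esub> coch y) (gen1 (arr l i)) = coch (\<lambda>k i. x k i + y k i) (gen1 (arr l i))"
      unfolding Phat1_at[OF gen1_mem[OF a]] coch_gen[OF x a] coch_gen[OF y a] coch_gen[OF xy a]
        cls_add[OF F_closed[OF x a] F_closed[OF y a]]
      by (simp add: F_def algebra_simps)
  qed
qed

lemma coch_smult:
  assumes x: "adm x"
  shows "c \<odot>\<^bsub>Phat1\<^esub> coch x = coch (\<lambda>k i. c * x k i)"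
proof -
  have xy: "adm (\<lambda>k i. c * x k i)" using x by (auto simp: adm_def)
  show ?thesis
  proof (rule hom1_eqI[OF C1.smult_in[OF coch_in[OF x]] coch_in[OF xy]])
    fix l i assume a: "arr l i \<in> arcs quiver"
    show "(c \<odot>\<^bsub>Phat1\<^esub> coch x) (gen1 (arr l i)) = coch (\<lambda>k i. c * x k i) (gen1 (arr l i))"
      unfolding Phat1_at[OF gen1_mem[OF a]] coch_gen[OF x a] coch_gen[OF xy a] cls_smult[OF F_closed[OF x a]]
      by (simp add: F_def algebra_simps)
  qed
qed

lemma adm_zero: "adm (\<lambda>k i. 0)" by (simp add: adm_def)

lemma coch_zero: "coch (\<lambda>k i. 0) = \<zero>\<^bsub>Phat1\<^esub>"
  using coch_smult[OF adm_zero, of 0] C1.zero_smult[OF coch_in[OF adm_zero]] by simp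

lemma coch_finsum:
  assumes "finite S" "\<And>s. s \<in> S \<Longrightarrow> adm (x s)"
  shows "(\<Oplus>\<^bsub>Phat1\<^esub>s\<in>S. coch (x s)) = coch (\<lambda>k i. \<Sum>s\<in>S. x s k i)"
  using assms
proof (induction S rule: finite_induct)
  case empty
  show ?case by (simp add: coch_zero)
next
  case (insert s S)
  have a: "adm (\<lambda>k i. \<Sum>s\<in>S. x s k i)" using insert.prems by (auto simp: adm_def)
  have "(\<Oplus>\<^bsub>Phat1\<^esub>s\<in>insert s S. coch (x s)) = coch (x s) \<oplus>\<^bsub>Phat1\<^esub> (\<Oplus>\<^bsub>Phat1\<^esub>s\<in>S. coch (x s))"
    by (rule C1.M.finsum_insert) (use insert.hyps insert.prems coch_in in auto)
  also have "\<dots> = coch (x s) \<oplus>\<^bsub>Phat1\<^esub> coch (\<lambda>k i. \<Sum>s\<in>S. x s k i)"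
    using insert.IH insert.prems by simp
  also have "\<dots> = coch (\<lambda>k i. x s k i + (\<Sum>s\<in>S. x s k i))"
    using insert.prems by (intro coch_add[OF _ a]) simp
  finally show ?case using insert.hyps by simp
qed

lemma coch_cong:
  assumes x: "adm x" and y: "adm y" and e: "\<And>l i. 1 \<le> i \<Longrightarrow> i + wt l \<le> 2 * (n + m) \<Longrightarrow>
    x (ix l) i = y (ix l) i \<and> x (jx l) i = y (jx l) i"
  shows "coch x = coch y"
  by (rule hom1_eqI[OF coch_in[OF x] coch_in[OF y]])
    (simp add: coch_gen[OF x] coch_gen[OF y] F_def e arr_simps)

subsection \<open>Coboundaries\<close>

definition cob :: "(nat \<Rightarrow> 'k) \<Rightarrow> nat \<Rightarrow> nat \<Rightarrow> 'k" where
  "cob u k i = (if k = 0 then u i - u (i + n) else if k = 1 then u i - u (i + m) else 0)"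

lemma adm_cob: "adm (cob u)" by (simp add: adm_def cob_def)

lemma dhat1_coch:
  assumes \<psi>: "\<psi> \<in> bimodule_hom algebra P0 reg"
    and u: "\<And>v. v \<in> verts quiver \<Longrightarrow> \<psi> (gen0 v) = cls (\<lambda>p. u v * W v [] p)"
  shows "dhat1 \<psi> = coch (cob u)"
proof (rule hom1_eqI[OF _ coch_in[OF adm_cob]])
  show "dhat1 \<psi> \<in> carrier Phat1"
    unfolding dhat1_def Phat1_carrier by (rule compose_bimodule_hom[OF P1_bimod d1_hom \<psi>])
  fix l i assume a: "arr l i \<in> arcs quiver"
  have ok: "1 \<le> i" "i + wt l \<le> 2 * (n + m)" using a by (simp_all add: arr_simps)
  have vs: "i \<in> verts quiver" "i + wt l \<in> verts quiver" using ok by (auto simp: quiver_simps)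
  have Ws: "W i [] \<in> carrier KQ" "W (i + wt l) [] \<in> carrier KQ" "W i [l] \<in> carrier KQ"
    using ok by (auto intro!: W_closed simp: deg_single)
  have ac: "arrow_class (arr l i) = cls (W i [l])"
    by (simp add: path_class_W[symmetric] spell_single arr_simps)
  have acc: "arrow_class (arr l i) \<in> carrier algebra" unfolding ac by (rule cls_closed[OF Ws(3)])
  note \<psi>' = \<psi>[unfolded P_eqs]
  note h = R0.hom_lin[OF \<psi>', folded P_eqs] R0.hom_l[OF \<psi>', folded P_eqs] R0.hom_r[OF \<psi>', folded P_eqs]
  have m1: "ract P0 (gen0 i) (arrow_class (arr l i)) \<in> carrier P0"
    by (rule Q0.r_closed[OF acc gen0_mem[OF vs(1)]])
  have m2: "lact P0 (arrow_class (arr l i)) (gen0 (i + wt l)) \<in> carrier P0"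
    by (rule Q0.l_closed[OF acc gen0_mem[OF vs(2)]])
  have "dhat1 \<psi> (gen1 (arr l i)) = \<psi> (d1 (gen1 (arr l i)))"
    by (simp add: dhat1_def compose_eq gen1_mem[OF a])
  also have "\<dots> = \<psi> (ract P0 (gen0 i) (arrow_class (arr l i)) \<ominus>\<^bsub>P0\<^esub> lact P0 (arrow_class (arr l i)) (gen0 (i + wt l)))"
    unfolding d1_gen[OF a] arr_simps ..
  also have "\<dots> = \<psi> (ract P0 (gen0 i) (arrow_class (arr l i))) \<ominus>\<^bsub>reg\<^esub> \<psi> (lact P0 (arrow_class (arr l i)) (gen0 (i + wt l)))"
    by (rule lin_minus[OF Q0.Q.vectorspace_axioms B.regular_bimodule_vspace h(1) m1 m2])
  also have "\<dots> = cls (\<lambda>p. u i * W i [l] p) \<ominus>\<^bsub>reg\<^esub> cls (\<lambda>p. u (i + wt l) * W i [l] p)"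
    unfolding h(3)[OF acc gen0_mem[OF vs(1)]] h(2)[OF acc gen0_mem[OF vs(2)]] B.regular_bimodule_simps u[OF vs(1)] u[OF vs(2)]
    unfolding ac cls_mult[OF KQ_sums(3)[OF Ws(1)] Ws(3)] cls_mult[OF Ws(3) KQ_sums(3)[OF Ws(2)]]
    by (simp add: Qv.pmult_scale_left Qv.pmult_scale_right W_mult deg_single)
  also have "\<dots> = cls (\<lambda>p. u i * W i [l] p) \<oplus>\<^bsub>algebra\<^esub> (- 1) \<odot>\<^bsub>algebra\<^esub> cls (\<lambda>p. u (i + wt l) * W i [l] p)"
  proof -
    interpret G: vsp reg by (rule vspI[OF B.regular_bimodule_vspace])
    have "cls (\<lambda>p. u (i + wt l) * W i [l] p) \<in> carrier reg"
      unfolding B.regular_bimodule_simps by (rule cls_closed[OF KQ_sums(3)[OF Ws(3)]])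
    from G.minus_one_smult[OF this] show ?thesis
      unfolding G.minus_eq_add by (simp only: B.regular_bimodule_simps)
  qed
  also have "\<dots> = cls (\<lambda>p. u i * W i [l] p + - 1 * (u (i + wt l) * W i [l] p))"
    unfolding cls_smult[OF KQ_sums(3)[OF Ws(3)]] by (rule cls_add[OF KQ_sums(3)[OF Ws(3)] KQ_sums(3)[OF KQ_sums(3)[OF Ws(3)]]])
  also have "\<dots> = coch (cob u) (gen1 (arr l i))"
    unfolding coch_gen[OF adm_cob a] F_def
    by (cases l) (simp_all add: cob_def algebra_simps)
  finally show "dhat1 \<psi> (gen1 (arr l i)) = coch (cob u) (gen1 (arr l i))" .
qed

text \<open>A word of weight 0 is empty, so the corner at a vertex consists of the multiples of its
  trivial path. Hence a 0-cochain is a function on the vertices.\<close>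

lemma coboundaries_eq: "coboundaries = range (\<lambda>u. coch (cob u))"
proof (rule equalityI; rule subsetI)
  fix \<phi> assume "\<phi> \<in> coboundaries"
  then obtain \<psi> where "\<phi> = dhat1 \<psi>" "\<psi> \<in> carrier Phat0" unfolding coboundaries_def by (rule imageE)
  then have \<psi>: "\<psi> \<in> bimodule_hom algebra P0 reg" "\<phi> = dhat1 \<psi>" by (simp_all add: Phat0_def hom_space_def)
  have "\<forall>v. \<exists>c. v \<in> verts quiver \<longrightarrow> \<psi> (gen0 v) = cls (\<lambda>p. c * W v [] p)"
  proof
    fix v
    show "\<exists>c. v \<in> verts quiver \<longrightarrow> \<psi> (gen0 v) = cls (\<lambda>p. c * W v [] p)"
    proof (cases "v \<in> verts quiver")
      case True
      note g = R0.hom_gen[OF \<psi>(1)[unfolded P_eqs] True, folded gen_eqs, unfolded B.regular_bimodule_simps id_apply]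
      obtain f where f: "f \<in> carrier KQ" "\<psi> (gen0 v) = cls f"
        "\<And>r. f r \<noteq> 0 \<Longrightarrow> \<exists>w. r = (v, spell v w) \<and> v + deg w = v"
        by (rule corner[OF g(1) True True g(2,3)]) (rule that)
      have "f r = f (v, []) * W v [] r" for r
      proof (cases "f r = 0")
        case True
        then show ?thesis by (auto simp: W_def basis_elem_def)
      next
        case False
        from f(3)[OF False] obtain w where w: "r = (v, spell v w)" "v + deg w = v" by blast
        then have "w = []" using deg_0 by simp
        with w show ?thesis by (auto simp: W_def basis_elem_def)
      qed
      then have feq: "f = (\<lambda>p. f (v, []) * W v [] p)" by (rule ext)
      have "\<psi> (gen0 v) = cls (\<lambda>p. f (v, []) * W v [] p)"
        using f(2) arg_cong[OF feq, of cls] by (rule trans)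
      then show ?thesis by blast
    qed blast
  qed
  from choice[OF this] obtain u where
    u': "\<forall>v. v \<in> verts quiver \<longrightarrow> \<psi> (gen0 v) = cls (\<lambda>p. u v * W v [] p)" by (rule exE)
  then have u: "\<psi> (gen0 v) = cls (\<lambda>p. u v * W v [] p)" if "v \<in> verts quiver" for v using that by blast
  show "\<phi> \<in> range (\<lambda>u. coch (cob u))" using dhat1_coch[OF \<psi>(1) u] \<psi>(2) by blast
next
  fix \<phi> assume "\<phi> \<in> range (\<lambda>u. coch (cob u))"
  then obtain u where u: "\<phi> = coch (cob u)" by blast
  let ?v = "\<lambda>v. cls (\<lambda>p. u v * W v [] p)"
  have v: "?v v \<in> carrier reg" "lact reg (vertex (id v)) (?v v) = ?v v" "ract reg (?v v) (vertex (id v)) = ?v v"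
    if "v \<in> verts quiver" for v
  proof -
    have W: "W v [] \<in> carrier KQ" using that by (auto intro!: W_closed simp: quiver_simps)
    show "?v v \<in> carrier reg" unfolding B.regular_bimodule_simps by (rule cls_closed[OF KQ_sums(3)[OF W]])
    show "lact reg (vertex (id v)) (?v v) = ?v v" "ract reg (?v v) (vertex (id v)) = ?v v"
      unfolding B.regular_bimodule_simps vertex_W id_apply cls_mult[OF W KQ_sums(3)[OF W]] cls_mult[OF KQ_sums(3)[OF W] W]
      by (simp_all add: Qv.pmult_scale_left Qv.pmult_scale_right W_mult)
  qed
  from R0.hom_exists[OF B.regular_bimod v, folded P_eqs gen_eqs]
  obtain \<psi> where \<psi>: "\<psi> \<in> bimodule_hom algebra P0 reg" "\<forall>v\<in>verts quiver. \<psi> (gen0 v) = ?v v"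
    by (rule bexE)
  have \<phi>: "\<phi> = dhat1 \<psi>" using dhat1_coch[OF \<psi>(1) bspec[OF \<psi>(2)]] u by simp
  show "\<phi> \<in> coboundaries"
    unfolding coboundaries_def by (rule image_eqI[of _ dhat1 \<psi>, OF \<phi>]) (simp add: Phat0_def hom_space_def \<psi>(1))
qed


subsection \<open>Cocycles\<close>

text \<open>A representative in the path algebra of the value of the derivation
  \<open>coch x\<close> on a path, given by the Leibniz rule.\<close>

definition D :: "(nat \<Rightarrow> nat \<Rightarrow> 'k) \<Rightarrow> nat \<times> arrow list \<Rightarrow> nat \<times> arrow list \<Rightarrow> 'k" where
  "D x = (\<lambda>(u, p) r. \<Sum>i<length p. mul (basis_elem (u, take i p))
     (mul (F x (letter_of (p ! i)) (tail quiver (p ! i))) (basis_elem (head quiver (p ! i), drop (Suc i) p))) r)"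

lemma basis_closed: "Qv.awalk u p v \<Longrightarrow> basis_elem (u, p) \<in> carrier KQ"
  unfolding Qv.PA_simps by (rule basis_elem_closed) (auto simp: paths_def)

lemma KQ_finsum:
  assumes "finite I" "\<And>i. i \<in> I \<Longrightarrow> f i \<in> carrier KQ"
  shows "finsum KQ f I = (\<lambda>r. \<Sum>i\<in>I. f i r)" "(\<lambda>r. \<Sum>i\<in>I. f i r) \<in> carrier KQ"
proof -
  have "finsum KQ f I = (\<lambda>r. \<Sum>i\<in>I. f i r)"
    using assms
  proof (induction I rule: finite_induct)
    case empty
    show ?case by (simp add: Qv.PA_simps)
  next
    case (insert i I)
    have "finsum KQ f (insert i I) = f i \<oplus>\<^bsub>KQ\<^esub> finsum KQ f I"
      by (rule KQ.A.M.finsum_insert[OF insert.hyps]) (use insert.prems in auto)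
    also have "\<dots> = (\<lambda>r. f i r + (\<Sum>i\<in>I. f i r))"
      using insert.IH insert.prems by (simp add: Qv.PA_simps)
    finally show ?case using insert.hyps by simp
  qed
  moreover have "finsum KQ f I \<in> carrier KQ"
    by (rule KQ.A.M.finsum_closed[OF Pi_I]) (rule assms(2))
  ultimately show "finsum KQ f I = (\<lambda>r. \<Sum>i\<in>I. f i r)" "(\<lambda>r. \<Sum>i\<in>I. f i r) \<in> carrier KQ" by simp_all
qed

lemma coch_cofactor:
  assumes x: "adm x" and w: "Qv.awalk u p v"
  shows "D x (u, p) \<in> carrier KQ" "coch x (cofactor (u, p)) = cls (D x (u, p))"
proof -
  let ?G = "\<lambda>i. F x (letter_of (p ! i)) (tail quiver (p ! i))"
  let ?t = "\<lambda>i. mul (basis_elem (u, take i p)) (mul (?G i) (basis_elem (head quiver (p ! i), drop (Suc i) p)))"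
  note s = awalk_split[OF w]
  have F: "?G i \<in> carrier KQ \<and> coch x (gen1 (p ! i)) = cls (?G i)" if i: "i < length p" for i
  proof -
    obtain l j where lj: "p ! i = arr l j" by (rule arr_cases)
    show ?thesis using F_closed[OF x] coch_gen[OF x] s(1)[OF i] unfolding lj letter_arr arr_simps(1,2) by blast
  qed
  have b: "mul (?G i) (basis_elem (head quiver (p ! i), drop (Suc i) p)) \<in> carrier KQ" if i: "i < length p" for i
    by (rule Qv.pmult_closed[OF conjunct1[OF F[OF i]] basis_closed[OF s(3)[OF i]]])
  have t: "?t i \<in> carrier KQ" if i: "i < length p" for i
    by (rule Qv.pmult_closed[OF basis_closed[OF s(2)[OF i]] b[OF i]])
  have Dt: "D x (u, p) = (\<lambda>r. \<Sum>i\<in>{..<length p}. ?t i r)" by (simp add: D_def)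
  have fs: "finsum KQ ?t {..<length p} = D x (u, p)"
    unfolding Dt by (rule KQ_finsum(1)) (simp_all only: finite_lessThan lessThan_iff t)
  show "D x (u, p) \<in> carrier KQ"
    unfolding Dt by (rule KQ_finsum(2)) (simp_all only: finite_lessThan lessThan_iff t)
  have "coch x (cofactor (u, p)) = (\<Oplus>\<^bsub>algebra\<^esub>i\<in>{..<length p}. path_class (u, take i p) \<otimes>\<^bsub>algebra\<^esub>
        (coch x (gen1 (p ! i)) \<otimes>\<^bsub>algebra\<^esub> path_class (head quiver (p ! i), drop (Suc i) p)))"
    by (rule cofactor_facts(4)[OF w coch_hom[OF x]])
  also have "\<dots> = (\<Oplus>\<^bsub>algebra\<^esub>i\<in>{..<length p}. cls (?t i))"
  proof (rule B.A.M.finsum_cong'[OF refl])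
    show "(\<lambda>i. cls (?t i)) \<in> {..<length p} \<rightarrow> carrier algebra"
      by (rule Pi_I) (simp only: lessThan_iff cls_closed[OF t])
    fix i assume "i \<in> {..<length p}"
    then have i: "i < length p" by simp
    show "path_class (u, take i p) \<otimes>\<^bsub>algebra\<^esub>
        (coch x (gen1 (p ! i)) \<otimes>\<^bsub>algebra\<^esub> path_class (head quiver (p ! i), drop (Suc i) p)) = cls (?t i)"
      unfolding conjunct2[OF F[OF i]] path_class_cls
        cls_mult[OF conjunct1[OF F[OF i]] basis_closed[OF s(3)[OF i]]] cls_mult[OF basis_closed[OF s(2)[OF i]] b[OF i]] ..
  qed
  also have "\<dots> = cls (finsum KQ ?t {..<length p})"
    by (rule lin_finsum[OF KQ.A.vectorspace_axioms B.A.vectorspace_axioms cls_lin finite_lessThan, symmetric])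
      (simp only: lessThan_iff t)
  finally show "coch x (cofactor (u, p)) = cls (D x (u, p))" unfolding fs .
qed

definition dG :: "(nat \<Rightarrow> nat \<Rightarrow> 'k) \<Rightarrow> relator \<Rightarrow> nat \<times> arrow list \<Rightarrow> 'k" where
  "dG x h = (\<lambda>r. \<Sum>q | relation h q \<noteq> 0. relation h q * D x q r)"

lemma coch_d2:
  assumes x: "adm x" and h: "h \<in> relators"
  shows "dG x h \<in> carrier KQ" "coch x (d2 (gen2 h)) = cls (dG x h)"
proof -
  let ?S = "{q. relation h q \<noteq> 0}"
  have q: "cofactor q \<in> carrier P1 \<and> D x q \<in> carrier KQ \<and> coch x (cofactor q) = cls (D x q)" if "q \<in> ?S" for q
  proof -
    obtain u p where up: "q = (u, p)" by (cases q)
    have "relation h (u, p) \<noteq> 0" using that up by simp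
    note w = relation_supp(2)[OF h this]
    show ?thesis unfolding up using cofactor_facts(1)[OF w] coch_cofactor[OF x w] by blast
  qed
  have t: "(\<lambda>r. relation h q * D x q r) \<in> carrier KQ" if "q \<in> ?S" for q
    by (rule KQ_sums(3)) (use q[OF that] in blast)
  have fs: "finsum KQ (\<lambda>q r. relation h q * D x q r) ?S = dG x h"
    unfolding dG_def by (rule KQ_finsum(1)[OF finite_supp[OF h] t])
  show "dG x h \<in> carrier KQ"
    unfolding dG_def by (rule KQ_finsum(2)[OF finite_supp[OF h] t])
  have cl: "coch x \<in> lin P1 algebra"
    using R1.hom_lin[OF coch_hom[OF x, unfolded P_eqs], folded P_eqs]
    by (simp add: LinearCombinations.module_hom_def B.regular_bimodule_simps)
  have "coch x (d2 (gen2 h)) = (\<Oplus>\<^bsub>algebra\<^esub>q\<in>?S. coch x (relation h q \<odot>\<^bsub>P1\<^esub> cofactor q))"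
    unfolding d2_gen[OF h]
    by (rule lin_finsum[OF Q1.Q.vectorspace_axioms B.A.vectorspace_axioms cl finite_supp[OF h]])
      (use q Q1.Q.smult_in in blast)
  also have "\<dots> = (\<Oplus>\<^bsub>algebra\<^esub>q\<in>?S. cls (\<lambda>r. relation h q * D x q r))"
  proof (rule B.A.M.finsum_cong'[OF refl])
    show "(\<lambda>q. cls (\<lambda>r. relation h q * D x q r)) \<in> ?S \<rightarrow> carrier algebra"
      by (rule Pi_I) (rule cls_closed[OF t])
    fix q assume "q \<in> ?S"
    note q' = q[OF this]
    show "coch x (relation h q \<odot>\<^bsub>P1\<^esub> cofactor q) = cls (\<lambda>r. relation h q * D x q r)"
      unfolding lin_smult[OF cl conjunct1[OF q']] using q' cls_smult by simp
  qed
  also have "\<dots> = cls (finsum KQ (\<lambda>q r. relation h q * D x q r) ?S)"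
    by (rule lin_finsum[OF KQ.A.vectorspace_axioms B.A.vectorspace_axioms cls_lin finite_supp[OF h] t, symmetric])
  finally show "coch x (d2 (gen2 h)) = cls (dG x h)" unfolding fs .
qed

text \<open>The composite with \<open>d2\<close> is determined by its values at the generators of
  \<open>P2\<close>, and \<open>dG x h\<close> represents the value at the generator of
  \<open>h\<close>.\<close>

lemma cocycle_iff:
  assumes x: "adm x"
  shows "coch x \<in> cocycles \<longleftrightarrow> (\<forall>h\<in>relators. dG x h \<in> rel_ideal)"
proof -
  have hom: "dhat2 (coch x) \<in> bimodule_hom algebra P2 reg"
    unfolding dhat2_def by (rule compose_bimodule_hom[OF P2_bimod d2_hom coch_hom[OF x]])
  interpret C2: vsp Phat2
    unfolding Phat2_def P_eqs by (rule vspI[OF R2.hom_space_vspace[OF B.regular_bimod]])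
  have C2c: "carrier Phat2 = bimodule_hom algebra P2 reg" by (simp add: Phat2_def hom_space_def)
  have zero: "\<zero>\<^bsub>Phat2\<^esub> \<in> bimodule_hom algebra P2 reg" using C2.zero_in unfolding C2c .
  have zero_at: "\<zero>\<^bsub>Phat2\<^esub> (gen2 h) = \<zero>\<^bsub>algebra\<^esub>" if "h \<in> relators" for h
    using gen2_mem[OF that] by (simp add: Phat2_def hom_space_def B.regular_bimodule_simps)
  have at: "dhat2 (coch x) (gen2 h) = cls (dG x h)" if "h \<in> relators" for h
    using coch_d2[OF x that] gen2_mem[OF that] by (simp add: dhat2_def compose_eq)
  have "dhat2 (coch x) = \<zero>\<^bsub>Phat2\<^esub> \<longleftrightarrow> (\<forall>h\<in>relators. dG x h \<in> rel_ideal)"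
  proof
    assume z: "dhat2 (coch x) = \<zero>\<^bsub>Phat2\<^esub>"
    show "\<forall>h\<in>relators. dG x h \<in> rel_ideal"
    proof
      fix h assume h: "h \<in> relators"
      have "cls (dG x h) = \<zero>\<^bsub>algebra\<^esub>" using at[OF h] zero_at[OF h] z by simp
      then show "dG x h \<in> rel_ideal" using cls_eq_zero[OF coch_d2(1)[OF x h]] by simp
    qed
  next
    assume r: "\<forall>h\<in>relators. dG x h \<in> rel_ideal"
    show "dhat2 (coch x) = \<zero>\<^bsub>Phat2\<^esub>"
    proof (rule R2.hom_eqI[OF B.regular_bimod hom[unfolded P_eqs] zero[unfolded P_eqs], folded gen_eqs])
      fix h assume h: "h \<in> relators"
      show "dhat2 (coch x) (gen2 h) = \<zero>\<^bsub>Phat2\<^esub> (gen2 h)"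
        using at[OF h] zero_at[OF h] cls_eq_zero[OF coch_d2(1)[OF x h]] r h by simp
    qed
  qed
  then show ?thesis using coch_in[OF x] by (simp add: cocycles_def)
qed

lemma D_three:
  assumes x: "adm x"
  shows "D x (u, spell u [a, b, c]) = (\<lambda>r.
      (x (ix a) u + x (ix b) (u + wt a) + x (ix c) (u + wt a + wt b)) * W u [a, b, c] r
      + x (jx a) u * W u (alt a @ [b, c]) r + x (jx b) (u + wt a) * W u ([a] @ alt b @ [c]) r
      + x (jx c) (u + wt a + wt b) * W u ([a, b] @ alt c) r)"
proof -
  have D: "D x (u, spell u [a, b, c]) = (\<lambda>r.
      mul (W u []) (mul (F x a u) (W (u + wt a) [b, c])) r
      + mul (W u [a]) (mul (F x b (u + wt a)) (W (u + wt a + wt b) [c])) r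
      + mul (W u [a, b]) (mul (F x c (u + wt a + wt b)) (W (u + wt a + wt b + wt c) [])) r)"
    by (rule ext) (simp add: D_def W_def spell_cons spell_single numeral_3_eq_3 lessThan_Suc letter_arr arr_simps
        del: spell.simps(2,3))
  show ?thesis
    unfolding D F_mult[OF x refl]
    by (subst W_mult_combo[OF _ x], simp, subst W_mult_combo[OF _ x], simp add: deg_single,
      subst W_mult_combo[OF _ x], simp add: deg_cons) (simp add: algebra_simps)
qed

lemma dG_three:
  assumes rel: "relation h = (\<lambda>p. W i x1 p - \<alpha> * W i x2 p - \<beta> * W i x3 p)"
    and d: "x1 \<noteq> x2" "x1 \<noteq> x3" "x2 \<noteq> x3"
  shows "dG x h = (\<lambda>r. D x (i, spell i x1) r - \<alpha> * D x (i, spell i x2) r - \<beta> * D x (i, spell i x3) r)"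
proof
  fix r
  let ?A = "{(i, spell i x1), (i, spell i x2), (i, spell i x3)}"
  have d': "spell i x1 \<noteq> spell i x2" "spell i x1 \<noteq> spell i x3" "spell i x2 \<noteq> spell i x3"
    using d by (simp_all add: spell_inj)
  have "dG x h r = (\<Sum>q\<in>?A. relation h q * D x q r)"
    unfolding dG_def
    by (rule sum.mono_neutral_left) (auto simp: rel W_def basis_elem_def)
  also have "\<dots> = D x (i, spell i x1) r - \<alpha> * D x (i, spell i x2) r - \<beta> * D x (i, spell i x3) r"
    using d' d'[symmetric] by (simp add: rel W_def basis_elem_def algebra_simps)
  finally show "dG x h r = D x (i, spell i x1) r - \<alpha> * D x (i, spell i x2) r - \<beta> * D x (i, spell i x3) r" .
qed

subsection \<open>Functionals separating the words that occur\<close>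

text \<open>The index is shifted by one: \<open>L k\<close> is
  \<open>\<lambda>\<^sub>k\<^sub>-\<^sub>1\<close>, so that \<open>L (m + 2)\<close> is
  \<open>\<lambda>\<^sub>m\<^sub>+\<^sub>1\<close>.\<close>

abbreviation L :: "nat \<Rightarrow> 'k" where "L \<equiv> lam_shift \<alpha> \<beta>"

lemma L_step: "L (Suc (Suc k)) = \<alpha> * L (Suc k) + \<beta> * L k" by simp

declare lam_shift.simps [simp del]

lemma L_simps: "\<beta> * L 0 = 1" "L (Suc 0) = 0" "L (Suc (Suc 0)) = 1" "L 2 = 1" "L 3 = \<alpha>"
  using beta by (simp_all add: numeral_2_eq_2 numeral_3_eq_3 lam_shift.simps)

definition pos :: "letter list \<Rightarrow> nat" where "pos w = length (takeWhile ((=) LX) w)"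

definition one_y :: "(nat \<Rightarrow> 'k) \<Rightarrow> letter list \<Rightarrow> 'k" where
  "one_y f w = (if count_list w LY = 1 then f (pos w) else 0)"

definition no :: "letter \<Rightarrow> letter list \<Rightarrow> 'k" where
  "no l w = of_bool (count_list w l = 0)"

text \<open>Supported on the three words of a relation \<open>g\<close>. The values at
  \<open>y x y\<close> and \<open>y y x\<close> are free, and the relation forces the one at
  \<open>x y y\<close>.\<close>

definition two_y :: "'k \<Rightarrow> 'k \<Rightarrow> letter list \<Rightarrow> 'k" where
  "two_y a b w = (if w = [LY, LX, LY] then a else if w = [LY, LY, LX] then b
     else if w = [LX, LY, LY] then \<alpha> * a + \<beta> * b else 0)"

lemma pos_append: "LY \<notin> set w \<Longrightarrow> pos (w @ w') = length w + pos w'"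
proof -
  assume "LY \<notin> set w"
  then have "LX = l" if "l \<in> set w" for l using that by (cases l) auto
  then show ?thesis by (simp add: pos_def takeWhile_append2)
qed

text \<open>With a single \<open>y\<close> in the word, a relation \<open>f\<close> compares the
  cases in which k + 2, k + 1 and k letters \<open>x\<close> stand in front of it, which is the
  recurrence for \<open>f\<close>. The words of a relation \<open>g\<close> have two letters
  \<open>y\<close>, so all three values are zero.\<close>

lemma one_y_compat:
  assumes f: "\<And>k. f (Suc (Suc k)) = \<alpha> * f (Suc k) + \<beta> * f k"
  shows "rel_compat (one_y f)"
  unfolding rel_compat_def
proof (intro allI conjI)
  fix w w'
  show "one_y f (w @ [LX, LX, LY] @ w') = \<alpha> * one_y f (w @ [LX, LY, LX] @ w') + \<beta> * one_y f (w @ [LY, LX, LX] @ w')"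
  proof (cases "LY \<in> set w \<or> LY \<in> set w'")
    case True
    then have "count_list w LY \<noteq> 0 \<or> count_list w' LY \<noteq> 0" by (simp add: count_list_0_iff)
    then show ?thesis by (elim disjE) (simp_all add: one_y_def)
  next
    case False
    then show ?thesis by (simp add: one_y_def pos_append) (simp add: pos_def f)
  qed
qed (simp add: one_y_def)

text \<open>Each word of a relation contains both letters, so all values vanish.
  \<open>no LY\<close> detects powers of \<open>x\<close>, and \<open>no LX\<close> powers of
  \<open>y\<close>.\<close>

lemma no_compat: "rel_compat (no l)"
  by (cases l) (simp_all add: rel_compat_def no_def)

text \<open>The support consists of words of length three, so only the empty context has to be
  examined.\<close>

lemma two_y_compat: "rel_compat (two_y a b)"
proof -
  have long: "two_y a b (w @ [l1, l2, l3] @ w') = 0" if "w \<noteq> [] \<or> w' \<noteq> []" for w w' l1 l2 l3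
  proof -
    have "length (w @ [l1, l2, l3] @ w') \<noteq> 3" using that by auto
    then have "w @ [l1, l2, l3] @ w' \<noteq> [y1, y2, y3]" for y1 y2 y3
      by (metis length_Cons list.size(3) numeral_3_eq_3)
    then show ?thesis unfolding two_y_def by simp
  qed
  show ?thesis
    unfolding rel_compat_def
  proof (intro allI)
    fix w w'
    show "two_y a b (w @ [LX, LX, LY] @ w') = \<alpha> * two_y a b (w @ [LX, LY, LX] @ w') + \<beta> * two_y a b (w @ [LY, LX, LX] @ w') \<and>
      two_y a b (w @ [LX, LY, LY] @ w') = \<alpha> * two_y a b (w @ [LY, LX, LY] @ w') + \<beta> * two_y a b (w @ [LY, LY, LX] @ w')"
    proof (cases "w = [] \<and> w' = []")
      case True
      then show ?thesis by (simp add: two_y_def)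
    next
      case False
      then have "w \<noteq> [] \<or> w' \<noteq> []" by simp
      then show ?thesis by (simp only: long) simp
    qed
  qed
qed

definition xyx :: "nat \<Rightarrow> nat \<Rightarrow> letter list" where
  "xyx k l = replicate k LX @ [LY] @ replicate l LX"

lemma count_replicate: "count_list (replicate k LX) LY = 0"
  by (induction k) auto

lemma one_y_xyx: "one_y f (xyx k l) = f k"
proof -
  have "pos (xyx k l) = k" unfolding xyx_def by (subst pos_append) (auto simp: pos_def)
  moreover have "count_list (xyx k l) LY = 1" by (simp add: xyx_def count_replicate)
  ultimately show ?thesis by (simp add: one_y_def)
qed

lemma no_xyx: "no LY (xyx k l) = 0" "0 < k + l \<Longrightarrow> no LX (xyx k l) = 0"
  by (simp add: no_def xyx_def) (cases k; cases l; simp add: no_def xyx_def)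

lemma two_y_xyx: "two_y a b (xyx k l) = 0"
proof -
  have "count_list (xyx k l) LY = 1" by (simp add: xyx_def count_replicate)
  then show ?thesis by (auto simp: two_y_def)
qed

lemma xyx_words:
  "[LX, LX, LY] = xyx 2 0" "[LX, LY, LX] = xyx 1 1" "[LY, LX, LX] = xyx 0 2"
  "LX # replicate k LX @ [LY] = xyx (Suc k) 0" "LX # LY # replicate k LX = xyx 1 k"
  "replicate k LX @ [LX, LY] = xyx (Suc k) 0" "LY # LX # replicate k LX = xyx 0 (Suc k)"
  "replicate k LX @ [LY, LX] = xyx k 1" "LY # replicate k LX @ [LX] = xyx 0 (Suc k)"
  by (simp_all add: xyx_def numeral_2_eq_2 replicate_app_Cons_same replicate_append_same)

definition xpow :: "nat \<Rightarrow> letter list" where "xpow k = replicate k LX"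

lemma x_words:
  "LX # LX # replicate k LX = xpow (k + 2)" "LX # replicate k LX @ [LX] = xpow (k + 2)"
  "replicate k LX @ [LX, LX] = xpow (k + 2)"
  by (simp_all add: xpow_def replicate_app_Cons_same replicate_append_same)

lemma vals:
  "one_y f (xpow k) = 0" "no LY (xpow k) = 1" "two_y a b (xpow k) = 0"
  "one_y f [LX, LY, LY] = 0" "one_y f [LY, LX, LY] = 0" "one_y f [LY, LY, LX] = 0" "one_y f [LY, LY, LY] = 0"
  "two_y a b [LX, LY, LY] = \<alpha> * a + \<beta> * b" "two_y a b [LY, LX, LY] = a" "two_y a b [LY, LY, LX] = b" "two_y a b [LY, LY, LY] = 0"
  "no l [LX, LY, LY] = 0" "no l [LY, LX, LY] = 0" "no l [LY, LY, LX] = 0" "no LX [LY, LY, LY] = 1"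
proof -
  have "count_list [LY, LX, LY] LY \<noteq> 0" "count_list [LY, LY, LX] LY \<noteq> 0" "count_list [LX, LY, LY] LY \<noteq> 0" by auto
  then have "replicate k LX \<noteq> [LY, LX, LY]" "replicate k LX \<noteq> [LY, LY, LX]" "replicate k LX \<noteq> [LX, LY, LY]"
    using count_replicate by metis+
  then show "two_y a b (xpow k) = 0" by (simp add: two_y_def xpow_def)
qed (cases l; simp add: one_y_def no_def two_y_def count_replicate xpow_def)+

text \<open>Additivity of \<open>wpair\<close> needs only finite support, which every
  \<open>W u w\<close> has even if the word leaves the quiver. The evaluations below therefore need
  no range conditions.\<close>

definition fsup :: "(nat \<times> arrow list \<Rightarrow> 'k) \<Rightarrow> bool" where "fsup f \<longleftrightarrow> finite {p. f p \<noteq> 0}"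

lemma fsup_rules:
  "fsup (W u w)" "fsup f \<Longrightarrow> fsup g \<Longrightarrow> fsup (\<lambda>p. f p + g p)" "fsup f \<Longrightarrow> fsup g \<Longrightarrow> fsup (\<lambda>p. f p - g p)"
  "fsup f \<Longrightarrow> fsup (\<lambda>p. c * f p)"
proof -
  show "fsup (W u w)" by (simp add: fsup_def W_def basis_elem_def)
  show "fsup (\<lambda>p. f p + g p)" if "fsup f" "fsup g"
    unfolding fsup_def
    by (rule finite_subset[of _ "{p. f p \<noteq> 0} \<union> {p. g p \<noteq> 0}"]) (use that in \<open>auto simp: fsup_def\<close>)
  show "fsup (\<lambda>p. f p - g p)" if "fsup f" "fsup g"
    unfolding fsup_def
    by (rule finite_subset[of _ "{p. f p \<noteq> 0} \<union> {p. g p \<noteq> 0}"]) (use that in \<open>auto simp: fsup_def\<close>)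
  show "fsup (\<lambda>p. c * f p)" if "fsup f"
    unfolding fsup_def
    by (rule finite_subset[of _ "{p. f p \<noteq> 0}"]) (use that in \<open>auto simp: fsup_def\<close>)
qed

lemma wpair_sum: "fsup f \<Longrightarrow> fsup g \<Longrightarrow> wpair c (\<lambda>p. f p + g p) = wpair c f + wpair c g"
  unfolding wpair_def fsup_def by (rule pair_add)

lemma wpair_sub: "fsup f \<Longrightarrow> fsup g \<Longrightarrow> wpair c (\<lambda>p. f p - g p) = wpair c f - wpair c g"
  using wpair_sum[of f "\<lambda>p. - 1 * g p" c] fsup_rules(4)[of g "- 1"] wpair_scale[of c "- 1" g] by simp

lemmas wpair_simps = fsup_rules wpair_sum wpair_sub wpair_scale wpair_W

section \<open>The cocycle equations of the two kinds of relations\<close>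

definition rF where
  "rF x i = (x 0 i + x 0 (i + n) + x 1 (i + n + n)
     , x 0 i + x 1 (i + n) + x 0 (i + n + m), x 1 i + x 0 (i + m) + x 0 (i + m + n))"

text \<open>\<open>rF\<close> holds the sums of the diagonal coefficients along
  \<open>x x y\<close>, \<open>x y x\<close> and \<open>y x x\<close>. Each other term replaces one
  letter by its alternative word: an \<open>x\<close> by \<open>y\<close> (coordinate 3) or a
  \<open>y\<close> by \<open>x^m\<close> (coordinate 2).\<close>

lemma dG_F:
  assumes x: "adm x" and a: "(a1, a2, a3) = rF x i"
  shows "dG x (RelF i) = (\<lambda>r.
      (a1 * W i (xyx 2 0) r + x 3 i * W i [LY, LX, LY] r + x 3 (i + n) * W i [LX, LY, LY] r
        + x 2 (i + n + n) * W i (xpow (m + 2)) r)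
      - \<alpha> * (a2 * W i (xyx 1 1) r + x 3 i * W i [LY, LY, LX] r + x 2 (i + n) * W i (xpow (m + 2)) r
        + x 3 (i + n + m) * W i [LX, LY, LY] r)
      - \<beta> * (a3 * W i (xyx 0 2) r + x 2 i * W i (xpow (m + 2)) r + x 3 (i + m) * W i [LY, LY, LX] r
        + x 3 (i + m + n) * W i [LY, LX, LY] r))"
proof -
  have "dG x (RelF i) = (\<lambda>r. D x (i, spell i [LX, LX, LY]) r - \<alpha> * D x (i, spell i [LX, LY, LX]) r
      - \<beta> * D x (i, spell i [LY, LX, LX]) r)"
    by (rule dG_three[OF relation_W(1)]) simp_all
  then show ?thesis
    using a unfolding D_three[OF x] rF_def
    by (simp only: ix.simps jx.simps wt.simps alt.simps prod.inject)
      (simp only: append.simps(1) append_Cons xyx_words x_words)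
qed

definition rG where
  "rG x j = (x 0 j + x 1 (j + n) + x 1 (j + n + m)
     , x 1 j + x 0 (j + m) + x 1 (j + m + n), x 1 j + x 1 (j + m) + x 0 (j + m + m))"

lemma dG_G:
  assumes x: "adm x" and b: "(b1, b2, b3) = rG x j"
  shows "dG x (RelG j) = (\<lambda>r.
      (b1 * W j [LX, LY, LY] r + x 3 j * W j [LY, LY, LY] r + x 2 (j + n) * W j (xyx (Suc m) 0) r
        + x 2 (j + n + m) * W j (xyx 1 m) r)
      - \<alpha> * (b2 * W j [LY, LX, LY] r + x 2 j * W j (xyx (Suc m) 0) r + x 3 (j + m) * W j [LY, LY, LY] r
        + x 2 (j + m + n) * W j (xyx 0 (Suc m)) r)
      - \<beta> * (b3 * W j [LY, LY, LX] r + x 2 j * W j (xyx m 1) r + x 2 (j + m) * W j (xyx 0 (Suc m)) r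
        + x 3 (j + m + m) * W j [LY, LY, LY] r))"
proof -
  have "dG x (RelG j) = (\<lambda>r. D x (j, spell j [LX, LY, LY]) r - \<alpha> * D x (j, spell j [LY, LX, LY]) r
      - \<beta> * D x (j, spell j [LY, LY, LX]) r)"
    by (rule dG_three[OF relation_W(2)]) simp_all
  then show ?thesis
    using b unfolding D_three[OF x] rG_def
    by (simp only: ix.simps jx.simps wt.simps alt.simps prod.inject)
      (simp only: append.simps(1) append_Cons xyx_words x_words)
qed

text \<open>The coefficients that remain after \<open>x x y\<close> and \<open>x y y\<close> have
  been eliminated by relations: those of \<open>x y x\<close> and \<open>y x x\<close>, then of
  \<open>x^(m+2)\<close>, then of \<open>y x y\<close> and \<open>y y x\<close>.\<close>

definition eqF where
  "eqF x i \<longleftrightarrow> (case rF x i of (a1, a2, a3) \<Rightarrow> \<alpha> * (a1 - a2) = 0 \<and> a1 = a3) \<and>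
     x 2 (i + n + n) = \<alpha> * x 2 (i + n) + \<beta> * x 2 i \<and>
     x 3 i + \<alpha> * (x 3 (i + n) - \<alpha> * x 3 (i + n + m)) = \<beta> * x 3 (i + m + n) \<and>
     \<beta> * (x 3 (i + n) - \<alpha> * x 3 (i + n + m)) = \<alpha> * x 3 i + \<beta> * x 3 (i + m)"

text \<open>The coefficients that remain after \<open>x y y\<close> has been eliminated and
  \<open>x^(m+1) y\<close>, \<open>x^m y x\<close> have been reduced as in
  \<open>xyx_reduce\<close>: those of \<open>y x y\<close> and \<open>y y x\<close>, then of
  \<open>y y y\<close>, then of \<open>x y x^m\<close> and \<open>y x^(m+1)\<close>.\<close>

definition eqG where
  "eqG x j \<longleftrightarrow> (case rG x j of (b1, b2, b3) \<Rightarrow> \<alpha> * (b1 - b2) = 0 \<and> b1 = b3) \<and>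
     x 3 j = \<alpha> * x 3 (j + m) + \<beta> * x 3 (j + m + m) \<and>
     (x 2 (j + n) - \<alpha> * x 2 j) * L (Suc (Suc m)) + x 2 (j + n + m) = \<beta> * x 2 j * L (Suc m) \<and>
     (x 2 (j + n) - \<alpha> * x 2 j) * (\<beta> * L (Suc m)) = \<alpha> * x 2 (j + m + n) + \<beta> * x 2 (j + m) + \<beta> * x 2 j * (\<beta> * L m)"

text \<open>The solutions of the recurrence with values 0, 1 and 1, 0 at k = 0, 1. They read off the
  coefficients of \<open>x y x^N\<close> and \<open>y x^(N+1)\<close> once \<open>x^k y x^l\<close>
  has been reduced.\<close>

lemma one_y_L: "rel_compat (one_y (\<lambda>k. L (Suc k)))" "rel_compat (one_y (\<lambda>k. \<beta> * L k))"
  by (rule one_y_compat, simp add: L_step algebra_simps)+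

text \<open>Necessity: each equation is the vanishing of one compatible functional on
  \<open>dG x (RelF i)\<close>. Sufficiency: the equations cancel every term except multiples of the
  relations themselves.\<close>

lemma eqF_iff:
  assumes x: "adm x" and i: "i \<in> {1..m}"
  shows "dG x (RelF i) \<in> rel_ideal \<longleftrightarrow> eqF x i"
proof -
  obtain a1 a2 a3 where a: "rF x i = (a1, a2, a3)" by (cases "rF x i")
  note dG = dG_F[OF x a[symmetric]]
  \<comment> \<open>\<open>k\<close> is the coefficient of \<open>x y y\<close>, hence the multiple
    of \<open>RelG i\<close> that has to be split off.\<close>
  define k where "k = x 3 (i + n) - \<alpha> * x 3 (i + n + m)"
  show ?thesis
  proof
    assume r: "dG x (RelF i) \<in> rel_ideal"
    note z = wpair_ideal[OF _ r, unfolded dG]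
    \<comment> \<open>\<open>L (Suc k)\<close> is 0, 1, \<alpha> at k = 0, 1, 2, which are the
      numbers of letters \<open>x\<close> in front of \<open>y\<close> in the three words of
      \<open>RelF i\<close>.\<close>
    have 1: "\<alpha> * a1 - \<alpha> * a2 = 0"
      using z[OF one_y_L(1)] by (simp only: wpair_simps) (simp add: one_y_xyx vals L_simps)
    have "\<beta> * a1 - \<beta> * a3 = 0"
      using z[OF one_y_L(2)] by (simp only: wpair_simps) (simp add: one_y_xyx vals L_simps)
    then have 2: "a1 = a3" using beta by simp
    have 3: "x 2 (i + n + n) = \<alpha> * x 2 (i + n) + \<beta> * x 2 i"
      using z[OF no_compat[of LY]] by (simp only: wpair_simps) (simp add: no_xyx vals algebra_simps)
    have 4: "x 3 i + \<alpha> * k = \<beta> * x 3 (i + m + n)"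
      using z[OF two_y_compat[of 1 0]] by (simp only: wpair_simps) (simp add: two_y_xyx vals algebra_simps k_def)
    have 5: "\<beta> * k = \<alpha> * x 3 i + \<beta> * x 3 (i + m)"
      using z[OF two_y_compat[of 0 1]] by (simp only: wpair_simps) (simp add: two_y_xyx vals algebra_simps k_def)
    show "eqF x i" unfolding eqF_def a prod.case k_def[symmetric] using 1 2 3 4 5 by (simp add: right_diff_distrib)
  next
    assume e: "eqF x i"
    note e' = e[unfolded eqF_def a prod.case]
    have e1: "\<alpha> * (a1 - a2) = 0" by (rule conjunct1[OF conjunct1[OF e']])
    have e1': "\<beta> * (a1 - a3) = 0" using e' by simp
    have e2: "x 2 (i + n + n) - \<alpha> * x 2 (i + n) - \<beta> * x 2 i = 0"
      and e3: "x 3 i + \<alpha> * k - \<beta> * x 3 (i + m + n) = 0" and e4: "\<beta> * k - \<alpha> * x 3 i - \<beta> * x 3 (i + m) = 0"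
      using e' by (simp_all add: k_def)
    have "dG x (RelF i) r = a1 * relation (RelF i) r + k * relation (RelG i) r" for r
    proof -
      have "dG x (RelF i) r = a1 * relation (RelF i) r + k * relation (RelG i) r
          + \<alpha> * (a1 - a2) * W i (xyx 1 1) r + \<beta> * (a1 - a3) * W i (xyx 0 2) r
          + (x 2 (i + n + n) - \<alpha> * x 2 (i + n) - \<beta> * x 2 i) * W i (xpow (m + 2)) r
          + (x 3 i + \<alpha> * k - \<beta> * x 3 (i + m + n)) * W i [LY, LX, LY] r
          + (\<beta> * k - \<alpha> * x 3 i - \<beta> * x 3 (i + m)) * W i [LY, LY, LX] r"
        unfolding dG relation_W xyx_words(1-3) k_def by (simp only: algebra_simps)
      then show ?thesis unfolding e1 e1' e2 e3 e4 by simp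
    qed
    then have d: "dG x (RelF i) = (\<lambda>r. a1 * relation (RelF i) r + k * relation (RelG i) r)" by (rule ext)
    have rF: "relation (RelF i) \<in> rel_ideal" using i by (intro relation_in) (simp add: relators_def)
    \<comment> \<open>\<open>RelG i\<close> is a relator for every i in question if n = m; otherwise
      coordinate 3 is zero by admissibility, and so is \<open>k\<close>.\<close>
    have kr: "(\<lambda>r. k * relation (RelG i) r) \<in> rel_ideal"
    proof (cases "n = m")
      case True
      have "RelG i \<in> relators" unfolding relators_def using i unfolding True by simp
      then show ?thesis by (intro rel_ideal_sums(2) relation_in)
    next
      case False
      then have "k = 0" using x by (simp add: k_def adm_def)
      then show ?thesis using rel_ideal_sums(2)[OF rF, of 0] by simp
    qed
    show "dG x (RelF i) \<in> rel_ideal"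
      unfolding d by (rule rel_ideal_sums(1)[OF rel_ideal_sums(2)[OF rF] kr])
  qed
qed

text \<open>A relation \<open>f\<close> moves \<open>y\<close> to the left, from k letters
  \<open>x\<close> in front of it to k - 1 and k - 2. So the coefficients obey the recurrence of
  \<open>L\<close>, and the words with k = 0 and k = 1 are already reduced.\<close>

lemma xyx_reduce:
  assumes "1 \<le> u" "u + (k + l) * n + m \<le> 2 * (n + m)" "k + l = Suc N"
  shows "(\<lambda>r. W u (xyx k l) r - L (Suc k) * W u (xyx 1 N) r - \<beta> * L k * W u (xyx 0 (Suc N)) r) \<in> rel_ideal"
  using assms
proof (induction k arbitrary: l rule: less_induct)
  case (less k)
  have zero: "(\<lambda>_. 0) \<in> rel_ideal" using I.VQ.sub_zero by (simp add: Qv.PA_simps)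
  consider "k = 0" | "k = 1" | k' where "k = Suc (Suc k')" by (cases k; cases "k - 1") auto
  then show ?case
  proof cases
    case 1
    then have "l = Suc N" using less.prems by simp
    then show ?thesis using 1 zero by (simp add: L_simps)
  next
    case 2
    then have "l = N" using less.prems by simp
    then show ?thesis using 2 zero by (simp add: L_simps)
  next
    case (3 k')
    \<comment> \<open>The relation is applied at the vertex reached after \<open>x^k'\<close>. The
      weight bound puts this vertex among 1, ..., m, where relations \<open>f\<close> start.\<close>
    have le: "u + k' * n \<le> m" using less.prems(2) 3 by (simp add: algebra_simps)
    have ideal: "mul (W u (replicate k' LX)) (mul (relation (RelF (u + k' * n)))
        (W (u + k' * n + (n + n + m)) (replicate l LX))) \<in> rel_ideal" (is "?R \<in> _")
    proof -
      have r: "relation (RelF (u + k' * n)) \<in> rel_ideal"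
        using le less.prems(1) by (intro relation_in) (auto simp: relators_def)
      have w: "W u (replicate k' LX) \<in> carrier KQ" "W (u + k' * n + (n + n + m)) (replicate l LX) \<in> carrier KQ"
        using less.prems(1,2) 3 by (auto intro!: W_closed simp: algebra_simps)
      show ?thesis
        using I.I.I_l_closed[OF I.I.I_r_closed[OF r w(2)] w(1)] by (simp only: Qv.PA_simps(5))
    qed
    have R: "?R = (\<lambda>r. W u (xyx k l) r + ((- \<alpha>) * W u (xyx (Suc k') (Suc l)) r + (- \<beta>) * W u (xyx k' (Suc (Suc l))) r))"
    proof -
      have w: "replicate k' LX @ [LX, LX, LY] @ replicate l LX = xyx k l"
        "replicate k' LX @ [LX, LY, LX] @ replicate l LX = xyx (Suc k') (Suc l)"
        "replicate k' LX @ [LY, LX, LX] @ replicate l LX = xyx k' (Suc (Suc l))"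
        by (simp_all add: xyx_def 3 replicate_app_Cons_same)
      have rel: "relation (RelF i) = (\<lambda>p. W i [LX, LX, LY] p + ((- \<alpha>) * W i [LX, LY, LX] p + (- \<beta>) * W i [LY, LX, LX] p))" for i
        unfolding relation_W by (rule ext) simp
      have d: "deg [LX, LX, LY] = n + n + m" "deg [LX, LY, LX] = n + n + m" "deg [LY, LX, LX] = n + n + m" by simp_all
      show ?thesis
        unfolding rel Qv.pmult_add_left Qv.pmult_scale_left W_mult d Qv.pmult_add_right Qv.pmult_scale_right
          if_P[OF refl] deg_replicate w ..
    qed
    have IH1: "(\<lambda>r. W u (xyx (Suc k') (Suc l)) r - L (Suc (Suc k')) * W u (xyx 1 N) r - \<beta> * L (Suc k') * W u (xyx 0 (Suc N)) r) \<in> rel_ideal"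
      by (rule less.IH) (use less.prems 3 in auto)
    have IH0: "(\<lambda>r. W u (xyx k' (Suc (Suc l))) r - L (Suc k') * W u (xyx 1 N) r - \<beta> * L k' * W u (xyx 0 (Suc N)) r) \<in> rel_ideal"
      by (rule less.IH) (use less.prems 3 in auto)
    have "(\<lambda>r. ?R r + (\<alpha> * (W u (xyx (Suc k') (Suc l)) r - L (Suc (Suc k')) * W u (xyx 1 N) r - \<beta> * L (Suc k') * W u (xyx 0 (Suc N)) r)
        + \<beta> * (W u (xyx k' (Suc (Suc l))) r - L (Suc k') * W u (xyx 1 N) r - \<beta> * L k' * W u (xyx 0 (Suc N)) r))) \<in> rel_ideal"
      by (rule rel_ideal_sums(1)[OF ideal rel_ideal_sums(1)[OF rel_ideal_sums(2)[OF IH1] rel_ideal_sums(2)[OF IH0]]])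
    moreover have "(\<lambda>r. ?R r + (\<alpha> * (W u (xyx (Suc k') (Suc l)) r - L (Suc (Suc k')) * W u (xyx 1 N) r - \<beta> * L (Suc k') * W u (xyx 0 (Suc N)) r)
        + \<beta> * (W u (xyx k' (Suc (Suc l))) r - L (Suc k') * W u (xyx 1 N) r - \<beta> * L k' * W u (xyx 0 (Suc N)) r)))
      = (\<lambda>r. W u (xyx k l) r - L (Suc k) * W u (xyx 1 N) r - \<beta> * L k * W u (xyx 0 (Suc N)) r)"
      unfolding R by (rule ext) (simp add: 3 L_step algebra_simps)
    ultimately show ?thesis by simp
  qed
qed

lemma eqG_iff:
  assumes x: "adm x" and j: "j \<in> {1..n}"
  shows "dG x (RelG j) \<in> rel_ideal \<longleftrightarrow> eqG x j"
proof -
  obtain b1 b2 b3 where b: "rG x j = (b1, b2, b3)" by (cases "rG x j")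
  note dG = dG_G[OF x b[symmetric]]
  \<comment> \<open>\<open>K\<close> is the coefficient of \<open>x^(m+1) y\<close> in
    \<open>dG x (RelG j)\<close>; that of \<open>x^m y x\<close> is - \<beta> times
    \<open>x 2 j\<close>.\<close>
  define K where "K = x 2 (j + n) - \<alpha> * x 2 j"
  show ?thesis
  proof
    assume r: "dG x (RelG j) \<in> rel_ideal"
    note z = wpair_ideal[OF _ r, unfolded dG]
    have 1: "\<alpha> * b1 - \<alpha> * b2 = 0"
      using z[OF two_y_compat[of 1 0]] by (simp only: wpair_simps) (simp add: two_y_xyx vals)
    have "\<beta> * b1 - \<beta> * b3 = 0"
      using z[OF two_y_compat[of 0 1]] by (simp only: wpair_simps) (simp add: two_y_xyx vals)
    then have 2: "b1 = b3" using beta by simp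
    have 3: "x 3 j = \<alpha> * x 3 (j + m) + \<beta> * x 3 (j + m + m)"
      using z[OF no_compat[of LX]] by (simp only: wpair_simps) (simp add: no_xyx vals algebra_simps)
    have 4: "K * L (Suc (Suc m)) + x 2 (j + n + m) = \<beta> * x 2 j * L (Suc m)"
      using z[OF one_y_L(1)]
      by (simp only: wpair_simps) (simp add: one_y_xyx vals L_simps K_def algebra_simps)
    have 5: "K * (\<beta> * L (Suc m)) = \<alpha> * x 2 (j + m + n) + \<beta> * x 2 (j + m) + \<beta> * x 2 j * (\<beta> * L m)"
      using z[OF one_y_L(2)]
      by (simp only: wpair_simps) (simp add: one_y_xyx vals L_simps K_def algebra_simps)
    show "eqG x j" unfolding eqG_def b prod.case K_def[symmetric] using 1 2 3 4 5 by (simp add: right_diff_distrib)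
  next
    assume e: "eqG x j"
    note e' = e[unfolded eqG_def b prod.case]
    have e1: "\<alpha> * (b1 - b2) = 0" by (rule conjunct1[OF conjunct1[OF e']])
    have e1': "\<beta> * (b1 - b3) = 0" using e' by simp
    have e2: "x 3 j - \<alpha> * x 3 (j + m) - \<beta> * x 3 (j + m + m) = 0"
      and e3: "K * L (Suc (Suc m)) + x 2 (j + n + m) - \<beta> * x 2 j * L (Suc m) = 0"
      and e4: "K * (\<beta> * L (Suc m)) - \<alpha> * x 2 (j + m + n) - \<beta> * x 2 (j + m) - \<beta> * x 2 j * (\<beta> * L m) = 0"
      using e' by (simp_all add: K_def)
    \<comment> \<open>\<open>s k l\<close> is the difference of \<open>x^k y x^l\<close> and its
      reduced form.\<close>
    define s where "s k l = (\<lambda>r. W j (xyx k l) r - L (Suc k) * W j (xyx 1 m) r - \<beta> * L k * W j (xyx 0 (Suc m)) r)" for k l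
    have d: "dG x (RelG j) = (\<lambda>r. b1 * relation (RelG j) r + (K * s (Suc m) 0 r + (- (\<beta> * x 2 j)) * s m 1 r))"
    proof
      fix r
      have "dG x (RelG j) r = b1 * relation (RelG j) r + (K * s (Suc m) 0 r + (- (\<beta> * x 2 j)) * s m 1 r)
          + \<alpha> * (b1 - b2) * W j [LY, LX, LY] r + \<beta> * (b1 - b3) * W j [LY, LY, LX] r
          + (x 3 j - \<alpha> * x 3 (j + m) - \<beta> * x 3 (j + m + m)) * W j [LY, LY, LY] r
          + (K * L (Suc (Suc m)) + x 2 (j + n + m) - \<beta> * x 2 j * L (Suc m)) * W j (xyx 1 m) r
          + (K * (\<beta> * L (Suc m)) - \<alpha> * x 2 (j + m + n) - \<beta> * x 2 (j + m) - \<beta> * x 2 j * (\<beta> * L m)) * W j (xyx 0 (Suc m)) r"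
        unfolding dG relation_W s_def K_def by (simp add: algebra_simps)
      then show "dG x (RelG j) r = b1 * relation (RelG j) r + (K * s (Suc m) 0 r + (- (\<beta> * x 2 j)) * s m 1 r)"
        unfolding e1 e1' e2 e3 e4 by simp
    qed
    have rG: "relation (RelG j) \<in> rel_ideal" using j by (intro relation_in) (simp add: relators_def)
    \<comment> \<open>For n = 1 both reductions lie in the ideal. For n > 1 admissibility makes both
      of their coefficients zero.\<close>
    show "dG x (RelG j) \<in> rel_ideal"
    proof (cases "n = 1")
      case True
      have "s (Suc m) 0 \<in> rel_ideal" unfolding s_def by (rule xyx_reduce) (use j True in auto)
      moreover have "s m 1 \<in> rel_ideal" unfolding s_def by (rule xyx_reduce) (use j True in auto)
      ultimately show ?thesis unfolding d by (intro rel_ideal_sums rG)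
    next
      case False
      then have "K = 0" "x 2 j = 0" using x by (simp_all add: K_def adm_def)
      then show ?thesis unfolding d using rel_ideal_sums(2)[OF rG, of b1] by simp
    qed
  qed
qed

lemma cocycle_eqs:
  assumes "adm x"
  shows "coch x \<in> cocycles \<longleftrightarrow> (\<forall>i\<in>{1..m}. eqF x i) \<and> (\<forall>j\<in>{1..n}. eqG x j)"
  unfolding cocycle_iff[OF assms] relators_def ball_Un ball_simps using eqF_iff[OF assms] eqG_iff[OF assms] by simp

end

subsection \<open>Bases of quotient spaces\<close>

text \<open>Spanning and independence are stated for representatives modulo \<open>N\<close>, so
  that users never handle cosets. Distinctness of the classes is a consequence of
  independence.\<close>

lemma basis_list_quot:
  fixes V :: "('k::field, 'm) module" and N zs
  defines "Q \<equiv> quot V N"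
  assumes V: "vspace V" and N: "subsp N V" and zs: "set zs \<subseteq> carrier V"
    and span: "\<And>z. z \<in> carrier V \<Longrightarrow> \<exists>c. \<exists>b\<in>N. z = (\<Oplus>\<^bsub>V\<^esub>i\<in>{..<length zs}. c i \<odot>\<^bsub>V\<^esub> zs ! i) \<oplus>\<^bsub>V\<^esub> b"
    and indep: "\<And>c i. (\<Oplus>\<^bsub>V\<^esub>i\<in>{..<length zs}. c i \<odot>\<^bsub>V\<^esub> zs ! i) \<in> N \<Longrightarrow> i < length zs \<Longrightarrow> c i = 0"
  shows "basis_list Q (map (\<lambda>z. N +>\<^bsub>V\<^esub> z) zs)"
proof -
  interpret V: vsp_quot V N by (rule vsp_quotI[OF V N])
  have Qv: "vspace Q" unfolding Q_def by (rule V.vspace_quot)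
  interpret Q: vsp Q by (rule vspI[OF Qv])
  let ?k = "\<lambda>z. N +>\<^bsub>V\<^esub> z" and ?I = "{..<length zs}"
  let ?s = "\<lambda>c. \<Oplus>\<^bsub>V\<^esub>i\<in>?I. c i \<odot>\<^bsub>V\<^esub> zs ! i"
  have k: "?k \<in> lin V Q" unfolding Q_def by (rule V.coset_lin)
  have zin: "zs ! i \<in> carrier V" if "i < length zs" for i using that zs by auto
  have sin: "?s c \<in> carrier V" for c by (rule V.M.finsum_closed) (auto simp: zin)
  have zero: "\<zero>\<^bsub>Q\<^esub> = N" unfolding Q_def by (rule V.quot_zero)
  have ks: "?k (?s c) = (\<Oplus>\<^bsub>Q\<^esub>i\<in>?I. c i \<odot>\<^bsub>Q\<^esub> ?k (zs ! i))" for c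
  proof -
    have "?k (?s c) = (\<Oplus>\<^bsub>Q\<^esub>i\<in>?I. ?k (c i \<odot>\<^bsub>V\<^esub> zs ! i))"
      by (rule lin_finsum[OF V Qv k]) (auto simp: zin)
    also have "\<dots> = (\<Oplus>\<^bsub>Q\<^esub>i\<in>?I. c i \<odot>\<^bsub>Q\<^esub> ?k (zs ! i))"
    proof (rule Q.M.finsum_cong'[OF refl])
      show "(\<lambda>i. c i \<odot>\<^bsub>Q\<^esub> ?k (zs ! i)) \<in> ?I \<rightarrow> carrier Q"
        by (rule Pi_I) (simp add: lin_closed[OF k zin])
    qed (simp add: lin_smult[OF k zin])
    finally show ?thesis .
  qed
  have inj: "inj_on (\<lambda>i. ?k (zs ! i)) ?I"
  proof (rule inj_onI, rule ccontr)
    fix i j assume ij: "i \<in> ?I" "j \<in> ?I" "?k (zs ! i) = ?k (zs ! j)" "i \<noteq> j"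
    \<comment> \<open>Equal classes would put the combination with coefficients 1 and -1 into
      \<open>N\<close>.\<close>
    define c where "c l = (if l = i then 1 else if l = j then - 1 else 0 :: 'k)" for l
    have "?s c = (\<Oplus>\<^bsub>V\<^esub>l\<in>{i, j}. c l \<odot>\<^bsub>V\<^esub> zs ! l)"
      by (rule V.M.add.finprod_mono_neutral_cong_right) (use ij zin in \<open>auto simp: c_def\<close>)
    also have "\<dots> = zs ! i \<ominus>\<^bsub>V\<^esub> zs ! j"
      using ij zin[of i] zin[of j] V.minus_one_smult[of "zs ! j"] by (simp add: c_def V.minus_eq_add)
    also have "\<dots> \<in> N" using V.coset_eq_iff[of "zs ! i" "zs ! j"] ij zin by simp
    finally have "c i = 0" using indep[of c i] ij(1) by simp
    then show False by (simp add: c_def)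
  qed
  define S where "S = set (map ?k zs)"
  have S: "S = (\<lambda>i. ?k (zs ! i)) ` ?I"
  proof -
    have "set zs = (!) zs ` ?I" by (auto simp: set_conv_nth)
    then show ?thesis by (simp add: S_def image_image)
  qed
  have Sc: "S \<subseteq> carrier Q" unfolding S using lin_closed[OF k zin] by auto
  have finS: "finite S" by (simp add: S_def)
  have lc: "Q.lincomb a S = ?k (?s (\<lambda>i. a (?k (zs ! i))))" for a
  proof -
    have "Q.lincomb a S = (\<Oplus>\<^bsub>Q\<^esub>v\<in>S. a v \<odot>\<^bsub>Q\<^esub> v)" by (simp add: Q.lincomb_def)
    also have "\<dots> = (\<Oplus>\<^bsub>Q\<^esub>i\<in>?I. a (?k (zs ! i)) \<odot>\<^bsub>Q\<^esub> ?k (zs ! i))"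
      unfolding S by (rule Q.M.add.finprod_reindex[OF _ inj]) (use lin_closed[OF k zin] in auto)
    finally show ?thesis unfolding ks .
  qed
  have ind: "\<not> Q.lin_dep S"
  proof (rule Q.finite_lin_indpt2[OF finS Sc])
    fix a :: "'m set \<Rightarrow> 'k" assume "Q.lincomb a S = \<zero>\<^bsub>Q\<^esub>"
    then have "?s (\<lambda>i. a (?k (zs ! i))) \<in> N"
      unfolding lc zero using V.coset_eq_zero_iff[OF sin] by simp
    from indep[OF this] have "a (?k (zs ! i)) = 0" if "i < length zs" for i using that by simp
    then show "\<forall>v\<in>S. a v = \<zero>\<^bsub>class_ring\<^esub>" unfolding S by simp
  qed
  have gen: "Q.span S = carrier Q"
  proof
    show "Q.span S \<subseteq> carrier Q" by (rule Q.span_is_subset2[OF Sc])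
    show "carrier Q \<subseteq> Q.span S"
    proof
      fix X assume "X \<in> carrier Q"
      then obtain z where z: "z \<in> carrier V" "X = ?k z" unfolding Q_def V.quot_carrier by blast
      obtain c b where cb: "b \<in> N" "z = ?s c \<oplus>\<^bsub>V\<^esub> b" using span[OF z(1)] by blast
      have bV: "b \<in> carrier V" by (rule V.sub_carrier[OF cb(1)])
      have "?k b = \<zero>\<^bsub>Q\<^esub>" unfolding zero using V.coset_eq_zero_iff[OF bV] cb(1) by simp
      then have X: "X = ?k (?s c)"
        using lin_add[OF k sin[of c] bV] lin_closed[OF k sin[of c]] cb(2) z(2) by simp
      \<comment> \<open>Linear combinations over a set take coefficients indexed by its elements;
        injectivity of the classes allows their positions in the list to be recovered.\<close>
      define a where "a v = c (the_inv_into ?I (\<lambda>i. ?k (zs ! i)) v)" for v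
      have "a (?k (zs ! i)) = c i" if "i < length zs" for i
        using the_inv_into_f_f[OF inj, of i] that by (simp add: a_def)
      then have "?s (\<lambda>i. a (?k (zs ! i))) = ?s c"
        by (intro V.M.finsum_cong') (auto simp: zin)
      then have "X = Q.lincomb a S" unfolding lc X by simp
      then show "X \<in> Q.span S" unfolding Q.finite_span[OF finS Sc] by auto
    qed
  qed
  have "distinct (map ?k zs)"
    unfolding distinct_conv_nth using inj by (auto simp: inj_on_def)
  then show ?thesis
    using ind gen Sc unfolding basis_list_def Q.basis_def S_def by simp
qed

section \<open>From the first cohomology space to coordinates\<close>

context down_up
begin

lemma dhat2_lin:
  shows "dhat2 \<in> lin Phat1 Phat2" and "vspace Phat2"
proof -
  show v: "vspace Phat2" unfolding Phat2_def P_eqs by (rule R2.hom_space_vspace[OF B.regular_bimod])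
  have d: "d2 z \<in> carrier P1" if "z \<in> carrier P2" for z
    using lin_closed[OF R2.hom_lin[OF d2_hom[unfolded P_eqs(3)]]] that unfolding P_eqs(3) by simp
  show "dhat2 \<in> lin Phat1 Phat2"
  proof (rule linI)
    show "dhat2 \<phi> \<in> carrier Phat2" if "\<phi> \<in> carrier Phat1" for \<phi>
      using compose_bimodule_hom[OF P2_bimod d2_hom that[unfolded Phat1_carrier]]
      by (simp add: dhat2_def Phat2_def hom_space_def)
    show "dhat2 (\<phi> \<oplus>\<^bsub>Phat1\<^esub> \<psi>) = dhat2 \<phi> \<oplus>\<^bsub>Phat2\<^esub> dhat2 \<psi>" for \<phi> \<psi>
      unfolding dhat2_def compose_def
      by (simp add: Phat2_def hom_space_def fun_eq_iff restrict_def d Phat1_at B.regular_bimodule_simps)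
    show "dhat2 (c \<odot>\<^bsub>Phat1\<^esub> \<phi>) = c \<odot>\<^bsub>Phat2\<^esub> dhat2 \<phi>" for c \<phi>
      unfolding dhat2_def compose_def
      by (simp add: Phat2_def hom_space_def fun_eq_iff restrict_def d Phat1_at B.regular_bimodule_simps)
  qed
qed

lemma cocycles_subsp: "subsp cocycles Phat1"
  unfolding cocycles_def by (rule lin_ker_subsp[OF Phat1_vspace dhat2_lin(2) dhat2_lin(1)])

text \<open>Coordinates are functions on all natural numbers, but a cochain depends only on their
  values at indices of arrows.\<close>

definition agree :: "(nat \<Rightarrow> nat \<Rightarrow> 'k) \<Rightarrow> (nat \<Rightarrow> nat \<Rightarrow> 'k) \<Rightarrow> bool" where
  "agree x y \<longleftrightarrow> (\<forall>i\<in>{1..n + 2 * m}. x 0 i = y 0 i \<and> x 3 i = y 3 i) \<and>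
     (\<forall>j\<in>{1..2 * n + m}. x 1 j = y 1 j \<and> x 2 j = y 2 j)"

lemma no_vals: "no LY (alt LX) = 0" "no LX (alt LX) = 1" "no LX (alt LY) = 0" "no LY (alt LY) = 1"
  "no LY [LX] = 1" "no LX [LX] = 0" "no LY [LY] = 0" "no LX [LY] = 1"
proof -
  have "count_list (replicate m LX) LX \<noteq> 0" using n1 nm by (cases m) auto
  then show "no LX (alt LY) = 0" by (simp add: no_def)
qed (simp_all add: no_def count_replicate)

text \<open>\<open>no LX\<close> and \<open>no LY\<close> separate an arrow from its alternative
  word, so the two coefficients of each value are determined by its class in the algebra.\<close>

lemma coch_eq_iff:
  assumes x: "adm x" and y: "adm y"
  shows "coch x = coch y \<longleftrightarrow> agree x y"
proof
  assume "agree x y"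
  then show "coch x = coch y"
    using x y
  proof (intro coch_cong[OF x y])
    fix l i assume "1 \<le> i" "i + wt l \<le> 2 * (n + m)"
    then show "x (ix l) i = y (ix l) i \<and> x (jx l) i = y (jx l) i"
      using \<open>agree x y\<close> by (cases l) (auto simp: agree_def)
  qed
next
  assume e: "coch x = coch y"
  have main: "x (ix l) i = y (ix l) i \<and> x (jx l) i = y (jx l) i" if "1 \<le> i" "i + wt l \<le> 2 * (n + m)" for l i
  proof -
    have a: "arr l i \<in> arcs quiver" using that by (simp add: arr_simps)
    note fx = F_closed[OF x a] and fy = F_closed[OF y a]
    have c: "cls (F x l i) = cls (F y l i)" using e coch_gen[OF x a] coch_gen[OF y a] by simp
    have "cls (\<lambda>p. F x l i p - F y l i p) = \<zero>\<^bsub>algebra\<^esub>"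
    proof -
      have "cls (\<lambda>p. F x l i p - F y l i p) = cls (\<lambda>p. F x l i p + - 1 * F y l i p)" by simp
      also have "\<dots> = cls (F x l i) \<oplus>\<^bsub>algebra\<^esub> (- 1) \<odot>\<^bsub>algebra\<^esub> cls (F y l i)"
        using cls_add[OF fx KQ_sums(3)[OF fy, of "- 1"]] cls_smult[OF fy, of "- 1"] by simp
      also have "\<dots> = \<zero>\<^bsub>algebra\<^esub>"
        using B.A.minus_one_smult[OF cls_closed[OF fy]] B.A.M.r_neg[OF cls_closed[OF fy]] unfolding c by simp
      finally show ?thesis .
    qed
    then have r: "(\<lambda>p. F x l i p - F y l i p) \<in> rel_ideal" using cls_eq_zero[OF KQ_sums(2)[OF fx fy]] by simp
    have "wpair (no l') (\<lambda>p. (x (ix l) i * W i [l] p + x (jx l) i * W i (alt l) p)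
        - (y (ix l) i * W i [l] p + y (jx l) i * W i (alt l) p)) = 0" for l'
      using wpair_ideal[OF no_compat r, of l'] unfolding F_def .
    then have "(x (ix l) i * no l' [l] + x (jx l) i * no l' (alt l)) - (y (ix l) i * no l' [l] + y (jx l) i * no l' (alt l)) = 0" for l'
      by (simp only: wpair_simps)
    from this[of LX] this[of LY] show ?thesis by (cases l) (simp_all only: no_vals ix.simps jx.simps, simp_all)
  qed
  show "agree x y"
    unfolding agree_def
  proof (intro conjI ballI)
    fix i assume i: "i \<in> {1..n + 2 * m}"
    have "1 \<le> i" "i + wt LX \<le> 2 * (n + m)" using i by auto
    from main[OF this] show "x 0 i = y 0 i" "x 3 i = y 3 i" by simp_all
  next
    fix i assume i: "i \<in> {1..2 * n + m}"
    have "1 \<le> i" "i + wt LY \<le> 2 * (n + m)" using i by auto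
    from main[OF this] show "x 1 i = y 1 i" "x 2 i = y 2 i" by simp_all
  qed
qed

definition solution :: "(nat \<Rightarrow> nat \<Rightarrow> 'k) \<Rightarrow> bool" where
  "solution x \<longleftrightarrow> adm x \<and> (\<forall>i\<in>{1..m}. eqF x i) \<and> (\<forall>j\<in>{1..n}. eqG x j)"

text \<open>The differences telescope, so the sums along parallel paths agree. This coordinate check
  replaces the computation of the composite of the two differentials.\<close>

lemma solution_cob: "solution (cob u)"
  unfolding solution_def eqF_def eqG_def rF_def rG_def
  by (simp add: adm_cob) (simp add: cob_def algebra_simps)

text \<open>After this reduction the claim concerns only functions of indices: solutions of the
  equations modulo differences of functions on vertices.\<close>

lemma basis_HH1:
  assumes xs: "\<And>x. x \<in> set xs \<Longrightarrow> solution x"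
    and span: "\<And>y. solution y \<Longrightarrow>
      \<exists>c u. agree y (\<lambda>k i. (\<Sum>l<length xs. c l * (xs ! l) k i) + cob u k i)"
    and indep: "\<And>c u l. agree (\<lambda>k i. \<Sum>l<length xs. c l * (xs ! l) k i) (cob u) \<Longrightarrow> l < length xs \<Longrightarrow> c l = 0"
  shows "basis_list HH1 (map (\<lambda>x. cohom_class (coch x)) xs)"
proof -
  let ?Z = "Phat1\<lparr>carrier := cocycles\<rparr>"
  have Zv: "vspace ?Z" by (rule subsp_vspace[OF Phat1_vspace cocycles_subsp])
  have sol: "coch x \<in> cocycles \<longleftrightarrow> solution x" if "adm x" for x
    using cocycle_eqs[OF that] that by (simp add: solution_def)
  have adm: "adm x" if "x \<in> set xs" for x using xs[OF that] by (simp add: solution_def)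
  have Bsub: "subsp coboundaries ?Z"
  proof (rule subspI[OF Zv])
    show "coboundaries \<subseteq> carrier ?Z"
      unfolding coboundaries_eq using sol[OF adm_cob] solution_cob by auto
    have "\<zero>\<^bsub>Phat1\<^esub> = coch (cob (\<lambda>_. 0))"
      unfolding coch_zero[symmetric] by (rule arg_cong[of _ _ coch], intro ext) (simp add: cob_def)
    then show "\<zero>\<^bsub>?Z\<^esub> \<in> coboundaries" by (simp add: coboundaries_eq)
    show "\<phi> \<oplus>\<^bsub>?Z\<^esub> \<psi> \<in> coboundaries" if \<phi>: "\<phi> \<in> coboundaries" "\<psi> \<in> coboundaries" for \<phi> \<psi>
    proof -
      obtain u v where "\<phi> = coch (cob u)" "\<psi> = coch (cob v)" using \<phi> unfolding coboundaries_eq by blast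
      then have "\<phi> \<oplus>\<^bsub>Phat1\<^esub> \<psi> = coch (\<lambda>k i. cob u k i + cob v k i)" using coch_add[OF adm_cob adm_cob] by simp
      also have "(\<lambda>k i. cob u k i + cob v k i) = cob (\<lambda>i. u i + v i)" by (auto simp: cob_def fun_eq_iff)
      finally show ?thesis by (simp add: coboundaries_eq)
    qed
    show "c \<odot>\<^bsub>?Z\<^esub> \<phi> \<in> coboundaries" if \<phi>: "\<phi> \<in> coboundaries" for c \<phi>
    proof -
      obtain u where "\<phi> = coch (cob u)" using \<phi> unfolding coboundaries_eq by blast
      then have "c \<odot>\<^bsub>Phat1\<^esub> \<phi> = coch (\<lambda>k i. c * cob u k i)" using coch_smult[OF adm_cob] by simp
      also have "(\<lambda>k i. c * cob u k i) = cob (\<lambda>i. c * u i)" by (auto simp: cob_def fun_eq_iff algebra_simps)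
      finally show ?thesis by (simp add: coboundaries_eq)
    qed
  qed
  let ?zs = "map coch xs"
  have adm_comb: "adm (\<lambda>k i. \<Sum>l<length xs. c l * (xs ! l) k i)" for c
    using adm[OF nth_mem] by (auto simp: adm_def)
  have comb: "(\<Oplus>\<^bsub>?Z\<^esub>l\<in>{..<length ?zs}. c l \<odot>\<^bsub>?Z\<^esub> ?zs ! l) = coch (\<lambda>k i. \<Sum>l<length xs. c l * (xs ! l) k i)" for c
  proof -
    have zin: "coch (xs ! l) \<in> cocycles" if "l < length xs" for l
      using sol[OF adm[OF nth_mem[OF that]]] xs[OF nth_mem[OF that]] by simp
    have a: "adm (\<lambda>k i. c l * (xs ! l) k i)" if "l < length xs" for l
      using adm[OF nth_mem[OF that]] by (auto simp: adm_def)
    interpret Z: vsp_sub Phat1 cocycles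
      by (intro vsp_sub.intro vspI[OF Phat1_vspace] vsp_sub_axioms.intro cocycles_subsp)
    interpret ZM: vsp ?Z by (rule vspI[OF Zv])
    have "(\<Oplus>\<^bsub>?Z\<^esub>l\<in>{..<length xs}. c l \<odot>\<^bsub>?Z\<^esub> ?zs ! l) = (\<Oplus>\<^bsub>?Z\<^esub>l\<in>{..<length xs}. coch (\<lambda>k i. c l * (xs ! l) k i))"
    proof (rule ZM.M.finsum_cong'[OF refl])
      show "(\<lambda>l. coch (\<lambda>k i. c l * (xs ! l) k i)) \<in> {..<length xs} \<rightarrow> carrier ?Z"
      proof (rule Pi_I)
        fix l assume l: "l \<in> {..<length xs}"
        then have "c l \<odot>\<^bsub>Phat1\<^esub> coch (xs ! l) \<in> cocycles" by (intro Z.sub_smult zin) simp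
        then show "coch (\<lambda>k i. c l * (xs ! l) k i) \<in> carrier ?Z" using coch_smult adm l by simp
      qed
    qed (simp add: coch_smult adm)
    \<comment> \<open>The sums live in two records with different carriers; the identity map is
      linear from the subspace to \<open>Phat1\<close> and carries one to the other.\<close>
    also have "\<dots> = (\<Oplus>\<^bsub>Phat1\<^esub>l\<in>{..<length xs}. coch (\<lambda>k i. c l * (xs ! l) k i))"
    proof (rule lin_finsum[OF Zv Phat1_vspace, where f = "\<lambda>z. z"])
      show "(\<lambda>z. z) \<in> lin ?Z Phat1" by (rule linI) (simp_all add: Z.sub_carrier)
      fix l assume l: "l \<in> {..<length xs}"
      then have "c l \<odot>\<^bsub>Phat1\<^esub> coch (xs ! l) \<in> cocycles" by (intro Z.sub_smult zin) simp
      then show "coch (\<lambda>k i. c l * (xs ! l) k i) \<in> carrier ?Z" using coch_smult adm l by simp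
    qed simp
    also have "\<dots> = coch (\<lambda>k i. \<Sum>l<length xs. c l * (xs ! l) k i)"
      by (rule coch_finsum) (use a in auto)
    finally show ?thesis by simp
  qed
  have "basis_list (quot ?Z coboundaries) (map (\<lambda>z. coboundaries +>\<^bsub>?Z\<^esub> z) ?zs)"
  proof (rule basis_list_quot[OF Zv Bsub])
    show "set ?zs \<subseteq> carrier ?Z" using sol[OF adm] xs by auto
    show "\<exists>c. \<exists>b\<in>coboundaries. z = (\<Oplus>\<^bsub>?Z\<^esub>l\<in>{..<length ?zs}. c l \<odot>\<^bsub>?Z\<^esub> ?zs ! l) \<oplus>\<^bsub>?Z\<^esub> b"
      if "z \<in> carrier ?Z" for z
    proof -
      have z: "z \<in> cocycles" using that by simp
      then have "z \<in> carrier Phat1" by (simp add: cocycles_def)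
      then obtain y where y: "adm y" "z = coch y" by (rule coch_surj)
      have "solution y" using sol[OF y(1)] z y(2) by simp
      then obtain c u where cu: "agree y (\<lambda>k i. (\<Sum>l<length xs. c l * (xs ! l) k i) + cob u k i)"
        using span by blast
      have a: "adm (\<lambda>k i. (\<Sum>l<length xs. c l * (xs ! l) k i) + cob u k i)"
        using adm_comb[of c] adm_cob[of u] by (auto simp: adm_def)
      have "z = coch (\<lambda>k i. \<Sum>l<length xs. c l * (xs ! l) k i) \<oplus>\<^bsub>Phat1\<^esub> coch (cob u)"
        unfolding y(2) coch_add[OF adm_comb adm_cob] using coch_eq_iff[OF y(1) a] cu by simp
      then have "z = (\<Oplus>\<^bsub>?Z\<^esub>l\<in>{..<length ?zs}. c l \<odot>\<^bsub>?Z\<^esub> ?zs ! l) \<oplus>\<^bsub>?Z\<^esub> coch (cob u)"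
        unfolding comb by simp
      then show ?thesis by (intro exI bexI) (assumption, simp add: coboundaries_eq)
    qed
    show "c l = 0" if h: "(\<Oplus>\<^bsub>?Z\<^esub>l\<in>{..<length ?zs}. c l \<odot>\<^bsub>?Z\<^esub> ?zs ! l) \<in> coboundaries" and l: "l < length ?zs" for c l
    proof -
      obtain u where "coch (\<lambda>k i. \<Sum>l<length xs. c l * (xs ! l) k i) = coch (cob u)"
        using h unfolding comb coboundaries_eq by (rule imageE)
      then show ?thesis
        using indep[of c u l] coch_eq_iff[OF adm_comb adm_cob] l by simp
    qed
  qed
  then show ?thesis unfolding HH1_def cohom_class_def[abs_def] by (simp add: comp_def a_r_coset_def r_coset_def)
qed

subsection \<open>The graph of the arrows as a cycle with chords\<close>

abbreviation N where "N \<equiv> n + m"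

text \<open>One step along the cycle: forwards along \<open>x\<^sub>k\<close> if
  \<open>k \<le> m\<close>, and otherwise backwards along \<open>y\<^sub>k\<^sub>-\<^sub>m\<close>.
  On 1, ..., n + m it is addition of n modulo n + m.\<close>

definition nxt :: "nat \<Rightarrow> nat" where "nxt k = (if k \<le> m then k + n else k - m)"

text \<open>Since \<open>n\<close> is prime to \<open>n + m\<close>, iterating \<open>nxt\<close> from the vertex \<open>1\<close> visits all of \<open>1, \<dots>, n + m\<close>.\<close>

definition idx :: "nat \<Rightarrow> nat" where "idx t = Suc (t * n mod N)"

lemma idx_0: "idx 0 = 1" by (simp add: idx_def)
lemma idx_N: "idx (t + N) = idx t"
proof -
  have "(t + N) * n = t * n + n * N" by (simp add: algebra_simps)
  then show ?thesis by (simp only: idx_def mod_mult_self1)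
qed

lemma idx_range: "idx t \<in> {1..N}"
  using n1 by (simp add: idx_def Suc_le_eq)

lemma idx_Suc: "idx (Suc t) = nxt (idx t)"
proof -
  define r where "r = t * n mod N"
  have r: "r < N" using n1 by (simp add: r_def)
  have "Suc t * n mod N = (r + n) mod N" by (simp add: r_def mod_simps add.commute)
  also have "\<dots> = (if r < m then r + n else r - m)"
  proof (cases "r < m")
    case False
    then have "(r + n) mod N = (r + n - N) mod N" by (intro le_mod_geq) simp
    then show ?thesis using False r by simp
  qed simp
  finally show ?thesis by (simp add: idx_def nxt_def r_def[symmetric] Suc_le_eq Suc_diff_le)
qed

lemma idx_inj: "inj_on idx {..<N}"
proof (rule inj_onI)
  fix s t assume s: "s \<in> {..<N}" and t: "t \<in> {..<N}" and "idx s = idx t"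
  then have "[s * n = t * n] (mod N)" by (simp add: idx_def cong_def)
  moreover have "coprime n N" using cop by (simp add: coprime_iff_gcd_eq_1)
  ultimately have "[s = t] (mod N)" using cong_mult_rcancel_nat by blast
  then show "s = t" using s t by (simp add: cong_def)
qed

lemma idx_bij: "bij_betw idx {..<N} {1..N}"
  unfolding bij_betw_def
proof
  have "card (idx ` {..<N}) = N" using card_image[OF idx_inj] by simp
  moreover have "idx ` {..<N} \<subseteq> {1..N}" using idx_range by blast
  ultimately show "idx ` {..<N} = {1..N}" by (intro card_subset_eq) auto
qed (rule idx_inj)

lemma idx_ex: "k \<in> {1..N} \<Longrightarrow> \<exists>t<N. k = idx t"
  using idx_bij unfolding bij_betw_def by (metis imageE lessThan_iff)

text \<open>Values on the edges of a cycle with total zero are differences of a potential, namely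
  minus the partial sums along the cycle.\<close>

lemma cycle_potential:
  fixes w :: "nat \<Rightarrow> 'k"
  assumes "(\<Sum>k\<in>{1..N}. w k) = 0"
  obtains u where "\<And>k. k \<in> {1..N} \<Longrightarrow> u k - u (nxt k) = w k"
proof -
  define S where "S t = (\<Sum>s<t. w (idx s))" for t
  have SN: "S N = 0"
    unfolding S_def using sum.reindex_bij_betw[OF idx_bij, of w] assms by simp
  define u where "u k = - S (the_inv_into {..<N} idx k)" for k
  have ut: "u (idx t) = - S t" if "t < N" for t
    using the_inv_into_f_f[OF idx_inj, of t] that by (simp add: u_def)
  have "u k - u (nxt k) = w k" if k: "k \<in> {1..N}" for k
  proof -
    from idx_ex[OF k] obtain t where t: "t < N" "k = idx t" by (elim exE conjE)
    \<comment> \<open>At the last step the cycle closes: \<open>idx N\<close> is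
      \<open>idx 0\<close>, and \<open>S N = 0\<close> makes the two prescriptions agree.\<close>
    have "u (idx (Suc t)) = - S (Suc t)"
    proof (cases "Suc t = N")
      case True
      have "u (idx (0 + N)) = - S 0" unfolding idx_N using ut[of 0] n1 by simp
      then show ?thesis using True SN by (simp add: S_def)
    next
      case False
      then show ?thesis using t(1) by (intro ut) simp
    qed
    then show ?thesis using t ut[of t] by (simp add: idx_Suc[symmetric] S_def)
  qed
  then show thesis using that by blast
qed

text \<open>The obstruction for the square \<open>k \<rightarrow> k + n + m\<close> to commute.\<close>

definition curl :: "(nat \<Rightarrow> nat \<Rightarrow> 'k) \<Rightarrow> nat \<Rightarrow> 'k" where
  "curl x k = x 0 k + x 1 (k + n) - x 1 k - x 0 (k + m)"

lemma sum_split: "(\<Sum>k\<in>{1..N}. f k) = (\<Sum>k\<in>{1..m}. f k) + (\<Sum>j\<in>{1..n}. f (j + m) :: 'k)"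
proof -
  have "{1..N} = {1..m} \<union> {1 + m..n + m}" by auto
  then have "(\<Sum>k\<in>{1..N}. f k) = (\<Sum>k\<in>{1..m}. f k) + (\<Sum>k\<in>{1 + m..n + m}. f k)"
    by (simp add: sum.union_disjoint)
  also have "(\<Sum>k\<in>{1 + m..n + m}. f k) = (\<Sum>j\<in>{1..n}. f (j + m))" by (rule sum.shift_bounds_cl_nat_ivl)
  finally show ?thesis .
qed

text \<open>The cycle supplies a potential on the first n + m vertices, once a constant has been
  subtracted from the values at the \<open>x\<close>-arrows. It is extended to the other vertices
  along \<open>x\<close>-arrows, and the commuting squares give the remaining
  \<open>y\<close>-arrows.\<close>

lemma curl_free:
  assumes c: "\<And>k. k \<in> {1..N} \<Longrightarrow> curl x k = 0"
  obtains t u where "\<And>i. i \<in> {1..n + 2 * m} \<Longrightarrow> x 0 i = t + (u i - u (i + n))"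
    "\<And>j. j \<in> {1..2 * n + m} \<Longrightarrow> x 1 j = u j - u (j + m)"
proof -
  \<comment> \<open>The cycle runs along \<open>x_1, ..., x_m\<close> and against
    \<open>y_1, ..., y_n\<close>; this \<open>t\<close> makes the total of the corrected edge values
    zero.\<close>
  define t where "t = ((\<Sum>k\<in>{1..m}. x 0 k) - (\<Sum>j\<in>{1..n}. x 1 j)) / of_nat m"
  have m0: "(of_nat m :: 'k) \<noteq> 0" using n1 nm by simp
  define w where "w k = (if k \<le> m then x 0 k - t else - x 1 (k - m))" for k
  have "(\<Sum>k\<in>{1..N}. w k) = 0"
    unfolding sum_split
    by (simp add: w_def sum_subtractf sum_negf) (use m0 in \<open>simp add: t_def\<close>)
  then obtain v where v: "\<And>k. k \<in> {1..N} \<Longrightarrow> v k - v (nxt k) = w k" by (rule cycle_potential) blast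
  \<comment> \<open>The vertex N + K + 1 is the head of the \<open>x\<close>-arrow at m + K + 1, so
    each step defines exactly one new value and keeps the old ones.\<close>
  have ext: "\<exists>u. (\<forall>k\<in>{1..N}. u k = v k) \<and> (\<forall>i. m < i \<and> i + n \<le> N + K \<longrightarrow> u (i + n) = u i - (x 0 i - t))" for K
  proof (induction K)
    case 0
    show ?case by (intro exI[of _ v]) auto
  next
    case (Suc K)
    then obtain u where u: "\<forall>k\<in>{1..N}. u k = v k"
      "\<forall>i. m < i \<and> i + n \<le> N + K \<longrightarrow> u (i + n) = u i - (x 0 i - t)" by (elim exE conjE)
    define u' where "u' = u (N + Suc K := u (m + Suc K) - (x 0 (m + Suc K) - t))"
    have "u' (i + n) = u' i - (x 0 i - t)" if i: "m < i" "i + n \<le> N + Suc K" for i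
    proof (cases "i + n = N + Suc K")
      case True
      then have "i = m + Suc K" by simp
      then show ?thesis using n1 by (simp add: u'_def)
    next
      case False
      then have "i + n \<le> N + K" "i \<noteq> N + Suc K" using i n1 by auto
      then show ?thesis using u(2) i False by (simp add: u'_def)
    qed
    moreover have "\<forall>k\<in>{1..N}. u' k = v k" using u(1) by (simp add: u'_def)
    ultimately show ?case by blast
  qed
  from ext[of N] obtain u where u: "\<forall>k\<in>{1..N}. u k = v k"
    "\<forall>i. m < i \<and> i + n \<le> N + N \<longrightarrow> u (i + n) = u i - (x 0 i - t)" by (elim exE conjE)
  have X: "x 0 i = t + (u i - u (i + n))" if i: "i \<in> {1..n + 2 * m}" for i
  proof (cases "i \<le> m")
    case True
    have "u i - u (i + n) = w i"
      using v[of i] u(1) i True by (simp add: nxt_def)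
    then show ?thesis using True by (simp add: w_def)
  next
    case False
    then have "u (i + n) = u i - (x 0 i - t)" using u(2) i by simp
    then show ?thesis by simp
  qed
  \<comment> \<open>The first n of the \<open>y\<close>-arrows lie on the cycle. Any later one is
    the edge \<open>y_(k+n)\<close> of the square at k = j - n, whose other three edges are already
    known.\<close>
  have Y: "x 1 j = u j - u (j + m)" if "j \<in> {1..2 * n + m}" for j
    using that
  proof (induction j rule: less_induct)
    case (less j)
    show ?case
    proof (cases "j \<le> n")
      case True
      have "u (j + m) - u j = w (j + m)"
        using v[of "j + m"] u(1) less.prems True by (simp add: nxt_def)
      then have "u (j + m) - u j = - x 1 j" using less.prems by (simp add: w_def)
      then show ?thesis by (simp add: algebra_simps)
    next
      case False
      define k where "k = j - n"
      have j: "j = k + n" "k \<in> {1..N}" using False less.prems by (auto simp: k_def)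
      have a: "x 1 k = u k - u (k + m)" using j n1 by (intro less.IH) auto
      have b: "x 0 k = t + (u k - u (k + n))" by (rule X) (use j in auto)
      have d: "x 0 (k + m) = t + (u (k + m) - u (k + m + n))" by (rule X) (use j in auto)
      have "x 1 (k + n) = x 1 k + x 0 (k + m) - x 0 k"
        using c[OF j(2)] unfolding curl_def by (simp add: algebra_simps)
      also have "\<dots> = u (k + n) - u (k + m + n)" unfolding a b d by simp
      also have "k + m + n = k + n + m" by simp
      finally show ?thesis unfolding j(1) .
    qed
  qed
  show thesis by (rule that[OF X Y])
qed

text \<open>Summed round the cycle, the potential cancels and m t = 0 remains. So no nonzero
  multiple of the constant cochain on the \<open>x\<close>-arrows is a coboundary.\<close>

lemma curl_constant:
  assumes x: "\<And>i. i \<in> {1..m} \<Longrightarrow> t = u i - u (i + n)" and y: "\<And>j. j \<in> {1..n} \<Longrightarrow> u j - u (j + m) = 0"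
  shows "t = (0 :: 'k)"
proof -
  have "{1..N} = {1..n} \<union> {1 + n..m + n}" by auto
  then have "(\<Sum>k\<in>{1..N}. u k) = (\<Sum>k\<in>{1..n}. u k) + (\<Sum>k\<in>{1 + n..m + n}. u k)"
    by (simp add: sum.union_disjoint)
  also have "(\<Sum>k\<in>{1 + n..m + n}. u k) = (\<Sum>i\<in>{1..m}. u (i + n))" by (rule sum.shift_bounds_cl_nat_ivl)
  finally have "(\<Sum>i\<in>{1..m}. u i - u (i + n)) = (\<Sum>j\<in>{1..n}. u j - u (j + m))"
    unfolding sum_split by (simp add: sum_subtractf algebra_simps)
  also have "\<dots> = 0" using y by (intro sum.neutral) blast
  finally have "(\<Sum>i\<in>{1..m}. t) = 0" using sum.cong[OF refl x, of "{1..m}" "\<lambda>i. i"] by simp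
  then show ?thesis using n1 nm by simp
qed

text \<open>A full turn gives c = (-1)^N c, which settles odd N. If N is even, coprimality makes n
  odd, so t and \<open>idx t - 1\<close> have the same parity and the sign can be read off from the
  vertex.\<close>

lemma curl_alternates:
  assumes s: "\<And>k. k \<in> {1..N} \<Longrightarrow> c (nxt k) = - c k"
  shows "odd N \<Longrightarrow> k \<in> {1..N} \<Longrightarrow> c k = (0 :: 'k)"
    and "even N \<Longrightarrow> k \<in> {1..N} \<Longrightarrow> c k = (- 1) ^ Suc k * c 1"
proof -
  have t: "c (idx t) = (- 1) ^ t * c 1" for t
  proof (induction t)
    case (Suc t)
    then show ?case using s[OF idx_range[of t]] by (simp add: idx_Suc)
  qed (simp add: idx_0)
  assume k: "k \<in> {1..N}"
  then obtain r where r: "k = idx r" using idx_ex by blast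
  show "c k = 0" if "odd N"
  proof -
    have "c 1 = - c 1" using t[of N] idx_N[of 0] idx_0 that by simp
    then have "2 * c 1 = 0" by (simp only: mult_2) simp
    then show ?thesis using t[of r] r by simp
  qed
  show "c k = (- 1) ^ Suc k * c 1" if N: "even N"
  proof -
    have "odd n"
    proof
      assume "even n"
      then have "even m" using N by simp
      then show False using coprime_common_divisor[OF cop \<open>even n\<close>] by simp
    qed
    then have "even (r * n mod N) \<longleftrightarrow> even r" using N dvd_mod_iff[of 2 N "r * n"] by simp
    then show ?thesis using t[of r] by (simp add: r idx_def minus_one_power_iff)
  qed
qed


subsection \<open>Reduction to the recurrence\<close>

text \<open>For \<open>n = 1\<close> these are the conditions on the coefficients of \<open>x\<^sup>m\<close> in the values at the \<open>y\<^sub>j\<close>; the last two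
  come from the relation \<open>g\<^sub>1\<close>. For \<open>n = m = 1\<close> the coefficients of \<open>y\<close> at the \<open>x\<^sub>i\<close> satisfy them as well, with the
  indices reversed.\<close>

definition sys :: "nat \<Rightarrow> (nat \<Rightarrow> 'k) \<Rightarrow> bool" where
  "sys M g \<longleftrightarrow> (\<forall>i\<in>{1..M}. g (i + 2) = \<alpha> * g (i + 1) + \<beta> * g i) \<and>
     (g 2 - \<alpha> * g 1) * L (M + 2) + g (M + 2) = \<beta> * g 1 * L (M + 1) \<and>
     (g 2 - \<alpha> * g 1) * (\<beta> * L (M + 1)) = \<alpha> * g (M + 2) + \<beta> * g (M + 1) + \<beta> * g 1 * (\<beta> * L M)"

text \<open>The path \<open>x x y\<close> differs from \<open>x y x\<close> by the square at i + n,
  and from \<open>y x x\<close> by the two squares at i + n and at i. So a1 - a2 is one curl and a1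
  - a3 the sum of two.\<close>

lemma curl_F: "(case rF x i of (a1, a2, a3) \<Rightarrow> \<alpha> * (a1 - a2) = 0 \<and> a1 = a3) \<longleftrightarrow>
    \<alpha> * curl x (i + n) = 0 \<and> curl x (i + n) = - curl x i"
proof -
  obtain a1 a2 a3 where a: "rF x i = (a1, a2, a3)" by (cases "rF x i")
  then have "a1 - a2 = curl x (i + n)" "a1 - a3 = curl x (i + n) - (- curl x i)"
    by (auto simp: rF_def curl_def algebra_simps)
  then show ?thesis unfolding a prod.case by (metis eq_iff_diff_eq_0)
qed

lemma curl_G: "(case rG x j of (b1, b2, b3) \<Rightarrow> \<alpha> * (b1 - b2) = 0 \<and> b1 = b3) \<longleftrightarrow>
    \<alpha> * curl x j = 0 \<and> curl x j = - curl x (j + m)"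
proof -
  obtain a1 a2 a3 where a: "rG x j = (a1, a2, a3)" by (cases "rG x j")
  then have "a1 - a2 = curl x j" "a1 - a3 = curl x j - (- curl x (j + m))"
    by (auto simp: rG_def curl_def algebra_simps)
  then show ?thesis unfolding a prod.case by (metis eq_iff_diff_eq_0)
qed

text \<open>The steps from i to i + n with \<open>i \<le> m\<close> and from j + m to j with
  \<open>j \<le> n\<close> are exactly those of \<open>nxt\<close>. So each of the n + m relations
  accounts for the sign change along one edge of the cycle.\<close>

lemma curl_conditions:
  "(\<forall>i\<in>{1..m}. \<alpha> * curl x (i + n) = 0 \<and> curl x (i + n) = - curl x i) \<and>
   (\<forall>j\<in>{1..n}. \<alpha> * curl x j = 0 \<and> curl x j = - curl x (j + m)) \<longleftrightarrow>
   (\<forall>k\<in>{1..N}. \<alpha> * curl x k = 0 \<and> curl x (nxt k) = - curl x k)" (is "?A \<and> ?B \<longleftrightarrow> ?C")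
proof
  assume AB: "?A \<and> ?B"
  show ?C
  proof
    fix k assume k: "k \<in> {1..N}"
    have "\<alpha> * curl x k = 0"
    proof (cases "k \<le> n")
      case True
      then show ?thesis using conjunct1[OF bspec[OF conjunct2[OF AB], of k]] k by simp
    next
      case False
      then have "k - n \<in> {1..m}" "k - n + n = k" using k by auto
      then show ?thesis using AB by metis
    qed
    moreover have "curl x (nxt k) = - curl x k"
    proof (cases "k \<le> m")
      case True
      then show ?thesis using AB k by (simp add: nxt_def)
    next
      case False
      then have "k - m \<in> {1..n}" "k - m + m = k" using k by auto
      then have "curl x (k - m) = - curl x k" using AB by metis
      then show ?thesis using False by (simp add: nxt_def)
    qed
    ultimately show "\<alpha> * curl x k = 0 \<and> curl x (nxt k) = - curl x k" ..
  qed
next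
  assume C: ?C
  have "curl x j = - curl x (j + m)" if "j \<in> {1..n}" for j
    using bspec[OF C, of "j + m"] that by (simp add: nxt_def)
  moreover have "curl x (i + n) = - curl x i" if "i \<in> {1..m}" for i
    using bspec[OF C, of i] that by (simp add: nxt_def)
  ultimately show "?A \<and> ?B" using C nm by auto
qed

lemma solution_iff:
  "solution x \<longleftrightarrow> adm x \<and> (\<forall>k\<in>{1..N}. \<alpha> * curl x k = 0 \<and> curl x (nxt k) = - curl x k) \<and>
     (n = 1 \<longrightarrow> sys m (x 2)) \<and> (m = 1 \<longrightarrow> sys m (\<lambda>r. x 3 (4 - r)))" (is "?S \<longleftrightarrow> ?A \<and> ?C \<and> ?Y \<and> ?X")
proof -
  let ?Y' = "(\<forall>i\<in>{1..m}. x 2 (i + n + n) = \<alpha> * x 2 (i + n) + \<beta> * x 2 i) \<and>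
    (\<forall>j\<in>{1..n}. (x 2 (j + n) - \<alpha> * x 2 j) * L (Suc (Suc m)) + x 2 (j + n + m) = \<beta> * x 2 j * L (Suc m) \<and>
       (x 2 (j + n) - \<alpha> * x 2 j) * (\<beta> * L (Suc m)) = \<alpha> * x 2 (j + m + n) + \<beta> * x 2 (j + m) + \<beta> * x 2 j * (\<beta> * L m))"
  let ?X' = "(\<forall>i\<in>{1..m}. x 3 i + \<alpha> * (x 3 (i + n) - \<alpha> * x 3 (i + n + m)) = \<beta> * x 3 (i + m + n) \<and>
     \<beta> * (x 3 (i + n) - \<alpha> * x 3 (i + n + m)) = \<alpha> * x 3 i + \<beta> * x 3 (i + m)) \<and>
    (\<forall>j\<in>{1..n}. x 3 j = \<alpha> * x 3 (j + m) + \<beta> * x 3 (j + m + m))"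
  have Y: "?Y' \<longleftrightarrow> ?Y" if "adm x"
  proof (cases "n = 1")
    case True
    then show ?thesis by (simp add: sys_def numeral_2_eq_2 add.commute)
  next
    case False
    then have "\<And>i. x 2 i = 0" using that by (simp add: adm_def)
    then show ?thesis using False by simp
  qed
  \<comment> \<open>Under the reversal \<open>r\<close> to \<open>4 - r\<close>, the relation
    \<open>g\<^sub>1\<close> supplies the recurrence and \<open>f\<^sub>1\<close> the two boundary
    conditions. For the coefficients at the \<open>y\<close>-arrows the roles of the relations are
    the other way round.\<close>
  have X: "?X' \<longleftrightarrow> ?X" if a: "adm x"
  proof (cases "m = 1")
    case True
    then have n: "n = 1" using n1 nm by simp
    have "L (Suc (Suc (Suc 0))) = \<alpha>" using L_simps(5) by (simp add: numeral_3_eq_3)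
    then show ?thesis unfolding True n by (simp add: sys_def L_simps numeral_eq_Suc) (auto simp: ac_simps)
  next
    case False
    then have "n \<noteq> m" using cop by auto
    then have "\<And>i. x 3 i = 0" using a by (simp add: adm_def)
    then show ?thesis using False by simp
  qed
  have "?S \<longleftrightarrow> ?A \<and> ((\<forall>i\<in>{1..m}. \<alpha> * curl x (i + n) = 0 \<and> curl x (i + n) = - curl x i) \<and>
   (\<forall>j\<in>{1..n}. \<alpha> * curl x j = 0 \<and> curl x j = - curl x (j + m))) \<and> ?Y' \<and> ?X'"
    unfolding solution_def eqF_def eqG_def curl_F curl_G ball_conj_distrib by blast
  then show ?thesis unfolding curl_conditions using X Y by blast
qed

subsection \<open>Diagonal cocycles\<close>

definition ones :: "nat \<Rightarrow> nat \<Rightarrow> 'k" where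
  "ones k i = (if k = 0 \<and> i \<in> {1..n + 2 * m} then 1 else 0)"

text \<open>For each vertex k up to n + m, exactly one of the edges \<open>x_k\<close> and
  \<open>x_(k+m)\<close> of the square at k has its index in n + 1, ..., n + m. For odd n and m the
  curl is therefore (-1)^k.\<close>

definition signs :: "nat \<Rightarrow> nat \<Rightarrow> 'k" where
  "signs k i = (if k = 0 \<and> i \<in> {Suc n..N} then (- 1) ^ (i - Suc n) else 0)"

definition diag :: "(nat \<Rightarrow> nat \<Rightarrow> 'k) list" where
  "diag = ones # (if case_I \<alpha> n m then [signs] else [])"

lemma sys_zero: "sys M (\<lambda>_. 0)" by (simp add: sys_def)

text \<open>In Case I the weights have the same parity, and being coprime they are not both
  even.\<close>

lemma odd_weights: "case_I \<alpha> n m \<Longrightarrow> odd n \<and> odd m"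
proof -
  assume "case_I \<alpha> n m"
  then have "even n \<longleftrightarrow> even m" by (simp add: case_I_def)
  then show ?thesis using coprime_common_divisor[OF cop, of 2] by auto
qed

lemma curl_ones: "k \<in> {1..N} \<Longrightarrow> curl ones k = 0"
  using nm by (auto simp: curl_def ones_def)

lemma curl_signs:
  assumes o: "odd n" "odd m" and k: "k \<in> {1..N}"
  shows "curl signs k = (- 1) ^ k"
proof (cases "k \<le> n")
  case True
  have "\<not> k + m < Suc n" using k nm by simp
  then have "even (k + m - Suc n) \<longleftrightarrow> odd k" using o by simp
  then show ?thesis using True k nm by (auto simp: curl_def signs_def minus_one_power_iff)
next
  case False
  then have "k = k - Suc n + Suc n" by simp
  then have "even k \<longleftrightarrow> even (k - Suc n)" using o by (metis even_Suc even_add)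
  then show ?thesis using False k n1 by (auto simp: curl_def signs_def minus_one_power_iff)
qed

lemma diag_solution: "x \<in> set diag \<Longrightarrow> solution x"
proof -
  have nk: "nxt k \<in> {1..N}" if "k \<in> {1..N}" for k using that nm n1 by (auto simp: nxt_def)
  have z: "ones 2 = (\<lambda>_. 0)" "(\<lambda>r. ones 3 (4 - r)) = (\<lambda>_. 0)" "signs 2 = (\<lambda>_. 0)" "(\<lambda>r. signs 3 (4 - r)) = (\<lambda>_. 0)"
    by (simp_all add: ones_def[abs_def] signs_def[abs_def])
  have 1: "solution ones"
    unfolding solution_iff
  proof (intro conjI ballI impI)
    show "adm ones" by (simp add: adm_def ones_def)
    show "\<alpha> * curl ones k = 0" "curl ones (nxt k) = - curl ones k" if "k \<in> {1..N}" for k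
      using curl_ones that nk[OF that] by simp_all
    show "sys m (ones 2)" "sys m (\<lambda>r. ones 3 (4 - r))" unfolding z by (rule sys_zero)+
  qed
  have 2: "solution signs" if I: "case_I \<alpha> n m"
    unfolding solution_iff
  proof (intro conjI ballI impI)
    show "adm signs" by (simp add: adm_def signs_def)
    show "\<alpha> * curl signs k = 0" for k using I by (simp add: case_I_def)
    show "curl signs (nxt k) = - curl signs k" if k: "k \<in> {1..N}" for k
    proof -
      have "even (nxt k) \<longleftrightarrow> odd k" using odd_weights[OF I] by (auto simp: nxt_def)
      then show ?thesis
        using curl_signs[OF _ _ k] curl_signs[OF _ _ nk[OF k]] odd_weights[OF I]
        by (simp add: minus_one_power_iff)
    qed
    show "sys m (signs 2)" "sys m (\<lambda>r. signs 3 (4 - r))" unfolding z by (rule sys_zero)+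
  qed
  assume "x \<in> set diag"
  then show "solution x" using 1 2 by (auto simp: diag_def split: if_splits)
qed

lemma diag_span:
  assumes y: "solution y"
  obtains c u where "\<And>i. i \<in> {1..n + 2 * m} \<Longrightarrow> y 0 i = (\<Sum>l<length diag. c l * (diag ! l) 0 i) + cob u 0 i"
    "\<And>j. j \<in> {1..2 * n + m} \<Longrightarrow> y 1 j = cob u 1 j"
proof -
  have c: "\<alpha> * curl y k = 0" "curl y (nxt k) = - curl y k" if "k \<in> {1..N}" for k
    using y that unfolding solution_iff by blast+
  show thesis
  proof (cases "case_I \<alpha> n m")
    case True
    then have ev: "even N" by (simp add: case_I_def)
    \<comment> \<open>The curl of \<open>signs\<close> at the vertex 1 is -1; hence this multiple of
      \<open>signs\<close> has the same curl as \<open>y\<close> there, and by alternation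
      everywhere.\<close>
    define s where "s = - curl y 1"
    define z where "z k i = y k i - s * signs k i" for k i
    have cz: "curl z k = 0" if k: "k \<in> {1..N}" for k
    proof -
      have "curl z k = curl y k - s * curl signs k" by (simp add: curl_def z_def algebra_simps)
      also have "\<dots> = 0"
        using curl_alternates(2)[of "curl y", OF c(2) ev k] curl_signs[OF _ _ k] odd_weights[OF True]
        by (simp add: s_def)
      finally show ?thesis .
    qed
    show thesis
    proof (rule curl_free[of z, OF cz])
      fix t u assume tu: "\<And>i. i \<in> {1..n + 2 * m} \<Longrightarrow> z 0 i = t + (u i - u (i + n))"
        "\<And>j. j \<in> {1..2 * n + m} \<Longrightarrow> z 1 j = u j - u (j + m)"
      show thesis
      proof (rule that[of "\<lambda>l. if l = 0 then t else s" u])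
        show "y 0 i = (\<Sum>l<length diag. (if l = 0 then t else s) * (diag ! l) 0 i) + cob u 0 i"
          if "i \<in> {1..n + 2 * m}" for i
          using tu(1)[OF that] that True by (simp add: z_def diag_def cob_def ones_def algebra_simps)
        show "y 1 j = cob u 1 j" if "j \<in> {1..2 * n + m}" for j
          using tu(2)[OF that] by (simp add: z_def signs_def cob_def)
      qed
    qed
  next
    case False
    \<comment> \<open>Outside Case I the curl is killed either by a nonzero \<alpha> or, if \<alpha>
      = 0, by the odd length of the cycle.\<close>
    have cy: "curl y k = 0" if k: "k \<in> {1..N}" for k
    proof (cases "\<alpha> = 0")
      case True
      then have "odd N" using False by (simp add: case_I_def)
      then show ?thesis using curl_alternates(1)[of "curl y", OF c(2) _ k] by simp
    qed (use c(1)[OF k] in simp)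
    show thesis
    proof (rule curl_free[of y, OF cy])
      fix t u assume tu: "\<And>i. i \<in> {1..n + 2 * m} \<Longrightarrow> y 0 i = t + (u i - u (i + n))"
        "\<And>j. j \<in> {1..2 * n + m} \<Longrightarrow> y 1 j = u j - u (j + m)"
      show thesis
      proof (rule that[of "\<lambda>_. t" u])
        show "y 0 i = (\<Sum>l<length diag. t * (diag ! l) 0 i) + cob u 0 i" if "i \<in> {1..n + 2 * m}" for i
          using tu(1)[OF that] that False by (simp add: diag_def cob_def ones_def)
        show "y 1 j = cob u 1 j" if "j \<in> {1..2 * n + m}" for j
          using tu(2)[OF that] by (simp add: cob_def)
      qed
    qed
  qed
qed

text \<open>The curl at the vertex 1 vanishes on \<open>ones\<close> and on coboundaries but not on
  \<open>signs\<close>, which isolates the coefficient of \<open>signs\<close>. Then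
  \<open>curl_constant\<close> disposes of \<open>ones\<close>.\<close>

lemma diag_indep:
  assumes x: "\<And>i. i \<in> {1..n + 2 * m} \<Longrightarrow> (\<Sum>l<length diag. c l * (diag ! l) 0 i) = cob u 0 i"
    and y: "\<And>j. j \<in> {1..2 * n + m} \<Longrightarrow> cob u 1 j = 0" and l: "l < length diag"
  shows "c l = 0"
proof -
  define s where "s = (if case_I \<alpha> n m then c 1 else 0)"
  have eq: "c 0 + s * signs 0 i = u i - u (i + n)" if "i \<in> {1..n + 2 * m}" for i
    using x[OF that] that by (simp add: s_def diag_def cob_def ones_def split: if_splits)
  have u: "u j - u (j + m) = 0" if "j \<in> {1..2 * n + m}" for j
    using y[OF that] by (simp add: cob_def)
  have s: "s = 0"
  proof (cases "case_I \<alpha> n m")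
    case True
    have r: "1 \<in> {1..n + 2 * m}" "1 + m \<in> {1..n + 2 * m}" "1 \<in> {1..2 * n + m}" "1 + n \<in> {1..2 * n + m}"
      using n1 nm by auto
    have cancel: "a = b" if "p + a = w - x" "p + b = y - z" "w - y = 0" "x - z = 0" for a b p w x y z :: 'k
      using that by (metis add_left_cancel eq_iff_diff_eq_0)
    have e: "c 0 + s * signs 0 (1 + m) = u (1 + m) - u (1 + n + m)"
      using eq[OF r(2)] by (simp only: add.assoc add.commute[of m n])
    have "s * signs 0 1 = s * signs 0 (1 + m)"
      by (rule cancel[OF eq[OF r(1)] e u[OF r(3)] u[OF r(4)]])
    moreover have "signs 1 k = 0" for k by (simp add: signs_def)
    ultimately have "s * curl signs 1 = 0" by (simp add: curl_def right_diff_distrib)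
    then show ?thesis using curl_signs[of 1] odd_weights[OF True] n1 by simp
  qed (simp add: s_def)
  have "c 0 = 0"
  proof (rule curl_constant[of _ u])
    show "c 0 = u i - u (i + n)" if "i \<in> {1..m}" for i using eq[of i] that s by simp
    show "u j - u (j + m) = 0" if "j \<in> {1..n}" for j using u[of j] that by simp
  qed
  moreover have "c 1 = 0" if "case_I \<alpha> n m" using s that by (simp add: s_def)
  ultimately show ?thesis
    using l by (cases "case_I \<alpha> n m") (auto simp: diag_def less_Suc_eq)
qed

subsection \<open>Solutions of the recurrence\<close>

definition sys_basis :: "nat \<Rightarrow> (nat \<Rightarrow> 'k) list \<Rightarrow> bool" where
  "sys_basis M gs \<longleftrightarrow> (\<forall>g\<in>set gs. sys M g) \<and>
     (\<forall>g. sys M g \<longrightarrow> (\<exists>c. \<forall>r\<in>{1..M + 2}. g r = (\<Sum>l<length gs. c l * (gs ! l) r))) \<and>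
     (\<forall>c. (\<forall>r\<in>{1..M + 2}. (\<Sum>l<length gs. c l * (gs ! l) r) = 0) \<longrightarrow> (\<forall>l<length gs. c l = 0))"

text \<open>\<open>L r\<close> and \<open>\<beta> * L (r - 1)\<close> are the solutions with values
  0, 1 and 1, 0 at r = 1, 2.\<close>

lemma recurrence_closed_form:
  assumes g: "\<forall>i\<in>{1..M}. g (i + 2) = \<alpha> * g (i + 1) + \<beta> * g i"
  shows "r \<in> {1..M + 2} \<Longrightarrow> g r = g 2 * L r + g 1 * (\<beta> * L (r - 1))"
proof (induction r rule: less_induct)
  case (less r)
  show ?case
  proof (cases "r \<le> 2")
    case True
    then have "r = 1 \<or> r = 2" using less.prems by auto
    then show ?thesis by (auto simp: L_simps)
  next
    case False
    define i where "i = r - 3"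
    have r: "r = Suc (Suc (Suc i))" using False by (simp add: i_def)
    have "g (Suc i + 2) = \<alpha> * g (Suc i + 1) + \<beta> * g (Suc i)" using g less.prems r by (intro bspec[OF g]) simp
    then have "g r = \<alpha> * g (Suc (Suc i)) + \<beta> * g (Suc i)" by (simp add: r)
    also have "\<dots> = \<alpha> * (g 2 * L (Suc (Suc i)) + g 1 * (\<beta> * L (Suc i))) + \<beta> * (g 2 * L (Suc i) + g 1 * (\<beta> * L i))"
      using less.IH[of "Suc (Suc i)"] less.IH[of "Suc i"] less.prems r by simp
    also have "\<dots> = g 2 * L (Suc (Suc (Suc i))) + g 1 * (\<beta> * L (Suc (Suc i)))"
      unfolding L_step[of "Suc i"] by (simp add: L_step[of i] algebra_simps)
    finally show ?thesis by (simp add: r)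
  qed
qed

text \<open>When the closed form is substituted for \<open>g (M + 1)\<close> and
  \<open>g (M + 2)\<close> in the two boundary conditions, the recurrence of \<open>L\<close>
  collects all terms into multiples of \<open>L (M + 2)\<close>.\<close>

lemma sys_iff:
  "sys M g \<longleftrightarrow> (\<forall>r\<in>{1..M + 2}. g r = g 2 * L r + g 1 * (\<beta> * L (r - 1))) \<and>
     (2 * g 2 - \<alpha> * g 1) * L (M + 2) = 0 \<and> (\<alpha> * g 2 + 2 * \<beta> * g 1) * L (M + 2) = 0"
proof -
  let ?R = "\<forall>i\<in>{1..M}. g (i + 2) = \<alpha> * g (i + 1) + \<beta> * g i"
  let ?C = "\<forall>r\<in>{1..M + 2}. g r = g 2 * L r + g 1 * (\<beta> * L (r - 1))"
  have RC: "?R \<longleftrightarrow> ?C"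
  proof
    assume C: ?C
    show ?R
    proof
      fix i assume "i \<in> {1..M}"
      then obtain j where j: "i = Suc j" "Suc j \<le> M" by (cases i) auto
      have "g (i + 2) = g 2 * L (Suc (Suc (Suc j))) + g 1 * (\<beta> * L (Suc (Suc j)))"
        "g (i + 1) = g 2 * L (Suc (Suc j)) + g 1 * (\<beta> * L (Suc j))"
        "g i = g 2 * L (Suc j) + g 1 * (\<beta> * L j)"
        using bspec[OF C, of "i + 2"] bspec[OF C, of "i + 1"] bspec[OF C, of i] j by simp_all
      then show "g (i + 2) = \<alpha> * g (i + 1) + \<beta> * g i"
        unfolding L_step[of "Suc j"] by (simp add: L_step[of j] algebra_simps)
    qed
  qed (use recurrence_closed_form in blast)
  have "(g 2 - \<alpha> * g 1) * L (M + 2) + g (M + 2) - \<beta> * g 1 * L (M + 1) = (2 * g 2 - \<alpha> * g 1) * L (M + 2)"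
    "\<alpha> * g (M + 2) + \<beta> * g (M + 1) + \<beta> * g 1 * (\<beta> * L M) - (g 2 - \<alpha> * g 1) * (\<beta> * L (M + 1))
      = (\<alpha> * g 2 + 2 * \<beta> * g 1) * L (M + 2)" if C: ?C
  proof -
    have g: "g (M + 2) = g 2 * L (Suc (Suc M)) + g 1 * (\<beta> * L (Suc M))" "g (M + 1) = g 2 * L (Suc M) + g 1 * (\<beta> * L M)"
      using bspec[OF C, of "M + 2"] bspec[OF C, of "M + 1"] by simp_all
    show "(g 2 - \<alpha> * g 1) * L (M + 2) + g (M + 2) - \<beta> * g 1 * L (M + 1) = (2 * g 2 - \<alpha> * g 1) * L (M + 2)"
      unfolding g by (simp add: L_step algebra_simps)
    show "\<alpha> * g (M + 2) + \<beta> * g (M + 1) + \<beta> * g 1 * (\<beta> * L M) - (g 2 - \<alpha> * g 1) * (\<beta> * L (M + 1))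
      = (\<alpha> * g 2 + 2 * \<beta> * g 1) * L (M + 2)"
      unfolding g by (simp add: L_step algebra_simps)
  qed
  then show ?thesis
    unfolding sys_def RC by (metis eq_iff_diff_eq_0)
qed

lemma sys_basis_1:
  assumes z: "L (M + 2) = 0"
  shows "sys_basis M [\<lambda>r. L r, \<lambda>r. \<beta> * L (r - 1)]"
  unfolding sys_basis_def
proof (intro conjI allI impI ballI)
  show "sys M g" if "g \<in> set [\<lambda>r. L r, \<lambda>r. \<beta> * L (r - 1)]" for g
    using that z by (auto simp: sys_iff L_simps)
  show "\<exists>c. \<forall>r\<in>{1..M + 2}. g r = (\<Sum>l<length [\<lambda>r. L r, \<lambda>r. \<beta> * L (r - 1)]. c l * ([\<lambda>r. L r, \<lambda>r. \<beta> * L (r - 1)] ! l) r)"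
    if "sys M g" for g
  proof (intro exI[of _ "\<lambda>l. if l = 0 then g 2 else g 1"] ballI)
    fix r assume "r \<in> {1..M + 2}"
    then have "g r = g 2 * L r + g 1 * (\<beta> * L (r - 1))" using that unfolding sys_iff by (elim conjE bspec)
    then show "g r = (\<Sum>l<length [\<lambda>r. L r, \<lambda>r. \<beta> * L (r - 1)]. (if l = 0 then g 2 else g 1) * ([\<lambda>r. L r, \<lambda>r. \<beta> * L (r - 1)] ! l) r)"
      by simp
  qed
  show "c l = 0" if h: "\<forall>r\<in>{1..M + 2}. (\<Sum>l<length [\<lambda>r. L r, \<lambda>r. \<beta> * L (r - 1)]. c l * ([\<lambda>r. L r, \<lambda>r. \<beta> * L (r - 1)] ! l) r) = 0"
    and l: "l < length [\<lambda>r. L r, \<lambda>r. \<beta> * L (r - 1)]" for c l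
  proof -
    have "c 0 = 0" using bspec[OF h, of 2] by (simp add: L_simps)
    moreover have "c 1 = 0" using bspec[OF h, of 1] by (simp add: L_simps)
    ultimately show ?thesis using l by (auto simp: less_Suc_eq)
  qed
qed

text \<open>The polynomial \<open>X^2 - \<alpha> X - \<beta>\<close> has the double root \<alpha> /
  2, whose powers satisfy the recurrence and both boundary conditions.\<close>

lemma sys_basis_2:
  assumes "\<alpha>\<^sup>2 + 4 * \<beta> = 0" and nz: "L (M + 2) \<noteq> 0"
  shows "sys_basis M [\<lambda>r. (\<alpha> / 2) ^ (r - 1)]"
  unfolding sys_basis_def
proof (intro conjI allI impI ballI)
  define a where "a = \<alpha> / 2"
  have al: "\<alpha> = 2 * a" by (simp add: a_def)
  have be: "\<beta> = - a\<^sup>2"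
  proof -
    have "4 * (a\<^sup>2 + \<beta>) = 0" using assms(1) by (simp add: al power2_eq_square algebra_simps)
    then have "a\<^sup>2 + \<beta> = 0" by (simp only: mult_eq_0_iff) simp
    then show ?thesis by (simp add: eq_neg_iff_add_eq_0 add.commute)
  qed
  have rec: "\<forall>i\<in>{1..M}. a ^ (i + 2 - 1) = \<alpha> * a ^ (i + 1 - 1) + \<beta> * a ^ (i - 1)"
  proof
    fix i assume "i \<in> {1..M}"
    then obtain j where "i = Suc j" by (cases i) auto
    then show "a ^ (i + 2 - 1) = \<alpha> * a ^ (i + 1 - 1) + \<beta> * a ^ (i - 1)"
      by (simp add: al be power2_eq_square algebra_simps)
  qed
  have s: "sys M (\<lambda>r. a ^ (r - 1))"
    unfolding sys_iff using recurrence_closed_form[OF rec]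
    by (simp add: al be power2_eq_square)
  show "sys M g" if "g \<in> set [\<lambda>r. (\<alpha> / 2) ^ (r - 1)]" for g
    using that s by (simp add: a_def)
  show "\<exists>c. \<forall>r\<in>{1..M + 2}. g r = (\<Sum>l<length [\<lambda>r. (\<alpha> / 2) ^ (r - 1)]. c l * ([\<lambda>r. (\<alpha> / 2) ^ (r - 1)] ! l) r)"
    if "sys M g" for g
  proof (intro exI[of _ "\<lambda>_. g 1"] ballI)
    fix r assume r: "r \<in> {1..M + 2}"
    have "(2 * g 2 - \<alpha> * g 1) * L (M + 2) = 0" using that unfolding sys_iff by (elim conjE)
    then have "2 * g 2 = 2 * (a * g 1)" using nz by (simp add: al)
    \<comment> \<open>The first boundary condition fixes \<open>g 2\<close> in terms of
      \<open>g 1\<close>, so the solution space is at most one-dimensional.\<close>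
    then have g2: "g 2 = a * g 1" by (simp only: mult_left_cancel[OF zero_neq_numeral[symmetric]])
    have "g r = g 2 * L r + g 1 * (\<beta> * L (r - 1))" using that r unfolding sys_iff by (elim conjE bspec)
    also have "\<dots> = g 1 * (a * L r + \<beta> * L (r - 1))" unfolding g2 by (simp add: algebra_simps)
    also have "a * L r + \<beta> * L (r - 1) = a ^ (r - 1)" using recurrence_closed_form[OF rec r] by simp
    finally show "g r = (\<Sum>l<length [\<lambda>r. (\<alpha> / 2) ^ (r - 1)]. g 1 * ([\<lambda>r. (\<alpha> / 2) ^ (r - 1)] ! l) r)"
      by (simp add: a_def)
  qed
  show "c l = 0" if h: "\<forall>r\<in>{1..M + 2}. (\<Sum>l<length [\<lambda>r. (\<alpha> / 2) ^ (r - 1)]. c l * ([\<lambda>r. (\<alpha> / 2) ^ (r - 1)] ! l) r) = 0"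
    and l: "l < length [\<lambda>r. (\<alpha> / 2) ^ (r - 1) :: 'k]" for c l
    using bspec[OF h, of 1] l by simp
qed

lemma sys_basis_3:
  assumes d: "\<alpha>\<^sup>2 + 4 * \<beta> \<noteq> 0" and nz: "L (M + 2) \<noteq> 0"
  shows "sys_basis M []"
  unfolding sys_basis_def
proof (intro conjI allI impI ballI)
  show "\<exists>c. \<forall>r\<in>{1..M + 2}. g r = (\<Sum>l<length ([] :: (nat \<Rightarrow> 'k) list). c l * ([] ! l) r)" if "sys M g" for g
  proof -
    have c: "g r = g 2 * L r + g 1 * (\<beta> * L (r - 1))" if "r \<in> {1..M + 2}" for r
      using \<open>sys M g\<close> that unfolding sys_iff by (elim conjE bspec)
    have "(2 * g 2 - \<alpha> * g 1) * L (M + 2) = 0" "(\<alpha> * g 2 + 2 * \<beta> * g 1) * L (M + 2) = 0"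
      using that sys_iff[of M g] by blast+
    then have e: "2 * g 2 = \<alpha> * g 1" "\<alpha> * g 2 + 2 * \<beta> * g 1 = 0" using nz by simp_all
    \<comment> \<open>Eliminating \<open>g 2\<close> leaves the determinant times
      \<open>g 1\<close>.\<close>
    have "(\<alpha>\<^sup>2 + 4 * \<beta>) * g 1 = \<alpha> * (\<alpha> * g 1) + 4 * \<beta> * g 1" by (simp add: power2_eq_square algebra_simps)
    also have "\<dots> = 2 * (\<alpha> * g 2 + 2 * \<beta> * g 1)" unfolding e(1)[symmetric] by (simp add: algebra_simps)
    finally have "(\<alpha>\<^sup>2 + 4 * \<beta>) * g 1 = 0" unfolding e(2) by simp
    then have g1: "g 1 = 0" using d by simp
    then have "g 2 = 0" using e(1) by simp
    then have "g r = 0" if "r \<in> {1..M + 2}" for r using c[OF that] g1 by simp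
    then show ?thesis by simp
  qed
qed simp_all

subsection \<open>The basis in coordinates\<close>

definition yx :: "(nat \<Rightarrow> 'k) \<Rightarrow> nat \<Rightarrow> nat \<Rightarrow> 'k" where
  "yx g k i = (if k = 2 \<and> i \<in> {1..m + 2} then g i else 0)"

text \<open>The reversed index lets the same solutions of \<open>sys\<close> serve for the
  \<open>x\<close>-arrows when n = m = 1.\<close>

definition xy :: "(nat \<Rightarrow> 'k) \<Rightarrow> nat \<Rightarrow> nat \<Rightarrow> 'k" where
  "xy g k i = (if k = 3 \<and> i \<in> {1..3} then g (4 - i) else 0)"

definition yxs :: "(nat \<Rightarrow> 'k) list \<Rightarrow> (nat \<Rightarrow> nat \<Rightarrow> 'k) list" where
  "yxs gs = (if n = 1 then map yx gs else [])"

definition xys :: "(nat \<Rightarrow> 'k) list \<Rightarrow> (nat \<Rightarrow> nat \<Rightarrow> 'k) list" where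
  "xys gs = (if m = 1 then map xy gs else [])"

lemma sys_cong:
  assumes "\<And>r. r \<in> {1..M + 2} \<Longrightarrow> g r = h r"
  shows "sys M g \<longleftrightarrow> sys M h"
proof -
  have "(\<forall>i\<in>{1..M}. g (i + 2) = \<alpha> * g (i + 1) + \<beta> * g i) \<longleftrightarrow> (\<forall>i\<in>{1..M}. h (i + 2) = \<alpha> * h (i + 1) + \<beta> * h i)"
    by (rule ball_cong) (simp_all add: assms)
  then show ?thesis by (simp add: sys_def assms)
qed

lemma zero_components:
  "x \<in> set diag \<Longrightarrow> k \<noteq> 0 \<Longrightarrow> x k i = 0" "x \<in> set (yxs gs) \<Longrightarrow> k \<noteq> 2 \<Longrightarrow> x k i = 0"
  "x \<in> set (xys gs) \<Longrightarrow> k \<noteq> 3 \<Longrightarrow> x k i = 0"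
  by (auto simp: diag_def ones_def signs_def yxs_def yx_def xys_def xy_def split: if_splits)

lemma curl_zero: "(\<And>k i. k < 2 \<Longrightarrow> x k i = 0) \<Longrightarrow> curl x k = 0"
  by (simp add: curl_def)

lemma yx_solution:
  assumes g: "sys m g" and n: "n = 1"
  shows "solution (yx g)"
  unfolding solution_iff
proof (intro conjI ballI impI)
  have c: "curl (yx g) k = 0" for k by (rule curl_zero) (simp add: yx_def)
  show "\<alpha> * curl (yx g) k = 0" "curl (yx g) (nxt k) = - curl (yx g) k" for k by (simp_all add: c)
  show "adm (yx g)" unfolding adm_def using n by (simp add: yx_def)
  show "sys m (yx g 2)" using g by (subst sys_cong[of m _ g]) (simp_all add: yx_def)
  have "(\<lambda>r. yx g 3 (4 - r)) = (\<lambda>_. 0)" by (simp add: yx_def)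
  then show "sys m (\<lambda>r. yx g 3 (4 - r))" by (simp only: sys_zero)
qed

lemma xy_solution:
  assumes g: "sys m g" and m: "m = 1"
  shows "solution (xy g)"
  unfolding solution_iff
proof (intro conjI ballI impI)
  have c: "curl (xy g) k = 0" for k by (rule curl_zero) (simp add: xy_def)
  show "\<alpha> * curl (xy g) k = 0" "curl (xy g) (nxt k) = - curl (xy g) k" for k by (simp_all add: c)
  show "adm (xy g)" unfolding adm_def using m n1 nm by (simp add: xy_def)
  have "xy g 2 = (\<lambda>_. 0)" by (rule ext) (simp add: xy_def)
  then show "sys m (xy g 2)" by (simp only: sys_zero)
  show "sys m (\<lambda>r. xy g 3 (4 - r))"
    using g by (subst sys_cong[of m _ g]) (auto simp: xy_def m)
qed

lemma yxs_eq: "n = 1 \<Longrightarrow> yxs gs = map yx gs" unfolding yxs_def by simp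
lemma xys_eq: "m = 1 \<Longrightarrow> xys gs = map xy gs" unfolding xys_def by simp

lemma sum_lessThan_add: "(\<Sum>i<a + b. f i) = (\<Sum>i<a. f i) + (\<Sum>i<b. f (a + i) :: 'k)" for a b :: nat
  by (induction b) (simp_all add: add.assoc)

definition vecs where "vecs gs = diag @ yxs gs @ xys gs"

lemma vecs_comb:
  "(\<Sum>l<length (vecs gs). c l * (vecs gs ! l) k i) = (\<Sum>l<length diag. c l * (diag ! l) k i) +
     ((\<Sum>l<length (yxs gs). c (length diag + l) * (yxs gs ! l) k i) +
      (\<Sum>l<length (xys gs). c (length diag + length (yxs gs) + l) * (xys gs ! l) k i))"
  unfolding vecs_def by (simp add: sum_lessThan_add nth_append add.assoc)

text \<open>The three lists live in the coordinates 0, 2 and 3, so a combination splits and the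
  three problems can be treated separately.\<close>

lemma vecs_comb_components:
  "(\<Sum>l<length (vecs gs). c l * (vecs gs ! l) 0 i) = (\<Sum>l<length diag. c l * (diag ! l) 0 i)"
  "(\<Sum>l<length (vecs gs). c l * (vecs gs ! l) 1 i) = 0"
  "(\<Sum>l<length (vecs gs). c l * (vecs gs ! l) 2 i) = (\<Sum>l<length (yxs gs). c (length diag + l) * (yxs gs ! l) 2 i)"
  "(\<Sum>l<length (vecs gs). c l * (vecs gs ! l) 3 i) = (\<Sum>l<length (xys gs). c (length diag + length (yxs gs) + l) * (xys gs ! l) 3 i)"
  unfolding vecs_comb by (simp_all add: zero_components[OF nth_mem])

context
  fixes gs
  assumes gs: "n = 1 \<Longrightarrow> sys_basis m gs"
begin

lemma yxs_span:
  assumes y: "solution y"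
  shows "\<exists>c. \<forall>i\<in>{1..2 * n + m}. y 2 i = (\<Sum>l<length (yxs gs). c l * (yxs gs ! l) 2 i)"
proof (cases "n = 1")
  case True
  have "sys m (y 2)" using y True unfolding solution_iff by blast
  then obtain c where c: "\<forall>r\<in>{1..m + 2}. y 2 r = (\<Sum>l<length gs. c l * (gs ! l) r)"
    using gs[OF True] unfolding sys_basis_def by blast
  have "(\<Sum>l<length gs. c l * (gs ! l) i) = (\<Sum>l<length (yxs gs). c l * (yxs gs ! l) 2 i)" if "i \<in> {1..m + 2}" for i
    unfolding yxs_eq[OF True] using that by (intro sum.cong) (auto simp: yx_def)
  then show ?thesis using c True by (intro exI[of _ c] ballI) simp
next
  case False
  have "y 2 i = 0" for i using y False unfolding solution_iff adm_def by blast
  then show ?thesis using False by (simp add: yxs_def)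
qed

lemma yxs_indep:
  assumes c: "\<And>i. i \<in> {1..2 * n + m} \<Longrightarrow> (\<Sum>l<length (yxs gs). c l * (yxs gs ! l) 2 i) = 0"
    and l: "l < length (yxs gs)"
  shows "c l = 0"
proof -
  have n: "n = 1" using l by (simp add: yxs_def split: if_splits)
  have "(\<Sum>l<length gs. c l * (gs ! l) i) = (\<Sum>l<length (yxs gs). c l * (yxs gs ! l) 2 i)" if "i \<in> {1..m + 2}" for i
    unfolding yxs_eq[OF n] using that by (intro sum.cong) (auto simp: yx_def)
  then have "\<forall>i\<in>{1..m + 2}. (\<Sum>l<length gs. c l * (gs ! l) i) = 0" using c n by simp
  then have "\<forall>l<length gs. c l = 0" using gs[OF n] unfolding sys_basis_def by blast
  then show ?thesis using l unfolding yxs_eq[OF n] by simp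
qed

lemma xys_span:
  assumes y: "solution y"
  shows "\<exists>c. \<forall>i\<in>{1..n + 2 * m}. y 3 i = (\<Sum>l<length (xys gs). c l * (xys gs ! l) 3 i)"
proof (cases "m = 1")
  case True
  then have n: "n = 1" using n1 nm by simp
  have "sys m (\<lambda>r. y 3 (4 - r))" using y True unfolding solution_iff by blast
  then obtain c where c: "\<forall>r\<in>{1..m + 2}. y 3 (4 - r) = (\<Sum>l<length gs. c l * (gs ! l) r)"
    using gs[OF n] unfolding sys_basis_def by blast
  have "y 3 i = (\<Sum>l<length (xys gs). c l * (xys gs ! l) 3 i)" if i: "i \<in> {1..3}" for i
  proof -
    have "y 3 i = (\<Sum>l<length gs. c l * (gs ! l) (4 - i))" using bspec[OF c, of "4 - i"] i True by fastforce
    also have "\<dots> = (\<Sum>l<length (xys gs). c l * (xys gs ! l) 3 i)"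
      unfolding xys_eq[OF True] using i by (intro sum.cong) (auto simp: xy_def)
    finally show ?thesis .
  qed
  then show ?thesis using True n by (intro exI[of _ c] ballI) simp
next
  case False
  then have "n \<noteq> m" using cop by auto
  then have "y 3 i = 0" for i using y unfolding solution_iff adm_def by blast
  then show ?thesis using False by (simp add: xys_def)
qed

lemma xys_indep:
  assumes c: "\<And>i. i \<in> {1..n + 2 * m} \<Longrightarrow> (\<Sum>l<length (xys gs). c l * (xys gs ! l) 3 i) = 0"
    and l: "l < length (xys gs)"
  shows "c l = 0"
proof -
  have m: "m = 1" using l by (simp add: xys_def split: if_splits)
  have n: "n = 1" using m n1 nm by simp
  have "(\<Sum>l<length gs. c l * (gs ! l) i) = 0" if i: "i \<in> {1..m + 2}" for i
  proof -
    have "(\<Sum>l<length gs. c l * (gs ! l) i) = (\<Sum>l<length (xys gs). c l * (xys gs ! l) 3 (4 - i))"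
      unfolding xys_eq[OF m] using i m by (intro sum.cong) (auto simp: xy_def)
    also have "\<dots> = 0" using i m n by (intro c) auto
    finally show ?thesis .
  qed
  then have "\<forall>l<length gs. c l = 0" using gs[OF n] unfolding sys_basis_def by blast
  then show ?thesis using l unfolding xys_eq[OF m] by simp
qed

text \<open>Coboundaries have no coordinates 2 and 3. So only the diagonal part is taken modulo
  potentials, while the other two parts must match exactly.\<close>

lemma basis_HH1_vecs: "basis_list HH1 (map (\<lambda>x. cohom_class (coch x)) (vecs gs))"
proof (rule basis_HH1)
  show "solution x" if "x \<in> set (vecs gs)" for x
  proof -
    have s: "sys m g" if "g \<in> set gs" "n = 1" for g using gs that unfolding sys_basis_def by blast
    from that consider "x \<in> set diag" | "x \<in> set (yxs gs)" | "x \<in> set (xys gs)" by (auto simp: vecs_def)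
    then show ?thesis
    proof cases
      case 1
      then show ?thesis by (rule diag_solution)
    next
      case 2
      then obtain g where "n = 1" "g \<in> set gs" "x = yx g" by (auto simp: yxs_def split: if_splits)
      then show ?thesis using yx_solution s by blast
    next
      case 3
      then obtain g where "m = 1" "g \<in> set gs" "x = xy g" by (auto simp: xys_def split: if_splits)
      moreover from this have "n = 1" using n1 nm by simp
      ultimately show ?thesis using xy_solution s by blast
    qed
  qed
next
  fix y assume y: "solution y"
  obtain c1 u where d: "\<And>i. i \<in> {1..n + 2 * m} \<Longrightarrow> y 0 i = (\<Sum>l<length diag. c1 l * (diag ! l) 0 i) + cob u 0 i"
    "\<And>j. j \<in> {1..2 * n + m} \<Longrightarrow> y 1 j = cob u 1 j" by (rule diag_span[OF y]) blast
  obtain c2 where c2: "\<forall>i\<in>{1..2 * n + m}. y 2 i = (\<Sum>l<length (yxs gs). c2 l * (yxs gs ! l) 2 i)"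
    using yxs_span[OF y] by (elim exE)
  obtain c3 where c3: "\<forall>i\<in>{1..n + 2 * m}. y 3 i = (\<Sum>l<length (xys gs). c3 l * (xys gs ! l) 3 i)"
    using xys_span[OF y] by (elim exE)
  \<comment> \<open>The three coefficient functions are laid end to end, following the order of the
    blocks in \<open>vecs\<close>.\<close>
  define c where "c l = (if l < length diag then c1 l else if l < length diag + length (yxs gs)
    then c2 (l - length diag) else c3 (l - length diag - length (yxs gs)))" for l
  have z: "cob u 2 i = 0" "cob u 3 i = 0" for i by (simp_all add: cob_def)
  have "agree y (\<lambda>k i. (\<Sum>l<length (vecs gs). c l * (vecs gs ! l) k i) + cob u k i)"
    unfolding agree_def vecs_comb_components z
    using d bspec[OF c2] bspec[OF c3] by (simp add: c_def)
  then show "\<exists>c u. agree y (\<lambda>k i. (\<Sum>l<length (vecs gs). c l * (vecs gs ! l) k i) + cob u k i)" by blast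
next
  fix c u l
  assume a: "agree (\<lambda>k i. \<Sum>l<length (vecs gs). c l * (vecs gs ! l) k i) (cob u)" and l: "l < length (vecs gs)"
  note a' = a[unfolded agree_def vecs_comb_components]
  have 1: "c l = 0" if "l < length diag" for l
    by (rule diag_indep[of c u]) (use a' that in auto)
  have 2: "c (length diag + l) = 0" if "l < length (yxs gs)" for l
    by (rule yxs_indep[of "\<lambda>l. c (length diag + l)"]) (use a' that in \<open>auto simp: cob_def\<close>)
  have 3: "c (length diag + length (yxs gs) + l) = 0" if "l < length (xys gs)" for l
    by (rule xys_indep[of "\<lambda>l. c (length diag + length (yxs gs) + l)"]) (use a' that in \<open>auto simp: cob_def\<close>)
  consider "l < length diag" | "length diag \<le> l" "l - length diag < length (yxs gs)"
    | "length diag + length (yxs gs) \<le> l" "l - (length diag + length (yxs gs)) < length (xys gs)"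
    using l by (auto simp: vecs_def) linarith
  then show "c l = 0" using 1 2[of "l - length diag"] 3[of "l - (length diag + length (yxs gs))"] by cases simp_all
qed

end

subsection \<open>The distinguished cochains\<close>

definition delta :: "nat \<Rightarrow> nat \<Rightarrow> nat \<Rightarrow> nat \<Rightarrow> 'k" where
  "delta k r k' i = (if k' = k \<and> i = r then 1 else 0)"

lemma hom_with_values_cong:
  "(\<And>h. h \<in> H \<Longrightarrow> v h = v' h) \<Longrightarrow> hom_with_values A P Q H g v = hom_with_values A P Q H g v'"
  unfolding hom_with_values_def by (simp cong: ball_cong)

text \<open>Both sides are definite descriptions with the same prescribed values on the arrows, so
  they are equal as soon as these values agree.\<close>

lemma coch_delta:
  assumes "\<And>l i. arr l i \<in> arcs quiver \<Longrightarrow> v (arr l i) =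
    (if ix l = k \<and> i = r then cls (W i [l]) else if jx l = k \<and> i = r then cls (W i (alt l)) else \<zero>\<^bsub>algebra\<^esub>)"
  shows "hom_with_values algebra P1 (regular_bimodule algebra) (arcs quiver) gen1 v = coch (delta k r)"
  unfolding coch_def
proof (rule hom_with_values_cong)
  fix a assume a: "a \<in> arcs quiver"
  obtain l i where li: "a = arr l i" by (rule arr_cases)
  show "v a = cls (F (delta k r) (letter_of a) (tail quiver a))"
    using assms[of l i] a unfolding li letter_arr arr_simps(1,2)
    by (cases l) (auto simp: F_def delta_def cls_zero)
qed

lemma tau_arrow_coch: "tau_arrow (ArrX r) = coch (delta 0 r)"
  unfolding tau_arrow_def
proof (rule coch_delta)
  fix l i
  show "(if arr l i = ArrX r then arrow_class (ArrX r) else \<zero>\<^bsub>algebra\<^esub>) =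
    (if ix l = 0 \<and> i = r then cls (W i [l]) else if jx l = 0 \<and> i = r then cls (W i (alt l)) else \<zero>\<^bsub>algebra\<^esub>)"
    using path_class_W[of r "[LX]"] arr_simps(1)[of LX r] by (cases l) auto
qed

lemma tau_yx_coch: "tau (ArrY r) (replicate m LX) = coch (delta 2 r)"
  unfolding tau_def
proof (rule coch_delta)
  fix l i
  show "(if arr l i = ArrY r then path_class (tail quiver (ArrY r), spell (tail quiver (ArrY r)) (replicate m LX)) else \<zero>\<^bsub>algebra\<^esub>) =
    (if ix l = 2 \<and> i = r then cls (W i [l]) else if jx l = 2 \<and> i = r then cls (W i (alt l)) else \<zero>\<^bsub>algebra\<^esub>)"
    using path_class_W[of r "replicate m LX"] arr_simps(1)[of LY r] by (cases l) auto
qed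

lemma tau_xy_coch: "tau (ArrX r) [LY] = coch (delta 3 r)"
  unfolding tau_def
proof (rule coch_delta)
  fix l i
  show "(if arr l i = ArrX r then path_class (tail quiver (ArrX r), spell (tail quiver (ArrX r)) [LY]) else \<zero>\<^bsub>algebra\<^esub>) =
    (if ix l = 3 \<and> i = r then cls (W i [l]) else if jx l = 3 \<and> i = r then cls (W i (alt l)) else \<zero>\<^bsub>algebra\<^esub>)"
    using path_class_W[of r "[LY]"] arr_simps(1)[of LX r] by (cases l) auto
qed

lemma adm_delta: "adm (delta 0 r)" "n = 1 \<Longrightarrow> adm (delta 2 r)" "n = m \<Longrightarrow> adm (delta 3 r)"
  unfolding adm_def by (simp_all add: delta_def)

lemma coch_comb:
  assumes "finite S" and a: "\<And>r. r \<in> S \<Longrightarrow> adm (x r)"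
  shows "(\<Oplus>\<^bsub>Phat1\<^esub>r\<in>S. c r \<odot>\<^bsub>Phat1\<^esub> coch (x r)) = coch (\<lambda>k i. \<Sum>r\<in>S. c r * x r k i)"
proof -
  have b: "adm (\<lambda>k i. c r * x r k i)" if "r \<in> S" for r using a[OF that] by (auto simp: adm_def)
  have "(\<Oplus>\<^bsub>Phat1\<^esub>r\<in>S. c r \<odot>\<^bsub>Phat1\<^esub> coch (x r)) = (\<Oplus>\<^bsub>Phat1\<^esub>r\<in>S. coch (\<lambda>k i. c r * x r k i))"
    by (rule C1.M.finsum_cong'[OF refl]) (simp_all add: coch_smult a coch_in[OF b])
  also have "\<dots> = coch (\<lambda>k i. \<Sum>r\<in>S. c r * x r k i)" by (rule coch_finsum[OF assms(1) b])
  finally show ?thesis .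
qed

lemma ones_coch: "(\<Oplus>\<^bsub>Phat1\<^esub>r\<in>{1..n + 2 * m}. tau_arrow (ArrX r)) = coch ones"
proof -
  have "(\<Oplus>\<^bsub>Phat1\<^esub>r\<in>{1..n + 2 * m}. coch (delta 0 r)) = coch (\<lambda>k i. \<Sum>r\<in>{1..n + 2 * m}. delta 0 r k i)"
    by (rule coch_finsum) (simp_all add: adm_delta)
  also have "(\<lambda>k i. \<Sum>r\<in>{1..n + 2 * m}. delta 0 r k i) = ones"
    by (intro ext) (auto simp: delta_def ones_def)
  finally show ?thesis unfolding tau_arrow_coch .
qed

lemma signs_coch: "(\<Oplus>\<^bsub>Phat1\<^esub>r\<in>{1..m}. (- 1) ^ (r - 1) \<odot>\<^bsub>Phat1\<^esub> tau_arrow (ArrX (n + r))) = coch signs"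
proof -
  have "(\<Oplus>\<^bsub>Phat1\<^esub>r\<in>{1..m}. (- 1) ^ (r - 1) \<odot>\<^bsub>Phat1\<^esub> coch (delta 0 (n + r)))
      = coch (\<lambda>k i. \<Sum>r\<in>{1..m}. (- 1) ^ (r - 1) * delta 0 (n + r) k i)"
    by (rule coch_comb) (simp_all add: adm_delta)
  also have "(\<lambda>k i. \<Sum>r\<in>{1..m}. (- 1) ^ (r - 1) * delta 0 (n + r) k i) = signs"
  proof (intro ext)
    fix k i
    \<comment> \<open>Only the summand with r = i - n can survive; in this form the sum has a single
      marked index.\<close>
    have "(\<Sum>r\<in>{1..m}. (- 1) ^ (r - 1) * delta 0 (n + r) k i) =
      (\<Sum>r\<in>{1..m}. if r = i - n then (if k = 0 \<and> n < i then (- 1) ^ (i - Suc n) else 0) else 0)"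
      by (rule sum.cong) (auto simp: delta_def)
    then show "(\<Sum>r\<in>{1..m}. (- 1) ^ (r - 1) * delta 0 (n + r) k i) = signs k i"
      by (auto simp: signs_def)
  qed
  finally show ?thesis unfolding tau_arrow_coch .
qed

text \<open>\<open>S\<close> may omit indices at which \<open>g\<close> vanishes. This covers the
  sum that starts at r = 2, since \<open>\<lambda>\<^sub>0 = 0\<close>.\<close>

lemma yx_coch:
  assumes n: "n = 1" and S: "S \<subseteq> {1..m + 2}" and z: "\<And>r. r \<in> {1..m + 2} - S \<Longrightarrow> g r = 0"
  shows "(\<Oplus>\<^bsub>Phat1\<^esub>r\<in>S. g r \<odot>\<^bsub>Phat1\<^esub> tau (ArrY r) (replicate m LX)) = coch (yx g)"
proof -
  have f: "finite S" using S finite_subset by blast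
  have "(\<Oplus>\<^bsub>Phat1\<^esub>r\<in>S. g r \<odot>\<^bsub>Phat1\<^esub> coch (delta 2 r)) = coch (\<lambda>k i. \<Sum>r\<in>S. g r * delta 2 r k i)"
    by (rule coch_comb[OF f adm_delta(2)[OF n]])
  also have "(\<lambda>k i. \<Sum>r\<in>S. g r * delta 2 r k i) = yx g"
  proof (intro ext)
    fix k i
    have "(\<Sum>r\<in>S. g r * delta 2 r k i) = (\<Sum>r\<in>S. if r = i then (if k = 2 then g i else 0) else 0)"
      by (rule sum.cong) (auto simp: delta_def)
    then show "(\<Sum>r\<in>S. g r * delta 2 r k i) = yx g k i" using f S z[of i] by (auto simp: yx_def)
  qed
  finally show ?thesis unfolding tau_yx_coch .
qed

lemma lam_L: "lam \<alpha> \<beta> (int r + 1) = L (r + 2)" "1 \<le> r \<Longrightarrow> lam \<alpha> \<beta> (int r - 2) = L (r - 1)"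
  "lam \<alpha> \<beta> (int r - 1) = L r"
proof -
  have "nat (int r - 1) = r - 1" by simp
  then show "1 \<le> r \<Longrightarrow> lam \<alpha> \<beta> (int r - 2) = L (r - 1)" by (simp add: lam_def)
  have "nat (int r + 1 + 1) = r + 2" by simp
  then show "lam \<alpha> \<beta> (int r + 1) = L (r + 2)" by (simp only: lam_def)
qed (simp add: lam_def)

lemma first_coch:
  assumes n: "n = 1"
  shows "(\<Oplus>\<^bsub>Phat1\<^esub>r\<in>{2..m + 2}. lam \<alpha> \<beta> (int r - 1) \<odot>\<^bsub>Phat1\<^esub> tau (ArrY r) (replicate m LX)) = coch (yx L)"
  unfolding lam_L
proof (rule yx_coch[OF n])
  show "L r = 0" if "r \<in> {1..m + 2} - {2..m + 2}" for r
  proof -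
    have "r = Suc 0" using that by auto
    then show ?thesis by (simp add: L_simps)
  qed
qed simp

lemma second_coch:
  assumes n: "n = 1"
  shows "\<beta> \<odot>\<^bsub>Phat1\<^esub> (\<Oplus>\<^bsub>Phat1\<^esub>r\<in>{1..m + 2}. lam \<alpha> \<beta> (int r - 2) \<odot>\<^bsub>Phat1\<^esub> tau (ArrY r) (replicate m LX))
    = coch (yx (\<lambda>r. \<beta> * L (r - 1)))"
proof -
  let ?g = "\<lambda>r. lam \<alpha> \<beta> (int r - 2)"
  have e: "(\<Oplus>\<^bsub>Phat1\<^esub>r\<in>{1..m + 2}. ?g r \<odot>\<^bsub>Phat1\<^esub> tau (ArrY r) (replicate m LX)) = coch (yx ?g)"
    by (rule yx_coch[OF n]) auto
  have a: "adm (yx ?g)" unfolding adm_def using n by (simp add: yx_def)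
  have "(\<lambda>k i. \<beta> * yx ?g k i) = yx (\<lambda>r. \<beta> * L (r - 1))"
    by (intro ext) (simp add: yx_def lam_L)
  then show ?thesis unfolding e coch_smult[OF a] by (rule arg_cong)
qed

text \<open>This is why Case I lies within Case 1: there m is odd, hence so is m + 2, and
  \<open>L (m + 2) = 0\<close>.\<close>

lemma L_odd: "\<alpha> = 0 \<Longrightarrow> odd r \<Longrightarrow> L r = 0"
proof (induction r rule: less_induct)
  case (less r)
  show ?case
  proof (cases "r = 1")
    case True
    then show ?thesis by (simp add: L_simps)
  next
    case False
    then obtain q where q: "r = Suc (Suc q)" using less.prems by (metis One_nat_def even_zero not0_implies_Suc)
    then have "odd q" using less.prems by simp
    then have "L q = 0" by (intro less.IH) (use q less.prems in auto)
    then show ?thesis unfolding q L_step using less.prems by simp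
  qed
qed

lemma yx_1: "m = 1 \<Longrightarrow> yx g k i = (if k = 2 \<and> (i = 1 \<or> i = 2 \<or> i = 3) then g i else 0)"
  unfolding yx_def by auto

lemma xy_1: "xy g k i = (if k = 3 \<and> (i = 1 \<or> i = 2 \<or> i = 3) then g (4 - i) else 0)"
  unfolding xy_def by auto

lemma tau_yx1_coch: "m = 1 \<Longrightarrow> tau (ArrY r) [LX] = coch (delta 2 r)"
proof -
  assume "m = 1"
  then have "replicate m LX = [LX]" by simp
  then show ?thesis using tau_yx_coch[of r] by argo
qed

lemma adm_comb: "adm x \<Longrightarrow> adm y \<Longrightarrow> adm (\<lambda>k i. c * x k i + d * y k i)"
  unfolding adm_def by auto

lemma coch_two:
  assumes "adm x" "adm y"
  shows "c \<odot>\<^bsub>Phat1\<^esub> coch x \<oplus>\<^bsub>Phat1\<^esub> coch y = coch (\<lambda>k i. c * x k i + y k i)"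
proof -
  have "adm (\<lambda>k i. c * x k i)" using adm_comb[OF assms, of c 0] by simp
  then show ?thesis unfolding coch_smult[OF assms(1)] by (rule coch_add[OF _ assms(2)])
qed

lemma coch_three:
  assumes x: "adm x" and y: "adm y" and z: "adm z"
  shows "c \<odot>\<^bsub>Phat1\<^esub> coch x \<oplus>\<^bsub>Phat1\<^esub> d \<odot>\<^bsub>Phat1\<^esub> coch y \<oplus>\<^bsub>Phat1\<^esub> coch z =
    coch (\<lambda>k i. c * x k i + d * y k i + z k i)"
proof -
  have c: "adm (\<lambda>k i. c * x k i)" using adm_comb[OF x y, of c 0] by simp
  have d: "adm (\<lambda>k i. d * y k i)" using adm_comb[OF x y, of 0 d] by simp
  show ?thesis unfolding coch_smult[OF x] coch_smult[OF y] coch_add[OF c d]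
    by (rule coch_add[OF adm_comb[OF x y] z])
qed

section \<open>Assembling the cases of the theorem\<close>

lemma vecs_cases:
  "n = 1 \<Longrightarrow> m = 1 \<Longrightarrow> vecs gs = diag @ map yx gs @ map xy gs"
  "n = 1 \<Longrightarrow> n < m \<Longrightarrow> vecs gs = diag @ map yx gs"
  "1 < n \<Longrightarrow> n < m \<Longrightarrow> vecs gs = diag"
  unfolding vecs_def yxs_def xys_def by auto

lemma diag_cases:
  "case_I \<alpha> n m \<Longrightarrow> diag = [ones, signs]" "case_II \<alpha> n m \<Longrightarrow> diag = [ones]"
  by (simp_all add: diag_def case_II_def)

lemma sys_basis_cases:
  "case_I \<alpha> n m \<Longrightarrow> sys_basis m [\<lambda>r. L r, \<lambda>r. \<beta> * L (r - 1)]"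
  "case_1 \<alpha> \<beta> m \<Longrightarrow> sys_basis m [\<lambda>r. L r, \<lambda>r. \<beta> * L (r - 1)]"
  "case_2 \<alpha> \<beta> m \<Longrightarrow> sys_basis m [\<lambda>r. (\<alpha> / 2) ^ (r - 1)]"
  "case_3 \<alpha> \<beta> m \<Longrightarrow> sys_basis m []"
proof -
  assume I: "case_I \<alpha> n m"
  then have "\<alpha> = 0" by (simp add: case_I_def)
  then have "L (m + 2) = 0" using odd_weights[OF I] by (intro L_odd) simp_all
  then show "sys_basis m [\<lambda>r. L r, \<lambda>r. \<beta> * L (r - 1)]" by (rule sys_basis_1)
next
  show "case_1 \<alpha> \<beta> m \<Longrightarrow> sys_basis m [\<lambda>r. L r, \<lambda>r. \<beta> * L (r - 1)]"
    unfolding case_1_def lam_L by (rule sys_basis_1)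
  show "case_2 \<alpha> \<beta> m \<Longrightarrow> sys_basis m [\<lambda>r. (\<alpha> / 2) ^ (r - 1)]"
    unfolding case_2_def lam_L by (elim conjE, rule sys_basis_2)
  show "case_3 \<alpha> \<beta> m \<Longrightarrow> sys_basis m []"
    unfolding case_3_def lam_L by (elim conjE, rule sys_basis_3)
qed

lemma basis_n1m1_I:
  assumes n: "n = 1" and m: "m = 1" and I: "case_I \<alpha> n m"
  shows "basis_list HH1
    [cohom_class (\<Oplus>\<^bsub>Phat1\<^esub>r\<in>{1..n + 2 * m}. tau_arrow (ArrX r)),
     cohom_class (tau_arrow (ArrX 2)),
     cohom_class (tau (ArrY 2) [LX]),
     cohom_class (\<beta> \<odot>\<^bsub>Phat1\<^esub> tau (ArrY 3) [LX] \<oplus>\<^bsub>Phat1\<^esub> tau (ArrY 1) [LX]),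
     cohom_class (tau (ArrX 2) [LY]),
     cohom_class (\<beta> \<odot>\<^bsub>Phat1\<^esub> tau (ArrX 1) [LY] \<oplus>\<^bsub>Phat1\<^esub> tau (ArrX 3) [LY])]"
proof -
  have nm': "n = m" using n m by simp
  have \<alpha>: "\<alpha> = 0" using I by (simp add: case_I_def)
  \<comment> \<open>On 1, 2, 3 the two basic solutions are 0, 1, 0 and 1, 0, \<beta>, which are the
    coefficients of the listed cochains.\<close>
  have L: "L 1 = 0" "L 2 = 1" "L 3 = 0" "\<beta> * L (1 - 1) = 1" "\<beta> * L (2 - 1) = 0" "\<beta> * L (3 - 1) = \<beta>"
    "4 - 1 = (3 :: nat)" "4 - 2 = (2 :: nat)" "4 - 3 = (1 :: nat)"
    using L_simps \<alpha> by simp_all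
  have "delta 0 2 = signs"
  proof (intro ext)
    show "delta 0 2 k i = signs k i" for k i unfolding delta_def signs_def unfolding n m by auto
  qed
  then have e1: "tau_arrow (ArrX 2) = coch signs" unfolding tau_arrow_coch by simp
  have "delta 2 2 = yx L"
    by (intro ext) (use L in \<open>auto simp add: delta_def yx_1[OF m]\<close>)
  then have e2: "tau (ArrY 2) [LX] = coch (yx L)" unfolding tau_yx1_coch[OF m] by simp
  have "(\<lambda>k i. \<beta> * delta 2 3 k i + delta 2 1 k i) = yx (\<lambda>r. \<beta> * L (r - 1))"
    by (intro ext) (use L in \<open>auto simp add: delta_def yx_1[OF m]\<close>)
  then have e3: "\<beta> \<odot>\<^bsub>Phat1\<^esub> tau (ArrY 3) [LX] \<oplus>\<^bsub>Phat1\<^esub> tau (ArrY 1) [LX] = coch (yx (\<lambda>r. \<beta> * L (r - 1)))"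
    unfolding tau_yx1_coch[OF m] coch_two[OF adm_delta(2)[OF n] adm_delta(2)[OF n]] by simp
  have "delta 3 2 = xy L"
    by (intro ext) (use L in \<open>auto simp add: delta_def xy_1\<close>)
  then have e4: "tau (ArrX 2) [LY] = coch (xy L)" unfolding tau_xy_coch by simp
  have "(\<lambda>k i. \<beta> * delta 3 1 k i + delta 3 3 k i) = xy (\<lambda>r. \<beta> * L (r - 1))"
    by (intro ext) (use L in \<open>auto simp add: delta_def xy_1\<close>)
  then have e5: "\<beta> \<odot>\<^bsub>Phat1\<^esub> tau (ArrX 1) [LY] \<oplus>\<^bsub>Phat1\<^esub> tau (ArrX 3) [LY] = coch (xy (\<lambda>r. \<beta> * L (r - 1)))"
    unfolding tau_xy_coch coch_two[OF adm_delta(3)[OF nm'] adm_delta(3)[OF nm']] by simp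
  show ?thesis
    using basis_HH1_vecs[OF sys_basis_cases(1)[OF I]]
    unfolding vecs_cases(1)[OF n m] diag_cases(1)[OF I] ones_coch e1 e2 e3 e4 e5
    by (simp only: append.simps list.map)
qed

lemma basis_n1m1_2:
  assumes n: "n = 1" and m: "m = 1" and II: "case_II \<alpha> n m" and c: "case_2 \<alpha> \<beta> m"
  shows "basis_list HH1
    [cohom_class (\<Oplus>\<^bsub>Phat1\<^esub>r\<in>{1..n + 2 * m}. tau_arrow (ArrX r)),
     cohom_class ((\<alpha> / 2)\<^sup>2 \<odot>\<^bsub>Phat1\<^esub> tau (ArrY 3) [LX] \<oplus>\<^bsub>Phat1\<^esub> (\<alpha> / 2) \<odot>\<^bsub>Phat1\<^esub> tau (ArrY 2) [LX]
       \<oplus>\<^bsub>Phat1\<^esub> tau (ArrY 1) [LX]),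
     cohom_class ((\<alpha> / 2)\<^sup>2 \<odot>\<^bsub>Phat1\<^esub> tau (ArrX 1) [LY] \<oplus>\<^bsub>Phat1\<^esub> (\<alpha> / 2) \<odot>\<^bsub>Phat1\<^esub> tau (ArrX 2) [LY]
       \<oplus>\<^bsub>Phat1\<^esub> tau (ArrX 3) [LY])]"
proof -
  have nm': "n = m" using n m by simp
  define a where "a = \<alpha> / 2"
  note y = adm_delta(2)[OF n] and x = adm_delta(3)[OF nm']
  have "(\<lambda>k i. a\<^sup>2 * delta 2 3 k i + a * delta 2 2 k i + delta 2 1 k i) = yx (\<lambda>r. a ^ (r - 1))"
    by (intro ext) (auto simp add: delta_def yx_1[OF m])
  then have e1: "a\<^sup>2 \<odot>\<^bsub>Phat1\<^esub> tau (ArrY 3) [LX] \<oplus>\<^bsub>Phat1\<^esub> a \<odot>\<^bsub>Phat1\<^esub> tau (ArrY 2) [LX] \<oplus>\<^bsub>Phat1\<^esub> tau (ArrY 1) [LX]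
      = coch (yx (\<lambda>r. a ^ (r - 1)))"
    unfolding tau_yx1_coch[OF m] coch_three[OF y y y] by simp
  have "(\<lambda>k i. a\<^sup>2 * delta 3 1 k i + a * delta 3 2 k i + delta 3 3 k i) = xy (\<lambda>r. a ^ (r - 1))"
    by (intro ext) (auto simp add: delta_def xy_1)
  then have e2: "a\<^sup>2 \<odot>\<^bsub>Phat1\<^esub> tau (ArrX 1) [LY] \<oplus>\<^bsub>Phat1\<^esub> a \<odot>\<^bsub>Phat1\<^esub> tau (ArrX 2) [LY] \<oplus>\<^bsub>Phat1\<^esub> tau (ArrX 3) [LY]
      = coch (xy (\<lambda>r. a ^ (r - 1)))"
    unfolding tau_xy_coch coch_three[OF x x x] by simp
  show ?thesis
    using basis_HH1_vecs[OF sys_basis_cases(3)[OF c]]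
    unfolding vecs_cases(1)[OF n m] diag_cases(2)[OF II] ones_coch a_def[symmetric] e1 e2
    by (simp only: append.simps list.map)
qed

text \<open>Only diagonal cocycles contribute: for n > 1 an arrow has no parallel word but itself
  unless n = m, which coprimality excludes, and for n = 1 in Case 3 the system has only the zero
  solution.\<close>

lemma basis_no_recurrence:
  assumes "n = 1 \<Longrightarrow> case_3 \<alpha> \<beta> m"
  shows "case_I \<alpha> n m \<Longrightarrow> basis_list HH1
      [cohom_class (\<Oplus>\<^bsub>Phat1\<^esub>r\<in>{1..n + 2 * m}. tau_arrow (ArrX r)),
       cohom_class (\<Oplus>\<^bsub>Phat1\<^esub>r\<in>{1..m}. (- 1) ^ (r - 1) \<odot>\<^bsub>Phat1\<^esub> tau_arrow (ArrX (n + r)))]"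
    and "case_II \<alpha> n m \<Longrightarrow> basis_list HH1 [cohom_class (\<Oplus>\<^bsub>Phat1\<^esub>r\<in>{1..n + 2 * m}. tau_arrow (ArrX r))]"
proof -
  have "vecs [] = diag" by (simp add: vecs_def yxs_def xys_def)
  then have b: "basis_list HH1 (map (\<lambda>x. cohom_class (coch x)) diag)"
    using basis_HH1_vecs[of "[]", OF sys_basis_cases(4)[OF assms]] by simp
  then show "case_I \<alpha> n m \<Longrightarrow> basis_list HH1
      [cohom_class (\<Oplus>\<^bsub>Phat1\<^esub>r\<in>{1..n + 2 * m}. tau_arrow (ArrX r)),
       cohom_class (\<Oplus>\<^bsub>Phat1\<^esub>r\<in>{1..m}. (- 1) ^ (r - 1) \<odot>\<^bsub>Phat1\<^esub> tau_arrow (ArrX (n + r)))]"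
    unfolding ones_coch signs_coch by (simp only: diag_cases(1) list.map)
  show "case_II \<alpha> n m \<Longrightarrow> basis_list HH1 [cohom_class (\<Oplus>\<^bsub>Phat1\<^esub>r\<in>{1..n + 2 * m}. tau_arrow (ArrX r))]"
    using b unfolding ones_coch by (simp only: diag_cases(2) list.map)
qed

lemma basis_n1_1:
  assumes n: "n = 1" and m: "n < m"
  shows "case_I \<alpha> n m \<Longrightarrow> basis_list HH1
      [cohom_class (\<Oplus>\<^bsub>Phat1\<^esub>r\<in>{1..n + 2 * m}. tau_arrow (ArrX r)),
       cohom_class (\<Oplus>\<^bsub>Phat1\<^esub>r\<in>{1..m}. (- 1) ^ (r - 1) \<odot>\<^bsub>Phat1\<^esub> tau_arrow (ArrX (n + r))),
       cohom_class (\<Oplus>\<^bsub>Phat1\<^esub>r\<in>{2..m + 2}. lam \<alpha> \<beta> (int r - 1) \<odot>\<^bsub>Phat1\<^esub> tau (ArrY r) (replicate m LX)),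
       cohom_class (\<beta> \<odot>\<^bsub>Phat1\<^esub> (\<Oplus>\<^bsub>Phat1\<^esub>r\<in>{1..m + 2}.
         lam \<alpha> \<beta> (int r - 2) \<odot>\<^bsub>Phat1\<^esub> tau (ArrY r) (replicate m LX)))]"
    and "case_II \<alpha> n m \<Longrightarrow> case_1 \<alpha> \<beta> m \<Longrightarrow> basis_list HH1
      [cohom_class (\<Oplus>\<^bsub>Phat1\<^esub>r\<in>{1..n + 2 * m}. tau_arrow (ArrX r)),
       cohom_class (\<Oplus>\<^bsub>Phat1\<^esub>r\<in>{2..m + 2}. lam \<alpha> \<beta> (int r - 1) \<odot>\<^bsub>Phat1\<^esub> tau (ArrY r) (replicate m LX)),
       cohom_class (\<beta> \<odot>\<^bsub>Phat1\<^esub> (\<Oplus>\<^bsub>Phat1\<^esub>r\<in>{1..m + 2}.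
         lam \<alpha> \<beta> (int r - 2) \<odot>\<^bsub>Phat1\<^esub> tau (ArrY r) (replicate m LX)))]"
proof -
  let ?gs = "[\<lambda>r. L r, \<lambda>r. \<beta> * L (r - 1)]"
  note eqs = ones_coch signs_coch first_coch[OF n] second_coch[OF n]
  have b: "basis_list HH1 (map (\<lambda>x. cohom_class (coch x)) (diag @ map yx ?gs))" if "sys_basis m ?gs"
    unfolding vecs_cases(2)[OF n m, symmetric] by (rule basis_HH1_vecs[OF that])
  show "basis_list HH1
      [cohom_class (\<Oplus>\<^bsub>Phat1\<^esub>r\<in>{1..n + 2 * m}. tau_arrow (ArrX r)),
       cohom_class (\<Oplus>\<^bsub>Phat1\<^esub>r\<in>{1..m}. (- 1) ^ (r - 1) \<odot>\<^bsub>Phat1\<^esub> tau_arrow (ArrX (n + r))),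
       cohom_class (\<Oplus>\<^bsub>Phat1\<^esub>r\<in>{2..m + 2}. lam \<alpha> \<beta> (int r - 1) \<odot>\<^bsub>Phat1\<^esub> tau (ArrY r) (replicate m LX)),
       cohom_class (\<beta> \<odot>\<^bsub>Phat1\<^esub> (\<Oplus>\<^bsub>Phat1\<^esub>r\<in>{1..m + 2}.
         lam \<alpha> \<beta> (int r - 2) \<odot>\<^bsub>Phat1\<^esub> tau (ArrY r) (replicate m LX)))]" if "case_I \<alpha> n m"
    using b[OF sys_basis_cases(1)[OF that]] unfolding eqs diag_cases(1)[OF that]
    by (simp only: append.simps list.map)
  show "basis_list HH1
      [cohom_class (\<Oplus>\<^bsub>Phat1\<^esub>r\<in>{1..n + 2 * m}. tau_arrow (ArrX r)),
       cohom_class (\<Oplus>\<^bsub>Phat1\<^esub>r\<in>{2..m + 2}. lam \<alpha> \<beta> (int r - 1) \<odot>\<^bsub>Phat1\<^esub> tau (ArrY r) (replicate m LX)),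
       cohom_class (\<beta> \<odot>\<^bsub>Phat1\<^esub> (\<Oplus>\<^bsub>Phat1\<^esub>r\<in>{1..m + 2}.
         lam \<alpha> \<beta> (int r - 2) \<odot>\<^bsub>Phat1\<^esub> tau (ArrY r) (replicate m LX)))]"
    if II: "case_II \<alpha> n m" and c: "case_1 \<alpha> \<beta> m"
    using b[OF sys_basis_cases(2)[OF c]] unfolding eqs diag_cases(2)[OF II]
    by (simp only: append.simps list.map)
qed

lemma basis_n1_2:
  assumes n: "n = 1" and m: "n < m" and II: "case_II \<alpha> n m" and c: "case_2 \<alpha> \<beta> m"
  shows "basis_list HH1
    [cohom_class (\<Oplus>\<^bsub>Phat1\<^esub>r\<in>{1..n + 2 * m}. tau_arrow (ArrX r)),
     cohom_class (\<Oplus>\<^bsub>Phat1\<^esub>r\<in>{1..m + 2}. (\<alpha> / 2) ^ (r - 1) \<odot>\<^bsub>Phat1\<^esub> tau (ArrY r) (replicate m LX))]"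
proof -
  have e: "(\<Oplus>\<^bsub>Phat1\<^esub>r\<in>{1..m + 2}. (\<alpha> / 2) ^ (r - 1) \<odot>\<^bsub>Phat1\<^esub> tau (ArrY r) (replicate m LX))
      = coch (yx (\<lambda>r. (\<alpha> / 2) ^ (r - 1)))"
    by (rule yx_coch[OF n]) auto
  show ?thesis
    using basis_HH1_vecs[OF sys_basis_cases(3)[OF c]]
    unfolding vecs_cases(2)[OF n m] diag_cases(2)[OF II] ones_coch e by (simp only: append.simps list.map)
qed

end

theorem proposition4p2:
  fixes \<alpha> \<beta> :: "'k::{alg_closed_field, field_char_0}" and n m :: nat
  assumes "\<beta> \<noteq> 0" and "coprime n m" and "n \<le> m" and "1 \<le> n"
  shows
    "let C = beilinson.Phat1 \<alpha> \<beta> n m;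
         cl = beilinson.cohom_class \<alpha> \<beta> n m;
         \<tau>a = beilinson.tau_arrow \<alpha> \<beta> n m;
         \<tau> = beilinson.tau \<alpha> \<beta> n m;
         is_basis = basis_list (beilinson.HH1 \<alpha> \<beta> n m)
     in
       (n = 1 \<and> m = 1 \<and> case_I \<alpha> n m \<longrightarrow> is_basis
          [cl (\<Oplus>\<^bsub>C\<^esub>r\<in>{1..n + 2 * m}. \<tau>a (ArrX r)),
           cl (\<tau>a (ArrX 2)),
           cl (\<tau> (ArrY 2) [LX]),
           cl (\<beta> \<odot>\<^bsub>C\<^esub> \<tau> (ArrY 3) [LX] \<oplus>\<^bsub>C\<^esub> \<tau> (ArrY 1) [LX]),
           cl (\<tau> (ArrX 2) [LY]),
           cl (\<beta> \<odot>\<^bsub>C\<^esub> \<tau> (ArrX 1) [LY] \<oplus>\<^bsub>C\<^esub> \<tau> (ArrX 3) [LY])]) \<and>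
       (n = 1 \<and> m = 1 \<and> case_II \<alpha> n m \<and> case_2 \<alpha> \<beta> m \<longrightarrow> is_basis
          [cl (\<Oplus>\<^bsub>C\<^esub>r\<in>{1..n + 2 * m}. \<tau>a (ArrX r)),
           cl ((\<alpha> / 2)\<^sup>2 \<odot>\<^bsub>C\<^esub> \<tau> (ArrY 3) [LX] \<oplus>\<^bsub>C\<^esub> (\<alpha> / 2) \<odot>\<^bsub>C\<^esub> \<tau> (ArrY 2) [LX]
               \<oplus>\<^bsub>C\<^esub> \<tau> (ArrY 1) [LX]),
           cl ((\<alpha> / 2)\<^sup>2 \<odot>\<^bsub>C\<^esub> \<tau> (ArrX 1) [LY] \<oplus>\<^bsub>C\<^esub> (\<alpha> / 2) \<odot>\<^bsub>C\<^esub> \<tau> (ArrX 2) [LY]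
               \<oplus>\<^bsub>C\<^esub> \<tau> (ArrX 3) [LY])]) \<and>
       (n = 1 \<and> m = 1 \<and> case_II \<alpha> n m \<and> case_3 \<alpha> \<beta> m \<longrightarrow> is_basis
          [cl (\<Oplus>\<^bsub>C\<^esub>r\<in>{1..n + 2 * m}. \<tau>a (ArrX r))]) \<and>
       (n = 1 \<and> n < m \<and> case_I \<alpha> n m \<longrightarrow> is_basis
          [cl (\<Oplus>\<^bsub>C\<^esub>r\<in>{1..n + 2 * m}. \<tau>a (ArrX r)),
           cl (\<Oplus>\<^bsub>C\<^esub>r\<in>{1..m}. (- 1) ^ (r - 1) \<odot>\<^bsub>C\<^esub> \<tau>a (ArrX (n + r))),
           cl (\<Oplus>\<^bsub>C\<^esub>r\<in>{2..m + 2}. lam \<alpha> \<beta> (int r - 1) \<odot>\<^bsub>C\<^esub> \<tau> (ArrY r) (replicate m LX)),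
           cl (\<beta> \<odot>\<^bsub>C\<^esub> (\<Oplus>\<^bsub>C\<^esub>r\<in>{1..m + 2}.
                 lam \<alpha> \<beta> (int r - 2) \<odot>\<^bsub>C\<^esub> \<tau> (ArrY r) (replicate m LX)))]) \<and>
       (n = 1 \<and> n < m \<and> case_II \<alpha> n m \<and> case_1 \<alpha> \<beta> m \<longrightarrow> is_basis
          [cl (\<Oplus>\<^bsub>C\<^esub>r\<in>{1..n + 2 * m}. \<tau>a (ArrX r)),
           cl (\<Oplus>\<^bsub>C\<^esub>r\<in>{2..m + 2}. lam \<alpha> \<beta> (int r - 1) \<odot>\<^bsub>C\<^esub> \<tau> (ArrY r) (replicate m LX)),
           cl (\<beta> \<odot>\<^bsub>C\<^esub> (\<Oplus>\<^bsub>C\<^esub>r\<in>{1..m + 2}.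
                 lam \<alpha> \<beta> (int r - 2) \<odot>\<^bsub>C\<^esub> \<tau> (ArrY r) (replicate m LX)))]) \<and>
       (n = 1 \<and> n < m \<and> case_II \<alpha> n m \<and> case_2 \<alpha> \<beta> m \<longrightarrow> is_basis
          [cl (\<Oplus>\<^bsub>C\<^esub>r\<in>{1..n + 2 * m}. \<tau>a (ArrX r)),
           cl (\<Oplus>\<^bsub>C\<^esub>r\<in>{1..m + 2}. (\<alpha> / 2) ^ (r - 1) \<odot>\<^bsub>C\<^esub> \<tau> (ArrY r) (replicate m LX))]) \<and>
       (n = 1 \<and> n < m \<and> case_II \<alpha> n m \<and> case_3 \<alpha> \<beta> m \<longrightarrow> is_basis
          [cl (\<Oplus>\<^bsub>C\<^esub>r\<in>{1..n + 2 * m}. \<tau>a (ArrX r))]) \<and>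
       (1 < n \<and> n < m \<and> case_I \<alpha> n m \<longrightarrow> is_basis
          [cl (\<Oplus>\<^bsub>C\<^esub>r\<in>{1..n + 2 * m}. \<tau>a (ArrX r)),
           cl (\<Oplus>\<^bsub>C\<^esub>r\<in>{1..m}. (- 1) ^ (r - 1) \<odot>\<^bsub>C\<^esub> \<tau>a (ArrX (n + r)))]) \<and>
       (1 < n \<and> n < m \<and> case_II \<alpha> n m \<longrightarrow> is_basis
          [cl (\<Oplus>\<^bsub>C\<^esub>r\<in>{1..n + 2 * m}. \<tau>a (ArrX r))])"
proof -
  interpret down_up \<alpha> \<beta> n m
    by unfold_locales (rule assms)+
  show ?thesis
    unfolding Let_def
    apply (intro conjI impI; elim conjE)
    subgoal by (rule basis_n1m1_I)
    subgoal by (rule basis_n1m1_2)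
    subgoal by (rule basis_no_recurrence(2))
    subgoal by (rule basis_n1_1(1))
    subgoal by (rule basis_n1_1(2))
    subgoal by (rule basis_n1_2)
    subgoal by (rule basis_no_recurrence(2))
    subgoal by (rule basis_no_recurrence(1)) simp_all
    subgoal by (rule basis_no_recurrence(2)) simp_all
    done
qed

end
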